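(* Let $X$ be an emm-space. The following are equivalent: \begin{itemize} \item $\mathcal L_1(X)$ is compact; \item the pyramid $\overline{\mathcal P_X}^{\square}$ is concentrated. \end{itemize} An emm-space with these properties is called a concentrated emm-space; denoting by $\mathfrak X_{\rm conc}$ the set of emm-isomorphism classes of concentrated emm-spaces, and by $\Pi$ the set of all pyramids, the map $\mathfrak X_{\rm conc}\ni X\mapsto\mathcal P_X\in\Pi$ is one-to-one.
   Context: An mm-space is a complete separable metric space $(X,d)$ with a Borel probability measure $m$. Two mm-spaces are mm-isomorphic if there is a measure-preserving map between them which is distance-preserving on the support of the measure of the domain. $\mathcal X$ is the set of mm-isomorphism classes of mm-spaces. An emm-space is a quadruple $(X,\tau,d,m)$ where $(X,\tau)$ is a Polish topological space; $d:X\times X\to[0,+\infty]$ is an extended distance (symmetric, triangle inequality, $d(x,y)=0$ iff $x=y$) that is complete and $\tau\times\tau$-lower semicontinuous; the topology $\tau_d$ induced by $d$ is finer than or equal to $\tau$; $m$ is a $\tau$-Borel probability measure. Mm-spaces are emm-spaces with the metric topology. Two emm-spaces $X,Y$ are emm-isomorphic if there are an $m_X$-measurable map $F:X\to Y$ with $F_\#m_X=m_Y$ and an $m_X$-measurable set $A\subset X$ with $m_X(A)=1$ such that $d_Y(F(x),F(y))=d_X(x,y)$ for all $x,y\in A$. For emm-spaces write $Y\prec X$ if there are a measurable map $\varphi:X\to Y$ with $\varphi_\#m_X=m_Y$ and a set $E\subset X$ with $m_X(E)=1$ such that $d_Y(\varphi(x),\varphi(y))\le d_X(x,y)$ for all $x,y\in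 E$. Put $\mathcal P_X:=\{Y\in\mathcal X: Y\prec X\}$. Box distance: a parameter of an mm-space $X$ is a Borel map $\iota:[0,1)\to X$ with $\iota_\#\mathrm{Leb}=m_X$. $\square(X,Y)$ is the infimum, over all parameters $\iota_X,\iota_Y$, of the infimum of those $\varepsilon\ge0$ for which there is a Borel set $I_0\subset[0,1)$ with $\mathrm{Leb}(I_0)\ge1-\varepsilon$ and $|d_X(\iota_X(s),\iota_X(t))-d_Y(\iota_Y(s),\iota_Y(t))|\le\varepsilon$ for all $s,t\in I_0$. $\overline{\,\cdot\,}^{\square}$ denotes closure in $(\mathcal X,\square)$. A pyramid is a nonempty $\square$-closed set $\mathcal P\subset\mathcal X$ such that (a) $X\in\mathcal P$, $Y\in\mathcal X$ and $Y\prec X$ imply $Y\in\mathcal P$; (b) for all $X,Y\in\mathcal P$ there is $Z\in\mathcal P$ with $X\prec Z$ and $Y\prec Z$. For every emm-space $X$, $\overline{\mathcal P_X}^{\square}$ is a pyramid; for concentrated $X$, $\mathcal P_X$ is itself $\square$-closed. For an emm-space $X$, $L^0(X)$ is the space of $m_X$-classes of real measurable functions with the Ky Fan distance $d_{L^0}(f,g)=\inf\{\varepsilon>0: m_X(|f-g|>\varepsilon)\le\varepsilon\}$; $\mathrm{Lip}_1(X,m_X)\subset L^0(X)$ is the set of classes of functions $f$ for which there is $E$ with $m_X(E)=1$ and $|f(x)-f(y)|\le d_X(x,y)$ on $E\times E$; $\mathcal L_1(X)=\mathrm{Lip}_1(X,m_X)/\mathbb R$ is its quotient by addition of constants, with the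 topology (quotient distance) inherited from $L^0(X)/\mathbb R$. A pyramid $\mathcal P$ is concentrated if $\{\mathcal L_1(X):X\in\mathcal P\}$ is precompact in the Gromov–Hausdorff topology on isometry classes of compact metric spaces. *)

theory Defs
  imports "HOL-Probability.Probability"
begin

section \<open>Spaces\<close>

definition borel_of :: "'a topology \<Rightarrow> 'a measure" where
  "borel_of T = sigma (topspace T) {U. openin T U}"

text \<open>An mm-space; the underlying set is the carrier \<open>mspace\<close> of the metric.\<close>

datatype 'a mm = MM (mm_metric: "'a metric") (mm_measure: "'a measure")

definition mm_space :: "'a mm \<Rightarrow> bool" where
  "mm_space X \<longleftrightarrow>
     mcomplete_of (mm_metric X) \<and>
     separable_space (mtopology_of (mm_metric X)) \<and>
     sets (mm_measure X) = sets (borel_of (mtopology_of (mm_metric X))) \<and>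
     prob_space (mm_measure X)"

definition measure_support :: "'a topology \<Rightarrow> 'a measure \<Rightarrow> 'a set" where
  "measure_support T m = {x \<in> topspace T. \<forall>U. openin T U \<and> x \<in> U \<longrightarrow> 0 < emeasure m U}"

definition mm_iso :: "'a mm \<Rightarrow> 'b mm \<Rightarrow> bool" where
  "mm_iso X Y \<longleftrightarrow>
     (\<exists>F \<in> measurable (mm_measure X) (mm_measure Y).
        distr (mm_measure X) (mm_measure Y) F = mm_measure Y \<and>
        (let S = measure_support (mtopology_of (mm_metric X)) (mm_measure X) in
           \<forall>x\<in>S. \<forall>y\<in>S. mdist (mm_metric Y) (F x) (F y) = mdist (mm_metric X) x y))"

text \<open>
  The set of mm-isomorphism classes.  A separable metric space has at most continuum many points,
  so every mm-space is isomorphic to one whose carrier is a set of reals.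
\<close>

definition mm_classes :: "real mm set set" where
  "mm_classes = {X. mm_space X} // {(X, Y). mm_space X \<and> mm_space Y \<and> mm_iso X Y}"

text \<open>
  An emm-space; the underlying set is \<open>topspace\<close> of the topology, and the values of the
  extended distance outside of it are irrelevant.
\<close>

datatype 'a emm =
  EMM (emm_top: "'a topology") (emm_dist: "'a \<Rightarrow> 'a \<Rightarrow> ennreal") (emm_measure: "'a measure")

abbreviation emm_carrier :: "'a emm \<Rightarrow> 'a set" where
  "emm_carrier X \<equiv> topspace (emm_top X)"

definition extended_distance :: "'a set \<Rightarrow> ('a \<Rightarrow> 'a \<Rightarrow> ennreal) \<Rightarrow> bool" where
  "extended_distance S d \<longleftrightarrow>
     (\<forall>x\<in>S. \<forall>y\<in>S. d x y = d y x) \<and>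
     (\<forall>x\<in>S. \<forall>y\<in>S. \<forall>z\<in>S. d x z \<le> d x y + d y z) \<and>
     (\<forall>x\<in>S. \<forall>y\<in>S. d x y = 0 \<longleftrightarrow> x = y)"

definition extended_complete :: "'a set \<Rightarrow> ('a \<Rightarrow> 'a \<Rightarrow> ennreal) \<Rightarrow> bool" where
  "extended_complete S d \<longleftrightarrow>
     (\<forall>s :: nat \<Rightarrow> 'a. range s \<subseteq> S \<and> (\<forall>e>0. \<exists>N. \<forall>i\<ge>N. \<forall>j\<ge>N. d (s i) (s j) < e)
        \<longrightarrow> (\<exists>x\<in>S. (\<lambda>n. d (s n) x) \<longlonglongrightarrow> 0))"

definition extended_dist_topology :: "'a set \<Rightarrow> ('a \<Rightarrow> 'a \<Rightarrow> ennreal) \<Rightarrow> 'a topology" where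
  "extended_dist_topology S d =
     topology (\<lambda>U. U \<subseteq> S \<and> (\<forall>x\<in>U. \<exists>r>0. {y \<in> S. d x y < r} \<subseteq> U))"

lemma openin_extended_dist_topology:
  "openin (extended_dist_topology S d) U \<longleftrightarrow>
     U \<subseteq> S \<and> (\<forall>x\<in>U. \<exists>r>0. {y \<in> S. d x y < r} \<subseteq> U)"
proof -
  let ?P = "\<lambda>U. U \<subseteq> S \<and> (\<forall>x\<in>U. \<exists>r>0. {y \<in> S. d x y < r} \<subseteq> U)"
  have "?P (U \<inter> V)" if U: "?P U" and V: "?P V" for U V
  proof (intro conjI ballI)
    show "U \<inter> V \<subseteq> S" using U by blast
    fix x assume "x \<in> U \<inter> V"
    then obtain r s where "r > 0" "{y \<in> S. d x y < r} \<subseteq> U" "s > 0" "{y \<in> S. d x y < s} \<subseteq> V"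
      using U V by (meson IntD1 IntD2)
    then show "\<exists>r>0. {y \<in> S. d x y < r} \<subseteq> U \<inter> V"
      by (intro exI[of _ "min r s"]) auto
  qed
  moreover have "?P (\<Union>\<K>)" if "\<forall>K\<in>\<K>. ?P K" for \<K>
    using that by (meson Sup_least UnionE Union_upper order_trans)
  ultimately have "istopology ?P"
    unfolding istopology_def by blast
  then show ?thesis
    by (simp add: extended_dist_topology_def)
qed

definition lower_semicontinuous_in :: "'a topology \<Rightarrow> ('a \<Rightarrow> 'b::linorder) \<Rightarrow> bool" where
  "lower_semicontinuous_in T f \<longleftrightarrow> (\<forall>a. openin T {x \<in> topspace T. a < f x})"

definition emm_space :: "'a emm \<Rightarrow> bool" where
  "emm_space X \<longleftrightarrow>
     completely_metrizable_space (emm_top X) \<and> separable_space (emm_top X) \<and>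
     extended_distance (emm_carrier X) (emm_dist X) \<and>
     extended_complete (emm_carrier X) (emm_dist X) \<and>
     lower_semicontinuous_in (prod_topology (emm_top X) (emm_top X)) (\<lambda>(x, y). emm_dist X x y) \<and>
     (\<forall>U. openin (emm_top X) U \<longrightarrow>
        openin (extended_dist_topology (emm_carrier X) (emm_dist X)) U) \<and>
     sets (emm_measure X) = sets (borel_of (emm_top X)) \<and>
     prob_space (emm_measure X)"

definition emm_of_mm :: "'a mm \<Rightarrow> 'a emm" where
  "emm_of_mm X =
     EMM (mtopology_of (mm_metric X)) (\<lambda>x y. ennreal (mdist (mm_metric X) x y)) (mm_measure X)"

text \<open>
  Measurability with respect to the measure itself (that is, up to null sets) is measurability with
  respect to its completion.
\<close>

abbreviation emm_completion :: "'a emm \<Rightarrow> 'a measure" where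
  "emm_completion X \<equiv> completion (emm_measure X)"

definition emm_iso :: "'a emm \<Rightarrow> 'b emm \<Rightarrow> bool" where
  "emm_iso X Y \<longleftrightarrow>
     (\<exists>F \<in> measurable (emm_completion X) (emm_measure Y).
        distr (emm_completion X) (emm_measure Y) F = emm_measure Y \<and>
        (\<exists>A \<in> sets (emm_completion X). emeasure (emm_completion X) A = 1 \<and>
           (\<forall>x\<in>A. \<forall>y\<in>A. emm_dist Y (F x) (F y) = emm_dist X x y)))"

definition dominated :: "'b emm \<Rightarrow> 'a emm \<Rightarrow> bool"  (infix \<open>\<prec>\<^sub>L\<close> 50) where
  "Y \<prec>\<^sub>L X \<longleftrightarrow>
     (\<exists>\<phi> \<in> measurable (emm_completion X) (emm_measure Y).
        distr (emm_completion X) (emm_measure Y) \<phi> = emm_measure Y \<and>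
        (\<exists>E \<in> sets (emm_completion X). emeasure (emm_completion X) E = 1 \<and>
           (\<forall>x\<in>E. \<forall>y\<in>E. emm_dist Y (\<phi> x) (\<phi> y) \<le> emm_dist X x y)))"


section \<open>Box distance and pyramids\<close>

abbreviation unit_leb :: "real measure" where
  "unit_leb \<equiv> restrict_space lborel {0..<1}"

definition parameters :: "'a mm \<Rightarrow> (real \<Rightarrow> 'a) set" where
  "parameters X =
     {\<iota> \<in> measurable unit_leb (mm_measure X). distr unit_leb (mm_measure X) \<iota> = mm_measure X}"

definition box_distance :: "'a mm \<Rightarrow> 'b mm \<Rightarrow> real" where
  "box_distance X Y =
     (INF (i, j) \<in> parameters X \<times> parameters Y.
        Inf {\<epsilon>. 0 \<le> \<epsilon> \<and>
               (\<exists>I \<in> sets unit_leb. measure unit_leb I \<ge> 1 - \<epsilon> \<and>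
                  (\<forall>s\<in>I. \<forall>t\<in>I.
                     \<bar>mdist (mm_metric X) (i s) (i t) - mdist (mm_metric Y) (j s) (j t)\<bar> \<le> \<epsilon>))})"

text \<open>The box distance is invariant under mm-isomorphism, so the set below is a singleton.\<close>

definition box_class_distance :: "real mm set \<Rightarrow> real mm set \<Rightarrow> real" where
  "box_class_distance \<X> \<Y> = the_elem {box_distance X Y | X Y. X \<in> \<X> \<and> Y \<in> \<Y>}"

definition box_closure :: "real mm set set \<Rightarrow> real mm set set" where
  "box_closure \<A> = {\<X> \<in> mm_classes. \<forall>\<epsilon>>0. \<exists>\<Y>\<in>\<A>. box_class_distance \<X> \<Y> < \<epsilon>}"

definition class_dominated :: "real mm set \<Rightarrow> real mm set \<Rightarrow> bool" where
  "class_dominated \<Y> \<X> \<longleftrightarrow> (\<exists>Y\<in>\<Y>. \<exists>X\<in>\<X>. emm_of_mm Y \<prec>\<^sub>L emm_of_mm X)"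

definition pyramid :: "real mm set set \<Rightarrow> bool" where
  "pyramid \<P> \<longleftrightarrow>
     \<P> \<noteq> {} \<and> \<P> \<subseteq> mm_classes \<and> box_closure \<P> = \<P> \<and>
     (\<forall>\<X>\<in>\<P>. \<forall>\<Y>\<in>mm_classes. class_dominated \<Y> \<X> \<longrightarrow> \<Y> \<in> \<P>) \<and>
     (\<forall>\<X>\<in>\<P>. \<forall>\<Y>\<in>\<P>. \<exists>\<Z>\<in>\<P>. class_dominated \<X> \<Z> \<and> class_dominated \<Y> \<Z>)"

definition below :: "'a emm \<Rightarrow> real mm set set" where
  "below X = {\<Y> \<in> mm_classes. \<exists>Y\<in>\<Y>. emm_of_mm Y \<prec>\<^sub>L X}"


section \<open>The space of Lipschitz functions modulo constants\<close>

definition L0 :: "'a emm \<Rightarrow> ('a \<Rightarrow> real) set" where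
  "L0 X = borel_measurable (emm_completion X)"

definition ky_fan :: "'a emm \<Rightarrow> ('a \<Rightarrow> real) \<Rightarrow> ('a \<Rightarrow> real) \<Rightarrow> real" where
  "ky_fan X f g =
     Inf {\<epsilon>. 0 < \<epsilon> \<and>
            measure (emm_completion X) {x \<in> emm_carrier X. \<epsilon> < \<bar>f x - g x\<bar>} \<le> \<epsilon>}"

text \<open>
  The two quotients, by almost everywhere equality and by addition of constants, are taken in one
  step.  The members of a class are then all the functions \<open>f + c\<close> up to null sets, so
  that the quotient distance is the infimum of the Ky Fan distance over pairs of members.
\<close>

definition L0_rel :: "'a emm \<Rightarrow> (('a \<Rightarrow> real) \<times> ('a \<Rightarrow> real)) set" where
  "L0_rel X = {(f, g). f \<in> L0 X \<and> g \<in> L0 X \<and> (\<exists>c. AE x in emm_completion X. f x = g x + c)}"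

definition L0_quotient_dist :: "'a emm \<Rightarrow> ('a \<Rightarrow> real) set \<Rightarrow> ('a \<Rightarrow> real) set \<Rightarrow> real" where
  "L0_quotient_dist X F G =
     (if F \<in> L0 X // L0_rel X \<and> G \<in> L0 X // L0_rel X
      then INF (f, g) \<in> F \<times> G. ky_fan X f g else 0)"

definition L0_quotient :: "'a emm \<Rightarrow> ('a \<Rightarrow> real) set metric" where
  "L0_quotient X = metric (L0 X // L0_rel X, L0_quotient_dist X)"

definition Lip1 :: "'a emm \<Rightarrow> ('a \<Rightarrow> real) set" where
  "Lip1 X =
     {f \<in> L0 X. \<exists>E \<in> sets (emm_completion X). emeasure (emm_completion X) E = 1 \<and>
                  (\<forall>x\<in>E. \<forall>y\<in>E. ennreal \<bar>f x - f y\<bar> \<le> emm_dist X x y)}"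

definition L1 :: "'a emm \<Rightarrow> ('a \<Rightarrow> real) set metric" where
  "L1 X = submetric (L0_quotient X) (Lip1 X // L0_rel X)"


section \<open>The Gromov--Hausdorff space and concentration\<close>

definition isometric_embedding :: "'a metric \<Rightarrow> 'b metric \<Rightarrow> ('a \<Rightarrow> 'b) \<Rightarrow> bool" where
  "isometric_embedding K Z f \<longleftrightarrow>
     f ` mspace K \<subseteq> mspace Z \<and>
     (\<forall>x\<in>mspace K. \<forall>y\<in>mspace K. mdist Z (f x) (f y) = mdist K x y)"

definition isometric_metrics :: "'a metric \<Rightarrow> 'b metric \<Rightarrow> bool" where
  "isometric_metrics K M \<longleftrightarrow> (\<exists>f. isometric_embedding K M f \<and> f ` mspace K = mspace M)"

definition hausdorff_distance :: "'a metric \<Rightarrow> 'a set \<Rightarrow> 'a set \<Rightarrow> real" where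
  "hausdorff_distance Z A B =
     Inf {r. 0 \<le> r \<and> (\<forall>a\<in>A. \<exists>b\<in>B. mdist Z a b \<le> r) \<and> (\<forall>b\<in>B. \<exists>a\<in>A. mdist Z a b \<le> r)}"

text \<open>
  Only the images of the two spaces in the ambient space \<open>Z\<close> matter, and their union can be
  injected into the sum type; hence ambient spaces on the sum type suffice.
\<close>

definition gh_distance :: "'a metric \<Rightarrow> 'b metric \<Rightarrow> real" where
  "gh_distance K M =
     Inf {hausdorff_distance Z (f ` mspace K) (g ` mspace M) | (Z :: ('a + 'b) metric) f g.
            isometric_embedding K Z f \<and> isometric_embedding M Z g}"

text \<open>
  The isometry class of a compact metric space on an arbitrary type.  A compact metric space has at
  most continuum many points, so representatives on sets of reals suffice.
\<close>

definition isometry_class :: "'a metric \<Rightarrow> real metric set" where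
  "isometry_class M = {K. compact_space (mtopology_of K) \<and> isometric_metrics M K}"

definition gh_classes :: "real metric set set" where
  "gh_classes =
     isometry_class ` {K :: real metric. compact_space (mtopology_of K) \<and> mspace K \<noteq> {}}"

text \<open>The Gromov--Hausdorff distance is isometry invariant, so the set below is a singleton.\<close>

definition gh_class_distance :: "real metric set \<Rightarrow> real metric set \<Rightarrow> real" where
  "gh_class_distance \<K> \<M> =
     (if \<K> \<in> gh_classes \<and> \<M> \<in> gh_classes
      then the_elem {gh_distance K M | K M. K \<in> \<K> \<and> M \<in> \<M>} else 0)"

definition gh_topology :: "real metric set topology" where
  "gh_topology = Metric_space.mtopology gh_classes gh_class_distance"

definition concentrated_pyramid :: "real mm set set \<Rightarrow> bool" where
  "concentrated_pyramid \<P> \<longleftrightarrow>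
     pyramid \<P> \<and>
     compactin gh_topology
       (gh_topology closure_of {isometry_class (L1 (emm_of_mm X)) | X. X \<in> \<Union>\<P>})"

definition concentrated_emm_space :: "'a emm \<Rightarrow> bool" where
  "concentrated_emm_space X \<longleftrightarrow> emm_space X \<and> compact_space (mtopology_of (L1 X))"

text \<open>
  The emm-isomorphism classes of concentrated emm-spaces with points in a type \<open>'a\<close>.  Polish
  spaces have at most continuum many points, so all classes are represented for
  \<open>'a = real\<close>.
\<close>

definition concentrated_emm_classes :: "'a emm set set" where
  "concentrated_emm_classes =
     {X. concentrated_emm_space X} // {(X, Y). emm_space X \<and> emm_space Y \<and> emm_iso X Y}"

text \<open>
  The value on a class is the common value on its members, and is unspecified if there were
  no such common value.
\<close>

definition class_below :: "'a emm set \<Rightarrow> real mm set set" where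
  "class_below \<X> = the_elem (below ` \<X>)"

end

theory Submission
  imports Defs "HOL-Library.Diagonal_Subsequence"
begin

text \<open>
  An emm-space carries countably many Lipschitz functions \<open>f n\<close> whose increments recover its distance
  almost everywhere, and the joint law of these functions determines the space: if \<open>g n\<close> are Lipschitz
  functions on \<open>Y\<close> with the same law, then inverting \<open>x \<mapsto> (f n x)\<close> gives a map that exhibits
  \<open>X \<prec>\<^sub>L Y\<close>. When \<open>L1 Y\<close> is compact, every weak limit of laws of sequences in \<open>Lip1 Y\<close> is again such a law.
  Hence \<open>X \<prec>\<^sub>L Y\<close> follows as soon as the finite marginals of the law of \<open>f\<close> can be approximated by
  laws of Lipschitz functions on \<open>Y\<close>. This applies to a \<open>\<box>\<close>-limit of members of \<open>below Y\<close>, so that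
  \<open>below Y\<close> is closed, and also when \<open>below X \<subseteq> below Y\<close>, since finitely many Lipschitz functions on \<open>X\<close>
  factor through a single mm-space dominated by \<open>X\<close>. Two concentrated spaces that dominate each other are
  isomorphic because an isometric self-embedding of a compact metric space is onto. Finally the spaces
  \<open>L1 Y\<close>, for \<open>Y\<close> below \<open>X\<close>, embed isometrically into \<open>L1 X\<close> and contain isometric copies of all of its finite
  subsets, so that their uniform total boundedness amounts to compactness of the complete space \<open>L1 X\<close>.
\<close>

section \<open>Metric preliminaries\<close>

text \<open>The obstacle is the extended distance. It may be infinite and non-separable: on every
  Polish space the distance that is infinite off the diagonal is admissible. Distances to countably
  many points therefore cannot recover it; distances to compact pieces of a tight exhaustion can, by
  lower semicontinuity. For the same reason infinitely many Lipschitz functions on \<open>X\<close>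
  need not define a map into an mm-space, since their supremum distance can be infinite or
  non-separable. Members of \<open>below X\<close> thus see finitely many functions at a time, and a
  passage to the limit is unavoidable; compactness of \<open>L1 Y\<close> ensures that the limit law
  is realized by functions on \<open>Y\<close> itself. Maps are merely measurable, so their images
  and inverses are controlled through compact sets on which they are continuous. On the
  Gromov-Hausdorff side everything is phrased with correspondences, which compose, instead of
  embeddings into ambient spaces, which would have to be glued.\<close>

lemma separable_metric_dense_sequence:
  assumes "separable_space (mtopology_of m)" "mspace m \<noteq> {}"
  obtains q :: "nat \<Rightarrow> 'a" where "range q \<subseteq> mspace m"
    "\<And>x e. x \<in> mspace m \<Longrightarrow> 0 < e \<Longrightarrow> \<exists>n. mdist m x (q n) < e"
proof -
  interpret Metric_space "mspace m" "mdist m" by simp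
  obtain C where C: "countable C" "C \<subseteq> mspace m" "mtopology_of m closure_of C = mspace m"
    using assms(1) unfolding separable_space_def by auto
  have ne: "C \<noteq> {}"
    using C(3) assms(2) by auto
  have "\<exists>n. mdist m x (from_nat_into C n) < e" if x: "x \<in> mspace m" and e: "0 < e" for x e
  proof -
    have "x \<in> mtopology closure_of C"
      using C(3) x by (simp add: mtopology_of_def)
    then obtain y where "y \<in> C" "mdist m x y < e"
      using e by (auto simp: metric_closure_of)
    then show ?thesis
      using C(1) by (metis from_nat_into_surj)
  qed
  moreover have "range (from_nat_into C) \<subseteq> mspace m"
    using C(2) ne by (metis range_from_nat_into_subset order_trans)
  ultimately show thesis
    using that by blast
qed

text \<open>Ascoli's argument for a separable domain that need not be compact: a subsequence is made
  to converge on a dense sequence, and the common Lipschitz constant spreads convergence to all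
  points.\<close>

lemma lipschitz_pointwise_convergent_subsequence:
  fixes f :: "nat \<Rightarrow> 'a \<Rightarrow> real"
  assumes sep: "separable_space (mtopology_of m)"
    and lip: "\<And>n x y. x \<in> mspace m \<Longrightarrow> y \<in> mspace m \<Longrightarrow> \<bar>f n x - f n y\<bar> \<le> mdist m x y"
    and a: "a \<in> mspace m" and bd: "\<And>n. \<bar>f n a\<bar> \<le> B"
  obtains r g where "strict_mono (r :: nat \<Rightarrow> nat)"
    "\<And>x. x \<in> mspace m \<Longrightarrow> (\<lambda>k. f (r k) x) \<longlonglongrightarrow> g x"
proof -
  obtain q :: "nat \<Rightarrow> 'a" where q: "range q \<subseteq> mspace m"
    "\<And>x e. x \<in> mspace m \<Longrightarrow> 0 < e \<Longrightarrow> \<exists>n. mdist m x (q n) < e"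
    using separable_metric_dense_sequence[OF sep] a by blast
  define v where "v n = (\<lambda>i. f n (q i))" for n
  \<comment> \<open>The bound at \<open>a\<close> and the Lipschitz condition confine
    \<open>f n (q i)\<close> to an interval that depends on \<open>i\<close> only. The product of
    these intervals is compact by Tychonoff, which in \<open>nat \<Rightarrow> real\<close> means
    sequentially compact; no explicit diagonal sequence is formed.\<close>
  define K where "K = (\<Pi>\<^sub>E i\<in>(UNIV::nat set). {-(B + mdist m a (q i))..B + mdist m a (q i)})"
  have "compactin (product_topology (\<lambda>i. euclidean) UNIV) K"
    unfolding K_def compactin_PiE by simp
  then have "compact K"
    by (simp add: euclidean_product_topology flip: compactin_euclidean_iff)
  moreover have "v n \<in> K" for n
  proof -
    have "\<bar>f n (q i)\<bar> \<le> B + mdist m a (q i)" for i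
      using lip[of a "q i" n] a q(1) bd[of n] by fastforce
    then show ?thesis
      unfolding K_def v_def by (auto simp: abs_le_iff) (smt (verit))
  qed
  ultimately obtain l r where r: "strict_mono r" "(v \<circ> r) \<longlonglongrightarrow> l"
    by (metis seq_compactE compact_imp_seq_compact)
  have lim: "(\<lambda>k. f (r k) (q i)) \<longlonglongrightarrow> l i" for i
  proof -
    show ?thesis
      using continuous_on_tendsto_compose[OF continuous_on_product_coordinates[of i] r(2)]
    by (simp add: v_def o_def)
  qed
  have "convergent (\<lambda>k. f (r k) x)" if x: "x \<in> mspace m" for x
  proof (rule Cauchy_convergent, rule CauchyI)
    fix e :: real assume e: "0 < e"
    obtain i where i: "mdist m x (q i) < e / 3"
      using q(2)[OF x, of "e / 3"] e by auto
    have "Cauchy (\<lambda>k. f (r k) (q i))"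
      using lim convergent_Cauchy convergent_def by blast
    then obtain N where N: "\<And>j k. j \<ge> N \<Longrightarrow> k \<ge> N \<Longrightarrow> \<bar>f (r j) (q i) - f (r k) (q i)\<bar> < e / 3"
      using CauchyD[of "\<lambda>k. f (r k) (q i)" "e/3"] e by (auto simp: real_norm_def)
    have "\<bar>f (r j) x - f (r k) x\<bar> < e" if "j \<ge> N" "k \<ge> N" for j k
    proof -
      have "q i \<in> mspace m"
        using q(1) by auto
      from lip[OF x this, of "r j"] lip[OF x this, of "r k"] N[OF that] i show ?thesis
        by linarith
    qed
    then show "\<exists>M. \<forall>j\<ge>M. \<forall>k\<ge>M. norm (f (r j) x - f (r k) x) < e"
      by auto
  qed
  then show thesis
    by (intro that[OF r(1), of "\<lambda>x. lim (\<lambda>k. f (r k) x)"]) (simp add: convergent_LIMSEQ_iff)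
qed

lemma compact_metric_bounded:
  assumes "compact_space (mtopology_of K)"
  obtains D where "0 < D" "\<And>x y. x \<in> mspace K \<Longrightarrow> y \<in> mspace K \<Longrightarrow> mdist K x y \<le> D"
proof -
  interpret Metric_space "mspace K" "mdist K" by simp
  have "mbounded (mspace K)"
    using assms compactin_imp_mbounded by (simp add: mtopology_of_def compact_space_def)
  then show thesis
    using that by (auto simp: mbounded_alt_pos)
qed

lemma compact_metric_separable:
  assumes "compact_space (mtopology_of K)"
  shows "separable_space (mtopology_of K)"
proof -
  interpret Metric_space "mspace K" "mdist K" by simp
  have tb: "mtotally_bounded (mspace K)"
    using assms compact_space_eq_mcomplete_mtotally_bounded by (simp add: mtopology_of_def)
  then have "\<forall>n::nat. \<exists>F. finite F \<and> F \<subseteq> mspace K \<and> mspace K \<subseteq> (\<Union>x\<in>F. mball x (1 / (real n + 1)))"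
    unfolding mtotally_bounded_def by auto
  then obtain F where F: "\<And>n. finite (F n)" "\<And>n. F n \<subseteq> mspace K"
    "\<And>n. mspace K \<subseteq> (\<Union>x\<in>F n. mball x (1 / (real n + 1)))"
    by metis
  have "x \<in> mtopology closure_of (\<Union>n. F n)" if x: "x \<in> mspace K" for x
    unfolding metric_closure_of
  proof (intro CollectI conjI allI impI x)
    fix r :: real assume "0 < r"
    then obtain n where n: "1 / (real n + 1) < r"
      using nat_approx_posE by (metis add.commute of_nat_Suc)
    obtain y where y: "y \<in> F n" "x \<in> mball y (1 / (real n + 1))"
      using F(3) x by blast
    then have "y \<in> mball x r"
      using n by (auto simp: mdist_commute)
    then show "\<exists>y\<in>\<Union>n. F n. y \<in> mball x r"
      using y by blast
  qed
  then have "mtopology closure_of (\<Union>n. F n) = mspace K"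
    using closure_of_subset_topspace by fastforce
  moreover have "countable (\<Union>n. F n)"
    using F(1) countable_finite by blast
  ultimately show ?thesis
    unfolding separable_space_def using F(2) by (auto simp: mtopology_of_def)
qed

text \<open>The image is compact, hence closed, so a point \<open>y\<close> outside it keeps a
  distance \<open>e\<close> from it. Then all points of the orbit of \<open>y\<close> are
  \<open>e\<close>-separated, which sequential compactness forbids.\<close>

lemma isometric_self_embedding_surj:
  assumes cp: "compact_space (mtopology_of m)" and im: "f ` mspace m \<subseteq> mspace m"
    and iso: "\<And>x y. x \<in> mspace m \<Longrightarrow> y \<in> mspace m \<Longrightarrow> mdist m (f x) (f y) = mdist m x y"
  shows "f ` mspace m = mspace m"
proof (rule ccontr)
  interpret Metric_space "mspace m" "mdist m" by simp
  interpret MM: Metric_space12 "mspace m" "mdist m" "mspace m" "mdist m"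
    by unfold_locales
  assume "f ` mspace m \<noteq> mspace m"
  then obtain y where y: "y \<in> mspace m" "y \<notin> f ` mspace m"
    using im by auto
  have "embedding_map mtopology mtopology f"
    using MM.isometry_imp_embedding_map im iso by blast
  then have "continuous_map mtopology mtopology f"
    by (meson continuous_map_in_subtopology embedding_map_def homeomorphic_imp_continuous_map)
  then have "compactin mtopology (f ` mspace m)"
    using cp by (metis compact_space_def image_compactin mtopology_of_def topspace_mtopology)
  then have "closedin mtopology (f ` mspace m)"
    by (simp add: Hausdorff_space_mtopology compactin_imp_closedin)
  then obtain e where e: "e > 0" "disjnt (f ` mspace m) (mball y e)"
    unfolding closedin_metric using y by blast
  have ey: "e \<le> mdist m y (f x)" if "x \<in> mspace m" for x
    using e(2) y that im by (force simp: disjnt_iff)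
  define z where "z n = (f ^^ n) y" for n
  have z0: "z 0 = y" and zS: "z (Suc n) = f (z n)" for n
    by (simp_all add: z_def)
  have z: "z n \<in> mspace m" for n
  proof (induction n)
    case (Suc n)
    then show ?case using im zS by (metis image_subset_iff)
  qed (simp add: z0 y)
  have zz: "mdist m (z (n + k)) (z (n + l)) = mdist m (z k) (z l)" for n k l
    by (induction n) (simp_all add: zS iso z)
  \<comment> \<open>Since \<open>f\<close> is an isometry, the pair \<open>i, j\<close> reduces to
    \<open>0, j - i\<close>, and \<open>z (Suc k)\<close> lies in the image of
    \<open>f\<close>.\<close>
  have sep: "e \<le> mdist m (z i) (z j)" if "i < j" for i j
  proof -
    define k where "k = j - i - 1"
    have k: "j = i + Suc k"
      using that by (simp add: k_def)
    have "e \<le> mdist m (z 0) (z (Suc k))"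
      using ey[OF z[of k]] by (simp add: z0 zS)
    then show ?thesis
      using zz[of i 0 "Suc k"] k by simp
  qed
  have "range z \<subseteq> mspace m" using z by auto
  then obtain l r where l: "strict_mono r" "limitin mtopology (z \<circ> r) l sequentially"
    using cp unfolding mtopology_of_def compact_space_sequentially by blast
  have "MCauchy (z \<circ> r)"
    using l(2) z by (intro convergent_imp_MCauchy) auto
  then obtain N where "\<And>i j. i \<ge> N \<Longrightarrow> j \<ge> N \<Longrightarrow> mdist m (z (r i)) (z (r j)) < e"
    unfolding MCauchy_def using e(1) by fastforce
  then have "mdist m (z (r N)) (z (r (Suc N))) < e"
    by simp
  moreover have "r N < r (Suc N)"
    using l(1) by (simp add: strict_mono_def)
  ultimately show False
    using sep by fastforce
qed

text \<open>Base 3 with digits 0 and 1: at the first place \<open>n\<close> where two sets differ,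
  \<open>(1/3) ^ n\<close> exceeds all that the later digits can contribute, which is half of it. In
  base 2 the two could be equal. The series packs countably many bits into one real number.\<close>

lemma inj_ternary_series: "inj (\<lambda>A::nat set. \<Sum>k. if k \<in> A then (1/3::real) ^ k else 0)"
proof (rule injI, rule ccontr)
  fix A B :: "nat set"
  assume eq: "(\<Sum>k. if k \<in> A then (1/3::real) ^ k else 0) = (\<Sum>k. if k \<in> B then (1/3) ^ k else 0)"
    and ne: "A \<noteq> B"
  define d where "d k = (if k \<in> A then (1/3::real) ^ k else 0) - (if k \<in> B then (1/3) ^ k else 0)" for k
  have sm: "summable (\<lambda>k. if k \<in> A then (1/3::real) ^ k else 0)" for A
    by (rule summable_comparison_test'[OF summable_geometric[of "1/3::real"]]) auto
  have dle: "\<bar>d k\<bar> \<le> (1/3) ^ k" for k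
    by (auto simp: d_def)
  have smd: "summable d"
    unfolding d_def by (intro summable_diff sm)
  have s0: "suminf d = 0"
    unfolding d_def by (subst suminf_diff[OF sm sm, symmetric]) (simp add: eq)
  define n where "n = (LEAST k. (k \<in> A) \<noteq> (k \<in> B))"
  have n: "(n \<in> A) \<noteq> (n \<in> B)"
    unfolding n_def by (rule LeastI_ex) (use ne in auto)
  have "(k \<in> A) = (k \<in> B)" if "k < n" for k
    using not_less_Least[of k "\<lambda>k. (k \<in> A) \<noteq> (k \<in> B)"] that unfolding n_def by blast
  then have zero: "d k = 0" if "k < n" for k
    using that by (simp add: d_def)
  have dn: "\<bar>d n\<bar> = (1/3) ^ n"
    using n by (auto simp: d_def)
  have sg: "summable (\<lambda>k. (1/3::real) ^ Suc n * (1/3) ^ k)"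
    by (intro summable_mult summable_geometric) simp
  have le: "\<bar>d (k + Suc n)\<bar> \<le> (1/3::real) ^ Suc n * (1/3) ^ k" for k
    using dle[of "k + Suc n"] by (simp only: power_add mult.commute)
  have smt: "summable (\<lambda>k. \<bar>d (k + Suc n)\<bar>)"
    by (rule summable_comparison_test'[OF sg]) (use le in \<open>simp only: real_norm_def abs_abs\<close>)
  have "\<bar>\<Sum>k. d (k + Suc n)\<bar> \<le> (\<Sum>k. \<bar>d (k + Suc n)\<bar>)"
    by (rule summable_rabs[OF smt])
  also have "\<dots> \<le> (\<Sum>k. (1/3::real) ^ Suc n * (1/3) ^ k)"
    by (rule suminf_le[OF le smt sg])
  also have "\<dots> = (1/3) ^ Suc n * (3/2)"
    by (subst suminf_mult) (simp_all add: suminf_geometric)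
  also have "\<dots> < (1/3) ^ n"
    by simp
  finally have "\<bar>\<Sum>k. d (k + Suc n)\<bar> < \<bar>d n\<bar>"
    using dn by simp
  moreover have "suminf d = (\<Sum>k. d (k + Suc n)) + d n"
    using suminf_split_initial_segment[OF smd, of "Suc n"] zero by simp
  ultimately show False
    using s0 by auto
qed

text \<open>Distances to a dense sequence, coded by a set of pairs, separate the points.\<close>

lemma separable_metric_inj_real:
  fixes m :: "'a metric"
  assumes "separable_space (mtopology_of m)"
  obtains c :: "'a \<Rightarrow> real" where "inj_on c (mspace m)"
proof (cases "mspace m = {}")
  case True
  then show thesis using that by simp
next
  case False
  obtain q :: "nat \<Rightarrow> 'a" where q: "range q \<subseteq> mspace m"
    "\<And>x e. x \<in> mspace m \<Longrightarrow> 0 < e \<Longrightarrow> \<exists>n. mdist m x (q n) < e"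
    using separable_metric_dense_sequence[OF assms False] by blast
  define S where "S x = {p :: nat \<times> nat. mdist m x (q (fst p)) < 1 / (real (snd p) + 1)}" for x
  have inj: "x = y" if x: "x \<in> mspace m" and y: "y \<in> mspace m" and eq: "S x = S y" for x y
  proof (rule ccontr)
    assume "x \<noteq> y"
    then have "mdist m x y > 0"
      using x y by (metis mdist_nonneg mdist_zero less_eq_real_def)
    then obtain k :: nat where k: "1 / (real k + 1) < mdist m x y / 2"
      using nat_approx_posE[of "mdist m x y / 2"] by (metis add.commute half_gt_zero of_nat_Suc)
    obtain n where n: "mdist m x (q n) < 1 / (real k + 1)"
      using q(2)[OF x, of "1 / (real k + 1)"] by auto
    then have "(n, k) \<in> S x"
      by (simp add: S_def)
    then have "(n, k) \<in> S y"
      using eq by simp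
    then have "mdist m y (q n) < 1 / (real k + 1)"
      by (simp add: S_def)
    then show False
      using n k mdist_triangle[OF x _ y, of "q n"] q(1) mdist_commute[of m y "q n"] by force
  qed
  define c where "c x = (\<Sum>k. if k \<in> prod_encode ` S x then (1/3::real) ^ k else 0)" for x
  have "S x = S y" if "c x = c y" for x y
  proof -
    have "prod_encode ` S x = prod_encode ` S y"
      using injD[OF inj_ternary_series] that unfolding c_def by blast
    then show ?thesis
      by (simp add: inj_image_eq_iff inj_prod_encode)
  qed
  then have "inj_on c (mspace m)"
    by (intro inj_onI inj)
  then show thesis using that by blast
qed

text \<open>Transports a metric along an injection, so that a space on an arbitrary type acquires an
  isometric copy among the \<open>real metric\<close>s from which \<open>gh_classes\<close> is
  built.\<close>

definition image_metric :: "('a \<Rightarrow> 'b) \<Rightarrow> 'a metric \<Rightarrow> 'b metric" where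
  "image_metric c m = metric (c ` mspace m,
     \<lambda>a b. mdist m (inv_into (mspace m) c a) (inv_into (mspace m) c b))"

lemma image_metric:
  assumes "inj_on c (mspace m)"
  shows mspace_image_metric: "mspace (image_metric c m) = c ` mspace m"
    and mdist_image_metric: "\<And>x y. x \<in> mspace m \<Longrightarrow> y \<in> mspace m \<Longrightarrow>
           mdist (image_metric c m) (c x) (c y) = mdist m x y"
proof -
  let ?d = "\<lambda>a b. mdist m (inv_into (mspace m) c a) (inv_into (mspace m) c b)"
  interpret M: Metric_space "mspace m" "mdist m" by simp
  interpret Metric_space "c ` mspace m" ?d
    by unfold_locales (use assms in \<open>auto simp: mdist_commute inj_on_eq_iff intro: M.triangle\<close>)
  show "mspace (image_metric c m) = c ` mspace m"
    by (simp add: image_metric_def)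
  show "mdist (image_metric c m) (c x) (c y) = mdist m x y"
    if "x \<in> mspace m" "y \<in> mspace m" for x y
    using that assms by (simp add: image_metric_def)
qed

section \<open>The Gromov--Hausdorff distance via correspondences\<close>

definition compact_metric :: "'a metric \<Rightarrow> bool" where
  "compact_metric K \<longleftrightarrow> compact_space (mtopology_of K) \<and> mspace K \<noteq> {}"

text \<open>Existence of a correspondence of distortion at most \<open>r\<close>. The
  Gromov-Hausdorff distance is half the least distortion, which is the origin of the factor 2 in the
  lemmas that relate the two.\<close>

definition gh_close :: "real \<Rightarrow> 'a metric \<Rightarrow> 'b metric \<Rightarrow> bool" where
  "gh_close r K M \<longleftrightarrow> (\<exists>R \<subseteq> mspace K \<times> mspace M.
     (\<forall>x\<in>mspace K. \<exists>y. (x, y) \<in> R) \<and> (\<forall>y\<in>mspace M. \<exists>x. (x, y) \<in> R) \<and>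
     (\<forall>x y x' y'. (x, y) \<in> R \<longrightarrow> (x', y') \<in> R \<longrightarrow> \<bar>mdist K x x' - mdist M y y'\<bar> \<le> r))"

lemma gh_closeI:
  assumes "R \<subseteq> mspace K \<times> mspace M"
    "\<And>x. x \<in> mspace K \<Longrightarrow> \<exists>y. (x, y) \<in> R" "\<And>y. y \<in> mspace M \<Longrightarrow> \<exists>x. (x, y) \<in> R"
    "\<And>x y x' y'. (x, y) \<in> R \<Longrightarrow> (x', y') \<in> R \<Longrightarrow> \<bar>mdist K x x' - mdist M y y'\<bar> \<le> r"
  shows "gh_close r K M"
  unfolding gh_close_def by (rule exI[of _ R]) (use assms in blast)

lemma gh_closeE:
  assumes "gh_close r K M"
  obtains R where "R \<subseteq> mspace K \<times> mspace M"
    "\<And>x. x \<in> mspace K \<Longrightarrow> \<exists>y. (x, y) \<in> R" "\<And>y. y \<in> mspace M \<Longrightarrow> \<exists>x. (x, y) \<in> R"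
    "\<And>x y x' y'. (x, y) \<in> R \<Longrightarrow> (x', y') \<in> R \<Longrightarrow> \<bar>mdist K x x' - mdist M y y'\<bar> \<le> r"
proof -
  obtain R where "R \<subseteq> mspace K \<times> mspace M \<and>
     (\<forall>x\<in>mspace K. \<exists>y. (x, y) \<in> R) \<and> (\<forall>y\<in>mspace M. \<exists>x. (x, y) \<in> R) \<and>
     (\<forall>x y x' y'. (x, y) \<in> R \<longrightarrow> (x', y') \<in> R \<longrightarrow> \<bar>mdist K x x' - mdist M y y'\<bar> \<le> r)"
    using assms unfolding gh_close_def by auto
  then show thesis
    by (intro that[of R]) auto
qed

lemma gh_close_sym:
  assumes "gh_close r K M"
  shows "gh_close r M K"
proof -
  obtain R where R: "R \<subseteq> mspace K \<times> mspace M"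
    "\<And>x. x \<in> mspace K \<Longrightarrow> \<exists>y. (x, y) \<in> R" "\<And>y. y \<in> mspace M \<Longrightarrow> \<exists>x. (x, y) \<in> R"
    "\<And>x y x' y'. (x, y) \<in> R \<Longrightarrow> (x', y') \<in> R \<Longrightarrow> \<bar>mdist K x x' - mdist M y y'\<bar> \<le> r"
    using gh_closeE[OF assms] by blast
  show ?thesis
    by (rule gh_closeI[of "R\<inverse>"]) (use R in \<open>auto simp: abs_minus_commute\<close>)
qed

lemma gh_close_trans:
  assumes "gh_close r K M" "gh_close s M N"
  shows "gh_close (r + s) K N"
proof -
  obtain R where R: "R \<subseteq> mspace K \<times> mspace M"
    "\<And>x. x \<in> mspace K \<Longrightarrow> \<exists>y. (x, y) \<in> R" "\<And>y. y \<in> mspace M \<Longrightarrow> \<exists>x. (x, y) \<in> R"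
    "\<And>x y x' y'. (x, y) \<in> R \<Longrightarrow> (x', y') \<in> R \<Longrightarrow> \<bar>mdist K x x' - mdist M y y'\<bar> \<le> r"
    using gh_closeE[OF assms(1)] by blast
  obtain S where S: "S \<subseteq> mspace M \<times> mspace N"
    "\<And>x. x \<in> mspace M \<Longrightarrow> \<exists>y. (x, y) \<in> S" "\<And>y. y \<in> mspace N \<Longrightarrow> \<exists>x. (x, y) \<in> S"
    "\<And>x y x' y'. (x, y) \<in> S \<Longrightarrow> (x', y') \<in> S \<Longrightarrow> \<bar>mdist M x x' - mdist N y y'\<bar> \<le> s"
    using gh_closeE[OF assms(2)] by blast
  show ?thesis
  proof (rule gh_closeI[of "R O S"])
    show "R O S \<subseteq> mspace K \<times> mspace N"
      using R(1) S(1) by auto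
    show "\<exists>z. (x, z) \<in> R O S" if "x \<in> mspace K" for x
      using R(1) R(2)[OF that] S(2) by blast
    show "\<exists>x. (x, z) \<in> R O S" if "z \<in> mspace N" for z
      using S(1) S(3)[OF that] R(3) by blast
    fix x z x' z' assume "(x, z) \<in> R O S" "(x', z') \<in> R O S"
    then obtain y y' where "(x, y) \<in> R" "(y, z) \<in> S" "(x', y') \<in> R" "(y', z') \<in> S"
      by auto
    then show "\<bar>mdist K x x' - mdist N z z'\<bar> \<le> r + s"
      using R(4)[of x y x' y'] S(4)[of y z y' z'] by linarith
  qed
qed

lemma gh_close_mono:
  assumes "gh_close r K M" "r \<le> s"
  shows "gh_close s K M"
proof -
  obtain R where R: "R \<subseteq> mspace K \<times> mspace M"
    "\<And>x. x \<in> mspace K \<Longrightarrow> \<exists>y. (x, y) \<in> R" "\<And>y. y \<in> mspace M \<Longrightarrow> \<exists>x. (x, y) \<in> R"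
    "\<And>x y x' y'. (x, y) \<in> R \<Longrightarrow> (x', y') \<in> R \<Longrightarrow> \<bar>mdist K x x' - mdist M y y'\<bar> \<le> r"
    using gh_closeE[OF assms(1)] by blast
  show ?thesis
    by (rule gh_closeI[OF R(1-3)]) (use R(4) assms(2) order_trans in blast)+
qed

lemma isometric_metricsE:
  assumes "isometric_metrics K M"
  obtains f where "f ` mspace K = mspace M"
    "\<And>x y. x \<in> mspace K \<Longrightarrow> y \<in> mspace K \<Longrightarrow> mdist M (f x) (f y) = mdist K x y"
proof -
  obtain f where "isometric_embedding K M f" "f ` mspace K = mspace M"
    using assms unfolding isometric_metrics_def by blast
  then show thesis
    by (intro that[of f]) (auto simp: isometric_embedding_def)
qed

lemma isometric_metrics_imp_gh_close:
  assumes "isometric_metrics K M"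
  shows "gh_close 0 K M"
proof -
  obtain f where f: "f ` mspace K = mspace M"
    "\<And>x y. x \<in> mspace K \<Longrightarrow> y \<in> mspace K \<Longrightarrow> mdist M (f x) (f y) = mdist K x y"
    using isometric_metricsE[OF assms] by blast
  show ?thesis
  proof (rule gh_closeI[of "(\<lambda>x. (x, f x)) ` mspace K"])
    show "\<exists>x. (x, y) \<in> (\<lambda>x. (x, f x)) ` mspace K" if "y \<in> mspace M" for y
      using that unfolding f(1)[symmetric] by blast
  qed (use f in auto)
qed

text \<open>The full product is a correspondence, of distortion at most the sum of the diameter
  bounds. It shows that the infimum in \<open>gh_distance\<close> runs over a nonempty set.\<close>

lemma gh_close_bounded:
  assumes "compact_metric K" "compact_metric M"
  shows "\<exists>r>0. gh_close r K M"
proof -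
  obtain D where D: "0 < D" "\<And>x y. x \<in> mspace K \<Longrightarrow> y \<in> mspace K \<Longrightarrow> mdist K x y \<le> D"
    using assms(1) unfolding compact_metric_def by (metis compact_metric_bounded)
  obtain E where E: "0 < E" "\<And>x y. x \<in> mspace M \<Longrightarrow> y \<in> mspace M \<Longrightarrow> mdist M x y \<le> E"
    using assms(2) unfolding compact_metric_def by (metis compact_metric_bounded)
  have "gh_close (D + E) K M"
  proof (rule gh_closeI[of "mspace K \<times> mspace M"])
    show "\<bar>mdist K x x' - mdist M y y'\<bar> \<le> D + E"
      if "(x, y) \<in> mspace K \<times> mspace M" "(x', y') \<in> mspace K \<times> mspace M" for x y x' y'
      using D(2)[of x x'] E(2)[of y y'] that D(1) E(1) mdist_nonneg[of K x x'] mdist_nonneg[of M y y']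
      unfolding mem_Times_iff fst_conv snd_conv by linarith
  qed (use assms in \<open>auto simp: compact_metric_def\<close>)
  then show ?thesis
    using D(1) E(1) by (intro exI[of _ "D + E"]) auto
qed

text \<open>A guard for \<open>Inf\<close>: the infimum of an empty set of reals is an unspecified
  value, so an admissible radius has to be exhibited, and boundedness of both spaces supplies
  one.\<close>

lemma hausdorff_radius_exists:
  assumes K: "compact_metric K" and M: "compact_metric M"
    and f: "isometric_embedding K Z f" and g: "isometric_embedding M Z g"
  shows "\<exists>r\<ge>0. (\<forall>a\<in>f ` mspace K. \<exists>b\<in>g ` mspace M. mdist Z a b \<le> r) \<and>
                (\<forall>b\<in>g ` mspace M. \<exists>a\<in>f ` mspace K. mdist Z a b \<le> r)"
proof -
  obtain D where D: "0 < D" "\<And>x y. x \<in> mspace K \<Longrightarrow> y \<in> mspace K \<Longrightarrow> mdist K x y \<le> D"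
    using K unfolding compact_metric_def by (metis compact_metric_bounded)
  obtain E where E: "0 < E" "\<And>x y. x \<in> mspace M \<Longrightarrow> y \<in> mspace M \<Longrightarrow> mdist M x y \<le> E"
    using M unfolding compact_metric_def by (metis compact_metric_bounded)
  obtain a b where a: "a \<in> mspace K" and b: "b \<in> mspace M"
    using K M by (auto simp: compact_metric_def)
  define r where "r = D + E + mdist Z (f a) (g b)"
  have fK: "f x \<in> mspace Z" if "x \<in> mspace K" for x
    using f that by (auto simp: isometric_embedding_def)
  have gM: "g x \<in> mspace Z" if "x \<in> mspace M" for x
    using g that by (auto simp: isometric_embedding_def)
  have le: "mdist Z (f x) (g y) \<le> r" if x: "x \<in> mspace K" and y: "y \<in> mspace M" for x y
  proof -
    have "mdist Z (f x) (g y) \<le> mdist Z (f x) (f a) + mdist Z (f a) (g y)"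
      using a x y fK gM by (intro mdist_triangle) auto
    moreover have "mdist Z (f a) (g y) \<le> mdist Z (f a) (g b) + mdist Z (g b) (g y)"
      using a b x y fK gM by (intro mdist_triangle) auto
    moreover have "mdist Z (f x) (f a) \<le> D"
      using f D(2) x a by (auto simp: isometric_embedding_def)
    moreover have "mdist Z (g b) (g y) \<le> E"
      using g E(2) y b by (auto simp: isometric_embedding_def)
    ultimately show ?thesis
      unfolding r_def by linarith
  qed
  have "r \<ge> 0"
    using D(1) E(1) by (simp add: r_def)
  with le a b show ?thesis
    by (intro exI[of _ r]) auto
qed

lemma hausdorff_distance_nonneg:
  assumes "compact_metric K" "compact_metric M" "isometric_embedding K Z f" "isometric_embedding M Z g"
  shows "0 \<le> hausdorff_distance Z (f ` mspace K) (g ` mspace M)"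
  unfolding hausdorff_distance_def
  by (rule cInf_greatest) (use hausdorff_radius_exists[OF assms] in auto)

text \<open>Glue the two spaces along a correspondence of distortion \<open>2 * r\<close>: corresponding
  points get distance \<open>r\<close>, which is exactly what the triangle inequality tolerates.\<close>

lemma gh_close_imp_common_space:
  fixes K :: "'a metric" and M :: "'b metric"
  assumes close: "gh_close (2 * r) K M" and r: "0 < r" and ne: "mspace K \<noteq> {}"
  obtains Z :: "('a + 'b) metric" where "isometric_embedding K Z Inl" "isometric_embedding M Z Inr"
    "\<forall>a\<in>Inl ` mspace K. \<exists>b\<in>Inr ` mspace M. mdist Z a b \<le> r"
    "\<forall>b\<in>Inr ` mspace M. \<exists>a\<in>Inl ` mspace K. mdist Z a b \<le> r"
proof -
  obtain R where R: "R \<subseteq> mspace K \<times> mspace M"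
    "\<And>x. x \<in> mspace K \<Longrightarrow> \<exists>y. (x, y) \<in> R" "\<And>y. y \<in> mspace M \<Longrightarrow> \<exists>x. (x, y) \<in> R"
    "\<And>x y x' y'. (x, y) \<in> R \<Longrightarrow> (x', y') \<in> R \<Longrightarrow> \<bar>mdist K x x' - mdist M y y'\<bar> \<le> 2 * r"
    using gh_closeE[OF close] by blast
  have Rne: "R \<noteq> {}" using R(2) ne by blast
  have RK: "p \<in> R \<Longrightarrow> fst p \<in> mspace K" and RM: "p \<in> R \<Longrightarrow> snd p \<in> mspace M" for p
    using R(1) by auto
  \<comment> \<open>A path metric: move inside \<open>K\<close> to the first component of
    \<open>p\<close>, cross at cost \<open>r\<close>, and continue inside \<open>M\<close> from the
    second component.\<close>
  define \<rho> where "\<rho> x y = (INF p\<in>R. mdist K x (fst p) + r + mdist M (snd p) y)" for x y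
  have \<rho>_le: "\<rho> x y \<le> mdist K x (fst p) + r + mdist M (snd p) y" if "p \<in> R" for p x y
    unfolding \<rho>_def by (rule cINF_lower) (use that r in \<open>auto intro!: bdd_belowI[of _ 0]\<close>)
  have \<rho>_ge: "c \<le> \<rho> x y" if "\<And>p. p \<in> R \<Longrightarrow> c \<le> mdist K x (fst p) + r + mdist M (snd p) y" for c x y
    unfolding \<rho>_def by (rule cINF_greatest) (use that Rne in auto)
  have \<rho>_pos: "r \<le> \<rho> x y" for x y
    by (rule \<rho>_ge) simp
  have tri1: "\<rho> x y \<le> mdist K x x' + \<rho> x' y" if "x \<in> mspace K" "x' \<in> mspace K" for x x' y
  proof -
    have "\<rho> x y - mdist K x x' \<le> \<rho> x' y"
    proof (rule \<rho>_ge)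
      fix p assume p: "p \<in> R"
      show "\<rho> x y - mdist K x x' \<le> mdist K x' (fst p) + r + mdist M (snd p) y"
        using \<rho>_le[OF p, of x y] mdist_triangle[OF that RK[OF p]] by linarith
    qed
    then show ?thesis by linarith
  qed
  have tri2: "\<rho> x y \<le> \<rho> x y' + mdist M y' y" if "y \<in> mspace M" "y' \<in> mspace M" for x y y'
  proof -
    have "\<rho> x y - mdist M y' y \<le> \<rho> x y'"
    proof (rule \<rho>_ge)
      fix p assume p: "p \<in> R"
      show "\<rho> x y - mdist M y' y \<le> mdist K x (fst p) + r + mdist M (snd p) y'"
        using \<rho>_le[OF p, of x y] mdist_triangle[OF RM[OF p] that(2,1)] by linarith
    qed
    then show ?thesis by linarith
  qed
  \<comment> \<open>Two crossings cost \<open>2 * r\<close> in total, and this pays for the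
    distortion between the two pairs \<open>p\<close> and \<open>q\<close> of the
    correspondence.\<close>
  have tri3: "mdist K x x' \<le> \<rho> x y + \<rho> x' y" if "x \<in> mspace K" "x' \<in> mspace K" "y \<in> mspace M" for x x' y
  proof -
    have "mdist K x x' - \<rho> x' y \<le> \<rho> x y"
    proof (rule \<rho>_ge)
      fix p assume p: "p \<in> R"
      have "mdist K x x' - (mdist K x (fst p) + r + mdist M (snd p) y) \<le> \<rho> x' y"
      proof (rule \<rho>_ge)
        fix q assume q: "q \<in> R"
        have "mdist K (fst p) (fst q) \<le> mdist M (snd p) (snd q) + 2 * r"
          using R(4)[of "fst p" "snd p" "fst q" "snd q"] p q unfolding prod.collapse by linarith
        moreover have "mdist M (snd p) (snd q) \<le> mdist M (snd p) y + mdist M (snd q) y"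
          using mdist_triangle[OF RM[OF p] that(3) RM[OF q]] by (simp add: mdist_commute)
        moreover have "mdist K x x' \<le> mdist K x (fst p) + mdist K (fst p) x'"
          using mdist_triangle[OF that(1) RK[OF p] that(2)] .
        moreover have "mdist K (fst p) x' \<le> mdist K (fst p) (fst q) + mdist K x' (fst q)"
          using mdist_triangle[OF RK[OF p] RK[OF q] that(2)] by (simp add: mdist_commute)
        ultimately show "mdist K x x' - (mdist K x (fst p) + r + mdist M (snd p) y)
            \<le> mdist K x' (fst q) + r + mdist M (snd q) y"
          by linarith
      qed
      then show "mdist K x x' - \<rho> x' y \<le> mdist K x (fst p) + r + mdist M (snd p) y"
        by linarith
    qed
    then show ?thesis by linarith
  qed
  have tri4: "mdist M y y' \<le> \<rho> x y + \<rho> x y'" if "y \<in> mspace M" "y' \<in> mspace M" "x \<in> mspace K" for x y y'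
  proof -
    have "mdist M y y' - \<rho> x y' \<le> \<rho> x y"
    proof (rule \<rho>_ge)
      fix p assume p: "p \<in> R"
      have "mdist M y y' - (mdist K x (fst p) + r + mdist M (snd p) y) \<le> \<rho> x y'"
      proof (rule \<rho>_ge)
        fix q assume q: "q \<in> R"
        have "mdist M (snd p) (snd q) \<le> mdist K (fst p) (fst q) + 2 * r"
          using R(4)[of "fst p" "snd p" "fst q" "snd q"] p q unfolding prod.collapse by linarith
        moreover have "mdist K (fst p) (fst q) \<le> mdist K x (fst p) + mdist K x (fst q)"
          using mdist_triangle[OF RK[OF p] that(3) RK[OF q]] by (simp add: mdist_commute)
        moreover have "mdist M y y' \<le> mdist M (snd p) y + mdist M (snd p) y'"
          using mdist_triangle[OF that(1) RM[OF p] that(2)] by (simp add: mdist_commute)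
        moreover have "mdist M (snd p) y' \<le> mdist M (snd p) (snd q) + mdist M (snd q) y'"
          using mdist_triangle[OF RM[OF p] RM[OF q] that(2)] .
        ultimately show "mdist M y y' - (mdist K x (fst p) + r + mdist M (snd p) y)
            \<le> mdist K x (fst q) + r + mdist M (snd q) y'"
          by linarith
      qed
      then show "mdist M y y' - \<rho> x y' \<le> mdist K x (fst p) + r + mdist M (snd p) y"
        by linarith
    qed
    then show ?thesis by linarith
  qed
  define S where "S = Inl ` mspace K \<union> Inr ` mspace M"
  define d where "d u v = (case (u, v) of (Inl x, Inl x') \<Rightarrow> mdist K x x' | (Inl x, Inr y) \<Rightarrow> \<rho> x y
      | (Inr y, Inl x) \<Rightarrow> \<rho> x y | (Inr y, Inr y') \<Rightarrow> mdist M y y')" for u v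
  have d: "d (Inl x) (Inl x') = mdist K x x'" "d (Inl x) (Inr y) = \<rho> x y"
    "d (Inr y) (Inl x) = \<rho> x y" "d (Inr y) (Inr y') = mdist M y y'" for x y x' y'
    by (simp_all add: d_def)
  interpret Z: Metric_space S d
  proof
    show "0 \<le> d u v" for u v
      using \<rho>_pos r by (cases u; cases v) (auto simp: d intro: order_trans[OF less_imp_le])
    show "d u v = d v u" for u v
      by (cases u; cases v) (auto simp: d mdist_commute)
    show "(d u v = 0) = (u = v)" if "u \<in> S" "v \<in> S" for u v
      using that \<rho>_pos r by (auto simp: S_def d) (smt (verit))+
    fix u v w assume "u \<in> S" "v \<in> S" "w \<in> S"
    then show "d u w \<le> d u v + d v w"
      unfolding S_def
    proof (elim UnE imageE, goal_cases)
      case (1 x y z) then show ?case using mdist_triangle by (simp add: d)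
    next
      case (2 x y z) then show ?case using tri1 by (simp add: d)
    next
      case (3 x y z) then show ?case using tri3 by (simp add: d)
    next
      case (4 x y z) then show ?case using tri2 by (simp add: d)
    next
      case (5 x y z) then show ?case using tri1[of z y x] by (simp add: d mdist_commute)
    next
      case (6 x y z) then show ?case using tri4 by (simp add: d)
    next
      case (7 x y z) then show ?case using tri2[of x y z] by (simp add: d mdist_commute)
    next
      case (8 x y z) then show ?case using mdist_triangle by (simp add: d)
    qed
  qed
  have near: "\<rho> x y \<le> r" if "(x, y) \<in> R" for x y
  proof -
    have "x \<in> mspace K" "y \<in> mspace M" using that R(1) by auto
    then have "mdist K x x = 0" "mdist M y y = 0" by simp_all
    then show ?thesis
      using \<rho>_le[OF that, of x y] by simp
  qed
  show thesis
  proof (rule that[of Z.Self])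
    show "isometric_embedding K Z.Self Inl" "isometric_embedding M Z.Self Inr"
      unfolding isometric_embedding_def Z.mspace_Self Z.mdist_Self by (auto simp: S_def d)
    show "\<forall>a\<in>Inl ` mspace K. \<exists>b\<in>Inr ` mspace M. mdist Z.Self a b \<le> r"
      unfolding Z.mdist_Self
    proof clarify
      fix x assume "x \<in> mspace K"
      then obtain y where "(x, y) \<in> R" "y \<in> mspace M" using R(1,2) by blast
      then show "\<exists>b\<in>Inr ` mspace M. d (Inl x) b \<le> r"
        using near by (auto simp: d)
    qed
    show "\<forall>b\<in>Inr ` mspace M. \<exists>a\<in>Inl ` mspace K. mdist Z.Self a b \<le> r"
      unfolding Z.mdist_Self
    proof clarify
      fix y assume "y \<in> mspace M"
      then obtain x where "(x, y) \<in> R" "x \<in> mspace K" using R(1,3) by blast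
      then show "\<exists>a\<in>Inl ` mspace K. d a (Inr y) \<le> r"
        using near by (auto simp: d)
    qed
  qed
qed

lemma gh_distance_le:
  assumes "gh_close (2 * r) K M" "0 < r" "compact_metric K" "compact_metric M"
  shows "gh_distance K M \<le> r"
proof -
  obtain Z where Z: "isometric_embedding K Z Inl" "isometric_embedding M Z Inr"
    "\<forall>a\<in>Inl ` mspace K. \<exists>b\<in>Inr ` mspace M. mdist Z a b \<le> r"
    "\<forall>b\<in>Inr ` mspace M. \<exists>a\<in>Inl ` mspace K. mdist Z a b \<le> r"
    using gh_close_imp_common_space[OF assms(1,2)] assms(3) unfolding compact_metric_def by metis
  have "hausdorff_distance Z (Inl ` mspace K) (Inr ` mspace M) \<le> r"
    unfolding hausdorff_distance_def
    by (rule cInf_lower) (use Z assms(2) in \<open>auto intro!: bdd_belowI[of _ 0]\<close>)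
  moreover have "gh_distance K M \<le> hausdorff_distance Z (Inl ` mspace K) (Inr ` mspace M)"
    unfolding gh_distance_def
    by (rule cInf_lower) (use Z hausdorff_distance_nonneg[OF assms(3,4)] in \<open>auto intro!: bdd_belowI[of _ 0]\<close>)
  ultimately show ?thesis by linarith
qed

lemma gh_distance_candidates_nonempty:
  assumes "compact_metric K" "compact_metric M"
  shows "{hausdorff_distance Z (f ` mspace K) (g ` mspace M) | (Z :: ('a + 'b) metric) f g.
            isometric_embedding (K :: 'a metric) Z f \<and> isometric_embedding (M :: 'b metric) Z g} \<noteq> {}"
proof -
  obtain r where "r > 0" "gh_close (2 * (r / 2)) K M"
    using gh_close_bounded[OF assms] by auto
  moreover have "mspace K \<noteq> {}"
    using assms(1) by (simp add: compact_metric_def)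
  ultimately obtain Z :: "('a + 'b) metric" where "isometric_embedding K Z Inl" "isometric_embedding M Z Inr"
    using gh_close_imp_common_space[of "r/2" K M] half_gt_zero by metis
  then show ?thesis by blast
qed

lemma gh_distance_nonneg:
  assumes "compact_metric K" "compact_metric M"
  shows "0 \<le> gh_distance K M"
  unfolding gh_distance_def
  by (rule cInf_greatest[OF gh_distance_candidates_nonempty[OF assms]])
    (use hausdorff_distance_nonneg[OF assms] in auto)

text \<open>Pairs whose images in \<open>Z\<close> lie within the Hausdorff radius form a
  correspondence, and replacing both endpoints of a distance by such partners changes it by at most
  twice that radius.\<close>

lemma gh_close_of_distance_less:
  fixes K :: "'a metric" and M :: "'b metric"
  assumes "gh_distance K M < r" "compact_metric K" "compact_metric M"
  shows "gh_close (2 * r) K M"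
proof -
  obtain Z :: "('a + 'b) metric" and f g where fg: "isometric_embedding K Z f" "isometric_embedding M Z g"
    and "hausdorff_distance Z (f ` mspace K) (g ` mspace M) < r"
    using cInf_lessD[OF gh_distance_candidates_nonempty[OF assms(2,3)] assms(1)[unfolded gh_distance_def]]
    by blast
  then obtain s where s: "s < r" "\<forall>a\<in>f ` mspace K. \<exists>b\<in>g ` mspace M. mdist Z a b \<le> s"
    "\<forall>b\<in>g ` mspace M. \<exists>a\<in>f ` mspace K. mdist Z a b \<le> s"
    unfolding hausdorff_distance_def
    using cInf_lessD[of "{r. 0 \<le> r \<and> (\<forall>a\<in>f ` mspace K. \<exists>b\<in>g ` mspace M. mdist Z a b \<le> r) \<and>
      (\<forall>b\<in>g ` mspace M. \<exists>a\<in>f ` mspace K. mdist Z a b \<le> r)}" r] hausdorff_radius_exists[OF assms(2,3) fg] by blast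
  show ?thesis
  proof (rule gh_closeI[of "{(x, y). x \<in> mspace K \<and> y \<in> mspace M \<and> mdist Z (f x) (g y) \<le> s}"])
    fix x y x' y'
    assume "(x, y) \<in> {(x, y). x \<in> mspace K \<and> y \<in> mspace M \<and> mdist Z (f x) (g y) \<le> s}"
      "(x', y') \<in> {(x, y). x \<in> mspace K \<and> y \<in> mspace M \<and> mdist Z (f x) (g y) \<le> s}"
    then have *: "x \<in> mspace K" "y \<in> mspace M" "mdist Z (f x) (g y) \<le> s"
      "x' \<in> mspace K" "y' \<in> mspace M" "mdist Z (f x') (g y') \<le> s" by auto
    then have Z: "f x \<in> mspace Z" "f x' \<in> mspace Z" "g y \<in> mspace Z" "g y' \<in> mspace Z"
      and eq: "mdist K x x' = mdist Z (f x) (f x')" "mdist M y y' = mdist Z (g y) (g y')"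
      using fg by (auto simp: isometric_embedding_def)
    show "\<bar>mdist K x x' - mdist M y y'\<bar> \<le> 2 * r"
      unfolding eq
      using mdist_triangle[OF Z(1,3,2)] mdist_triangle[OF Z(3,4,2)] mdist_triangle[OF Z(3,1,4)]
        mdist_triangle[OF Z(1,2,4)] *(3,6) s(1)
        mdist_commute[of Z "g y" "f x"] mdist_commute[of Z "g y'" "f x'"] by linarith
  next
    show "\<exists>y. (x, y) \<in> {(x, y). x \<in> mspace K \<and> y \<in> mspace M \<and> mdist Z (f x) (g y) \<le> s}" if "x \<in> mspace K" for x
      using s(2) that by blast
    show "\<exists>x. (x, y) \<in> {(x, y). x \<in> mspace K \<and> y \<in> mspace M \<and> mdist Z (f x) (g y) \<le> s}" if "y \<in> mspace M" for y
      using s(3) that by blast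
  qed blast
qed

section \<open>Isometric compact metric spaces\<close>

lemma isometric_metrics_refl: "isometric_metrics K K"
  unfolding isometric_metrics_def isometric_embedding_def by (intro exI[of _ id]) auto

lemma isometric_metrics_sym:
  assumes "isometric_metrics K M"
  shows "isometric_metrics M K"
proof -
  obtain f where f: "f ` mspace K = mspace M"
    "\<And>x y. x \<in> mspace K \<Longrightarrow> y \<in> mspace K \<Longrightarrow> mdist M (f x) (f y) = mdist K x y"
    using isometric_metricsE[OF assms] by blast
  have inj: "inj_on f (mspace K)"
    by (rule inj_onI) (metis f mdist_zero)
  show ?thesis
    unfolding isometric_metrics_def isometric_embedding_def
  proof (intro exI[of _ "inv_into (mspace K) f"] conjI ballI)
    show *: "inv_into (mspace K) f ` mspace M = mspace K"
      unfolding f(1)[symmetric] using inj by force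
    then show "inv_into (mspace K) f ` mspace M \<subseteq> mspace K" by simp
    show "mdist K (inv_into (mspace K) f x) (inv_into (mspace K) f y) = mdist M x y"
      if "x \<in> mspace M" "y \<in> mspace M" for x y
      using that f by (metis f_inv_into_f inv_into_into)
  qed
qed

lemma isometric_metrics_trans:
  assumes "isometric_metrics K M" "isometric_metrics M N"
  shows "isometric_metrics K N"
proof -
  obtain f where f: "f ` mspace K = mspace M"
    "\<And>x y. x \<in> mspace K \<Longrightarrow> y \<in> mspace K \<Longrightarrow> mdist M (f x) (f y) = mdist K x y"
    using isometric_metricsE[OF assms(1)] by blast
  obtain g where g: "g ` mspace M = mspace N"
    "\<And>x y. x \<in> mspace M \<Longrightarrow> y \<in> mspace M \<Longrightarrow> mdist N (g x) (g y) = mdist M x y"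
    using isometric_metricsE[OF assms(2)] by blast
  have "(g \<circ> f) ` mspace K = mspace N"
    unfolding image_comp[symmetric] f(1) g(1) ..
  moreover have "mdist N ((g \<circ> f) x) ((g \<circ> f) y) = mdist K x y" if "x \<in> mspace K" "y \<in> mspace K" for x y
    using that f g by (metis comp_apply image_eqI)
  ultimately show ?thesis
    unfolding isometric_metrics_def isometric_embedding_def by (intro exI[of _ "g \<circ> f"]) auto
qed

lemma isometric_metrics_homeomorphic:
  assumes "isometric_metrics K M"
  shows "mtopology_of K homeomorphic_space mtopology_of M"
proof -
  obtain f where f: "f ` mspace K = mspace M"
    "\<And>x y. x \<in> mspace K \<Longrightarrow> y \<in> mspace K \<Longrightarrow> mdist M (f x) (f y) = mdist K x y"
    using isometric_metricsE[OF assms] by blast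
  interpret Metric_space12 "mspace K" "mdist K" "mspace M" "mdist M"
    by (simp add: Metric_space12_mspace_mdist)
  have "homeomorphic_map M1.mtopology M2.mtopology f"
    by (rule isometry_imp_homeomorphic_map) (use f in auto)
  then show ?thesis
    by (metis homeomorphic_map_imp_homeomorphic_space mtopology_of_def)
qed

lemma isometric_metrics_compact:
  assumes "isometric_metrics K M" "compact_metric K"
  shows "compact_metric M"
proof -
  have "compact_space (mtopology_of M)"
    using assms isometric_metrics_homeomorphic homeomorphic_compact_space
    unfolding compact_metric_def by blast
  moreover have "mspace M \<noteq> {}"
    using assms unfolding isometric_metrics_def compact_metric_def by auto
  ultimately show ?thesis by (simp add: compact_metric_def)
qed

text \<open>Tychonoff's theorem turns the almost isometries into an isometric embedding.\<close>

lemma gh_close_zero_embedding: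
  assumes K: "compact_metric K" and M: "compact_metric M" and close: "\<And>r. 0 < r \<Longrightarrow> gh_close r K M"
  obtains f where "isometric_embedding K M f"
proof -
  interpret M: Metric_space "mspace M" "mdist M" by simp
  let ?T = "product_topology (\<lambda>_. mtopology_of M) (mspace K)"
  \<comment> \<open>No continuity is asked of the maps: conditions on pairs of coordinates are
    closed in the product topology, and the almost isometries of increasing precision form nested
    nonempty closed sets, which have a common element.\<close>
  define C where "C n = {f \<in> topspace ?T. \<forall>x\<in>mspace K. \<forall>y\<in>mspace K.
      mdist M (f x) (f y) \<in> {mdist K x y - 1 / (real n + 1)..mdist K x y + 1 / (real n + 1)}}" for n
  have closed: "closedin ?T (C n)" for n
  proof -
    have "closedin ?T {f \<in> topspace ?T. mdist M (f x) (f y) \<in> {a..b}}" if "x \<in> mspace K" "y \<in> mspace K" for x y a b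
    proof (rule closedin_continuous_map_preimage)
      show "continuous_map ?T euclideanreal (\<lambda>f. mdist M (f x) (f y))"
        using that by (intro continuous_map_mdist continuous_map_product_projection)
    qed simp
    then have "closedin ?T (\<Inter>x\<in>mspace K. \<Inter>y\<in>mspace K. {f \<in> topspace ?T. mdist M (f x) (f y)
         \<in> {mdist K x y - 1 / (real n + 1)..mdist K x y + 1 / (real n + 1)}})"
      using K by (intro closedin_Inter) (auto simp: compact_metric_def)
    moreover have "C n = (\<Inter>x\<in>mspace K. \<Inter>y\<in>mspace K. {f \<in> topspace ?T. mdist M (f x) (f y)
         \<in> {mdist K x y - 1 / (real n + 1)..mdist K x y + 1 / (real n + 1)}})"
      using K by (auto simp: C_def compact_metric_def)
    ultimately show ?thesis by simp
  qed
  have ne: "C n \<noteq> {}" for n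
  proof -
    have "gh_close (1 / (real n + 1)) K M"
      by (rule close) simp
    then obtain R where R: "R \<subseteq> mspace K \<times> mspace M"
      "\<And>x. x \<in> mspace K \<Longrightarrow> \<exists>y. (x, y) \<in> R" "\<And>y. y \<in> mspace M \<Longrightarrow> \<exists>x. (x, y) \<in> R"
      "\<And>x y x' y'. (x, y) \<in> R \<Longrightarrow> (x', y') \<in> R \<Longrightarrow> \<bar>mdist K x x' - mdist M y y'\<bar> \<le> 1 / (real n + 1)"
      using gh_closeE[of "1 / (real n + 1)" K M] by blast
    define f where "f = restrict (\<lambda>x. SOME y. (x, y) \<in> R) (mspace K)"
    have f: "(x, f x) \<in> R" if "x \<in> mspace K" for x
      unfolding f_def using someI_ex[OF R(2)[OF that]] that by simp
    have "f \<in> C n"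
      unfolding C_def
    proof (intro CollectI conjI ballI)
      show "f \<in> topspace ?T"
        unfolding topspace_product_topology topspace_mtopology_of
        using f R(1) by (intro PiE_I) (auto simp: f_def)
      show "mdist M (f x) (f y) \<in> {mdist K x y - 1 / (real n + 1)..mdist K x y + 1 / (real n + 1)}"
        if "x \<in> mspace K" "y \<in> mspace K" for x y
        using R(4)[OF f[OF that(1)] f[OF that(2)]] unfolding atLeastAtMost_iff abs_le_iff by linarith
    qed
    then show ?thesis by blast
  qed
  have mono: "C n \<subseteq> C m" if "m \<le> n" for m n
  proof -
    have "1 / (real n + 1) \<le> 1 / (real m + 1)"
      using that by (intro divide_left_mono) auto
    then have "{a - 1 / (real n + 1)..a + 1 / (real n + 1)} \<subseteq> {a - 1 / (real m + 1)..a + 1 / (real m + 1)}" for a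
      by auto
    then show ?thesis
      unfolding C_def by blast
  qed
  have "compact_space ?T"
    using M by (simp add: compact_space_product_topology compact_metric_def)
  then have "(\<Inter>n. C n) \<noteq> {}"
  proof (rule compact_space_imp_nest)
    show "closedin ?T (C n)" "C n \<noteq> {}" for n by (fact closed ne)+
    show "decseq C" using mono by (auto simp: decseq_def)
  qed
  then obtain f where f: "\<And>n. f \<in> C n" by auto
  have "mdist M (f x) (f y) = mdist K x y" if xy: "x \<in> mspace K" "y \<in> mspace K" for x y
  proof (rule ccontr)
    assume "mdist M (f x) (f y) \<noteq> mdist K x y"
    then have "0 < \<bar>mdist M (f x) (f y) - mdist K x y\<bar>"
      by simp
    then obtain n :: nat where "1 / real (Suc n) < \<bar>mdist M (f x) (f y) - mdist K x y\<bar>"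
      by (rule nat_approx_posE)
    moreover have "mdist M (f x) (f y) \<in> {mdist K x y - 1 / (real n + 1)..mdist K x y + 1 / (real n + 1)}"
      using f[of n] xy unfolding C_def by blast
    ultimately show False
      unfolding of_nat_Suc atLeastAtMost_iff add.commute[of 1] by linarith
  qed
  moreover have "f ` mspace K \<subseteq> mspace M"
    using f[of 0] by (auto simp: C_def)
  ultimately show thesis
    by (intro that[of f]) (auto simp: isometric_embedding_def)
qed

text \<open>Embeddings exist in both directions. Their composite is an isometric self-embedding of
  the compact space \<open>M\<close>, hence onto, and so the outer map \<open>f\<close> is onto as
  well.\<close>

lemma gh_close_zero_imp_isometric:
  assumes K: "compact_metric K" and M: "compact_metric M" and close: "\<And>r. 0 < r \<Longrightarrow> gh_close r K M"
  shows "isometric_metrics K M"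
proof -
  obtain f where f: "isometric_embedding K M f"
    using gh_close_zero_embedding[OF assms] .
  obtain g where g: "isometric_embedding M K g"
    by (rule gh_close_zero_embedding[OF M K gh_close_sym[OF close]])
  have im: "f ` mspace K \<subseteq> mspace M" "g ` mspace M \<subseteq> mspace K"
    using f g by (simp_all add: isometric_embedding_def)
  have iso: "mdist M (f x) (f y) = mdist K x y" if "x \<in> mspace K" "y \<in> mspace K" for x y
    using f that by (simp add: isometric_embedding_def)
  have "(\<lambda>x. f (g x)) ` mspace M = mspace M"
  proof (rule isometric_self_embedding_surj)
    show "compact_space (mtopology_of M)"
      using M by (simp add: compact_metric_def)
    show "(\<lambda>x. f (g x)) ` mspace M \<subseteq> mspace M"
      using im by (meson image_subset_iff)
    fix x y assume xy: "x \<in> mspace M" "y \<in> mspace M"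
    then have "g x \<in> mspace K" "g y \<in> mspace K"
      using im(2) by blast+
    then show "mdist M (f (g x)) (f (g y)) = mdist M x y"
      using iso g xy by (simp add: isometric_embedding_def)
  qed
  then have "f ` mspace K = mspace M"
    using im by (metis image_image image_mono subset_antisym)
  with f show ?thesis
    by (auto simp: isometric_metrics_def)
qed

section \<open>Isometry classes and the metric on them\<close>

lemma isometry_class_eq:
  assumes "isometric_metrics K M"
  shows "isometry_class K = isometry_class M"
  unfolding isometry_class_def
  using isometric_metrics_trans[OF assms] isometric_metrics_trans[OF isometric_metrics_sym[OF assms]]
  by blast

lemma image_metric_isometric:
  assumes "inj_on c (mspace m)"
  shows "isometric_metrics m (image_metric c m)"
  unfolding isometric_metrics_def isometric_embedding_def
  by (rule exI[of _ c]) (simp add: image_metric[OF assms])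

text \<open>A compact space is separable and therefore injects into the reals. This is how
  \<open>L1\<close>, whose points are sets of functions, gets a class in
  \<open>gh_classes\<close>.\<close>

lemma isometry_class_in_gh_classes:
  assumes "compact_metric K"
  obtains M :: "real metric" where "compact_metric M" "isometric_metrics K M"
    "isometry_class K = isometry_class M" "isometry_class K \<in> gh_classes" "M \<in> isometry_class K"
proof -
  have "separable_space (mtopology_of K)"
    using assms compact_metric_separable by (auto simp: compact_metric_def)
  then obtain c :: "'a \<Rightarrow> real" where c: "inj_on c (mspace K)"
    using separable_metric_inj_real by blast
  have iso: "isometric_metrics K (image_metric c K)"
    using image_metric_isometric[OF c] .
  have cpt: "compact_metric (image_metric c K)"
    using isometric_metrics_compact[OF iso assms] .
  show thesis
  proof (rule that[OF cpt iso isometry_class_eq[OF iso]])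
    show "isometry_class K \<in> gh_classes"
      unfolding isometry_class_eq[OF iso] gh_classes_def
      by (rule imageI) (use cpt in \<open>auto simp: compact_metric_def\<close>)
    show "image_metric c K \<in> isometry_class K"
      using iso cpt by (simp add: isometry_class_def compact_metric_def)
  qed
qed

lemma gh_classesE:
  assumes "\<K> \<in> gh_classes"
  obtains K :: "real metric" where "compact_metric K" "\<K> = isometry_class K"
  using assms unfolding gh_classes_def compact_metric_def by blast

text \<open>Isometric spaces are joined by a correspondence of distortion 0, so composing
  correspondences shows that the set under \<open>the_elem\<close> is a singleton.\<close>

lemma gh_class_distance_eq:
  assumes K: "compact_metric K" and M: "compact_metric M"
  obtains K' M' :: "real metric" where
    "gh_class_distance (isometry_class K) (isometry_class M) = gh_distance K' M'"
    "isometric_metrics K K'" "isometric_metrics M M'" "compact_metric K'" "compact_metric M'"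
proof -
  obtain K' :: "real metric" where K': "compact_metric K'" "isometric_metrics K K'"
    "isometry_class K = isometry_class K'" "isometry_class K \<in> gh_classes" "K' \<in> isometry_class K"
    using isometry_class_in_gh_classes[OF K] by blast
  obtain M' :: "real metric" where M': "compact_metric M'" "isometric_metrics M M'"
    "isometry_class M = isometry_class M'" "isometry_class M \<in> gh_classes" "M' \<in> isometry_class M"
    using isometry_class_in_gh_classes[OF M] by blast
  have le: "gh_distance A B \<le> gh_distance A' B'"
    if "A \<in> isometry_class K" "A' \<in> isometry_class K" "B \<in> isometry_class M" "B' \<in> isometry_class M"
    for A A' B B'
  proof (rule dense_ge)
    have iso: "isometric_metrics K A" "isometric_metrics K A'" "isometric_metrics M B" "isometric_metrics M B'"
      using that by (auto simp: isometry_class_def)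
    have cpt: "compact_metric A" "compact_metric A'" "compact_metric B" "compact_metric B'"
      by (rule isometric_metrics_compact[OF iso(1) K] isometric_metrics_compact[OF iso(2) K]
            isometric_metrics_compact[OF iso(3) M] isometric_metrics_compact[OF iso(4) M])+
    fix r assume r: "gh_distance A' B' < r"
    then have close: "gh_close (2 * r) A' B'"
      using gh_close_of_distance_less cpt by blast
    have A: "gh_close 0 A A'"
      by (rule isometric_metrics_imp_gh_close[OF isometric_metrics_trans[OF isometric_metrics_sym[OF iso(1)] iso(2)]])
    have B: "gh_close 0 B' B"
      by (rule isometric_metrics_imp_gh_close[OF isometric_metrics_trans[OF isometric_metrics_sym[OF iso(4)] iso(3)]])
    have "gh_close (2 * r) A B"
      using gh_close_trans[OF gh_close_trans[OF A close] B] by simp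
    moreover have "0 < r"
      using r gh_distance_nonneg[OF cpt(2,4)] by linarith
    ultimately show "gh_distance A B \<le> r"
      by (rule gh_distance_le[OF _ _ cpt(1,3)])
  qed
  have "{gh_distance A B | A B. A \<in> isometry_class K \<and> B \<in> isometry_class M} = {gh_distance K' M'}"
    using le K'(5) M'(5) by (blast intro: antisym)
  then have "gh_class_distance (isometry_class K) (isometry_class M) = gh_distance K' M'"
    using K'(4) M'(4) by (simp add: gh_class_distance_def)
  then show thesis
    by (rule that[OF _ K'(2) M'(2) K'(1) M'(1)])
qed

lemma gh_class_distance_le:
  assumes "gh_close (2 * r) K M" "0 < r" "compact_metric K" "compact_metric M"
  shows "gh_class_distance (isometry_class K) (isometry_class M) \<le> r"
proof -
  obtain K' M' :: "real metric" where *: "gh_class_distance (isometry_class K) (isometry_class M) = gh_distance K' M'"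
    "isometric_metrics K K'" "isometric_metrics M M'" "compact_metric K'" "compact_metric M'"
    using gh_class_distance_eq[OF assms(3,4)] by blast
  have A: "gh_close 0 K' K" and B: "gh_close 0 M M'"
    using *(2,3) by (simp_all add: gh_close_sym isometric_metrics_imp_gh_close)
  have "gh_close (2 * r) K' M'"
    using gh_close_trans[OF gh_close_trans[OF A assms(1)] B] by simp
  then show ?thesis
    unfolding *(1) by (rule gh_distance_le[OF _ assms(2) *(4,5)])
qed

lemma gh_close_of_class_distance_less:
  assumes "gh_class_distance (isometry_class K) (isometry_class M) < r" "compact_metric K" "compact_metric M"
  shows "gh_close (2 * r) K M"
proof -
  obtain K' M' :: "real metric" where *: "gh_class_distance (isometry_class K) (isometry_class M) = gh_distance K' M'"
    "isometric_metrics K K'" "isometric_metrics M M'" "compact_metric K'" "compact_metric M'"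
    using gh_class_distance_eq[OF assms(2,3)] by blast
  have close: "gh_close (2 * r) K' M'"
    using gh_close_of_distance_less *(1,4,5) assms(1) by simp
  have A: "gh_close 0 K K'" and B: "gh_close 0 M' M"
    using *(2,3) by (simp_all add: gh_close_sym isometric_metrics_imp_gh_close)
  show ?thesis
    using gh_close_trans[OF gh_close_trans[OF A close] B] by simp
qed

lemma gh_class_distance_nonneg: "0 \<le> gh_class_distance \<K> \<M>"
proof (cases "\<K> \<in> gh_classes \<and> \<M> \<in> gh_classes")
  case True
  then obtain K M :: "real metric" where *: "compact_metric K" "\<K> = isometry_class K" "compact_metric M" "\<M> = isometry_class M"
    by (meson gh_classesE)
  show ?thesis
    unfolding *(2,4) by (rule gh_class_distance_eq[OF *(1,3)]) (simp add: gh_distance_nonneg)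
qed (auto simp: gh_class_distance_def)

text \<open>Definiteness is the isometry obtained from Tychonoff's theorem, and the triangle
  inequality is composition of correspondences. The locale demands nonnegativity and symmetry for
  all arguments; off \<open>gh_classes\<close> they come from the value 0 in
  \<open>gh_class_distance\<close>.\<close>

lemma Metric_space_gh: "Metric_space gh_classes gh_class_distance"
proof
  show "0 \<le> gh_class_distance \<K> \<M>" for \<K> \<M>
    by (rule gh_class_distance_nonneg)
  have sym: "gh_class_distance \<K> \<M> \<le> gh_class_distance \<M> \<K>" if KM: "\<K> \<in> gh_classes" "\<M> \<in> gh_classes" for \<K> \<M>
  proof (rule dense_ge)
    obtain K M :: "real metric" where *: "compact_metric K" "\<K> = isometry_class K" "compact_metric M" "\<M> = isometry_class M"
      using KM by (meson gh_classesE)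
    fix r assume r: "gh_class_distance \<M> \<K> < r"
    then have "gh_close (2 * r) M K"
      using gh_close_of_class_distance_less * by blast
    moreover have "0 < r"
      using r gh_class_distance_nonneg[of \<M> \<K>] by linarith
    ultimately show "gh_class_distance \<K> \<M> \<le> r"
      using gh_class_distance_le * gh_close_sym by blast
  qed
  show "gh_class_distance \<K> \<M> = gh_class_distance \<M> \<K>" for \<K> \<M>
    using sym[of \<K> \<M>] sym[of \<M> \<K>] by (cases "\<K> \<in> gh_classes \<and> \<M> \<in> gh_classes") (auto simp: gh_class_distance_def)
  show "(gh_class_distance \<K> \<M> = 0) = (\<K> = \<M>)" if KM: "\<K> \<in> gh_classes" "\<M> \<in> gh_classes" for \<K> \<M>
  proof -
    obtain K M :: "real metric" where *: "compact_metric K" "\<K> = isometry_class K" "compact_metric M" "\<M> = isometry_class M"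
      using KM by (meson gh_classesE)
    show ?thesis
    proof
      assume eq: "gh_class_distance \<K> \<M> = 0"
      have "gh_close r K M" if "0 < r" for r
        using gh_close_of_class_distance_less[of K M "r / 2"] * eq that by simp
      then show "\<K> = \<M>"
        using gh_close_zero_imp_isometric isometry_class_eq * by blast
    next
      assume eq: "\<K> = \<M>"
      have "gh_class_distance \<K> \<M> \<le> r" if "0 < r" for r
      proof -
        have "gh_close (2 * r) K K"
          using that by (intro gh_close_mono[OF isometric_metrics_imp_gh_close[OF isometric_metrics_refl]]) simp
        then show ?thesis
          using gh_class_distance_le[of r K K] * eq that by simp
      qed
      then show "gh_class_distance \<K> \<M> = 0"
        using gh_class_distance_nonneg[of \<K> \<M>] by (meson dense_ge order_antisym)
    qed
  qed
  show "gh_class_distance \<K> \<N> \<le> gh_class_distance \<K> \<M> + gh_class_distance \<M> \<N>"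
    if KM: "\<K> \<in> gh_classes" "\<M> \<in> gh_classes" "\<N> \<in> gh_classes" for \<K> \<M> \<N>
  proof (rule field_le_epsilon)
    obtain K M :: "real metric" where *: "compact_metric K" "\<K> = isometry_class K" "compact_metric M" "\<M> = isometry_class M"
      using KM by (meson gh_classesE)
    obtain N :: "real metric" where N: "compact_metric N" "\<N> = isometry_class N"
      using gh_classesE[OF KM(3)] by blast
    fix e :: real assume e: "0 < e"
    let ?a = "gh_class_distance \<K> \<M> + e / 2" and ?b = "gh_class_distance \<M> \<N> + e / 2"
    have "gh_close (2 * ?a) K M" "gh_close (2 * ?b) M N"
      by (rule gh_close_of_class_distance_less; use * N e in simp)+
    then have "gh_close (2 * ?a + 2 * ?b) K N"
      by (rule gh_close_trans)
    then have "gh_close (2 * (?a + ?b)) K N"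
      by (simp add: algebra_simps)
    moreover have "0 < ?a + ?b"
      using gh_class_distance_nonneg[of \<K> \<M>] gh_class_distance_nonneg[of \<M> \<N>] e by linarith
    ultimately have "gh_class_distance \<K> \<N> \<le> ?a + ?b"
      using gh_class_distance_le *(1,2) N by blast
    then show "gh_class_distance \<K> \<N> \<le> gh_class_distance \<K> \<M> + gh_class_distance \<M> \<N> + e"
      by simp
  qed
qed

section \<open>Precompact families in the Gromov-Hausdorff space\<close>

lemma gh_precompact_uniformly_totally_bounded:
  assumes S: "S \<subseteq> gh_classes" and cpt: "compactin gh_topology (gh_topology closure_of S)" and e: "0 < e"
  obtains N :: nat where
    "\<And>(K :: 'b metric) P. \<lbrakk>compact_metric K; isometry_class K \<in> S; finite P; P \<subseteq> mspace K;
        \<And>x y. x \<in> P \<Longrightarrow> y \<in> P \<Longrightarrow> x \<noteq> y \<Longrightarrow> e \<le> mdist K x y\<rbrakk> \<Longrightarrow> card P \<le> N"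
proof -
  interpret GH: Metric_space gh_classes gh_class_distance by (rule Metric_space_gh)
  \<comment> \<open>An eighth leaves room: two errors of \<open>e / 8\<close> from a net and a
    distortion of \<open>2 * (e / 8)\<close> add up to \<open>e / 2\<close>, which is less than the
    separation \<open>e\<close>.\<close>
  have e8: "0 < e / 8" using e by simp
  have "GH.mtotally_bounded S"
    using cpt S GH.compact_closure_of_imp_mtotally_bounded by (simp add: gh_topology_def)
  from this[unfolded GH.mtotally_bounded_def, rule_format, OF e8]
  obtain \<F> where \<F>: "finite \<F>" "\<F> \<subseteq> S" "S \<subseteq> (\<Union>\<K>\<in>\<F>. GH.mball \<K> (e / 8))"
    by blast
  have "\<forall>\<K>\<in>\<F>. \<exists>(K::real metric) F. compact_metric K \<and> \<K> = isometry_class K \<and> finite F \<and> F \<subseteq> mspace K \<and>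
          (\<forall>x\<in>mspace K. \<exists>z\<in>F. mdist K z x < e / 8)"
  proof
    fix \<K> assume "\<K> \<in> \<F>"
    then have "\<K> \<in> gh_classes" using \<F>(2) S by blast
    from gh_classesE[OF this] obtain K :: "real metric" where K: "compact_metric K" "\<K> = isometry_class K"
      by blast
    interpret Metric_space "mspace K" "mdist K" by simp
    have "mtotally_bounded (mspace K)"
      using K(1) compact_space_eq_mcomplete_mtotally_bounded by (simp add: mtopology_of_def compact_metric_def)
    from this[unfolded mtotally_bounded_def, rule_format, OF e8]
    obtain F where F: "finite F" "F \<subseteq> mspace K" "mspace K \<subseteq> (\<Union>x\<in>F. mball x (e / 8))"
      by blast
    have "\<exists>z\<in>F. mdist K z x < e / 8" if "x \<in> mspace K" for x
      using subsetD[OF F(3) that] unfolding UN_iff in_mball by blast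
    then show "\<exists>(K::real metric) F. compact_metric K \<and> \<K> = isometry_class K \<and> finite F \<and> F \<subseteq> mspace K \<and>
          (\<forall>x\<in>mspace K. \<exists>z\<in>F. mdist K z x < e / 8)"
      using K F(1,2) by (intro exI[of _ K] exI[of _ F] conjI ballI)
  qed
  from bchoice[OF this] obtain K :: "real metric set \<Rightarrow> real metric" where "\<forall>\<K>\<in>\<F>. \<exists>F. compact_metric (K \<K>) \<and> \<K> = isometry_class (K \<K>) \<and> finite F \<and>
      F \<subseteq> mspace (K \<K>) \<and> (\<forall>x\<in>mspace (K \<K>). \<exists>z\<in>F. mdist (K \<K>) z x < e / 8)" ..
  from bchoice[OF this] obtain F where KF: "\<forall>\<K>\<in>\<F>. compact_metric (K \<K>) \<and> \<K> = isometry_class (K \<K>) \<and> finite (F \<K>) \<and>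
      F \<K> \<subseteq> mspace (K \<K>) \<and> (\<forall>x\<in>mspace (K \<K>). \<exists>z\<in>F \<K>. mdist (K \<K>) z x < e / 8)" ..
  show thesis
  proof (rule that[of "\<Sum>\<K>\<in>\<F>. card (F \<K>)"])
    fix M :: "'b metric" and P
    assume M: "compact_metric M" "isometry_class M \<in> S" "finite P" "P \<subseteq> mspace M"
      and sep: "\<And>x y. x \<in> P \<Longrightarrow> y \<in> P \<Longrightarrow> x \<noteq> y \<Longrightarrow> e \<le> mdist M x y"
    have "\<exists>\<K>\<in>\<F>. isometry_class M \<in> GH.mball \<K> (e / 8)"
      using subsetD[OF \<F>(3) M(2)] by (simp only: UN_iff)
    then obtain \<K> where \<K>F: "\<K> \<in> \<F>" and \<K>M: "isometry_class M \<in> GH.mball \<K> (e / 8)" ..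
    have \<K>: "\<K> \<in> \<F>" "gh_class_distance \<K> (isometry_class M) < e / 8"
      using \<K>F \<K>M by (simp_all only: GH.in_mball)
    have k: "compact_metric (K \<K>)" "\<K> = isometry_class (K \<K>)" "finite (F \<K>)" "F \<K> \<subseteq> mspace (K \<K>)"
      "\<forall>x\<in>mspace (K \<K>). \<exists>z\<in>F \<K>. mdist (K \<K>) z x < e / 8"
      using KF \<K>(1) by blast+
    have "gh_close (2 * (e / 8)) (K \<K>) M"
      by (rule gh_close_of_class_distance_less[OF _ k(1) M(1)]) (use k(2) \<K>(2) in simp)
    then obtain R where R: "R \<subseteq> mspace (K \<K>) \<times> mspace M"
      "\<And>x. x \<in> mspace (K \<K>) \<Longrightarrow> \<exists>y. (x, y) \<in> R" "\<And>y. y \<in> mspace M \<Longrightarrow> \<exists>x. (x, y) \<in> R"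
      "\<And>x y x' y'. (x, y) \<in> R \<Longrightarrow> (x', y') \<in> R \<Longrightarrow> \<bar>mdist (K \<K>) x x' - mdist M y y'\<bar> \<le> 2 * (e / 8)"
      using gh_closeE[of "2 * (e / 8)" "K \<K>" M] by blast
    have "\<forall>y\<in>P. \<exists>zx. fst zx \<in> F \<K> \<and> (snd zx, y) \<in> R \<and> mdist (K \<K>) (fst zx) (snd zx) < e / 8"
    proof
      fix y assume "y \<in> P"
      then obtain x where x: "(x, y) \<in> R" "x \<in> mspace (K \<K>)"
        using R(3)[of y] R(1) M(4) by blast
      then obtain z where "z \<in> F \<K>" "mdist (K \<K>) z x < e / 8"
        using k(5) by blast
      with x(1) show "\<exists>zx. fst zx \<in> F \<K> \<and> (snd zx, y) \<in> R \<and> mdist (K \<K>) (fst zx) (snd zx) < e / 8"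
        by (intro exI[of _ "(z, x)"]) simp
    qed
    from bchoice[OF this] obtain p where p: "\<forall>y\<in>P. fst (p y) \<in> F \<K> \<and> (snd (p y), y) \<in> R \<and>
        mdist (K \<K>) (fst (p y)) (snd (p y)) < e / 8" ..
    define h g where "h y = fst (p y)" and "g y = snd (p y)" for y
    have hg: "h y \<in> F \<K>" "(g y, y) \<in> R" "mdist (K \<K>) (h y) (g y) < e / 8" if "y \<in> P" for y
      using p that by (auto simp: h_def g_def)
    \<comment> \<open>Points of \<open>P\<close> that share a net point would be closer than
      \<open>e\<close>. So \<open>P\<close> is no larger than one of finitely many nets, and the sum
      of all their sizes is a bound independent of the space.\<close>
    have "inj_on h P"
    proof (rule inj_onI, rule ccontr)
      fix y y' assume y: "y \<in> P" "y' \<in> P" "h y = h y'" "y \<noteq> y'"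
      have m: "h y \<in> mspace (K \<K>)" "g y \<in> mspace (K \<K>)" "g y' \<in> mspace (K \<K>)"
        using hg(1,2)[OF y(1)] hg(2)[OF y(2)] R(1) k(4) by auto
      have "mdist (K \<K>) (g y) (g y') \<le> mdist (K \<K>) (h y) (g y) + mdist (K \<K>) (h y') (g y')"
        using mdist_triangle[OF m(2,1,3)] y(3) by (simp add: mdist_commute)
      moreover have "\<bar>mdist (K \<K>) (g y) (g y') - mdist M y y'\<bar> \<le> 2 * (e / 8)"
        using R(4)[OF hg(2)[OF y(1)] hg(2)[OF y(2)]] .
      ultimately show False
        using sep[OF y(1,2,4)] e hg(3)[OF y(1)] hg(3)[OF y(2)] by linarith
    qed
    then have "card P \<le> card (F \<K>)"
      using hg(1) k(3) by (intro card_inj_on_le[of h]) auto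
    also have "\<dots> \<le> (\<Sum>\<K>\<in>\<F>. card (F \<K>))"
      using \<F>(1) \<K>(1) by (intro member_le_sum) auto
    finally show "card P \<le> (\<Sum>\<K>\<in>\<F>. card (F \<K>))" .
  qed
qed

text \<open>Blaschke's selection theorem. A closed set is encoded by its distance function, which is
  1-Lipschitz; a limit of such functions exists along a subsequence, and its zero set is the limit
  of the closed sets in the Hausdorff sense, hence in the Gromov-Hausdorff sense.\<close>

lemma gh_compact_closed_subsets:
  fixes L :: "'a metric"
  assumes L: "compact_space (mtopology_of L)"
    and S: "S \<subseteq> (\<lambda>A. isometry_class (submetric L A)) ` {A. closedin (mtopology_of L) A \<and> A \<noteq> {}}"
  shows "compactin gh_topology (gh_topology closure_of S)"
proof -
  interpret GH: Metric_space gh_classes gh_class_distance by (rule Metric_space_gh)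
  interpret L: Metric_space "mspace L" "mdist L" by simp
  define H where "H = (\<lambda>A. isometry_class (submetric L A)) ` {A. closedin (mtopology_of L) A \<and> A \<noteq> {}}"
  have sub: "A \<subseteq> mspace L" if "closedin (mtopology_of L) A" for A
    using closedin_subset[OF that] by simp
  have ms: "mspace (submetric L A) = A" if "closedin (mtopology_of L) A" for A
    using sub[OF that] by auto
  have cpt: "compact_metric (submetric L A)" if "closedin (mtopology_of L) A" "A \<noteq> {}" for A
  proof -
    have "compactin (mtopology_of L) A"
      using L that(1) closedin_compact_space by blast
    then have "compact_space (mtopology_of (submetric L A))"
      unfolding mtopology_of_submetric by (rule compact_space_subtopology)
    then show ?thesis
      using ms[OF that(1)] that(2) by (simp add: compact_metric_def)
  qed
  have Hsub: "H \<subseteq> gh_classes"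
  proof
    fix \<K> assume "\<K> \<in> H"
    then obtain A where A: "\<K> = isometry_class (submetric L A)" "closedin (mtopology_of L) A" "A \<noteq> {}"
      unfolding H_def by blast
    show "\<K> \<in> gh_classes"
      unfolding A(1) using isometry_class_in_gh_classes[OF cpt[OF A(2,3)]] by blast
  qed
  obtain D where D: "0 < D" "\<And>x y. x \<in> mspace L \<Longrightarrow> y \<in> mspace L \<Longrightarrow> mdist L x y \<le> D"
    using compact_metric_bounded[OF L] by blast
  have tb: "L.mtotally_bounded (mspace L)"
    using L L.compact_space_eq_mcomplete_mtotally_bounded by (simp add: mtopology_of_def)
  have seq: "\<exists>l r. l \<in> H \<and> strict_mono r \<and> limitin GH.mtopology (\<sigma> \<circ> r) l sequentially"
    if \<sigma>: "range \<sigma> \<subseteq> H" for \<sigma> :: "nat \<Rightarrow> real metric set"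
  proof -
    have "\<forall>n. \<exists>A. \<sigma> n = isometry_class (submetric L A) \<and> closedin (mtopology_of L) A \<and> A \<noteq> {}"
      using \<sigma> unfolding H_def by blast
    from choice[OF this] obtain A where A: "\<And>n. \<sigma> n = isometry_class (submetric L (A n))"
      "\<And>n. closedin (mtopology_of L) (A n)" "\<And>n. A n \<noteq> {}"
      by blast
    have AL: "a \<in> mspace L" if "a \<in> A n" for a n
      using sub[OF A(2)] that by blast
    obtain x0 where x0: "x0 \<in> mspace L"
      using A(3)[of 0] AL by blast
    define u where "u n x = (INF a\<in>A n. mdist L x a)" for n x
    have u_le: "u n x \<le> mdist L x a" if "a \<in> A n" for n x a
      unfolding u_def by (rule cINF_lower) (use that in \<open>auto intro!: bdd_belowI[of _ 0]\<close>)
    have u_ge: "c \<le> u n x" if "\<And>a. a \<in> A n \<Longrightarrow> c \<le> mdist L x a" for n x c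
      unfolding u_def by (rule cINF_greatest) (use that A(3) in auto)
    have u_near: "\<exists>a\<in>A n. mdist L x a < u n x + e" if "0 < e" for n x e
    proof (rule ccontr)
      assume "\<not> ?thesis"
      then have "u n x + e \<le> u n x"
        by (intro u_ge) force
      then show False using that by simp
    qed
    have u_lip1: "u n x - mdist L x y \<le> u n y" if "x \<in> mspace L" "y \<in> mspace L" for n x y
    proof (rule u_ge)
      fix a assume "a \<in> A n"
      then show "u n x - mdist L x y \<le> mdist L y a"
        using u_le[of a n x] mdist_triangle[OF that AL[of a n]] by linarith
    qed
    have u_lip: "\<bar>u n x - u n y\<bar> \<le> mdist L x y" if "x \<in> mspace L" "y \<in> mspace L" for n x y
      using u_lip1[OF that, of n] u_lip1[OF that(2,1), of n] mdist_commute[of L x y] by linarith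
    have u0: "0 \<le> u n x" for n x
      by (rule u_ge) simp
    have ubd: "\<bar>u n x0\<bar> \<le> D" for n
    proof -
      obtain a where "a \<in> A n" using A(3) by blast
      then show ?thesis
        using u_le[of a n x0] D(2)[OF x0 AL[of a n]] u0[of n x0] by linarith
    qed
    have "\<exists>r g. strict_mono (r :: nat \<Rightarrow> nat) \<and> (\<forall>x\<in>mspace L. (\<lambda>k. u (r k) x) \<longlonglongrightarrow> g x)"
    proof (rule lipschitz_pointwise_convergent_subsequence[where f = u, OF compact_metric_separable[OF L] u_lip x0 ubd])
      fix r g assume "strict_mono (r :: nat \<Rightarrow> nat)" "\<And>x. x \<in> mspace L \<Longrightarrow> (\<lambda>k. u (r k) x) \<longlonglongrightarrow> g x"
      then show "\<exists>r g. strict_mono (r :: nat \<Rightarrow> nat) \<and> (\<forall>x\<in>mspace L. (\<lambda>k. u (r k) x) \<longlonglongrightarrow> g x)"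
        by (intro exI[of _ r] exI[of _ g]) simp
    qed
    then obtain r g where r: "strict_mono (r :: nat \<Rightarrow> nat)"
      and g: "\<And>x. x \<in> mspace L \<Longrightarrow> (\<lambda>k. u (r k) x) \<longlonglongrightarrow> g x"
      by blast
    have g_lip: "\<bar>g x - g y\<bar> \<le> mdist L x y" if "x \<in> mspace L" "y \<in> mspace L" for x y
    proof (rule LIMSEQ_le_const2)
      show "(\<lambda>k. \<bar>u (r k) x - u (r k) y\<bar>) \<longlonglongrightarrow> \<bar>g x - g y\<bar>"
        by (intro tendsto_intros g that)
    qed (use u_lip[OF that] in blast)
    have g0: "0 \<le> g x" if "x \<in> mspace L" for x
      by (rule LIMSEQ_le_const[OF g[OF that]]) (use u0 in blast)
    define B where "B = {x \<in> mspace L. g x = 0}"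
    have Bclosed: "closedin (mtopology_of L) B"
      unfolding mtopology_of_def L.closedin_metric
    proof (intro conjI allI impI)
      show "B \<subseteq> mspace L" by (auto simp: B_def)
      fix x assume x: "x \<in> mspace L - B"
      then have "0 < g x"
        using g0[of x] by (auto simp: B_def less_le)
      moreover have "disjnt B (L.mball x (g x))"
        unfolding disjnt_iff B_def
        using g_lip x by fastforce
      ultimately show "\<exists>r>0. disjnt B (L.mball x r)" by blast
    qed
    \<comment> \<open>Almost nearest points of \<open>A (r k)\<close> to \<open>x\<close> have a
      convergent subsequence; its limit lies in \<open>B\<close> and within \<open>g x\<close> of
      \<open>x\<close>. In particular \<open>B\<close> is nonempty.\<close>
    have near: "\<exists>a\<in>B. mdist L x a \<le> g x" if x: "x \<in> mspace L" for x
    proof -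
      have "\<forall>k. \<exists>a. a \<in> A (r k) \<and> mdist L x a < u (r k) x + 1 / real (Suc k)"
      proof
        fix k
        have "\<exists>a\<in>A (r k). mdist L x a < u (r k) x + 1 / real (Suc k)"
          by (rule u_near) simp
        then show "\<exists>a. a \<in> A (r k) \<and> mdist L x a < u (r k) x + 1 / real (Suc k)"
          by blast
      qed
      from choice[OF this] obtain a where a: "\<And>k. a k \<in> A (r k)"
        "\<And>k. mdist L x (a k) < u (r k) x + 1 / real (Suc k)" by blast
      have "range a \<subseteq> mspace L" using a(1) AL by blast
      then obtain l s where l: "l \<in> mspace L" "strict_mono s" "limitin L.mtopology (a \<circ> s) l sequentially"
        using L unfolding mtopology_of_def L.compact_space_sequentially by blast
      have dl: "(\<lambda>k. mdist L (a (s k)) l) \<longlonglongrightarrow> 0"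
        using l(3) by (simp add: L.limitin_metric_dist_null o_def)
      have ul: "(\<lambda>k. u (r (s k)) y) \<longlonglongrightarrow> g y" if "y \<in> mspace L" for y
        using LIMSEQ_subseq_LIMSEQ[OF g[OF that] l(2)] by (simp add: o_def)
      have "g l \<le> 0"
      proof (rule LIMSEQ_le[OF ul[OF l(1)] dl])
        show "\<exists>N. \<forall>n\<ge>N. u (r (s n)) l \<le> mdist L (a (s n)) l"
          using u_le[OF a(1), of _ l] by (auto simp: mdist_commute)
      qed
      then have "l \<in> B"
        using g0[OF l(1)] l(1) by (simp add: B_def)
      moreover have "mdist L x l \<le> g x"
      proof (rule LIMSEQ_le_const)
        have "(\<lambda>k. 1 / real (Suc (s k))) \<longlonglongrightarrow> 0"
          using LIMSEQ_subseq_LIMSEQ[OF LIMSEQ_Suc[OF lim_1_over_n] l(2)] by (simp add: o_def)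
        then have "(\<lambda>k. u (r (s k)) x + 1 / real (Suc (s k)) + mdist L (a (s k)) l) \<longlonglongrightarrow> g x + 0 + 0"
          by (intro tendsto_add ul x dl)
        then show "(\<lambda>k. u (r (s k)) x + 1 / real (Suc (s k)) + mdist L (a (s k)) l) \<longlonglongrightarrow> g x"
          by simp
        have "mdist L x l \<le> u (r (s k)) x + 1 / real (Suc (s k)) + mdist L (a (s k)) l" for k
          using mdist_triangle[OF x AL[OF a(1)] l(1), of "s k"] a(2)[of "s k"] by linarith
        then show "\<exists>N. \<forall>n\<ge>N. mdist L x l \<le> u (r (s n)) x + 1 / real (Suc (s n)) + mdist L (a (s n)) l"
          by blast
      qed
      ultimately show ?thesis by blast
    qed
    then have Bne: "B \<noteq> {}" using x0 by blast
    \<comment> \<open>A finite net and the common Lipschitz constant upgrade pointwise to uniform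
      convergence.\<close>
    have unif: "eventually (\<lambda>k. \<forall>x\<in>mspace L. \<bar>u (r k) x - g x\<bar> < e) sequentially" if "0 < e" for e
    proof -
      have e3: "0 < e / 3" using that by simp
      from tb[unfolded L.mtotally_bounded_def, rule_format, OF e3]
      obtain F where F: "finite F" "F \<subseteq> mspace L" "mspace L \<subseteq> (\<Union>x\<in>F. L.mball x (e / 3))"
        by blast
      have "eventually (\<lambda>k. \<forall>z\<in>F. \<bar>u (r k) z - g z\<bar> < e / 3) sequentially"
      proof (rule eventually_ball_finite[OF F(1)], rule ballI)
        fix z assume "z \<in> F"
        then have "(\<lambda>k. u (r k) z) \<longlonglongrightarrow> g z" using g F(2) by blast
        from tendstoD[OF this e3] show "eventually (\<lambda>k. \<bar>u (r k) z - g z\<bar> < e / 3) sequentially"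
          by (simp add: dist_real_def)
      qed
      then show ?thesis
      proof (rule eventually_mono, intro ballI)
        fix k x assume k: "\<forall>z\<in>F. \<bar>u (r k) z - g z\<bar> < e / 3" and x: "x \<in> mspace L"
        obtain z where z: "z \<in> F" "z \<in> mspace L" "mdist L z x < e / 3"
          using subsetD[OF F(3) x] unfolding UN_iff L.in_mball by blast
        show "\<bar>u (r k) x - g x\<bar> < e"
          using bspec[OF k z(1)] u_lip[OF z(2) x, of "r k"] g_lip[OF z(2) x] z(3) by linarith
      qed
    qed
    have conv: "eventually (\<lambda>k. gh_class_distance (\<sigma> (r k)) (isometry_class (submetric L B)) \<le> e) sequentially"
      if e: "0 < e" for e
      using unif[OF e]
    proof (rule eventually_mono)
      fix k assume k: "\<forall>x\<in>mspace L. \<bar>u (r k) x - g x\<bar> < e"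
      have "gh_close (2 * e) (submetric L (A (r k))) (submetric L B)"
      proof (rule gh_closeI[of "{(a, b). a \<in> A (r k) \<and> b \<in> B \<and> mdist L a b \<le> e}"], unfold ms[OF A(2)] ms[OF Bclosed] mdist_submetric)
        show "{(a, b). a \<in> A (r k) \<and> b \<in> B \<and> mdist L a b \<le> e} \<subseteq> A (r k) \<times> B"
          by blast
        show "\<exists>b. (a, b) \<in> {(a, b). a \<in> A (r k) \<and> b \<in> B \<and> mdist L a b \<le> e}" if a: "a \<in> A (r k)" for a
        proof -
          have aL: "a \<in> mspace L" using AL[OF a] .
          have "u (r k) a = 0"
            using u_le[OF a, of a] u0[of "r k" a] aL by simp
          then have "g a < e"
            using bspec[OF k aL] by linarith
          then show ?thesis
            using near[OF aL] a by force
        qed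
        show "\<exists>a. (a, b) \<in> {(a, b). a \<in> A (r k) \<and> b \<in> B \<and> mdist L a b \<le> e}" if b: "b \<in> B" for b
        proof -
          have bL: "b \<in> mspace L" "g b = 0" using b by (auto simp: B_def)
          have "u (r k) b < e"
            using bspec[OF k bL(1)] bL(2) by linarith
          then obtain a where "a \<in> A (r k)" "mdist L b a < u (r k) b + (e - u (r k) b)"
            using u_near[of "e - u (r k) b" "r k" b] by auto
          then show ?thesis
            using b by (auto simp: mdist_commute intro!: exI[of _ a])
        qed
        fix x y x' y'
        assume "(x, y) \<in> {(a, b). a \<in> A (r k) \<and> b \<in> B \<and> mdist L a b \<le> e}"
          "(x', y') \<in> {(a, b). a \<in> A (r k) \<and> b \<in> B \<and> mdist L a b \<le> e}"
        then have *: "x \<in> mspace L" "y \<in> mspace L" "mdist L x y \<le> e" "x' \<in> mspace L" "y' \<in> mspace L" "mdist L x' y' \<le> e"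
          using AL by (auto simp: B_def)
        show "\<bar>mdist L x x' - mdist L y y'\<bar> \<le> 2 * e"
          using mdist_triangle[OF *(1,2,4)] mdist_triangle[OF *(2,5,4)] mdist_triangle[OF *(2,1,5)]
            mdist_triangle[OF *(1,4,5)] *(3,6) mdist_commute[of L y x] mdist_commute[of L y' x'] by linarith
      qed
      then show "gh_class_distance (\<sigma> (r k)) (isometry_class (submetric L B)) \<le> e"
        unfolding A(1) by (rule gh_class_distance_le[OF _ e cpt[OF A(2,3)] cpt[OF Bclosed Bne]])
    qed
    have BH: "isometry_class (submetric L B) \<in> H"
      unfolding H_def using Bclosed Bne by blast
    have "limitin GH.mtopology (\<sigma> \<circ> r) (isometry_class (submetric L B)) sequentially"
      unfolding GH.limitin_metric
    proof (intro conjI allI impI)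
      show "isometry_class (submetric L B) \<in> gh_classes" using BH Hsub by blast
      fix e :: real assume "0 < e"
      then have "0 < e / 2" by simp
      from conv[OF this] show "eventually (\<lambda>k. (\<sigma> \<circ> r) k \<in> gh_classes \<and>
          gh_class_distance ((\<sigma> \<circ> r) k) (isometry_class (submetric L B)) < e) sequentially"
      proof (rule eventually_mono)
        fix k assume "gh_class_distance (\<sigma> (r k)) (isometry_class (submetric L B)) \<le> e / 2"
        moreover have "\<sigma> (r k) \<in> gh_classes" using \<sigma> Hsub by blast
        ultimately show "(\<sigma> \<circ> r) k \<in> gh_classes \<and> gh_class_distance ((\<sigma> \<circ> r) k) (isometry_class (submetric L B)) < e"
          using \<open>0 < e\<close> by simp
      qed
    qed
    then show ?thesis
      using BH r by blast
  qed
  have Hc: "compactin GH.mtopology H"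
    unfolding GH.compactin_sequentially using Hsub seq by blast
  then have "closedin GH.mtopology H"
    by (simp add: GH.Hausdorff_space_mtopology compactin_imp_closedin)
  then have "GH.mtopology closure_of S \<subseteq> H"
    using S by (intro closure_of_minimal) (simp_all add: H_def)
  then have "compactin GH.mtopology (GH.mtopology closure_of S)"
    using Hc closed_compactin closedin_closure_of by blast
  then show ?thesis
    by (simp add: gh_topology_def)
qed

section \<open>Borel probability measures on Polish spaces\<close>

lemma space_borel_of [simp]: "space (borel_of T) = topspace T"
  by (simp add: borel_of_def space_measure_of_conv)

lemma sets_borel_of: "sets (borel_of T) = sigma_sets (topspace T) {U. openin T U}"
  unfolding borel_of_def by (rule sets_measure_of) (auto dest: openin_subset)

lemma borel_of_open: "openin T U \<Longrightarrow> U \<in> sets (borel_of T)"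
  by (auto simp: sets_borel_of)

lemma borel_of_closed:
  assumes "closedin T C" shows "C \<in> sets (borel_of T)"
proof -
  have "topspace T - (topspace T - C) \<in> sets (borel_of T)"
    using assms borel_of_open[of T "topspace T - C"] borel_of_open[of T "topspace T"] by blast
  then show ?thesis
    using closedin_subset[OF assms] by (simp add: double_diff)
qed

lemma measurable_borel_ofI:
  assumes "f \<in> space M \<rightarrow> topspace T" "\<And>U. openin T U \<Longrightarrow> f -` U \<inter> space M \<in> sets M"
  shows "f \<in> measurable M (borel_of T)"
  unfolding borel_of_def
  by (rule measurable_measure_of) (use assms in \<open>auto dest: openin_subset\<close>)

lemma continuous_map_measurable:
  assumes "continuous_map S T f"
  shows "f \<in> measurable (borel_of S) (borel_of T)"
proof (rule measurable_borel_ofI)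
  show "f \<in> space (borel_of S) \<rightarrow> topspace T"
    using assms by (auto simp: continuous_map_def)
  show "f -` U \<inter> space (borel_of S) \<in> sets (borel_of S)" if "openin T U" for U
  proof -
    have "openin S {x \<in> topspace S. f x \<in> U}"
      using assms that by (auto simp: continuous_map_def)
    then show ?thesis
      using borel_of_open by (simp add: vimage_def Int_def conj_commute)
  qed
qed

lemma sets_borel_of_euclidean: "sets (borel_of euclidean) = sets borel"
  unfolding sets_borel_of borel_def by simp

section \<open>Regularity and tightness\<close>

definition polish_prob :: "'a topology \<Rightarrow> 'a measure \<Rightarrow> bool" where
  "polish_prob T M \<longleftrightarrow> completely_metrizable_space T \<and> separable_space T \<and>
     sets M = sets (borel_of T) \<and> prob_space M"

lemma polish_probD:
  assumes "polish_prob T M"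
  shows "sets M = sets (borel_of T)" "space M = topspace T" "prob_space M" "topspace T \<noteq> {}"
    "Hausdorff_space T" "finite_measure M" "prob_space (completion M)" "finite_measure (completion M)"
proof -
  show *: "sets M = sets (borel_of T)" "prob_space M" "Hausdorff_space T"
    using assms completely_metrizable_imp_metrizable_space metrizable_imp_Hausdorff_space
    by (auto simp: polish_prob_def)
  then show sp: "space M = topspace T"
    by (metis sets_eq_imp_space_eq space_borel_of)
  show "topspace T \<noteq> {}"
    using prob_space.not_empty[OF *(2)] sp by simp
  show "finite_measure M"
    using *(2) by (rule prob_space.finite_measure)
  show **: "prob_space (completion M)"
    by (rule prob_spaceI) (simp add: *(2) prob_space.emeasure_space_1)
  then show "finite_measure (completion M)"
    by (rule prob_space.finite_measure)
qed

lemma open_increasing_closed: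
  assumes "metrizable_space T" "openin T U"
  obtains C :: "nat \<Rightarrow> 'a set" where "\<And>n. closedin T (C n)" "incseq C" "(\<Union>n. C n) = U"
proof -
  have "fsigma_in T U"
    using open_imp_fsigma_in assms by blast
  then obtain C where C: "\<And>n. closedin T (C n)" "\<And>n. C n \<subseteq> C (Suc n)" "(\<Union>n. C n) = U"
    unfolding fsigma_in_ascending by blast
  then show thesis
    by (intro that[of C]) (auto intro: incseq_SucI)
qed

text \<open>Positive errors, one for each index, with total \<open>e / 2\<close>; the other half of
  \<open>e\<close> remains for one further error.\<close>

lemma halving_sums: "(\<lambda>n. e / 4 * (1/2::real) ^ n) sums (e / 2)"
proof -
  have "(\<lambda>n. e / 4 * (1/2::real) ^ n) sums (e / 4 * (1 / (1 - 1/2)))"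
    by (intro sums_mult geometric_sums) simp
  moreover have "e / 4 * (1 / (1 - 1/2)) = e / 2" by simp
  ultimately show ?thesis by (simp only:)
qed

text \<open>Induction over the generated sigma-algebra: sets squeezed between closed and open sets
  of nearly equal measure are stable under complements and countable unions, and open sets are among
  them because in a metrizable space they are increasing unions of closed sets.\<close>

lemma polish_prob_regular:
  assumes P: "polish_prob T M" and A: "A \<in> sets M" and e: "0 < (e::real)"
  shows "\<exists>C U. closedin T C \<and> openin T U \<and> C \<subseteq> A \<and> A \<subseteq> U \<and> measure M (U - C) < e"
proof -
  interpret prob_space M using polish_probD[OF P] by simp
  have sM: "sets M = sets (borel_of T)" and spM: "space M = topspace T"
    using polish_probD[OF P] by auto
  have met: "metrizable_space T"
    using P completely_metrizable_imp_metrizable_space by (auto simp: polish_prob_def)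
  have open_M: "U \<in> sets M" if "openin T U" for U
    using borel_of_open[OF that] sM by simp
  have closed_M: "C \<in> sets M" if "closedin T C" for C
    using borel_of_closed[OF that] sM by simp
  have "A \<in> sigma_sets (topspace T) {U. openin T U}"
    using A sM sets_borel_of by metis
  then have "\<forall>e>0. \<exists>C U. closedin T C \<and> openin T U \<and> C \<subseteq> A \<and> A \<subseteq> U \<and> measure M (U - C) < e"
  proof induction
    case (Basic U)
    then have U: "openin T U" by simp
    obtain C :: "nat \<Rightarrow> 'a set" where C: "\<And>n. closedin T (C n)" "incseq C" "(\<Union>n. C n) = U"
      using open_increasing_closed[OF met U] by blast
    show ?case
    proof (intro allI impI)
      fix e :: real assume e: "0 < e"
      have "(\<lambda>n. measure M (C n)) \<longlonglongrightarrow> measure M (\<Union>n. C n)"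
        by (rule finite_Lim_measure_incseq) (use C closed_M in auto)
      from tendstoD[OF this e] obtain n where n: "dist (measure M (C n)) (measure M U) < e"
        unfolding C(3) eventually_sequentially by blast
      have "measure M (U - C n) = measure M U - measure M (C n)"
        by (rule finite_measure_Diff) (use open_M[OF U] closed_M[OF C(1)] C(3) in auto)
      then have "measure M (U - C n) < e"
        using n by (simp add: dist_real_def)
      then show "\<exists>C V. closedin T C \<and> openin T V \<and> C \<subseteq> U \<and> U \<subseteq> V \<and> measure M (V - C) < e"
        using C(1,3) U by blast
    qed
  next
    case Empty
    then show ?case
      by (intro allI impI exI[of _ "{}"]) simp
  next
    case (Compl A)
    show ?case
    proof (intro allI impI)
      fix e :: real assume "0 < e"
      from Compl.IH[rule_format, OF this]
      obtain C U where CU: "closedin T C" "openin T U" "C \<subseteq> A" "A \<subseteq> U" "measure M (U - C) < e"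
        by blast
      have "(topspace T - C) - (topspace T - U) = U - C"
        using openin_subset[OF CU(2)] by blast
      then show "\<exists>C U. closedin T C \<and> openin T U \<and> C \<subseteq> topspace T - A \<and> topspace T - A \<subseteq> U \<and> measure M (U - C) < e"
        using CU by (intro exI[of _ "topspace T - U"] exI[of _ "topspace T - C"]) auto
    qed
  next
    case (Union A)
    show ?case
    proof (intro allI impI)
      fix e :: real assume e: "0 < e"
      define d where "d = (\<lambda>n::nat. e / 4 * (1/2) ^ n)"
      have d: "0 < d n" for n using e by (simp add: d_def)
      have "\<forall>n. \<exists>C U. closedin T C \<and> openin T U \<and> C \<subseteq> A n \<and> A n \<subseteq> U \<and> measure M (U - C) < d n"
        using Union.IH[rule_format, OF d] by (intro allI)
      from choice[OF this] obtain C where "\<forall>n. \<exists>U. closedin T (C n) \<and> openin T U \<and> C n \<subseteq> A n \<and> A n \<subseteq> U \<and> measure M (U - C n) < d n" ..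
      from choice[OF this] obtain U where CU: "\<And>n. closedin T (C n)" "\<And>n. openin T (U n)" "\<And>n. C n \<subseteq> A n"
        "\<And>n. A n \<subseteq> U n" "\<And>n. measure M (U n - C n) < d n" by blast
      have Cm: "C n \<in> sets M" and Um: "U n \<in> sets M" for n
        using open_M closed_M CU by auto
      have dsum: "d sums (e / 2)"
        unfolding d_def by (rule halving_sums)
      \<comment> \<open>The union of all \<open>C n\<close> need not be closed, so it is cut off
        after \<open>N\<close> terms at the cost of \<open>e / 2\<close>.\<close>
      have "(\<lambda>n. measure M (\<Union>i<n. C i)) \<longlonglongrightarrow> measure M (\<Union>n. \<Union>i<n. C i)"
      proof (rule finite_Lim_measure_incseq)
        show "range (\<lambda>n. \<Union>i<n. C i) \<subseteq> sets M" using Cm by auto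
        show "incseq (\<lambda>n. \<Union>i<n. C i)"
          unfolding incseq_def by (intro allI impI UN_mono) auto
      qed
      moreover have "(\<Union>n. \<Union>i<n. C i) = (\<Union>n. C n)"
        by auto
      ultimately have "(\<lambda>n. measure M (\<Union>i<n. C i)) \<longlonglongrightarrow> measure M (\<Union>n. C n)"
        by simp
      from tendstoD[OF this half_gt_zero[OF e]] obtain N where "dist (measure M (\<Union>i<N. C i)) (measure M (\<Union>n. C n)) < e / 2"
        unfolding eventually_sequentially by blast
      moreover have "measure M ((\<Union>n. C n) - (\<Union>i<N. C i)) = measure M (\<Union>n. C n) - measure M (\<Union>i<N. C i)"
        by (rule finite_measure_Diff) (use Cm in auto)
      ultimately have 1: "measure M ((\<Union>n. C n) - (\<Union>i<N. C i)) < e / 2"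
        unfolding dist_real_def by linarith
      have sd: "summable (\<lambda>n. measure M (U n - C n))"
      proof (rule summable_comparison_test'[OF sums_summable[OF dsum]])
        show "norm (measure M (U n - C n)) \<le> d n" for n
          using CU(5)[of n] by simp
      qed
      have "measure M (\<Union>n. U n - C n) \<le> (\<Sum>n. measure M (U n - C n))"
        by (rule finite_measure_subadditive_countably) (use Cm Um sd in auto)
      also have "\<dots> \<le> suminf d"
        by (rule suminf_le) (use CU(5) sd sums_summable[OF dsum] in \<open>auto intro: less_imp_le\<close>)
      finally have 2: "measure M (\<Union>n. U n - C n) \<le> e / 2"
        using sums_unique[OF dsum] by simp
      have "measure M ((\<Union>n. U n) - (\<Union>i<N. C i)) \<le> measure M ((\<Union>n. U n - C n) \<union> ((\<Union>n. C n) - (\<Union>i<N. C i)))"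
        by (rule finite_measure_mono) (use Cm Um in auto)
      also have "\<dots> \<le> measure M (\<Union>n. U n - C n) + measure M ((\<Union>n. C n) - (\<Union>i<N. C i))"
        by (rule measure_Un_le) (use Cm Um in auto)
      also have "\<dots> < e"
        using 1 2 by linarith
      finally have 3: "measure M ((\<Union>n. U n) - (\<Union>i<N. C i)) < e" .
      have 4: "closedin T (\<Union>i<N. C i)"
        by (rule closedin_Union) (use CU(1) in auto)
      have 5: "openin T (\<Union>n. U n)"
        by (rule openin_Union) (use CU(2) in auto)
      have 6: "(\<Union>i<N. C i) \<subseteq> (\<Union>n. A n)" "(\<Union>n. A n) \<subseteq> (\<Union>n. U n)"
        using CU(3,4) by blast+
      show "\<exists>C U. closedin T C \<and> openin T U \<and> C \<subseteq> \<Union> (range A) \<and> \<Union> (range A) \<subseteq> U \<and> measure M (U - C) < e"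
        using 3 4 5 6 by (intro exI[of _ "\<Union>i<N. C i"] exI[of _ "\<Union>n. U n"] conjI)
    qed
  qed
  from this[rule_format, OF e] show ?thesis .
qed

text \<open>Ulam's theorem: at every scale finitely many closed balls around dense points carry
  almost all of the mass. The intersection over all scales is closed and totally bounded, hence
  compact by completeness.\<close>

lemma polish_prob_tight:
  assumes P: "polish_prob T M" and e: "0 < (e::real)"
  shows "\<exists>K. compactin T K \<and> measure M (space M - K) < e"
proof -
  interpret prob_space M using polish_probD[OF P] by simp
  have sM: "sets M = sets (borel_of T)" and spM: "space M = topspace T"
    using polish_probD[OF P] by auto
  obtain S d where "Metric_space S d" "Metric_space.mcomplete S d" and T: "T = Metric_space.mtopology S d"
    using P unfolding polish_prob_def completely_metrizable_space_def by blast
  then interpret S: Metric_space S d by simp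
  have TS: "topspace T = S" by (simp add: T)
  have closed_M: "C \<in> sets M" if "closedin T C" for C
    using borel_of_closed[OF that] sM by simp
  have "separable_space (mtopology_of S.Self)"
    using P unfolding polish_prob_def T mtopology_of_def by simp
  moreover have "mspace S.Self \<noteq> {}"
    using polish_probD(4)[OF P] TS by simp
  ultimately have "\<exists>q::nat\<Rightarrow>'a. range q \<subseteq> S \<and> (\<forall>x e. x \<in> S \<longrightarrow> 0 < e \<longrightarrow> (\<exists>n. d x (q n) < e))"
    by (rule separable_metric_dense_sequence) (simp, blast)
  then obtain q :: "nat \<Rightarrow> 'a" where q: "\<And>n. q n \<in> S" "\<And>x e. x \<in> S \<Longrightarrow> 0 < e \<Longrightarrow> \<exists>n. d x (q n) < e"
    by blast
  define r where "r n = 1 / real (Suc n)" for n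
  have r: "0 < r n" for n by (simp add: r_def)
  define \<delta> where "\<delta> = (\<lambda>n::nat. e / 4 * (1/2) ^ n)"
  have \<delta>: "0 < \<delta> n" for n using e by (simp add: \<delta>_def)
  have \<delta>sum: "\<delta> sums (e / 2)"
    unfolding \<delta>_def by (rule halving_sums)
  have cb: "S.mcball (q i) (r n) \<in> sets M" for i n
    using closed_M T by simp
  have ex: "\<forall>n. \<exists>k. measure M (space M - (\<Union>i<k. S.mcball (q i) (r n))) < \<delta> n"
  proof
    fix n
    have "(\<lambda>k. measure M (\<Union>i<k. S.mcball (q i) (r n))) \<longlonglongrightarrow> measure M (\<Union>k. \<Union>i<k. S.mcball (q i) (r n))"
    proof (rule finite_Lim_measure_incseq)
      show "range (\<lambda>k. \<Union>i<k. S.mcball (q i) (r n)) \<subseteq> sets M" using cb by auto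
      show "incseq (\<lambda>k. \<Union>i<k. S.mcball (q i) (r n))"
        unfolding incseq_def by (intro allI impI UN_mono) auto
    qed
    moreover have "(\<Union>k. \<Union>i<k. S.mcball (q i) (r n)) = space M"
    proof
      show "(\<Union>k. \<Union>i<k. S.mcball (q i) (r n)) \<subseteq> space M"
        unfolding spM TS by (intro UN_least S.mcball_subset_mspace)
      show "space M \<subseteq> (\<Union>k. \<Union>i<k. S.mcball (q i) (r n))"
      proof
        fix x assume "x \<in> space M"
        then have x: "x \<in> S" using TS spM by simp
        then obtain i where "d x (q i) < r n" using q(2)[OF x r] by blast
        then have "x \<in> S.mcball (q i) (r n)"
          using x q(1) by (simp add: S.commute)
        then show "x \<in> (\<Union>k. \<Union>i<k. S.mcball (q i) (r n))"
          by (intro UN_I[of "Suc i"] UN_I[of i]) auto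
      qed
    qed
    ultimately have "(\<lambda>k. measure M (\<Union>i<k. S.mcball (q i) (r n))) \<longlonglongrightarrow> 1"
      by (simp add: prob_space)
    from tendstoD[OF this \<delta>[of n]] obtain k where "dist (measure M (\<Union>i<k. S.mcball (q i) (r n))) 1 < \<delta> n"
      unfolding eventually_sequentially by blast
    moreover have "measure M (space M - (\<Union>i<k. S.mcball (q i) (r n))) = 1 - measure M (\<Union>i<k. S.mcball (q i) (r n))"
      by (rule prob_compl) (use cb in auto)
    ultimately have "measure M (space M - (\<Union>i<k. S.mcball (q i) (r n))) < \<delta> n"
      by (simp add: dist_real_def)
    then show "\<exists>k. measure M (space M - (\<Union>i<k. S.mcball (q i) (r n))) < \<delta> n" ..
  qed
  from choice[OF ex] obtain k where k: "\<And>n. measure M (space M - (\<Union>i<k n. S.mcball (q i) (r n))) < \<delta> n" by blast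
  define K where "K = (\<Inter>n. \<Union>i<k n. S.mcball (q i) (r n))"
  have KS: "K \<subseteq> S" unfolding K_def by (auto simp: INT_iff dest: spec[of _ 0])
  have Kc: "closedin S.mtopology K"
    unfolding K_def
  proof (rule closedin_Inter)
    fix C assume "C \<in> range (\<lambda>n. \<Union>i<k n. S.mcball (q i) (r n))"
    then obtain n where "C = (\<Union>i<k n. S.mcball (q i) (r n))" by blast
    then show "closedin S.mtopology C"
      by (auto intro!: closedin_Union)
  qed simp
  have tb: "S.mtotally_bounded K"
    unfolding S.mtotally_bounded_def
  proof (intro allI impI)
    fix \<epsilon> :: real assume "0 < \<epsilon>"
    then have "0 < \<epsilon> / 2" by simp
    then obtain n :: nat where n: "1 / real (Suc n) < \<epsilon> / 2" by (rule nat_approx_posE)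
    \<comment> \<open>Total boundedness of \<open>K\<close> asks for a net inside \<open>K\<close>,
      while the centres \<open>q i\<close> may lie outside. Each ball that meets \<open>K\<close> is
      represented by a point of \<open>K\<close> in it, which doubles the radius; hence the scale
      below \<open>\<epsilon> / 2\<close>.\<close>
    define I where "I = {i. i < k n \<and> K \<inter> S.mcball (q i) (r n) \<noteq> {}}"
    define p where "p i = (SOME y. y \<in> K \<inter> S.mcball (q i) (r n))" for i
    have p: "p i \<in> K" "p i \<in> S.mcball (q i) (r n)" if "i \<in> I" for i
      using that someI_ex[of "\<lambda>y. y \<in> K \<inter> S.mcball (q i) (r n)"] unfolding I_def p_def by blast+
    have "K \<subseteq> (\<Union>x\<in>p ` I. S.mball x \<epsilon>)"
    proof
      fix x assume x: "x \<in> K"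
      then obtain i where i: "i < k n" "x \<in> S.mcball (q i) (r n)" unfolding K_def by blast
      then have iI: "i \<in> I" using x by (auto simp: I_def)
      have "d (p i) x \<le> d (p i) (q i) + d (q i) x"
        using p[OF iI] i by (intro S.triangle) auto
      also have "\<dots> < \<epsilon>"
        using p(2)[OF iI] i(2) n by (simp add: S.commute r_def)
      finally have "x \<in> S.mball (p i) \<epsilon>" using p(1)[OF iI] x KS by auto
      then show "x \<in> (\<Union>x\<in>p ` I. S.mball x \<epsilon>)" using iI by blast
    qed
    then show "\<exists>L. finite L \<and> L \<subseteq> K \<and> K \<subseteq> (\<Union>x\<in>L. S.mball x \<epsilon>)"
      using p(1) by (intro exI[of _ "p ` I"]) (auto simp: I_def)
  qed
  have "compactin S.mtopology (S.mtopology closure_of K)"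
    using tb S.mtotally_bounded_eq_compact_closure_of \<open>S.mcomplete\<close> by blast
  then have Kcpt: "compactin T K"
    using Kc T by (simp add: closure_of_closedin)
  have sd: "summable (\<lambda>n. measure M (space M - (\<Union>i<k n. S.mcball (q i) (r n))))"
  proof (rule summable_comparison_test'[OF sums_summable[OF \<delta>sum]])
    show "norm (measure M (space M - (\<Union>i<k n. S.mcball (q i) (r n)))) \<le> \<delta> n" for n
      using k[of n] by simp
  qed
  have "space M - K = (\<Union>n. space M - (\<Union>i<k n. S.mcball (q i) (r n)))"
    by (auto simp: K_def)
  also have "measure M \<dots> \<le> (\<Sum>n. measure M (space M - (\<Union>i<k n. S.mcball (q i) (r n))))"
    by (rule finite_measure_subadditive_countably) (use cb sd in auto)
  also have "\<dots> \<le> suminf \<delta>"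
    by (rule suminf_le) (use k sd sums_summable[OF \<delta>sum] in \<open>auto intro: less_imp_le\<close>)
  also have "\<dots> < e"
    using sums_unique[OF \<delta>sum] e by simp
  finally show ?thesis using Kcpt by blast
qed

text \<open>A set of the completion has a measurable part of the same measure; a closed set nearly
  fills that part, and intersecting it with a compact set of nearly full measure makes it
  compact.\<close>

lemma polish_prob_inner_compact:
  assumes P: "polish_prob T M" and A: "A \<in> sets (completion M)" and e: "0 < (e::real)"
  shows "\<exists>K. compactin T K \<and> K \<subseteq> A \<and> K \<in> sets M \<and> measure (completion M) (A - K) < e"
proof -
  interpret prob_space M using polish_probD[OF P] by simp
  interpret C: prob_space "completion M" using polish_probD[OF P] by simp
  have sM: "sets M = sets (borel_of T)" and spM: "space M = topspace T"
    using polish_probD[OF P] by auto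
  have closed_M: "C \<in> sets M" if "closedin T C" for C
    using borel_of_closed[OF that] sM by simp
  define A0 where "A0 = main_part M A"
  have A0: "A0 \<in> sets M" "A0 \<subseteq> A" "measure (completion M) (A - A0) = 0"
  proof -
    show m: "A0 \<in> sets M" unfolding A0_def using A by simp
    have u: "A = A0 \<union> null_part M A" unfolding A0_def using main_part_null_part_Un[OF A] by simp
    then show s: "A0 \<subseteq> A" by blast
    have "measure (completion M) (A - A0) = measure (completion M) A - measure (completion M) A0"
      by (rule C.finite_measure_Diff) (use A m s in auto)
    also have "measure (completion M) A = measure M A0"
      unfolding measure_def A0_def using emeasure_completion[OF A] by simp
    finally show "measure (completion M) (A - A0) = 0" using m by simp
  qed
  obtain C U where CU: "closedin T C" "openin T U" "C \<subseteq> A0" "A0 \<subseteq> U" "measure M (U - C) < e / 2"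
    using polish_prob_regular[OF P A0(1) half_gt_zero[OF e]] by blast
  obtain K where K: "compactin T K" "measure M (space M - K) < e / 2"
    using polish_prob_tight[OF P half_gt_zero[OF e]] by blast
  have Kcl: "closedin T K"
    using K(1) polish_probD(5)[OF P] compactin_imp_closedin by blast
  have comp: "compactin T (C \<inter> K)"
    using closed_Int_compactin[OF CU(1) K(1)] .
  have KM: "K \<in> sets M" and CM: "C \<in> sets M" and UM: "U \<in> sets M"
    using closed_M Kcl CU(1) borel_of_open[OF CU(2)] sM by auto
  have "measure (completion M) (A - C \<inter> K) \<le> measure (completion M) ((A - A0) \<union> ((U - C) \<union> (space M - K)))"
  proof (rule C.finite_measure_mono)
    have "A \<subseteq> space M" using sets.sets_into_space[OF A] by simp
    then show "A - C \<inter> K \<subseteq> (A - A0) \<union> ((U - C) \<union> (space M - K))" using CU(4) by blast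
    show "(A - A0) \<union> ((U - C) \<union> (space M - K)) \<in> sets (completion M)"
      using A A0(1) KM CM UM by (intro sets.Un sets.Diff) auto
  qed
  also have "\<dots> \<le> measure (completion M) (A - A0) + measure (completion M) ((U - C) \<union> (space M - K))"
    by (rule measure_Un_le) (use A A0(1) KM CM UM in auto)
  also have "measure (completion M) ((U - C) \<union> (space M - K)) = measure M ((U - C) \<union> (space M - K))"
    by (rule measure_completion) (use KM CM UM in auto)
  also have "\<dots> \<le> measure M (U - C) + measure M (space M - K)"
    by (rule measure_Un_le) (use KM CM UM in auto)
  finally have "measure (completion M) (A - C \<inter> K) < e"
    using A0(3) CU(5) K(2) by linarith
  moreover have "C \<inter> K \<subseteq> A" using CU(3) A0(2) by blast
  moreover have "C \<inter> K \<in> sets M" using KM CM by blast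
  ultimately show ?thesis using comp by (intro exI[of _ "C \<inter> K"] conjI)
qed

text \<open>Lusin's argument: on compact sets exhausting \<open>A\<close> the map \<open>F\<close> is continuous and injective, so there
  it is a homeomorphism onto a compact image.\<close>

lemma polish_injection_inverse:
  fixes F :: "'a \<Rightarrow> 'b"
  assumes P: "polish_prob T M" and T': "Hausdorff_space T'" "second_countable T'"
    and F: "F \<in> measurable (completion M) (borel_of T')"
    and A: "A \<in> sets (completion M)" "measure (completion M) A = 1" and inj: "inj_on F A"
  shows "\<exists>B G. B \<in> sets (borel_of T') \<and> G \<in> measurable (borel_of T') M \<and>
    (\<forall>y\<in>B. G y \<in> A \<and> F (G y) = y) \<and> (AE x in completion M. F x \<in> B)"
proof -
  interpret prob_space M using polish_probD[OF P] by simp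
  interpret C: prob_space "completion M" using polish_probD[OF P] by simp
  have sM: "sets M = sets (borel_of T)" and spM: "space M = topspace T" and HT: "Hausdorff_space T"
    using polish_probD[OF P] by auto
  have closed_M: "C \<in> sets M" if "closedin T C" for C
    using borel_of_closed[OF that] sM by simp
  have cpt_closed: "closedin T K" if "compactin T K" for K
    using that HT compactin_imp_closedin by blast
  obtain \<B> where \<B>: "countable \<B>" "\<And>V. V \<in> \<B> \<Longrightarrow> openin T' V"
    "\<And>U x. openin T' U \<Longrightarrow> x \<in> U \<Longrightarrow> \<exists>V\<in>\<B>. x \<in> V \<and> V \<subseteq> U"
    using T'(2) unfolding second_countable_def by metis
  \<comment> \<open>Adding \<open>{}\<close> makes the countable family nonempty, so that
    \<open>from_nat_into\<close> enumerates exactly it.\<close>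
  define V where "V = from_nat_into (insert {} \<B>)"
  have rV: "range V = insert {} \<B>"
    unfolding V_def by (rule range_from_nat_into) (use \<B>(1) in auto)
  have Vo: "openin T' (V n)" for n
    using rV \<B>(2) by (metis insertE openin_empty rangeI)
  define S where "S n = F -` V n \<inter> space M" for n
  have SM: "S n \<in> sets (completion M)" for n
    using measurable_sets[OF F borel_of_open[OF Vo[of n]]] by (simp add: S_def)
  have good: "\<exists>K. compactin T K \<and> K \<subseteq> A \<and> continuous_map (subtopology T K) T' F \<and>
      measure (completion M) (space M - K) < e" if e: "0 < e" for e :: real
  proof -
    define d where "d = (\<lambda>n::nat. e / 2 / 4 * (1/2) ^ n)"
    have d: "0 < d n" for n using e by (simp add: d_def)
    have dsum: "d sums (e / 2 / 2)" unfolding d_def by (rule halving_sums)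
    obtain K0 where K0: "compactin T K0" "K0 \<subseteq> A" "K0 \<in> sets M" "measure (completion M) (A - K0) < e / 2"
      using polish_prob_inner_compact[OF P A(1) half_gt_zero[OF e]] by blast
    have "\<forall>n. \<exists>C. compactin T C \<and> C \<subseteq> S n \<and> C \<in> sets M \<and> measure (completion M) (S n - C) < d n / 2"
      using polish_prob_inner_compact[OF P SM half_gt_zero[OF d]] by (intro allI)
    from choice[OF this] obtain C where C: "\<And>n. compactin T (C n)" "\<And>n. C n \<subseteq> S n" "\<And>n. C n \<in> sets M"
      "\<And>n. measure (completion M) (S n - C n) < d n / 2" by blast
    have SM': "space M - S n \<in> sets (completion M)" for n
      using SM[of n] by (metis sets.compl_sets space_completion)
    have "\<forall>n. \<exists>D. compactin T D \<and> D \<subseteq> space M - S n \<and> D \<in> sets M \<and> measure (completion M) ((space M - S n) - D) < d n / 2"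
      using polish_prob_inner_compact[OF P SM' half_gt_zero[OF d]] by (intro allI)
    from choice[OF this] obtain D where D: "\<And>n. compactin T (D n)" "\<And>n. D n \<subseteq> space M - S n" "\<And>n. D n \<in> sets M"
      "\<And>n. measure (completion M) ((space M - S n) - D n) < d n / 2" by blast
    \<comment> \<open>Inside \<open>K\<close> the set \<open>S n\<close> and its complement are cut
      out by the disjoint closed sets \<open>C n\<close> and \<open>D n\<close>. So the preimage of
      every basic \<open>V n\<close> is relatively open, which is continuity of \<open>F\<close> on
      \<open>K\<close>.\<close>
    define K where "K = K0 \<inter> (\<Inter>n. C n \<union> D n)"
    have cl: "closedin T (\<Inter>n. C n \<union> D n)"
      by (rule closedin_Inter) (use C(1) D(1) cpt_closed in auto)
    have Kc: "compactin T K"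
      unfolding K_def Int_commute[of K0] by (rule closed_Int_compactin[OF cl K0(1)])
    have KA: "K \<subseteq> A" using K0(2) by (auto simp: K_def)
    have Ksub: "K \<subseteq> topspace T" using Kc compactin_subset_topspace by blast
    have part: "measure (completion M) (space M - (C n \<union> D n)) \<le> d n" for n
    proof -
      have "measure (completion M) (space M - (C n \<union> D n)) \<le> measure (completion M) ((S n - C n) \<union> ((space M - S n) - D n))"
        by (rule C.finite_measure_mono) (use SM[of n] SM'[of n] C(3)[of n] D(3)[of n] in auto)
      also have "\<dots> \<le> measure (completion M) (S n - C n) + measure (completion M) ((space M - S n) - D n)"
        by (rule measure_Un_le) (use SM[of n] SM'[of n] C(3)[of n] D(3)[of n] in auto)
      also have "\<dots> \<le> d n" using C(4)[of n] D(4)[of n] by linarith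
      finally show ?thesis .
    qed
    have sd: "summable (\<lambda>n. measure (completion M) (space M - (C n \<union> D n)))"
      by (rule summable_comparison_test'[OF sums_summable[OF dsum]]) (use part in simp)
    have "measure (completion M) (\<Union>n. space M - (C n \<union> D n)) \<le> (\<Sum>n. measure (completion M) (space M - (C n \<union> D n)))"
    proof (rule C.finite_measure_subadditive_countably[OF _ sd])
      have "space M - (C n \<union> D n) \<in> sets M" for n
        using C(3)[of n] D(3)[of n] by blast
      then show "range (\<lambda>n. space M - (C n \<union> D n)) \<subseteq> sets (completion M)" by blast
    qed
    also have "\<dots> \<le> suminf d"
      by (rule suminf_le[OF part sd sums_summable[OF dsum]])
    finally have 1: "measure (completion M) (\<Union>n. space M - (C n \<union> D n)) \<le> e / 2 / 2"
      using sums_unique[OF dsum] by simp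
    have CDm: "(\<Union>n. space M - (C n \<union> D n)) \<in> sets (completion M)"
    proof (rule sets.countable_UN)
      have "space M - (C n \<union> D n) \<in> sets M" for n
        using C(3)[of n] D(3)[of n] by blast
      then show "range (\<lambda>n. space M - (C n \<union> D n)) \<subseteq> sets (completion M)" by blast
    qed
    have AK: "A - K0 \<in> sets (completion M)" using A(1) K0(3) by auto
    have Ac: "space M - A \<in> sets (completion M)" using A(1) by (metis sets.compl_sets space_completion)
    have A0: "measure (completion M) (space M - A) = 0"
      using C.prob_compl[OF A(1)] A(2) by simp
    have "measure (completion M) (space M - K) \<le>
        measure (completion M) ((space M - A) \<union> ((A - K0) \<union> (\<Union>n. space M - (C n \<union> D n))))"
      by (rule C.finite_measure_mono) (use Ac AK CDm in \<open>auto simp: K_def\<close>)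
    also have "\<dots> \<le> measure (completion M) (space M - A) + measure (completion M) ((A - K0) \<union> (\<Union>n. space M - (C n \<union> D n)))"
      by (rule measure_Un_le) (use Ac AK CDm in blast)+
    also have "measure (completion M) ((A - K0) \<union> (\<Union>n. space M - (C n \<union> D n))) \<le>
        measure (completion M) (A - K0) + measure (completion M) (\<Union>n. space M - (C n \<union> D n))"
      by (rule measure_Un_le) (use AK CDm in blast)+
    finally have 2: "measure (completion M) (space M - K) < e"
      using 1 K0(4) A0 e by simp
    have pre: "openin (subtopology T K) {x \<in> K. F x \<in> V n}" for n
    proof -
      have "{x \<in> K. F x \<in> V n} = K - D n"
      proof (intro set_eqI iffI)
        fix x assume x: "x \<in> {x \<in> K. F x \<in> V n}"
        then have "x \<in> S n" using Ksub spM by (auto simp: S_def)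
        then show "x \<in> K - D n" using x D(2) by blast
      next
        fix x assume x: "x \<in> K - D n"
        then have "x \<in> C n" unfolding K_def by blast
        then show "x \<in> {x \<in> K. F x \<in> V n}" using x C(2) by (auto simp: S_def)
      qed
      also have "K - D n = (topspace T - D n) \<inter> K"
        using Ksub by blast
      finally show ?thesis
        unfolding openin_subtopology using cpt_closed[OF D(1)[of n]] openin_diff[OF openin_topspace] by blast
    qed
    have "continuous_map (subtopology T K) T' F"
      unfolding continuous_map_def
    proof (intro conjI allI impI)
      show "F \<in> topspace (subtopology T K) \<rightarrow> topspace T'"
        using measurable_space[OF F] spM Ksub by auto
      fix U assume U: "openin T' U"
      have "{x \<in> topspace (subtopology T K). F x \<in> U} = (\<Union>n\<in>{n. V n \<subseteq> U}. {x \<in> K. F x \<in> V n})"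
      proof (intro set_eqI iffI)
        fix x assume "x \<in> {x \<in> topspace (subtopology T K). F x \<in> U}"
        then have x: "x \<in> K" "F x \<in> U" by auto
        obtain W where W: "W \<in> \<B>" "F x \<in> W" "W \<subseteq> U" using \<B>(3)[OF U x(2)] by blast
        then obtain n where "W = V n" using rV by (metis insertCI rangeE)
        then show "x \<in> (\<Union>n\<in>{n. V n \<subseteq> U}. {x \<in> K. F x \<in> V n})" using W x by blast
      next
        fix x assume "x \<in> (\<Union>n\<in>{n. V n \<subseteq> U}. {x \<in> K. F x \<in> V n})"
        then show "x \<in> {x \<in> topspace (subtopology T K). F x \<in> U}" using Ksub by auto
      qed
      then show "openin (subtopology T K) {x \<in> topspace (subtopology T K). F x \<in> U}"
        using pre by (simp only:) (intro openin_Union ballI; auto)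
    qed
    with Kc KA 2 show ?thesis by (intro exI[of _ K] conjI)
  qed
  have "\<forall>k. \<exists>K. compactin T K \<and> K \<subseteq> A \<and> continuous_map (subtopology T K) T' F \<and>
      measure (completion M) (space M - K) < 1 / real (Suc k)"
    by (intro allI good) simp
  from choice[OF this] obtain K where K: "\<And>k. compactin T (K k)" "\<And>k. K k \<subseteq> A"
    "\<And>k. continuous_map (subtopology T (K k)) T' F" "\<And>k. measure (completion M) (space M - K k) < 1 / real (Suc k)"
    by blast
  have KM: "K k \<in> sets M" for k using closed_M[OF cpt_closed[OF K(1)]] .
  define Z where "Z = (\<Union>k. K k)"
  have ZM: "Z \<in> sets M" unfolding Z_def using KM by blast
  have ZA: "Z \<subseteq> A" unfolding Z_def using K(2) by blast
  have Z0: "measure (completion M) (space M - Z) = 0"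
  proof (rule ccontr)
    assume "measure (completion M) (space M - Z) \<noteq> 0"
    then have "0 < measure (completion M) (space M - Z)" by (simp add: less_le)
    then obtain n :: nat where n: "1 / real (Suc n) < measure (completion M) (space M - Z)" by (rule nat_approx_posE)
    have "measure (completion M) (space M - Z) \<le> measure (completion M) (space M - K n)"
      by (rule C.finite_measure_mono) (use KM[of n] in \<open>auto simp: Z_def\<close>)
    then show False using n K(4)[of n] by linarith
  qed
  have im_closed: "closedin T' (F ` (K k \<inter> C))" if "closedin T C" for k C
  proof -
    have "compactin T (K k \<inter> C)"
      using closed_Int_compactin[OF that K(1)[of k]] by (simp add: Int_commute)
    then have "compactin (subtopology T (K k)) (K k \<inter> C)"
      by (simp add: compactin_subtopology)
    from image_compactin[OF this K(3)] show ?thesis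
      using T'(1) compactin_imp_closedin by blast
  qed
  \<comment> \<open>Being the image of a countable union of compact sets on each of which
    \<open>F\<close> is continuous, \<open>B\<close> is a countable union of closed sets and thus
    Borel.\<close>
  define B where "B = F ` Z"
  have Beq: "B = (\<Union>k. F ` (K k \<inter> topspace T))"
  proof -
    have "K k \<inter> topspace T = K k" for k
      using compactin_subset_topspace[OF K(1)[of k]] by blast
    then show ?thesis by (simp add: B_def Z_def image_UN)
  qed
  have BM: "B \<in> sets (borel_of T')"
    unfolding Beq by (intro sets.countable_UN image_subsetI borel_of_closed im_closed) simp
  obtain x0 where x0: "x0 \<in> space M" using not_empty by blast
  \<comment> \<open>The value \<open>x0\<close> only makes \<open>G\<close> total; almost no
    \<open>F x\<close> falls outside \<open>B\<close>.\<close>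
  define G where "G y = (if y \<in> B then inv_into Z F y else x0)" for y
  have injZ: "inj_on F Z" using inj ZA inj_on_subset by blast
  have G: "G y \<in> Z" "F (G y) = y" if "y \<in> B" for y
    using that by (auto simp: G_def B_def inv_into_into f_inv_into_f)
  have GF: "G (F x) = x" if "x \<in> Z" for x
    using that injZ by (auto simp: G_def B_def)
  have Gm: "G \<in> measurable (borel_of T') M"
  proof -
    \<comment> \<open>Preimages of closed sets under \<open>G\<close> are images under
      \<open>F\<close> of compact pieces, up to the default value. Therefore the target
      sigma-algebra is generated here by the closed sets.\<close>
    have "G \<in> measurable (borel_of T') (sigma (topspace T) {C. closedin T C})"
    proof (rule measurable_measure_of)
      show "{C. closedin T C} \<subseteq> Pow (topspace T)" using closedin_subset by blast
      show "G \<in> space (borel_of T') \<rightarrow> topspace T"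
      proof
        fix y
        show "G y \<in> topspace T"
        proof (cases "y \<in> B")
          case True
          from G(1)[OF True] show ?thesis using sets.sets_into_space[OF ZM] spM by blast
        next
          case False then show ?thesis using x0 spM by (simp add: G_def)
        qed
      qed
      fix C assume "C \<in> {C. closedin T C}"
      then have C: "closedin T C" by simp
      have "G -` C \<inter> space (borel_of T') = (\<Union>k. F ` (K k \<inter> C)) \<union> (if x0 \<in> C then topspace T' - B else {})"
      proof (intro set_eqI iffI)
        fix y assume y: "y \<in> G -` C \<inter> space (borel_of T')"
        show "y \<in> (\<Union>k. F ` (K k \<inter> C)) \<union> (if x0 \<in> C then topspace T' - B else {})"
        proof (cases "y \<in> B")
          case True
          then obtain k where "G y \<in> K k" using G(1) unfolding Z_def by blast
          then have "y \<in> F ` (K k \<inter> C)" using G(2)[OF True] y by (metis IntD1 IntI image_eqI vimageE)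
          then show ?thesis by blast
        next
          case False
          then have "G y = x0" by (simp add: G_def)
          then show ?thesis using y False by auto
        qed
      next
        fix y assume y: "y \<in> (\<Union>k. F ` (K k \<inter> C)) \<union> (if x0 \<in> C then topspace T' - B else {})"
        show "y \<in> G -` C \<inter> space (borel_of T')"
        proof (cases "y \<in> (\<Union>k. F ` (K k \<inter> C))")
          case True
          then obtain k x where x: "x \<in> K k" "x \<in> C" "y = F x" by blast
          then have "x \<in> Z" unfolding Z_def by blast
          moreover have "F x \<in> topspace T'"
            using closedin_subset[OF im_closed[OF C, of k]] x by blast
          ultimately show ?thesis using x GF by simp
        next
          case False
          then have "x0 \<in> C" "y \<in> topspace T' - B" using y by (auto split: if_splits)
          then show ?thesis by (simp add: G_def)
        qed
      qed
      also have "\<dots> \<in> sets (borel_of T')"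
      proof (rule sets.Un)
        show "(\<Union>k. F ` (K k \<inter> C)) \<in> sets (borel_of T')"
          by (intro sets.countable_UN image_subsetI borel_of_closed im_closed C)
        show "(if x0 \<in> C then topspace T' - B else {}) \<in> sets (borel_of T')"
          using sets.compl_sets[OF BM] by simp
      qed
      finally show "G -` C \<inter> space (borel_of T') \<in> sets (borel_of T')" .
    qed
    moreover have "sets (sigma (topspace T) {C. closedin T C}) = sets M"
    proof -
      have 1: "{C. closedin T C} \<subseteq> Pow (topspace T)" using closedin_subset by blast
      have "sigma_sets (topspace T) {C. closedin T C} = sigma_sets (topspace T) {U. openin T U}"
      proof (rule sigma_sets_eqI)
        fix C assume "C \<in> {C. closedin T C}"
        then show "C \<in> sigma_sets (topspace T) {U. openin T U}"
          using borel_of_closed[of T C] by (simp add: sets_borel_of)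
      next
        fix U assume "U \<in> {U. openin T U}"
        then have U: "openin T U" by simp
        then have "closedin T (topspace T - U)" by blast
        then have "topspace T - (topspace T - U) \<in> sigma_sets (topspace T) {C. closedin T C}"
          by (intro sigma_sets.Compl sigma_sets.Basic) simp
        then show "U \<in> sigma_sets (topspace T) {C. closedin T C}"
          using openin_subset[OF U] by (simp add: double_diff)
      qed
      then show ?thesis
        unfolding sM sets_borel_of sets_measure_of[OF 1] .
    qed
    ultimately show ?thesis
      using measurable_cong_sets[OF refl] by blast
  qed
  have "AE x in completion M. F x \<in> B"
  proof -
    have "AE x in completion M. x \<in> Z"
    proof (rule C.AE_prob_1)
      show "measure (completion M) Z = 1"
        using C.prob_compl[of Z] ZM Z0 by simp
    qed
    then show ?thesis
      by (rule AE_mp) (auto simp: B_def)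
  qed
  then show ?thesis
    using BM Gm G ZA by (intro exI[of _ B] exI[of _ G]) auto
qed

section \<open>The Ky Fan distance modulo constants\<close>

text \<open>The formula of \<open>ky_fan\<close> for an arbitrary measure, so that it can be moved
  along measure-preserving maps between different spaces.\<close>

definition kfan :: "'a measure \<Rightarrow> ('a \<Rightarrow> real) \<Rightarrow> ('a \<Rightarrow> real) \<Rightarrow> real" where
  "kfan N f g = Inf {\<epsilon>. 0 < \<epsilon> \<and> measure N {x \<in> space N. \<epsilon> < \<bar>f x - g x\<bar>} \<le> \<epsilon>}"

definition kfan_mod :: "'a measure \<Rightarrow> ('a \<Rightarrow> real) \<Rightarrow> ('a \<Rightarrow> real) \<Rightarrow> real" where
  "kfan_mod N f g = (INF c. kfan N f (\<lambda>x. g x + c))"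

context prob_space
begin

lemma full_set_of_AE:
  assumes "AE x in M. P x"
  shows "\<exists>E\<in>sets M. emeasure M E = 1 \<and> (\<forall>x\<in>E. x \<in> space M \<and> P x)"
proof -
  obtain N where N: "N \<in> sets M" "emeasure M N = 0" "{x \<in> space M. \<not> P x} \<subseteq> N"
    using assms by (auto elim!: AE_E)
  have "measure M (space M - N) = 1"
    using prob_compl[OF N(1)] N(2) by (simp add: measure_def)
  then have "emeasure M (space M - N) = 1"
    by (simp add: emeasure_eq_measure)
  then show ?thesis
    using N by (intro bexI[of _ "space M - N"]) auto
qed

lemma AE_of_full_set:
  assumes "E \<in> sets M" "emeasure M E = 1"
  shows "AE x in M. x \<in> E"
  by (rule AE_prob_1) (use assms in \<open>simp add: measure_def\<close>)

lemma kfan_nonneg: "0 \<le> kfan M f g"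
  unfolding kfan_def
  by (rule cInf_greatest) (auto intro!: exI[of _ 1])

lemma kfan_le:
  assumes "0 < e" "measure M {x \<in> space M. e < \<bar>f x - g x\<bar>} \<le> e"
  shows "kfan M f g \<le> e"
  unfolding kfan_def by (rule cInf_lower) (use assms in \<open>auto intro!: bdd_belowI[of _ 0]\<close>)

text \<open>The admissible \<open>\<epsilon>\<close> form an upward closed set, so every
  \<open>e\<close> above the infimum is admissible, even strictly.\<close>

lemma kfan_less:
  assumes [measurable]: "f \<in> borel_measurable M" "g \<in> borel_measurable M" and "kfan M f g < e"
  shows "measure M {x \<in> space M. e < \<bar>f x - g x\<bar>} < e"
proof -
  have "{\<epsilon>. 0 < \<epsilon> \<and> measure M {x \<in> space M. \<epsilon> < \<bar>f x - g x\<bar>} \<le> \<epsilon>} \<noteq> {}"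
    by (auto intro!: exI[of _ 1])
  from cInf_lessD[OF this assms(3)[unfolded kfan_def]]
  obtain \<epsilon> where \<epsilon>: "\<epsilon> < e" "measure M {x \<in> space M. \<epsilon> < \<bar>f x - g x\<bar>} \<le> \<epsilon>"
    by blast
  have "measure M {x \<in> space M. e < \<bar>f x - g x\<bar>} \<le> measure M {x \<in> space M. \<epsilon> < \<bar>f x - g x\<bar>}"
    by (rule finite_measure_mono) (use \<epsilon>(1) in auto)
  then show ?thesis using \<epsilon> by linarith
qed

lemma kfan_sym: "kfan M f g = kfan M g f"
  unfolding kfan_def by (simp add: abs_minus_commute)

lemma kfan_triangle:
  assumes [measurable]: "f \<in> borel_measurable M" "g \<in> borel_measurable M" "h \<in> borel_measurable M"
  shows "kfan M f h \<le> kfan M f g + kfan M g h"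
proof (rule field_le_epsilon)
  fix e :: real assume e: "0 < e"
  define a b where "a = kfan M f g + e / 2" and "b = kfan M g h + e / 2"
  have ab: "0 < a" "0 < b"
    using kfan_nonneg[of f g] kfan_nonneg[of g h] e by (auto simp: a_def b_def)
  have 1: "measure M {x \<in> space M. a < \<bar>f x - g x\<bar>} < a"
    by (rule kfan_less) (use e in \<open>simp_all add: a_def\<close>)
  have 2: "measure M {x \<in> space M. b < \<bar>g x - h x\<bar>} < b"
    by (rule kfan_less) (use e in \<open>simp_all add: b_def\<close>)
  have "measure M {x \<in> space M. a + b < \<bar>f x - h x\<bar>} \<le>
      measure M ({x \<in> space M. a < \<bar>f x - g x\<bar>} \<union> {x \<in> space M. b < \<bar>g x - h x\<bar>})"
    by (rule finite_measure_mono) auto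
  also have "\<dots> \<le> measure M {x \<in> space M. a < \<bar>f x - g x\<bar>} + measure M {x \<in> space M. b < \<bar>g x - h x\<bar>}"
    by (rule measure_Un_le) auto
  finally have "kfan M f h \<le> a + b"
    by (intro kfan_le) (use ab 1 2 in linarith)+
  then show "kfan M f h \<le> kfan M f g + kfan M g h + e"
    by (simp add: a_def b_def)
qed

lemma kfan_cong_AE:
  assumes "AE x in M. f x = f' x" "AE x in M. g x = g' x"
    and [measurable]: "f \<in> borel_measurable M" "g \<in> borel_measurable M" "f' \<in> borel_measurable M" "g' \<in> borel_measurable M"
  shows "kfan M f g = kfan M f' g'"
proof -
  have "measure M {x \<in> space M. e < \<bar>f x - g x\<bar>} = measure M {x \<in> space M. e < \<bar>f' x - g' x\<bar>}" for e
    by (rule finite_measure_eq_AE) (use assms(1,2) in auto)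
  then show ?thesis
    unfolding kfan_def by simp
qed

lemma kfan_shift: "kfan M (\<lambda>x. f x + c) (\<lambda>x. g x + c) = kfan M f g"
  unfolding kfan_def by simp

lemma kfan_const_le: "kfan M (\<lambda>x. g x + a) (\<lambda>x. g x + b) \<le> \<bar>a - b\<bar>"
proof (rule dense_ge)
  fix e assume e: "\<bar>a - b\<bar> < e"
  show "kfan M (\<lambda>x. g x + a) (\<lambda>x. g x + b) \<le> e"
    by (rule kfan_le) (use e in auto)
qed

text \<open>The Ky Fan distance never exceeds 1, so it can bound a shift only below that value; this
  is the role of \<open>e \<le> 1\<close>. Once the shift exceeds \<open>e\<close>, the exceptional
  set is the whole space.\<close>

lemma const_le_kfan:
  assumes [measurable]: "g \<in> borel_measurable M" and "kfan M (\<lambda>x. g x + a) (\<lambda>x. g x + b) < e" "e \<le> 1"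
  shows "\<bar>a - b\<bar> \<le> e"
proof (rule ccontr)
  assume *: "\<not> \<bar>a - b\<bar> \<le> e"
  have "measure M {x \<in> space M. e < \<bar>(g x + a) - (g x + b)\<bar>} < e"
    by (rule kfan_less) (use assms in auto)
  moreover have "{x \<in> space M. e < \<bar>(g x + a) - (g x + b)\<bar>} = space M"
    using * by auto
  ultimately show False
    using assms(3) prob_space by simp
qed

lemma kfan_zero_imp_AE:
  assumes [measurable]: "f \<in> borel_measurable M" "g \<in> borel_measurable M" and z: "kfan M f g = 0"
  shows "AE x in M. f x = g x"
proof -
  have null: "AE x in M. \<bar>f x - g x\<bar> \<le> 1 / real (Suc n)" for n
  proof -
    have "measure M {x \<in> space M. 1 / real (Suc n) < \<bar>f x - g x\<bar>} \<le> e" if e: "0 < e" for e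
    proof -
      let ?e = "min e (1 / real (Suc n))"
      have "measure M {x \<in> space M. ?e < \<bar>f x - g x\<bar>} < ?e"
        by (rule kfan_less) (use z e in auto)
      moreover have "measure M {x \<in> space M. 1 / real (Suc n) < \<bar>f x - g x\<bar>} \<le> measure M {x \<in> space M. ?e < \<bar>f x - g x\<bar>}"
        by (rule finite_measure_mono) auto
      ultimately show ?thesis by linarith
    qed
    then have "measure M {x \<in> space M. 1 / real (Suc n) < \<bar>f x - g x\<bar>} = 0"
      by (meson dense_ge order_antisym measure_nonneg)
    then have "AE x in M. x \<notin> {x \<in> space M. 1 / real (Suc n) < \<bar>f x - g x\<bar>}"
      by (intro AE_not_in null_setsI) (auto simp: emeasure_eq_measure)
    then show ?thesis
      using AE_space by eventually_elim auto
  qed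
  have "AE x in M. \<forall>n. \<bar>f x - g x\<bar> \<le> 1 / real (Suc n)"
    using null by (simp add: AE_all_countable)
  then show ?thesis
  proof eventually_elim
    case (elim x)
    show ?case
    proof (rule ccontr)
      assume "f x \<noteq> g x"
      then have "0 < \<bar>f x - g x\<bar>" by simp
      then obtain n :: nat where "1 / real (Suc n) < \<bar>f x - g x\<bar>" by (rule nat_approx_posE)
      then show False using elim by (meson not_le)
    qed
  qed
qed

text \<open>Convergence almost everywhere implies convergence in measure: dominated convergence
  applies to the indicators of the exceptional sets.\<close>

lemma kfan_tendsto_zero:
  assumes [measurable]: "\<And>n. h n \<in> borel_measurable M" "g \<in> borel_measurable M"
    and lim: "AE x in M. (\<lambda>n. h n x) \<longlonglongrightarrow> g x"
  shows "(\<lambda>n. kfan M (h n) g) \<longlonglongrightarrow> 0"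
proof (rule tendstoI)
  fix e :: real assume e: "0 < e"
  define A where "A n = {x \<in> space M. e / 2 < \<bar>h n x - g x\<bar>}" for n
  have [measurable]: "A n \<in> sets M" for n unfolding A_def by measurable
  have "(\<lambda>n. integral\<^sup>L M (indicator (A n) :: _ \<Rightarrow> real)) \<longlonglongrightarrow> integral\<^sup>L M (\<lambda>x. 0 :: real)"
  proof (rule integral_dominated_convergence[where w = "\<lambda>_. 1"])
    show "AE x in M. (\<lambda>n. indicator (A n) x :: real) \<longlonglongrightarrow> 0"
      using lim
    proof eventually_elim
      case (elim x)
      have "eventually (\<lambda>n. dist (h n x) (g x) < e / 2) sequentially"
        by (rule tendstoD[OF elim half_gt_zero[OF e]])
      then have "eventually (\<lambda>n. (indicator (A n) x :: real) = 0) sequentially"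
        by eventually_elim (auto simp: A_def dist_real_def)
      then show ?case by (rule tendsto_eventually)
    qed
  qed auto
  then have "(\<lambda>n. measure M (A n)) \<longlonglongrightarrow> 0"
    by simp
  from tendstoD[OF this half_gt_zero[OF e]]
  show "eventually (\<lambda>n. dist (kfan M (h n) g) 0 < e) sequentially"
  proof eventually_elim
    case (elim n)
    then have "kfan M (h n) g \<le> e / 2"
      by (intro kfan_le) (use e in \<open>auto simp: A_def\<close>)
    then show ?case using e kfan_nonneg[of "h n" g] by simp
  qed
qed

lemma kfan_mod_nonneg: "0 \<le> kfan_mod M f g"
  unfolding kfan_mod_def by (rule cINF_greatest) (auto simp: kfan_nonneg)

lemma kfan_mod_le: "kfan_mod M f g \<le> kfan M f (\<lambda>x. g x + c)"
  unfolding kfan_mod_def by (rule cINF_lower) (auto intro!: bdd_belowI[of _ 0] simp: kfan_nonneg)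

lemma kfan_mod_le0: "kfan_mod M f g \<le> kfan M f g"
  using kfan_mod_le[of f g 0] by simp

lemma kfan_mod_less:
  assumes "kfan_mod M f g < e"
  shows "\<exists>c. kfan M f (\<lambda>x. g x + c) < e"
proof -
  have "bdd_below (range (\<lambda>c. kfan M f (\<lambda>x. g x + c)))"
    by (rule bdd_belowI[of _ 0]) (auto simp: kfan_nonneg)
  then show ?thesis
    using cINF_less_iff[of UNIV "\<lambda>c. kfan M f (\<lambda>x. g x + c)" e] assms unfolding kfan_mod_def by simp
qed

lemma kfan_swap_shift: "kfan M f (\<lambda>x. g x + c) = kfan M g (\<lambda>x. f x + (- c))"
  using kfan_shift[of "\<lambda>x. f x + (- c)" c g] by (simp add: kfan_sym)

lemma kfan_mod_sym: "kfan_mod M f g = kfan_mod M g f"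
proof -
  have le: "kfan_mod M f g \<le> kfan_mod M g f" for f g
  proof (rule dense_ge)
    fix e assume "kfan_mod M g f < e"
    then obtain c where "kfan M g (\<lambda>x. f x + c) < e" using kfan_mod_less by blast
    then have "kfan M f (\<lambda>x. g x + (- c)) < e" using kfan_swap_shift[of g f c] by simp
    then show "kfan_mod M f g \<le> e" using kfan_mod_le[of f g "- c"] by linarith
  qed
  show ?thesis by (rule antisym) (rule le)+
qed

lemma kfan_mod_triangle:
  assumes [measurable]: "f \<in> borel_measurable M" "g \<in> borel_measurable M" "h \<in> borel_measurable M"
  shows "kfan_mod M f h \<le> kfan_mod M f g + kfan_mod M g h"
proof (rule field_le_epsilon)
  fix e :: real assume e: "0 < e"
  obtain a where a: "kfan M f (\<lambda>x. g x + a) < kfan_mod M f g + e / 2"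
    using kfan_mod_less[of f g "kfan_mod M f g + e / 2"] e by auto
  obtain b where b: "kfan M g (\<lambda>x. h x + b) < kfan_mod M g h + e / 2"
    using kfan_mod_less[of g h "kfan_mod M g h + e / 2"] e by auto
  have "kfan M (\<lambda>x. g x + a) (\<lambda>x. (h x + b) + a) < kfan_mod M g h + e / 2"
    using b by (subst kfan_shift)
  moreover have "kfan M f (\<lambda>x. h x + (b + a)) \<le> kfan M f (\<lambda>x. g x + a) + kfan M (\<lambda>x. g x + a) (\<lambda>x. h x + (b + a))"
    by (rule kfan_triangle) auto
  ultimately have "kfan M f (\<lambda>x. h x + (b + a)) < kfan_mod M f g + kfan_mod M g h + e"
    using a by (simp add: add.assoc)
  then show "kfan_mod M f h \<le> kfan_mod M f g + kfan_mod M g h + e"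
    using kfan_mod_le[of f h "b + a"] by linarith
qed

text \<open>The infimum over constants is attained: nearly optimal constants form a Cauchy sequence
  by \<open>const_le_kfan\<close>, and their limit realizes distance 0.\<close>

lemma kfan_mod_zero_imp:
  assumes [measurable]: "f \<in> borel_measurable M" "g \<in> borel_measurable M" and z: "kfan_mod M f g = 0"
  shows "\<exists>c. AE x in M. f x = g x + c"
proof -
  have "\<forall>n. \<exists>c. kfan M f (\<lambda>x. g x + c) < 1 / real (Suc n)"
    using z by (intro allI kfan_mod_less) simp
  from choice[OF this] obtain c where c: "\<And>n. kfan M f (\<lambda>x. g x + c n) < 1 / real (Suc n)" by blast
  have small: "(\<lambda>n. 1 / real (Suc n)) \<longlonglongrightarrow> 0"
    using LIMSEQ_Suc[OF lim_1_over_n] .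
  have "Cauchy c"
  proof (rule metric_CauchyI)
    fix e :: real assume e: "0 < e"
    define e' where "e' = min (e / 2) 1"
    have e': "0 < e'" "e' \<le> 1" "e' < e" using e by (auto simp: e'_def)
    obtain N where N: "\<And>n. n \<ge> N \<Longrightarrow> 1 / real (Suc n) < e' / 2"
      using order_tendstoD(2)[OF small, of "e' / 2"] e'(1) unfolding eventually_sequentially by auto
    have "dist (c m) (c n) < e" if "m \<ge> N" "n \<ge> N" for m n
    proof -
      have "kfan M (\<lambda>x. g x + c m) (\<lambda>x. g x + c n) \<le> kfan M (\<lambda>x. g x + c m) f + kfan M f (\<lambda>x. g x + c n)"
        by (rule kfan_triangle) auto
      then have "kfan M (\<lambda>x. g x + c m) (\<lambda>x. g x + c n) < e'"
        using c[of m] c[of n] N[OF that(1)] N[OF that(2)] kfan_sym[of "\<lambda>x. g x + c m" f] by linarith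
      from const_le_kfan[OF _ this e'(2)] show ?thesis using e'(3) by (simp add: dist_real_def)
    qed
    then show "\<exists>N. \<forall>m\<ge>N. \<forall>n\<ge>N. dist (c m) (c n) < e" by blast
  qed
  then obtain l where l: "c \<longlonglongrightarrow> l" by (meson Cauchy_convergent_iff convergent_def)
  have "kfan M f (\<lambda>x. g x + l) \<le> 0"
  proof (rule LIMSEQ_le_const)
    show "(\<lambda>n. 1 / real (Suc n) + \<bar>c n - l\<bar>) \<longlonglongrightarrow> 0"
      using tendsto_add[OF small tendsto_rabs[OF tendsto_diff[OF l tendsto_const[of l]]]] by simp
    have "kfan M f (\<lambda>x. g x + l) \<le> 1 / real (Suc n) + \<bar>c n - l\<bar>" for n
    proof -
      have "kfan M f (\<lambda>x. g x + l) \<le> kfan M f (\<lambda>x. g x + c n) + kfan M (\<lambda>x. g x + c n) (\<lambda>x. g x + l)"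
        by (rule kfan_triangle) auto
      then show ?thesis using c[of n] kfan_const_le[of g "c n" l] by linarith
    qed
    then show "\<exists>N. \<forall>n\<ge>N. kfan M f (\<lambda>x. g x + l) \<le> 1 / real (Suc n) + \<bar>c n - l\<bar>" by blast
  qed
  then have "kfan M f (\<lambda>x. g x + l) = 0" using kfan_nonneg[of f "\<lambda>x. g x + l"] by linarith
  then have "AE x in M. f x = g x + l" by (intro kfan_zero_imp_AE) auto
  then show ?thesis ..
qed

lemma kfan_self: "kfan M f f = 0"
  using kfan_const_le[of f 0 0] kfan_nonneg[of f f] by simp

text \<open>The functions \<open>f k + (\<Sum>j<k. \<delta> j)\<close> are representatives with summable increments, hence converge almost
  everywhere by Borel--Cantelli.\<close>

lemma kfan_mod_cauchy_AE_convergent: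
  assumes [measurable]: "\<And>k. f k \<in> borel_measurable M"
    and cau: "\<And>k. kfan_mod M (f k) (f (Suc k)) < (1/2) ^ k"
  shows "\<exists>c g. g \<in> borel_measurable M \<and> (AE x in M. (\<lambda>k. f k x + c k) \<longlonglongrightarrow> g x)"
proof -
  have "\<forall>k. \<exists>c. kfan M (f k) (\<lambda>x. f (Suc k) x + c) < (1/2) ^ k"
    using cau by (intro allI kfan_mod_less)
  from choice[OF this] obtain \<delta> where \<delta>: "\<And>k. kfan M (f k) (\<lambda>x. f (Suc k) x + \<delta> k) < (1/2) ^ k" by blast
  define c where "c k = (\<Sum>j<k. \<delta> j)" for k
  define h where "h k x = f k x + c k" for k x
  have hm[measurable]: "h k \<in> borel_measurable M" for k unfolding h_def by measurable
  have "kfan M (h k) (h (Suc k)) < (1/2) ^ k" for k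
  proof -
    have "h (Suc k) = (\<lambda>x. (f (Suc k) x + \<delta> k) + c k)" by (auto simp: h_def c_def)
    moreover have "h k = (\<lambda>x. f k x + c k)" by (auto simp: h_def)
    ultimately show ?thesis using \<delta>[of k] by (simp only: kfan_shift)
  qed
  then have small: "measure M {x \<in> space M. (1/2) ^ k < \<bar>h k x - h (Suc k) x\<bar>} < (1/2) ^ k" for k
    by (intro kfan_less) auto
  have "AE x in M. eventually (\<lambda>k. x \<in> space M - {x \<in> space M. (1/2) ^ k < \<bar>h k x - h (Suc k) x\<bar>}) sequentially"
  proof (rule borel_cantelli_AE1)
    show "summable (\<lambda>k. measure M {x \<in> space M. (1/2) ^ k < \<bar>h k x - h (Suc k) x\<bar>})"
      by (rule summable_comparison_test'[OF summable_geometric[of "1/2::real"]]) (use small in \<open>auto intro: less_imp_le\<close>)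
  qed (auto simp: less_top[symmetric])
  then have conv: "AE x in M. convergent (\<lambda>k. h k x)"
  proof (rule AE_mp, intro AE_I2 impI)
    fix x assume "x \<in> space M"
      and "eventually (\<lambda>k. x \<in> space M - {x \<in> space M. (1/2) ^ k < \<bar>h k x - h (Suc k) x\<bar>}) sequentially"
    then obtain N where N: "\<And>k. k \<ge> N \<Longrightarrow> \<bar>h k x - h (Suc k) x\<bar> \<le> (1/2) ^ k"
      unfolding eventually_sequentially by force
    have "summable (\<lambda>k. h (Suc k) x - h k x)"
      by (rule summable_comparison_test[OF _ summable_geometric[of "1/2::real"]])
        (use N in \<open>auto simp: abs_minus_commute\<close>)
    then have "convergent (\<lambda>n. \<Sum>k<n. h (Suc k) x - h k x)"
      by (simp add: summable_iff_convergent)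
    then have "convergent (\<lambda>n. h n x - h 0 x)"
      using sum_lessThan_telescope[of "\<lambda>n. h n x"] by simp
    then show "convergent (\<lambda>k. h k x)"
      using convergent_add[OF _ convergent_const[of "h 0 x"]] by fastforce
  qed
  have "AE x in M. (\<lambda>k. h k x) \<longlonglongrightarrow> lim (\<lambda>k. h k x)"
    using conv by eventually_elim (simp add: convergent_LIMSEQ_iff)
  moreover have "(\<lambda>x. lim (\<lambda>k. h k x)) \<in> borel_measurable M"
    by (rule borel_measurable_lim_metric) simp
  ultimately show ?thesis
    unfolding h_def by (intro exI[of _ c] exI[of _ "\<lambda>x. lim (\<lambda>k. f k x + c k)"] conjI)
qed

end

lemma kfan_distr:
  assumes [measurable]: "\<phi> \<in> measurable N N'" "f \<in> borel_measurable N'" "g \<in> borel_measurable N'" and "distr N N' \<phi> = N'"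
  shows "kfan N (\<lambda>x. f (\<phi> x)) (\<lambda>x. g (\<phi> x)) = kfan N' f g"
proof -
  have "measure N' {y \<in> space N'. e < \<bar>f y - g y\<bar>} = measure N {x \<in> space N. e < \<bar>f (\<phi> x) - g (\<phi> x)\<bar>}" for e
  proof -
    have "measure N' {y \<in> space N'. e < \<bar>f y - g y\<bar>} = measure (distr N N' \<phi>) {y \<in> space N'. e < \<bar>f y - g y\<bar>}"
      using assms(4) by simp
    also have "\<dots> = measure N (\<phi> -` {y \<in> space N'. e < \<bar>f y - g y\<bar>} \<inter> space N)"
      by (rule measure_distr) measurable
    also have "\<phi> -` {y \<in> space N'. e < \<bar>f y - g y\<bar>} \<inter> space N = {x \<in> space N. e < \<bar>f (\<phi> x) - g (\<phi> x)\<bar>}"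
      using measurable_space[OF assms(1)] by auto
    finally show ?thesis .
  qed
  then show ?thesis unfolding kfan_def by simp
qed

lemma kfan_mod_distr:
  assumes "\<phi> \<in> measurable N N'" "f \<in> borel_measurable N'" "g \<in> borel_measurable N'" "distr N N' \<phi> = N'"
  shows "kfan_mod N (\<lambda>x. f (\<phi> x)) (\<lambda>x. g (\<phi> x)) = kfan_mod N' f g"
proof -
  have "kfan N (\<lambda>x. f (\<phi> x)) (\<lambda>x. g (\<phi> x) + c) = kfan N' f (\<lambda>x. g x + c)" for c
    by (rule kfan_distr[OF assms(1,2) _ assms(4)]) (use assms(3) in measurable)
  then show ?thesis unfolding kfan_mod_def by simp
qed

section \<open>The metric space of Lipschitz functions modulo constants\<close>

lemma emm_spaceD:
  assumes "emm_space X"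
  shows "polish_prob (emm_top X) (emm_measure X)" "space (emm_measure X) = emm_carrier X"
    "prob_space (emm_completion X)" "prob_space (emm_measure X)"
    "extended_distance (emm_carrier X) (emm_dist X)"
    "sets (emm_measure X) = sets (borel_of (emm_top X))"
proof -
  show P: "polish_prob (emm_top X) (emm_measure X)"
    using assms by (auto simp: emm_space_def polish_prob_def)
  show "space (emm_measure X) = emm_carrier X" "prob_space (emm_completion X)" "prob_space (emm_measure X)"
    "sets (emm_measure X) = sets (borel_of (emm_top X))"
    using polish_probD[OF P] by auto
  show "extended_distance (emm_carrier X) (emm_dist X)"
    using assms by (simp add: emm_space_def)
qed

abbreviation L1_class :: "'a emm \<Rightarrow> ('a \<Rightarrow> real) \<Rightarrow> ('a \<Rightarrow> real) set" where
  "L1_class X f \<equiv> L0_rel X `` {f}"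

lemma ky_fan_eq_kfan: "emm_space X \<Longrightarrow> ky_fan X f g = kfan (emm_completion X) f g"
  unfolding ky_fan_def kfan_def by (simp add: emm_spaceD(2))

lemma equiv_L0_rel:
  assumes "emm_space X"
  shows "equiv (L0 X) (L0_rel X)"
proof (rule equivI)
  show "L0_rel X \<subseteq> L0 X \<times> L0 X" by (auto simp: L0_rel_def)
  show "refl_on (L0 X) (L0_rel X)"
    by (auto simp: refl_on_def L0_rel_def intro!: exI[of _ 0])
  show "sym (L0_rel X)"
  proof (rule symI)
    fix f g assume "(f, g) \<in> L0_rel X"
    then obtain c where fg: "f \<in> L0 X" "g \<in> L0 X" and c: "AE x in emm_completion X. f x = g x + c"
      by (auto simp: L0_rel_def)
    have "AE x in emm_completion X. g x = f x + (- c)"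
      using c by eventually_elim simp
    then show "(g, f) \<in> L0_rel X" using fg by (auto simp: L0_rel_def)
  qed
  show "trans (L0_rel X)"
  proof (rule transI)
    fix f g h assume "(f, g) \<in> L0_rel X" "(g, h) \<in> L0_rel X"
    then obtain c d where fgh: "f \<in> L0 X" "g \<in> L0 X" "h \<in> L0 X"
      and cd: "AE x in emm_completion X. f x = g x + c" "AE x in emm_completion X. g x = h x + d"
      by (auto simp: L0_rel_def)
    have "AE x in emm_completion X. f x = h x + (d + c)"
      using cd by eventually_elim simp
    then show "(f, h) \<in> L0_rel X" using fgh by (auto simp: L0_rel_def)
  qed
qed

text \<open>Members of the two classes differ from \<open>f\<close> and \<open>g\<close> by
  constants and on null sets, and a common shift changes nothing. So the infimum over pairs of
  members collapses to one over a single constant.\<close>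

lemma L0_quotient_dist_class:
  assumes X: "emm_space X" and f: "f \<in> L0 X" and g: "g \<in> L0 X"
  shows "L0_quotient_dist X (L1_class X f) (L1_class X g) = kfan_mod (emm_completion X) f g"
proof -
  let ?N = "emm_completion X"
  interpret prob_space ?N using emm_spaceD[OF X] by simp
  have fm[measurable]: "f \<in> borel_measurable ?N" "g \<in> borel_measurable ?N" using f g by (simp_all add: L0_def)
  have "(\<lambda>(f, g). ky_fan X f g) ` (L1_class X f \<times> L1_class X g) = range (\<lambda>c. kfan ?N f (\<lambda>x. g x + c))"
  proof (intro set_eqI iffI)
    fix r assume "r \<in> (\<lambda>(f, g). ky_fan X f g) ` (L1_class X f \<times> L1_class X g)"
    then obtain f' g' where r: "r = kfan ?N f' g'" "(f, f') \<in> L0_rel X" "(g, g') \<in> L0_rel X"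
      using ky_fan_eq_kfan[OF X] by auto
    then obtain c d where cd: "AE x in ?N. f x = f' x + c" "AE x in ?N. g x = g' x + d"
      and [measurable]: "f' \<in> borel_measurable ?N" "g' \<in> borel_measurable ?N"
      by (auto simp: L0_rel_def L0_def)
    have "kfan ?N f' g' = kfan ?N (\<lambda>x. f x + (- c)) (\<lambda>x. g x + (- d))"
    proof (rule kfan_cong_AE)
      show "AE x in ?N. f' x = f x + (- c)" using cd(1) by eventually_elim simp
      show "AE x in ?N. g' x = g x + (- d)" using cd(2) by eventually_elim simp
    qed measurable
    also have "\<dots> = kfan ?N (\<lambda>x. f x + (- c)) (\<lambda>x. (g x + (c - d)) + (- c))"
      by (simp add: algebra_simps)
    also have "\<dots> = kfan ?N f (\<lambda>x. g x + (c - d))"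
      by (rule kfan_shift)
    finally show "r \<in> range (\<lambda>c. kfan ?N f (\<lambda>x. g x + c))" using r(1) by simp
  next
    fix r assume "r \<in> range (\<lambda>c. kfan ?N f (\<lambda>x. g x + c))"
    then obtain c where r: "r = kfan ?N f (\<lambda>x. g x + c)" by blast
    have "(f, f) \<in> L0_rel X"
      using f by (auto simp: L0_rel_def intro!: exI[of _ 0])
    moreover have "(g, \<lambda>x. g x + c) \<in> L0_rel X"
      using g unfolding L0_rel_def by (auto simp: L0_def intro!: exI[of _ "- c"])
    ultimately show "r \<in> (\<lambda>(f, g). ky_fan X f g) ` (L1_class X f \<times> L1_class X g)"
      using r ky_fan_eq_kfan[OF X] by (intro image_eqI[of _ _ "(f, \<lambda>x. g x + c)"]) auto
  qed
  moreover have "L1_class X f \<in> L0 X // L0_rel X" "L1_class X g \<in> L0 X // L0_rel X"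
    using f g by (auto intro: quotientI)
  ultimately show ?thesis
    unfolding L0_quotient_dist_def kfan_mod_def by simp
qed

lemma L1_class_eq_iff:
  assumes X: "emm_space X" and f: "f \<in> L0 X" and g: "g \<in> L0 X"
  shows "L1_class X f = L1_class X g \<longleftrightarrow> (\<exists>c. AE x in emm_completion X. f x = g x + c)"
  using eq_equiv_class_iff[OF equiv_L0_rel[OF X] f g] f g by (simp add: L0_rel_def)

lemma Metric_space_L0_quotient:
  assumes X: "emm_space X"
  shows "Metric_space (L0 X // L0_rel X) (L0_quotient_dist X)"
proof
  let ?N = "emm_completion X" and ?Q = "L0 X // L0_rel X"
  interpret prob_space ?N using emm_spaceD[OF X] by simp
  have rep: "\<exists>f\<in>L0 X. F = L1_class X f" if "F \<in> ?Q" for F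
    using that by (auto elim: quotientE)
  show "0 \<le> L0_quotient_dist X F G" for F G
  proof (cases "F \<in> ?Q \<and> G \<in> ?Q")
    case True
    then obtain f g where "f \<in> L0 X" "F = L1_class X f" "g \<in> L0 X" "G = L1_class X g" using rep by metis
    then show ?thesis using L0_quotient_dist_class[OF X] kfan_mod_nonneg by simp
  qed (auto simp: L0_quotient_dist_def)
  show "L0_quotient_dist X F G = L0_quotient_dist X G F" for F G
  proof (cases "F \<in> ?Q \<and> G \<in> ?Q")
    case True
    then obtain f g where "f \<in> L0 X" "F = L1_class X f" "g \<in> L0 X" "G = L1_class X g" using rep by metis
    then show ?thesis using L0_quotient_dist_class[OF X] kfan_mod_sym by simp
  qed (auto simp: L0_quotient_dist_def)
  show "(L0_quotient_dist X F G = 0) = (F = G)" if "F \<in> ?Q" "G \<in> ?Q" for F G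
  proof -
    obtain f g where fg: "f \<in> L0 X" "F = L1_class X f" "g \<in> L0 X" "G = L1_class X g" using rep \<open>F \<in> ?Q\<close> \<open>G \<in> ?Q\<close> by metis
    show ?thesis
    proof
      assume "L0_quotient_dist X F G = 0"
      then have "kfan_mod ?N f g = 0" using fg L0_quotient_dist_class[OF X] by simp
      then have "\<exists>c. AE x in ?N. f x = g x + c"
        using fg(1,3) by (intro kfan_mod_zero_imp) (auto simp: L0_def)
      then show "F = G" using L1_class_eq_iff[OF X fg(1,3)] fg by simp
    next
      assume "F = G"
      then have "L0_quotient_dist X F G = kfan_mod ?N f f"
        using fg L0_quotient_dist_class[OF X fg(1) fg(1)] by simp
      then show "L0_quotient_dist X F G = 0"
        using kfan_mod_le0[of f f] kfan_mod_nonneg[of f f] kfan_self[of f] by linarith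
    qed
  qed
  show "L0_quotient_dist X F H \<le> L0_quotient_dist X F G + L0_quotient_dist X G H"
    if FGH: "F \<in> ?Q" "G \<in> ?Q" "H \<in> ?Q" for F G H
  proof -
    obtain f where f: "f \<in> L0 X" "F = L1_class X f" using rep FGH(1) by blast
    obtain g where g: "g \<in> L0 X" "G = L1_class X g" using rep FGH(2) by blast
    obtain h where h: "h \<in> L0 X" "H = L1_class X h" using rep FGH(3) by blast
    have "kfan_mod ?N f h \<le> kfan_mod ?N f g + kfan_mod ?N g h"
      using f(1) g(1) h(1) by (intro kfan_mod_triangle) (auto simp: L0_def)
    then show ?thesis using f g h L0_quotient_dist_class[OF X] by simp
  qed
qed

lemma Lip1_subset_L0: "Lip1 X \<subseteq> L0 X"
  by (auto simp: Lip1_def)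

lemma mspace_L1:
  assumes X: "emm_space X"
  shows "mspace (L1 X) = L1_class X ` Lip1 X"
proof -
  interpret Metric_space "L0 X // L0_rel X" "L0_quotient_dist X"
    using Metric_space_L0_quotient[OF X] .
  have "Lip1 X // L0_rel X \<subseteq> L0 X // L0_rel X"
    using Lip1_subset_L0[of X] by (auto simp: quotient_def)
  then have "mspace (L1 X) = Lip1 X // L0_rel X"
    by (auto simp: L1_def L0_quotient_def)
  then show ?thesis by (auto simp: quotient_def)
qed

lemma mdist_L1:
  assumes X: "emm_space X" and "f \<in> L0 X" "g \<in> L0 X"
  shows "mdist (L1 X) (L1_class X f) (L1_class X g) = kfan_mod (emm_completion X) f g"
proof -
  interpret Metric_space "L0 X // L0_rel X" "L0_quotient_dist X"
    using Metric_space_L0_quotient[OF X] .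
  show ?thesis
    using L0_quotient_dist_class[OF assms] by (simp add: L1_def L0_quotient_def)
qed

text \<open>Trades a measurable set of measure 1 for any set that contains almost every point;
  countably many such sets are then intersected by reasoning with \<open>AE\<close>.\<close>

lemma Lip1_iff:
  assumes X: "emm_space X"
  shows "f \<in> Lip1 X \<longleftrightarrow> f \<in> borel_measurable (emm_completion X) \<and>
    (\<exists>E. (AE x in emm_completion X. x \<in> E) \<and> (\<forall>x\<in>E. \<forall>y\<in>E. ennreal \<bar>f x - f y\<bar> \<le> emm_dist X x y))"
    (is "?l \<longleftrightarrow> ?r")
proof
  interpret prob_space "emm_completion X" using emm_spaceD[OF X] by simp
  show ?r if ?l
    using that AE_of_full_set unfolding Lip1_def L0_def by blast
  show ?l if ?r
  proof -
    from conjunct2[OF that] obtain E where "(AE x in emm_completion X. x \<in> E) \<and>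
        (\<forall>x\<in>E. \<forall>y\<in>E. ennreal \<bar>f x - f y\<bar> \<le> emm_dist X x y)" ..
    then have E: "AE x in emm_completion X. x \<in> E" "\<forall>x\<in>E. \<forall>y\<in>E. ennreal \<bar>f x - f y\<bar> \<le> emm_dist X x y"
      by simp_all
    obtain E' where E': "E' \<in> sets (emm_completion X)" "emeasure (emm_completion X) E' = 1"
      "\<forall>x\<in>E'. x \<in> space (emm_completion X) \<and> x \<in> E"
      using full_set_of_AE[OF E(1)] by blast
    have "\<forall>x\<in>E'. \<forall>y\<in>E'. ennreal \<bar>f x - f y\<bar> \<le> emm_dist X x y"
      using E(2) E'(3) by simp
    then show ?thesis
      unfolding Lip1_def L0_def mem_Collect_eq using conjunct1[OF that] E'(1,2) by (intro conjI bexI[of _ E'])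
  qed
qed

text \<open>The shifts \<open>c n\<close> cancel in increments, so the Lipschitz bound passes to the
  limit on the intersection of all the full sets.\<close>

lemma Lip1_AE_limit:
  assumes X: "emm_space X" and f: "\<And>n. f n \<in> Lip1 X" and g: "g \<in> borel_measurable (emm_completion X)"
    and lim: "AE x in emm_completion X. (\<lambda>n. f n x + c n) \<longlonglongrightarrow> g x"
  shows "g \<in> Lip1 X"
proof -
  have "\<forall>n. \<exists>E. (AE x in emm_completion X. x \<in> E) \<and> (\<forall>x\<in>E. \<forall>y\<in>E. ennreal \<bar>f n x - f n y\<bar> \<le> emm_dist X x y)"
    using f unfolding Lip1_iff[OF X] by blast
  from choice[OF this] obtain E where E: "\<And>n. AE x in emm_completion X. x \<in> E n"
    "\<And>n x y. x \<in> E n \<Longrightarrow> y \<in> E n \<Longrightarrow> ennreal \<bar>f n x - f n y\<bar> \<le> emm_dist X x y" by blast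
  define Z where "Z = {x. (\<lambda>n. f n x + c n) \<longlonglongrightarrow> g x \<and> (\<forall>n. x \<in> E n)}"
  have "AE x in emm_completion X. \<forall>n. x \<in> E n"
    using E(1) by (simp add: AE_all_countable)
  then have "AE x in emm_completion X. x \<in> Z"
    using lim by eventually_elim (simp add: Z_def)
  moreover have "ennreal \<bar>g x - g y\<bar> \<le> emm_dist X x y" if "x \<in> Z" "y \<in> Z" for x y
  proof (rule LIMSEQ_le_const2)
    have "(\<lambda>n. \<bar>(f n x + c n) - (f n y + c n)\<bar>) \<longlonglongrightarrow> \<bar>g x - g y\<bar>"
      using that by (intro tendsto_intros) (auto simp: Z_def)
    then have "(\<lambda>n. \<bar>f n x - f n y\<bar>) \<longlonglongrightarrow> \<bar>g x - g y\<bar>" by simp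
    then show "(\<lambda>n. ennreal \<bar>f n x - f n y\<bar>) \<longlonglongrightarrow> ennreal \<bar>g x - g y\<bar>"
      by (rule tendsto_ennrealI)
    show "\<exists>N. \<forall>n\<ge>N. ennreal \<bar>f n x - f n y\<bar> \<le> emm_dist X x y"
      using that E(2) by (auto simp: Z_def)
  qed
  ultimately show ?thesis
    unfolding Lip1_iff[OF X] using g by (intro conjI exI[of _ Z]) auto
qed

text \<open>A fast subsequence of representatives converges almost everywhere after shifts by
  constants, and the limit is again Lipschitz. Hence compactness of \<open>L1 X\<close> amounts to
  total boundedness.\<close>

lemma L1_mcomplete:
  assumes X: "emm_space X"
  shows "mcomplete_of (L1 X)"
proof -
  let ?N = "emm_completion X"
  interpret prob_space ?N using emm_spaceD[OF X] by simp
  interpret L: Metric_space "mspace (L1 X)" "mdist (L1 X)" by simp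
  have "L.mcomplete"
    unfolding L.mcomplete_def
  proof (intro allI impI)
    fix \<sigma> assume \<sigma>: "L.MCauchy \<sigma>"
    have "\<sigma> n \<in> mspace (L1 X)" for n using \<sigma> unfolding L.MCauchy_def by blast
    then have "\<forall>n. \<exists>f. f \<in> Lip1 X \<and> \<sigma> n = L1_class X f"
      unfolding mspace_L1[OF X] by blast
    from choice[OF this] obtain f where f: "\<And>n. f n \<in> Lip1 X" "\<And>n. \<sigma> n = L1_class X (f n)" by blast
    have fL0: "f n \<in> L0 X" for n using f(1) Lip1_subset_L0 by blast
    have fm: "f n \<in> borel_measurable ?N" for n using fL0 by (simp add: L0_def)
    have dist: "mdist (L1 X) (\<sigma> i) (\<sigma> j) = kfan_mod ?N (f i) (f j)" for i j
      unfolding f(2) by (rule mdist_L1[OF X fL0 fL0])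
    have "\<forall>k. \<exists>N. \<forall>i\<ge>N. \<forall>j\<ge>N. kfan_mod ?N (f i) (f j) < (1/2) ^ k"
    proof
      fix k
      have "0 < (1/2::real) ^ k" by simp
      from \<sigma>[unfolded L.MCauchy_def, THEN conjunct2, rule_format, OF this]
      obtain N where "\<forall>n n'. N \<le> n \<longrightarrow> N \<le> n' \<longrightarrow> mdist (L1 X) (\<sigma> n) (\<sigma> n') < (1/2) ^ k" ..
      then show "\<exists>N. \<forall>i\<ge>N. \<forall>j\<ge>N. kfan_mod ?N (f i) (f j) < (1/2) ^ k"
        unfolding dist by (intro exI[of _ N]) simp
    qed
    from choice[OF this] obtain R where R: "\<And>k i j. R k \<le> i \<Longrightarrow> R k \<le> j \<Longrightarrow> kfan_mod ?N (f i) (f j) < (1/2) ^ k" by blast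
    \<comment> \<open>The sum dominates every \<open>R k\<close>, and the summand \<open>k\<close>
      makes \<open>r\<close> strictly increasing.\<close>
    define r where "r k = (\<Sum>j\<le>k. R j) + k" for k
    have rS: "r k < r (Suc k)" for k by (simp add: r_def)
    have rm: "strict_mono r" using rS by (rule strict_monoI_Suc)
    have rR: "R k \<le> r k" for k
      unfolding r_def using member_le_sum[of k "{..k}" R] by simp
    have "kfan_mod ?N (f (r k)) (f (r (Suc k))) < (1/2) ^ k" for k
      using R[OF rR[of k], of "r (Suc k)"] rR[of k] rS[of k] by linarith
    from kfan_mod_cauchy_AE_convergent[OF fm this]
    obtain c g where g: "g \<in> borel_measurable ?N" "AE x in ?N. (\<lambda>k. f (r k) x + c k) \<longlonglongrightarrow> g x" by blast
    have gL: "g \<in> Lip1 X"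
      by (rule Lip1_AE_limit[OF X _ g]) (rule f(1))
    have lim0: "(\<lambda>k. kfan ?N (\<lambda>x. f (r k) x + c k) g) \<longlonglongrightarrow> 0"
      by (rule kfan_tendsto_zero[OF _ g]) (use fm in measurable)
    have le: "kfan_mod ?N g (f (r k)) \<le> kfan ?N (\<lambda>x. f (r k) x + c k) g" for k
      using kfan_mod_le[of g "f (r k)" "c k"] kfan_sym[of g] by simp
    have "(\<lambda>k. kfan_mod ?N g (f (r k))) \<longlonglongrightarrow> 0"
      by (rule tendsto_sandwich[OF _ _ tendsto_const lim0]) (simp_all add: kfan_mod_nonneg le)
    then have "limitin L.mtopology (\<sigma> \<circ> r) (L1_class X g) sequentially"
      unfolding L.limitin_metric_dist_null
      using gL f mdist_L1[OF X fL0 subsetD[OF Lip1_subset_L0 gL]] kfan_mod_sym[of g]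
      by (simp add: mspace_L1[OF X])
    from L.MCauchy_convergent_subsequence[OF \<sigma> rm this]
    show "\<exists>x. limitin L.mtopology \<sigma> x sequentially" ..
  qed
  then show ?thesis by (simp add: mcomplete_of_def)
qed

section \<open>Domination and isomorphism\<close>

lemma separable_metrizable_second_countable:
  assumes "metrizable_space T" "separable_space T"
  shows "second_countable T"
proof -
  obtain S d where "Metric_space S d" and T: "T = Metric_space.mtopology S d"
    using assms(1) unfolding metrizable_space_def by blast
  then interpret S: Metric_space S d by simp
  show ?thesis
  proof (cases "S = {}")
    case True
    then have "topspace T = {}" unfolding T S.topspace_mtopology .
    then have "T = discrete_topology {}" by (simp add: null_topspace_iff_trivial)
    then show ?thesis
      by (simp only: second_countable_discrete_topology countable_empty)
  next
    case False
    have "separable_space (mtopology_of S.Self)"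
      using assms(2) T by (simp add: mtopology_of_def)
    moreover have "mspace S.Self \<noteq> {}" using False by simp
    ultimately have "\<exists>q::nat\<Rightarrow>'a. range q \<subseteq> S \<and> (\<forall>x e. x \<in> S \<longrightarrow> 0 < e \<longrightarrow> (\<exists>n. d x (q n) < e))"
      by (rule separable_metric_dense_sequence) (simp, blast)
    then obtain q :: "nat \<Rightarrow> 'a" where q: "\<And>n. q n \<in> S" "\<And>x e. x \<in> S \<Longrightarrow> 0 < e \<Longrightarrow> \<exists>n. d x (q n) < e"
      by blast
    define \<B> where "\<B> = (\<lambda>(n, k). S.mball (q n) (1 / real (Suc k))) ` UNIV"
    have "\<exists>B\<in>\<B>. x \<in> B \<and> B \<subseteq> U" if U: "openin T U" "x \<in> U" for U x
    proof -
      have xS: "x \<in> S" using openin_subset[OF U(1)] U(2) T by auto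
      obtain r where r: "r > 0" "S.mball x r \<subseteq> U"
        using U(1)[unfolded T S.openin_mtopology, THEN conjunct2, rule_format, OF U(2)] by blast
      obtain k :: nat where k: "1 / real (Suc k) < r / 2" using nat_approx_posE[of "r / 2"] r(1) by auto
      obtain n where n: "d x (q n) < 1 / real (Suc k)" using q(2)[OF xS, of "1 / real (Suc k)"] by auto
      have "S.mball (q n) (1 / real (Suc k)) \<subseteq> S.mball x r"
        by (rule S.mball_subset) (use n k xS q(1) S.commute in auto)
      moreover have "x \<in> S.mball (q n) (1 / real (Suc k))"
        using n xS q(1) by (simp add: S.commute)
      ultimately show ?thesis
        using r(2) unfolding \<B>_def by (intro bexI[of _ "S.mball (q n) (1 / real (Suc k))"]) auto
    qed
    moreover have "openin T B" if "B \<in> \<B>" for B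
      using that T by (auto simp: \<B>_def)
    moreover have "countable \<B>" unfolding \<B>_def by simp
    ultimately show ?thesis
      unfolding second_countable_def by (intro exI[of _ \<B>] conjI ballI allI impI) simp_all
  qed
qed

lemma emm_space_second_countable:
  assumes "emm_space X"
  shows "second_countable (emm_top X)" "Hausdorff_space (emm_top X)"
proof -
  have "metrizable_space (emm_top X)" "separable_space (emm_top X)"
    using assms completely_metrizable_imp_metrizable_space by (auto simp: emm_space_def)
  then show "second_countable (emm_top X)" "Hausdorff_space (emm_top X)"
    using separable_metrizable_second_countable metrizable_imp_Hausdorff_space by auto
qed

text \<open>A witness for \<open>\<prec>\<^sub>L\<close> with its full set in \<open>AE\<close>
  form; composition and pullback are properties of the map, not of the relation.\<close>

definition dom_map :: "'a emm \<Rightarrow> 'b emm \<Rightarrow> ('a \<Rightarrow> 'b) \<Rightarrow> bool" where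
  "dom_map X Y \<phi> \<longleftrightarrow> \<phi> \<in> measurable (emm_completion X) (emm_measure Y) \<and>
     distr (emm_completion X) (emm_measure Y) \<phi> = emm_measure Y \<and>
     (\<exists>E. (AE x in emm_completion X. x \<in> E) \<and>
        (\<forall>x\<in>E. \<forall>y\<in>E. emm_dist Y (\<phi> x) (\<phi> y) \<le> emm_dist X x y))"

lemma full_set_iff:
  assumes "prob_space N"
  shows "(\<exists>E\<in>sets N. emeasure N E = 1 \<and> (\<forall>x\<in>E. \<forall>y\<in>E. R x y)) \<longleftrightarrow> (\<exists>E. (AE x in N. x \<in> E) \<and> (\<forall>x\<in>E. \<forall>y\<in>E. R x y))"
    (is "?l \<longleftrightarrow> ?r")
proof
  interpret prob_space N by fact
  show ?r if ?l
  proof -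
    from that obtain E where "E \<in> sets N" "emeasure N E = 1 \<and> (\<forall>x\<in>E. \<forall>y\<in>E. R x y)" ..
    then show ?thesis using AE_of_full_set[of E] by (intro exI[of _ E]) simp
  qed
  show ?l if ?r
  proof -
    from that obtain E where E: "(AE x in N. x \<in> E) \<and> (\<forall>x\<in>E. \<forall>y\<in>E. R x y)" ..
    from full_set_of_AE[OF conjunct1[OF E]] obtain E' where E': "E' \<in> sets N"
      "emeasure N E' = 1 \<and> (\<forall>x\<in>E'. x \<in> space N \<and> x \<in> E)" ..
    then show ?thesis using E by (intro bexI[of _ E']) simp_all
  qed
qed

lemma dominated_iff:
  assumes "emm_space X"
  shows "Y \<prec>\<^sub>L X \<longleftrightarrow> (\<exists>\<phi>. dom_map X Y \<phi>)"
  by (simp only: dominated_def dom_map_def full_set_iff[OF emm_spaceD(3)[OF assms]]) (simp only: Bex_def)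

lemma emm_iso_iff:
  assumes "emm_space X"
  shows "emm_iso X Y \<longleftrightarrow> (\<exists>F. F \<in> measurable (emm_completion X) (emm_measure Y) \<and>
     distr (emm_completion X) (emm_measure Y) F = emm_measure Y \<and>
     (\<exists>A. (AE x in emm_completion X. x \<in> A) \<and> (\<forall>x\<in>A. \<forall>y\<in>A. emm_dist Y (F x) (F y) = emm_dist X x y)))"
  by (simp only: emm_iso_def full_set_iff[OF emm_spaceD(3)[OF assms]]) (simp only: Bex_def)

text \<open>Composing maps that are measurable up to null sets requires preimages of null sets to be
  null, which preservation of the measure supplies.\<close>

lemma measure_preserving_completion:
  assumes \<phi>: "\<phi> \<in> measurable (completion M) N" and d: "distr (completion M) N \<phi> = N"
  shows "\<phi> \<in> measurable (completion M) (completion N)" "distr (completion M) (completion N) \<phi> = completion N"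
proof -
  show "\<phi> \<in> measurable (completion M) (completion N)"
    by (rule completion.measurable_completion2[OF \<phi>]) (simp add: d)
  show "distr (completion M) (completion N) \<phi> = completion N"
    using completion.completion_distr_eq[OF \<phi>] d by simp
qed

lemma measure_preserving_AE:
  assumes \<phi>: "\<phi> \<in> measurable (completion M) N" "distr (completion M) N \<phi> = N"
    and "AE y in completion N. P y"
  shows "AE x in completion M. P (\<phi> x)"
proof (rule AE_distrD[where f = \<phi> and M' = "completion N" and P = P])
  show "\<phi> \<in> measurable (completion M) (completion N)" by (rule measure_preserving_completion[OF \<phi>])
  show "AE y in distr (completion M) (completion N) \<phi>. P y"
    unfolding measure_preserving_completion(2)[OF \<phi>] by fact
qed

lemma dom_mapD:
  assumes "dom_map X Y \<phi>"
  shows "\<phi> \<in> measurable (emm_completion X) (emm_measure Y)"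
    "distr (emm_completion X) (emm_measure Y) \<phi> = emm_measure Y"
    "\<exists>E. (AE x in emm_completion X. x \<in> E) \<and> (\<forall>x\<in>E. \<forall>y\<in>E. emm_dist Y (\<phi> x) (\<phi> y) \<le> emm_dist X x y)"
  using assms unfolding dom_map_def by simp_all

lemma dom_map_comp:
  assumes \<phi>: "dom_map X Y \<phi>" and \<psi>: "dom_map Y Z \<psi>"
  shows "dom_map X Z (\<lambda>x. \<psi> (\<phi> x))"
proof -
  note f = dom_mapD(1,2)[OF \<phi>] and g = dom_mapD(1,2)[OF \<psi>]
  note f' = measure_preserving_completion[OF f]
  from dom_mapD(3)[OF \<phi>] obtain E where E: "(AE x in emm_completion X. x \<in> E) \<and>
    (\<forall>x\<in>E. \<forall>y\<in>E. emm_dist Y (\<phi> x) (\<phi> y) \<le> emm_dist X x y)" ..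
  from dom_mapD(3)[OF \<psi>] obtain D where D: "(AE x in emm_completion Y. x \<in> D) \<and>
    (\<forall>x\<in>D. \<forall>y\<in>D. emm_dist Z (\<psi> x) (\<psi> y) \<le> emm_dist Y x y)" ..
  have "(\<lambda>x. \<psi> (\<phi> x)) \<in> measurable (emm_completion X) (emm_measure Z)"
    using measurable_compose[OF f'(1) g(1)] .
  moreover have "distr (emm_completion X) (emm_measure Z) (\<lambda>x. \<psi> (\<phi> x)) = emm_measure Z"
    using distr_distr[OF g(1) f'(1)] g(2) unfolding f'(2) by (simp add: comp_def)
  moreover have "AE x in emm_completion X. x \<in> {x \<in> E. \<phi> x \<in> D}"
    using conjunct1[OF E] measure_preserving_AE[OF f conjunct1[OF D]] by eventually_elim simp
  moreover have "\<forall>x\<in>{x \<in> E. \<phi> x \<in> D}. \<forall>y\<in>{x \<in> E. \<phi> x \<in> D}. emm_dist Z (\<psi> (\<phi> x)) (\<psi> (\<phi> y)) \<le> emm_dist X x y"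
  proof (intro ballI)
    fix x y assume xy: "x \<in> {x \<in> E. \<phi> x \<in> D}" "y \<in> {x \<in> E. \<phi> x \<in> D}"
    have "emm_dist Z (\<psi> (\<phi> x)) (\<psi> (\<phi> y)) \<le> emm_dist Y (\<phi> x) (\<phi> y)"
      using conjunct2[OF D] xy by simp
    also have "\<dots> \<le> emm_dist X x y" using conjunct2[OF E] xy by simp
    finally show "emm_dist Z (\<psi> (\<phi> x)) (\<psi> (\<phi> y)) \<le> emm_dist X x y" .
  qed
  ultimately show ?thesis unfolding dom_map_def by (intro conjI exI[of _ "{x \<in> E. \<phi> x \<in> D}"])
qed

lemma dominated_trans:
  assumes "emm_space X" "emm_space Y" "Z \<prec>\<^sub>L Y" "Y \<prec>\<^sub>L X"
  shows "Z \<prec>\<^sub>L X"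
proof -
  obtain \<phi> where \<phi>: "dom_map X Y \<phi>" using assms(4) dominated_iff[OF assms(1)] by blast
  obtain \<psi> where \<psi>: "dom_map Y Z \<psi>" using assms(3) dominated_iff[OF assms(2)] by blast
  show ?thesis unfolding dominated_iff[OF assms(1)] by (rule exI[of _ "\<lambda>x. \<psi> (\<phi> x)"], rule dom_map_comp[OF \<phi> \<psi>])
qed

text \<open>Makes \<open>L1\<close> contravariant under domination; together with
  \<open>kfan_mod_pullback\<close> the induced map from \<open>L1 Y\<close> to \<open>L1 X\<close>
  is isometric.\<close>

lemma Lip1_pullback:
  assumes X: "emm_space X" and Y: "emm_space Y" and \<phi>: "dom_map X Y \<phi>" and g: "g \<in> Lip1 Y"
  shows "(\<lambda>x. g (\<phi> x)) \<in> Lip1 X"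
proof -
  note f = dom_mapD(1,2)[OF \<phi>]
  from dom_mapD(3)[OF \<phi>] obtain E where E: "(AE x in emm_completion X. x \<in> E) \<and>
    (\<forall>x\<in>E. \<forall>y\<in>E. emm_dist Y (\<phi> x) (\<phi> y) \<le> emm_dist X x y)" ..
  from g[unfolded Lip1_iff[OF Y], THEN conjunct2] obtain D where D: "(AE x in emm_completion Y. x \<in> D) \<and>
    (\<forall>x\<in>D. \<forall>y\<in>D. ennreal \<bar>g x - g y\<bar> \<le> emm_dist Y x y)" ..
  have "(\<lambda>x. g (\<phi> x)) \<in> borel_measurable (emm_completion X)"
    using measurable_compose[OF measure_preserving_completion(1)[OF f] g[unfolded Lip1_iff[OF Y], THEN conjunct1]] .
  moreover have "AE x in emm_completion X. x \<in> {x \<in> E. \<phi> x \<in> D}"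
    using conjunct1[OF E] measure_preserving_AE[OF f conjunct1[OF D]] by eventually_elim simp
  moreover have "\<forall>x\<in>{x \<in> E. \<phi> x \<in> D}. \<forall>y\<in>{x \<in> E. \<phi> x \<in> D}. ennreal \<bar>g (\<phi> x) - g (\<phi> y)\<bar> \<le> emm_dist X x y"
  proof (intro ballI)
    fix x y assume xy: "x \<in> {x \<in> E. \<phi> x \<in> D}" "y \<in> {x \<in> E. \<phi> x \<in> D}"
    have "ennreal \<bar>g (\<phi> x) - g (\<phi> y)\<bar> \<le> emm_dist Y (\<phi> x) (\<phi> y)"
      using conjunct2[OF D] xy by simp
    also have "\<dots> \<le> emm_dist X x y" using conjunct2[OF E] xy by simp
    finally show "ennreal \<bar>g (\<phi> x) - g (\<phi> y)\<bar> \<le> emm_dist X x y" .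
  qed
  ultimately show ?thesis unfolding Lip1_iff[OF X] by (intro conjI exI[of _ "{x \<in> E. \<phi> x \<in> D}"])
qed

lemma kfan_mod_pullback:
  assumes "dom_map X Y \<phi>" "f \<in> L0 Y" "g \<in> L0 Y"
  shows "kfan_mod (emm_completion X) (\<lambda>x. f (\<phi> x)) (\<lambda>x. g (\<phi> x)) = kfan_mod (emm_completion Y) f g"
  by (rule kfan_mod_distr[OF measure_preserving_completion(1)[OF dom_mapD(1,2)[OF assms(1)]] _ _
        measure_preserving_completion(2)[OF dom_mapD(1,2)[OF assms(1)]]])
    (use assms(2,3) in \<open>simp_all add: L0_def\<close>)

lemma emm_iso_imp_dominated: "emm_iso X Y \<Longrightarrow> Y \<prec>\<^sub>L X"
  unfolding emm_iso_def dominated_def by (metis order_refl)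

lemma emm_iso_refl:
  assumes "emm_space X" shows "emm_iso X X"
  unfolding emm_iso_iff[OF assms]
proof (intro exI[of _ "\<lambda>x. x"] conjI exI[of _ UNIV])
  show "(\<lambda>x. x) \<in> measurable (emm_completion X) (emm_measure X)"
    by (rule measurable_completion) simp
  show "distr (emm_completion X) (emm_measure X) (\<lambda>x. x) = emm_measure X"
    by (subst distr_completion) (simp_all add: distr_id2)
qed auto

lemma emm_iso_trans:
  assumes X: "emm_space X" and Y: "emm_space Y" and "emm_iso X Y" "emm_iso Y Z"
  shows "emm_iso X Z"
proof -
  from assms(3)[unfolded emm_iso_iff[OF X]] obtain F where F: "F \<in> measurable (emm_completion X) (emm_measure Y) \<and>
     distr (emm_completion X) (emm_measure Y) F = emm_measure Y \<and>
     (\<exists>A. (AE x in emm_completion X. x \<in> A) \<and> (\<forall>x\<in>A. \<forall>y\<in>A. emm_dist Y (F x) (F y) = emm_dist X x y))" ..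
  from assms(4)[unfolded emm_iso_iff[OF Y]] obtain G where G: "G \<in> measurable (emm_completion Y) (emm_measure Z) \<and>
     distr (emm_completion Y) (emm_measure Z) G = emm_measure Z \<and>
     (\<exists>A. (AE x in emm_completion Y. x \<in> A) \<and> (\<forall>x\<in>A. \<forall>y\<in>A. emm_dist Z (G x) (G y) = emm_dist Y x y))" ..
  from F obtain A where A: "(AE x in emm_completion X. x \<in> A)" "\<forall>x\<in>A. \<forall>y\<in>A. emm_dist Y (F x) (F y) = emm_dist X x y"
    by (elim conjE exE)
  from G obtain B where B: "(AE x in emm_completion Y. x \<in> B)" "\<forall>x\<in>B. \<forall>y\<in>B. emm_dist Z (G x) (G y) = emm_dist Y x y"
    by (elim conjE exE)
  have f: "F \<in> measurable (emm_completion X) (emm_measure Y)" "distr (emm_completion X) (emm_measure Y) F = emm_measure Y"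
    and g: "G \<in> measurable (emm_completion Y) (emm_measure Z)" "distr (emm_completion Y) (emm_measure Z) G = emm_measure Z"
    using F G by simp_all
  note f' = measure_preserving_completion[OF f]
  show ?thesis
    unfolding emm_iso_iff[OF X]
  proof (intro exI[of _ "\<lambda>x. G (F x)"] conjI exI[of _ "{x \<in> A. F x \<in> B}"])
    show "(\<lambda>x. G (F x)) \<in> measurable (emm_completion X) (emm_measure Z)"
      using measurable_compose[OF f'(1) g(1)] .
    show "distr (emm_completion X) (emm_measure Z) (\<lambda>x. G (F x)) = emm_measure Z"
      using distr_distr[OF g(1) f'(1)] g(2) unfolding f'(2) by (simp add: comp_def)
    show "AE x in emm_completion X. x \<in> {x \<in> A. F x \<in> B}"
      using A(1) measure_preserving_AE[OF f B(1)] by eventually_elim simp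
    show "\<forall>x\<in>{x \<in> A. F x \<in> B}. \<forall>y\<in>{x \<in> A. F x \<in> B}. emm_dist Z (G (F x)) (G (F y)) = emm_dist X x y"
      using A(2) B(2) by simp
  qed
qed

lemma extended_distance_zero:
  assumes "emm_space X" "x \<in> emm_carrier X" "y \<in> emm_carrier X"
  shows "emm_dist X x y = 0 \<longleftrightarrow> x = y"
  using emm_spaceD(5)[OF assms(1)] assms(2,3) unfolding extended_distance_def by simp

text \<open>Equality of distances makes \<open>F\<close> injective on \<open>A\<close>, because
  \<open>emm_dist\<close> vanishes only on the diagonal. Since \<open>F\<close> is merely
  measurable, its inverse comes from \<open>polish_injection_inverse\<close>; it is defined on a
  Borel set of full measure.\<close>

lemma emm_iso_sym:
  assumes X: "emm_space X" and Y: "emm_space Y" and "emm_iso X Y"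
  shows "emm_iso Y X"
proof -
  interpret prob_space "emm_completion X" using emm_spaceD[OF X] by simp
  interpret Y: prob_space "emm_completion Y" using emm_spaceD[OF Y] by simp
  from assms(3)[unfolded emm_iso_def] obtain F where F: "F \<in> measurable (emm_completion X) (emm_measure Y)"
     and F2: "distr (emm_completion X) (emm_measure Y) F = emm_measure Y \<and>
     (\<exists>A\<in>sets (emm_completion X). emeasure (emm_completion X) A = 1 \<and> (\<forall>x\<in>A. \<forall>y\<in>A. emm_dist Y (F x) (F y) = emm_dist X x y))" ..
  from conjunct2[OF F2] obtain A where A: "A \<in> sets (emm_completion X)" and
     A2: "emeasure (emm_completion X) A = 1 \<and> (\<forall>x\<in>A. \<forall>y\<in>A. emm_dist Y (F x) (F y) = emm_dist X x y)" ..
  have Fd: "distr (emm_completion X) (emm_measure Y) F = emm_measure Y" using F2 by simp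
  have Ad: "emm_dist Y (F x) (F y) = emm_dist X x y" if "x \<in> A" "y \<in> A" for x y using A2 that by simp
  have Ac: "A \<subseteq> emm_carrier X"
    using sets.sets_into_space[OF A] emm_spaceD(2)[OF X] by simp
  have inj: "inj_on F A"
  proof (rule inj_onI)
    fix x y assume xy: "x \<in> A" "y \<in> A" "F x = F y"
    have "F x \<in> emm_carrier Y"
      using measurable_space[OF F, of x] xy(1) Ac emm_spaceD(2)[OF X] emm_spaceD(2)[OF Y] by auto
    then have "emm_dist Y (F x) (F y) = 0"
      using extended_distance_zero[OF Y] xy(3) by simp
    then show "x = y"
      using Ad[OF xy(1,2)] extended_distance_zero[OF X] xy Ac by auto
  qed
  have "F \<in> measurable (emm_completion X) (borel_of (emm_top Y))"
    using F measurable_cong_sets[OF refl emm_spaceD(6)[OF Y]] by blast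
  note Fm = this
  have A1: "measure (emm_completion X) A = 1" using A2 by (simp add: measure_def)
  from polish_injection_inverse[OF emm_spaceD(1)[OF X] emm_space_second_countable(2,1)[OF Y] Fm A A1 inj]
  obtain B where "\<exists>G. B \<in> sets (borel_of (emm_top Y)) \<and> G \<in> measurable (borel_of (emm_top Y)) (emm_measure X) \<and>
    (\<forall>y\<in>B. G y \<in> A \<and> F (G y) = y) \<and> (AE x in emm_completion X. F x \<in> B)" ..
  then obtain G where BG: "B \<in> sets (borel_of (emm_top Y)) \<and> G \<in> measurable (borel_of (emm_top Y)) (emm_measure X) \<and>
    (\<forall>y\<in>B. G y \<in> A \<and> F (G y) = y) \<and> (AE x in emm_completion X. F x \<in> B)" ..
  have B: "B \<in> sets (emm_measure Y)"
    using BG emm_spaceD(6)[OF Y] by simp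
  have G0: "G \<in> measurable (emm_measure Y) (emm_measure X)"
    using BG measurable_cong_sets[OF emm_spaceD(6)[OF Y] refl] by blast
  have GF: "\<And>y. y \<in> B \<Longrightarrow> G y \<in> A" "\<And>y. y \<in> B \<Longrightarrow> F (G y) = y" and AEB: "AE x in emm_completion X. F x \<in> B"
    using BG by simp_all
  have G: "G \<in> measurable (emm_completion Y) (emm_measure X)"
    using G0 by (rule measurable_completion)
  have F': "F \<in> measurable (emm_completion X) (emm_completion Y)"
    and Fd': "distr (emm_completion X) (emm_completion Y) F = emm_completion Y"
    using measure_preserving_completion[OF F Fd] by auto
  have AEid: "AE x in emm_completion X. G (F x) = x"
    using AEB AE_of_full_set[OF A conjunct1[OF A2]]
  proof eventually_elim
    case (elim x)
    show ?case using inj GF[OF elim(1)] elim(2) by (meson inj_onD)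
  qed
  show ?thesis
    unfolding emm_iso_iff[OF Y]
  proof (intro exI[of _ G] conjI exI[of _ B] G)
    have "distr (emm_completion Y) (emm_measure X) G = distr (emm_completion X) (emm_measure X) (G \<circ> F)"
      using distr_distr[OF G F'] Fd' by simp
    also have "\<dots> = distr (emm_completion X) (emm_measure X) (\<lambda>x. x)"
      by (rule distr_cong_AE[OF refl]) (use AEid F' G in \<open>auto intro: measurable_completion\<close>)
    also have "\<dots> = emm_measure X"
      by (subst distr_completion) (simp_all add: distr_id2)
    finally show "distr (emm_completion Y) (emm_measure X) G = emm_measure X" .
    have "AE y in distr (emm_completion X) (emm_completion Y) F. y \<in> B"
      by (subst AE_distr_iff[OF F']) (use B AEB in auto)
    then show "AE y in emm_completion Y. y \<in> B" unfolding Fd' .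
    show "\<forall>x\<in>B. \<forall>y\<in>B. emm_dist X (G x) (G y) = emm_dist Y x y"
      using GF Ad by metis
  qed
qed

section \<open>Generating sequences and equality of laws\<close>

lemma second_countable_euclidean: "second_countable (euclidean :: 'a::second_countable_topology topology)"
proof -
  obtain B :: "'a set set" where B: "countable B" "topological_basis B" using ex_countable_basis by blast
  have "\<exists>V\<in>B. x \<in> V \<and> V \<subseteq> U" if "open U" "x \<in> U" for U x
    by (rule topological_basisE[OF B(2) that]) (rule bexI, rule conjI)
  then show ?thesis
    unfolding second_countable_def using B(1) topological_basis_open[OF B(2)]
    by (intro exI[of _ B] conjI ballI allI impI) simp_all
qed

text \<open>Only the upper bound on the distance is demanded. If every \<open>f n\<close> is in
  \<open>Lip1 X\<close>, the reverse inequality holds on a full set, and then the distance is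
  recovered exactly there.\<close>

definition generating :: "'a emm \<Rightarrow> (nat \<Rightarrow> 'a \<Rightarrow> real) \<Rightarrow> bool" where
  "generating X f \<longleftrightarrow> (\<forall>n. f n \<in> borel_measurable (emm_completion X)) \<and>
     (\<exists>E. (AE x in emm_completion X. x \<in> E) \<and>
        (\<forall>x\<in>E. \<forall>y\<in>E. emm_dist X x y \<le> (SUP n. ennreal \<bar>f n x - f n y\<bar>)))"

text \<open>A generating sequence embeds \<open>X\<close> almost isometrically into the sequence space with the sup distance, and
  the inverse of this embedding turns equality of laws into a domination map.\<close>

lemma dom_map_of_equal_laws:
  assumes X: "emm_space X" and Y: "emm_space Y" and f: "generating X f" and g: "\<And>n. g n \<in> Lip1 Y"
    and law: "distr (emm_completion X) borel (\<lambda>x n. f n x) = distr (emm_completion Y) borel (\<lambda>y n. g n y)"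
  shows "\<exists>\<phi>. dom_map Y X \<phi>"
proof -
  interpret prob_space "emm_completion X" using emm_spaceD[OF X] by simp
  let ?F = "\<lambda>x n. f n x" and ?g = "\<lambda>y n. g n y"
  from f[unfolded generating_def, THEN conjunct2] obtain E where E: "(AE x in emm_completion X. x \<in> E) \<and>
        (\<forall>x\<in>E. \<forall>y\<in>E. emm_dist X x y \<le> (SUP n. ennreal \<bar>f n x - f n y\<bar>))" ..
  from full_set_of_AE[OF conjunct1[OF E]] obtain A where A: "A \<in> sets (emm_completion X)"
      "emeasure (emm_completion X) A = 1 \<and> (\<forall>x\<in>A. x \<in> space (emm_completion X) \<and> x \<in> E)" ..
  have Ad: "emm_dist X x y \<le> (SUP n. ennreal \<bar>f n x - f n y\<bar>)" if "x \<in> A" "y \<in> A" for x y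
    using A(2) E that by simp
  have inj: "inj_on ?F A"
  proof (rule inj_onI)
    fix x y assume xy: "x \<in> A" "y \<in> A" "?F x = ?F y"
    then have "f n x = f n y" for n by metis
    then have "emm_dist X x y \<le> 0" using Ad[OF xy(1,2)] by simp
    then show "x = y"
      using extended_distance_zero[OF X, of x y] A(2) xy emm_spaceD(2)[OF X] by simp
  qed
  have Fb: "?F \<in> measurable (emm_completion X) borel"
    by (rule measurable_coordinatewise_then_product) (use f in \<open>simp add: generating_def\<close>)
  have gb: "?g \<in> measurable (emm_completion Y) borel"
    by (rule measurable_coordinatewise_then_product) (use g Lip1_iff[OF Y] in blast)
  have "?F \<in> measurable (emm_completion X) (borel_of euclidean)"
    using Fb measurable_cong_sets[OF refl sets_borel_of_euclidean] by blast
  note Fm = this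
  have A1: "measure (emm_completion X) A = 1" using A(2) by (simp add: measure_def)
  from polish_injection_inverse[OF emm_spaceD(1)[OF X] Hausdorff_space_euclidean second_countable_euclidean Fm A(1) A1 inj]
  obtain B where "\<exists>G. B \<in> sets (borel_of euclidean) \<and> G \<in> measurable (borel_of euclidean) (emm_measure X) \<and>
    (\<forall>y\<in>B. G y \<in> A \<and> ?F (G y) = y) \<and> (AE x in emm_completion X. ?F x \<in> B)" ..
  then obtain G where BG: "B \<in> sets (borel_of euclidean) \<and> G \<in> measurable (borel_of euclidean) (emm_measure X) \<and>
    (\<forall>y\<in>B. G y \<in> A \<and> ?F (G y) = y) \<and> (AE x in emm_completion X. ?F x \<in> B)" ..
  have B: "B \<in> sets borel"
    using BG sets_borel_of_euclidean by blast
  have G: "G \<in> measurable borel (emm_measure X)"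
    using BG measurable_cong_sets[OF sets_borel_of_euclidean refl] by blast
  have GF: "\<And>y. y \<in> B \<Longrightarrow> G y \<in> A" "\<And>y. y \<in> B \<Longrightarrow> ?F (G y) = y" and AEB: "AE x in emm_completion X. ?F x \<in> B"
    using BG by simp_all
  have AEid: "AE x in emm_completion X. G (?F x) = x"
    using AEB AE_of_full_set[OF A(1) conjunct1[OF A(2)]]
  proof eventually_elim
    case (elim x)
    show ?case using inj GF[OF elim(1)] elim(2) by (meson inj_onD)
  qed
  \<comment> \<open>The set \<open>B\<close> has full measure for the law of \<open>f\<close>, hence
    for the equal law of \<open>g\<close>; so the inverse \<open>G\<close> can be applied to almost
    every value of \<open>g\<close>.\<close>
  have AEg: "AE y in emm_completion Y. ?g y \<in> B"
  proof -
    have "AE z in distr (emm_completion X) borel ?F. z \<in> B"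
      by (subst AE_distr_iff[OF Fb]) (use B AEB in auto)
    then have "AE z in distr (emm_completion Y) borel ?g. z \<in> B" unfolding law .
    then show ?thesis by (rule AE_distrD[OF gb])
  qed
  have "\<forall>n. \<exists>D. (AE y in emm_completion Y. y \<in> D) \<and> (\<forall>x\<in>D. \<forall>y\<in>D. ennreal \<bar>g n x - g n y\<bar> \<le> emm_dist Y x y)"
    using g Lip1_iff[OF Y] by blast
  from choice[OF this] obtain D where D: "\<forall>n. (AE y in emm_completion Y. y \<in> D n) \<and>
      (\<forall>x\<in>D n. \<forall>y\<in>D n. ennreal \<bar>g n x - g n y\<bar> \<le> emm_dist Y x y)" ..
  have AED: "AE y in emm_completion Y. \<forall>n. y \<in> D n"
    using D by (simp add: AE_all_countable)
  let ?Z = "{y. ?g y \<in> B \<and> (\<forall>n. y \<in> D n)}"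
  have "dom_map Y X (\<lambda>y. G (?g y))"
    unfolding dom_map_def
  proof (intro conjI exI[of _ ?Z])
    show "(\<lambda>y. G (?g y)) \<in> measurable (emm_completion Y) (emm_measure X)"
      using measurable_compose[OF gb G] .
    have "distr (emm_completion Y) (emm_measure X) (\<lambda>y. G (?g y)) = distr (distr (emm_completion Y) borel ?g) (emm_measure X) G"
      using distr_distr[OF G gb] by (simp add: comp_def)
    also have "\<dots> = distr (emm_completion X) (emm_measure X) (G \<circ> ?F)"
      unfolding law[symmetric] by (rule distr_distr[OF G Fb])
    also have "\<dots> = distr (emm_completion X) (emm_measure X) (\<lambda>x. x)"
      by (rule distr_cong_AE[OF refl]) (use AEid Fb G in \<open>auto intro: measurable_completion\<close>)
    also have "\<dots> = emm_measure X"
      by (subst distr_completion) (simp_all add: distr_id2)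
    finally show "distr (emm_completion Y) (emm_measure X) (\<lambda>y. G (?g y)) = emm_measure X" .
    show "AE y in emm_completion Y. y \<in> ?Z"
      using AEg AED by eventually_elim simp
    show "\<forall>x\<in>?Z. \<forall>y\<in>?Z. emm_dist X (G (?g x)) (G (?g y)) \<le> emm_dist Y x y"
    proof (intro ballI)
      fix x y assume xy: "x \<in> ?Z" "y \<in> ?Z"
      have eq: "f n (G (?g x)) = g n x" "f n (G (?g y)) = g n y" for n
        using GF(2)[of "?g x"] GF(2)[of "?g y"] xy by (auto dest: fun_cong[of _ _ n])
      have "emm_dist X (G (?g x)) (G (?g y)) \<le> (SUP n. ennreal \<bar>f n (G (?g x)) - f n (G (?g y))\<bar>)"
        using xy GF(1) by (intro Ad) auto
      also have "\<dots> = (SUP n. ennreal \<bar>g n x - g n y\<bar>)"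
        unfolding eq ..
      also have "\<dots> \<le> emm_dist Y x y"
        using xy D by (intro SUP_least) auto
      finally show "emm_dist X (G (?g x)) (G (?g y)) \<le> emm_dist Y x y" .
    qed
  qed
  then show ?thesis by (rule exI[of _ "\<lambda>y. G (?g y)"])
qed

text \<open>Pulling back along the composite is an isometric self-embedding of the compact space \<open>L1 X\<close>, hence onto;
  so every Lipschitz function factors through the composite, which can therefore not shrink any distance.\<close>

lemma mutual_domination_imp_iso:
  assumes X: "emm_space X" and Y: "emm_space Y" and cpt: "compact_space (mtopology_of (L1 X))"
    and gen: "generating X f" and f: "\<And>n. f n \<in> Lip1 X"
    and \<phi>: "dom_map X Y \<phi>" and \<psi>: "dom_map Y X \<psi>"
  shows "emm_iso X Y"
proof -
  define \<theta> where "\<theta> = (\<lambda>x. \<psi> (\<phi> x))"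
  have \<theta>: "dom_map X X \<theta>" unfolding \<theta>_def by (rule dom_map_comp[OF \<phi> \<psi>])
  \<comment> \<open>Pulling back along \<open>\<theta>\<close> acts on functions, so a Lipschitz
    representative is fixed for every class; \<open>T\<close> is the induced map on classes.\<close>
  define rep where "rep F = (SOME f. f \<in> Lip1 X \<and> F = L1_class X f)" for F
  have rep: "rep F \<in> Lip1 X" "L1_class X (rep F) = F" if "F \<in> mspace (L1 X)" for F
  proof -
    have "\<exists>f. f \<in> Lip1 X \<and> F = L1_class X f" using that unfolding mspace_L1[OF X] by auto
    from someI_ex[OF this] show "rep F \<in> Lip1 X" "L1_class X (rep F) = F" unfolding rep_def by auto
  qed
  have L0: "h \<in> Lip1 X \<Longrightarrow> h \<in> L0 X" for h using Lip1_subset_L0 by blast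
  define T where "T F = L1_class X (\<lambda>x. rep F (\<theta> x))" for F
  have "T ` mspace (L1 X) = mspace (L1 X)"
  proof (rule isometric_self_embedding_surj[OF cpt])
    show "T ` mspace (L1 X) \<subseteq> mspace (L1 X)"
    proof (rule image_subsetI)
      fix F assume "F \<in> mspace (L1 X)"
      from Lip1_pullback[OF X X \<theta> rep(1)[OF this]] show "T F \<in> mspace (L1 X)"
        unfolding T_def mspace_L1[OF X] by (rule imageI)
    qed
    fix F G assume FG: "F \<in> mspace (L1 X)" "G \<in> mspace (L1 X)"
    note rF = rep[OF FG(1)] and rG = rep[OF FG(2)]
    have "mdist (L1 X) (T F) (T G) = kfan_mod (emm_completion X) (\<lambda>x. rep F (\<theta> x)) (\<lambda>x. rep G (\<theta> x))"
      unfolding T_def by (rule mdist_L1[OF X]) (use Lip1_pullback[OF X X \<theta>] rF(1) rG(1) L0 in auto)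
    also have "\<dots> = kfan_mod (emm_completion X) (rep F) (rep G)"
      by (rule kfan_mod_pullback[OF \<theta> L0[OF rF(1)] L0[OF rG(1)]])
    also have "\<dots> = mdist (L1 X) (L1_class X (rep F)) (L1_class X (rep G))"
      by (rule mdist_L1[OF X L0[OF rF(1)] L0[OF rG(1)], symmetric])
    finally show "mdist (L1 X) (T F) (T G) = mdist (L1 X) F G" unfolding rF(2) rG(2) .
  qed
  then have surj: "\<exists>F\<in>mspace (L1 X). L1_class X (f n) = T F" for n
    using f mspace_L1[OF X] by (metis (no_types, lifting) imageE imageI)
  have fac: "\<exists>h c. h \<in> Lip1 X \<and> (AE x in emm_completion X. f n x = h (\<theta> x) + c)" for n
  proof -
    from surj[of n] obtain F where F: "F \<in> mspace (L1 X)" "L1_class X (f n) = T F" ..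
    have "\<exists>c. AE x in emm_completion X. f n x = rep F (\<theta> x) + c"
      using F(2) L1_class_eq_iff[OF X L0[OF f[of n]] L0[OF Lip1_pullback[OF X X \<theta> rep(1)[OF F(1)]]]] unfolding T_def by simp
    then obtain c where "AE x in emm_completion X. f n x = rep F (\<theta> x) + c" ..
    then show ?thesis using rep(1)[OF F(1)] by (intro exI[of _ "rep F"] exI[of _ c] conjI)
  qed
  have "\<forall>n. \<exists>Z. (AE x in emm_completion X. x \<in> Z) \<and> (\<forall>x\<in>Z. \<forall>y\<in>Z. ennreal \<bar>f n x - f n y\<bar> \<le> emm_dist X (\<theta> x) (\<theta> y))"
  proof
    fix n
    from fac[of n] obtain h c where h: "h \<in> Lip1 X" "AE x in emm_completion X. f n x = h (\<theta> x) + c" by (elim exE conjE)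
    from h(1)[unfolded Lip1_iff[OF X], THEN conjunct2] obtain D where D: "(AE x in emm_completion X. x \<in> D) \<and>
      (\<forall>x\<in>D. \<forall>y\<in>D. ennreal \<bar>h x - h y\<bar> \<le> emm_dist X x y)" ..
    have "AE x in emm_completion X. x \<in> {x. f n x = h (\<theta> x) + c \<and> \<theta> x \<in> D}"
      using h(2) measure_preserving_AE[OF dom_mapD(1,2)[OF \<theta>] conjunct1[OF D]] by eventually_elim simp
    moreover have "\<forall>x\<in>{x. f n x = h (\<theta> x) + c \<and> \<theta> x \<in> D}. \<forall>y\<in>{x. f n x = h (\<theta> x) + c \<and> \<theta> x \<in> D}.
        ennreal \<bar>f n x - f n y\<bar> \<le> emm_dist X (\<theta> x) (\<theta> y)"
      using D by simp
    ultimately show "\<exists>Z. (AE x in emm_completion X. x \<in> Z) \<and> (\<forall>x\<in>Z. \<forall>y\<in>Z. ennreal \<bar>f n x - f n y\<bar> \<le> emm_dist X (\<theta> x) (\<theta> y))"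
      by (intro exI conjI)
  qed
  from choice[OF this] obtain Z where Z: "\<forall>n. (AE x in emm_completion X. x \<in> Z n) \<and>
      (\<forall>x\<in>Z n. \<forall>y\<in>Z n. ennreal \<bar>f n x - f n y\<bar> \<le> emm_dist X (\<theta> x) (\<theta> y))" ..
  have AEZ: "AE x in emm_completion X. \<forall>n. x \<in> Z n" using Z by (simp add: AE_all_countable)
  from gen[unfolded generating_def, THEN conjunct2] obtain E where E: "(AE x in emm_completion X. x \<in> E) \<and>
        (\<forall>x\<in>E. \<forall>y\<in>E. emm_dist X x y \<le> (SUP n. ennreal \<bar>f n x - f n y\<bar>))" ..
  from dom_mapD(3)[OF \<phi>] obtain A where A: "(AE x in emm_completion X. x \<in> A) \<and>
    (\<forall>x\<in>A. \<forall>y\<in>A. emm_dist Y (\<phi> x) (\<phi> y) \<le> emm_dist X x y)" ..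
  from dom_mapD(3)[OF \<psi>] obtain B where B: "(AE x in emm_completion Y. x \<in> B) \<and>
    (\<forall>x\<in>B. \<forall>y\<in>B. emm_dist X (\<psi> x) (\<psi> y) \<le> emm_dist Y x y)" ..
  let ?W = "{x. (\<forall>n. x \<in> Z n) \<and> x \<in> E \<and> x \<in> A \<and> \<phi> x \<in> B}"
  show ?thesis
    unfolding emm_iso_iff[OF X]
  proof (intro exI[of _ \<phi>] conjI exI[of _ ?W] dom_mapD(1,2)[OF \<phi>])
    show "AE x in emm_completion X. x \<in> ?W"
      using AEZ conjunct1[OF E] conjunct1[OF A] measure_preserving_AE[OF dom_mapD(1,2)[OF \<phi>] conjunct1[OF B]]
      by eventually_elim simp
    show "\<forall>x\<in>?W. \<forall>y\<in>?W. emm_dist Y (\<phi> x) (\<phi> y) = emm_dist X x y"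
    proof (intro ballI antisym)
      fix x y assume xy: "x \<in> ?W" "y \<in> ?W"
      show "emm_dist Y (\<phi> x) (\<phi> y) \<le> emm_dist X x y"
        by (rule conjunct2[OF A, rule_format]) (use xy in simp_all)
      \<comment> \<open>The distance in \<open>X\<close> is bounded by that of the images under
        \<open>\<theta>\<close>, this by the one of the images under \<open>\<phi>\<close>, and that
        by the distance in \<open>X\<close>: the chain closes up to equalities.\<close>
      have "emm_dist X x y \<le> (SUP n. ennreal \<bar>f n x - f n y\<bar>)"
        by (rule conjunct2[OF E, rule_format]) (use xy in simp_all)
      also have "\<dots> \<le> emm_dist X (\<theta> x) (\<theta> y)"
        by (intro SUP_least conjunct2[OF spec[OF Z], rule_format]) (use xy in simp_all)
      also have "\<dots> \<le> emm_dist Y (\<phi> x) (\<phi> y)"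
        unfolding \<theta>_def by (rule conjunct2[OF B, rule_format]) (use xy in simp_all)
      finally show "emm_dist X x y \<le> emm_dist Y (\<phi> x) (\<phi> y)" .
    qed
  qed
qed

section \<open>A countable family of Lipschitz functions determining the distance\<close>

lemma ennreal_abs_diff_le:
  assumes "0 \<le> u" "0 \<le> v" "ennreal u \<le> d + ennreal v" "ennreal v \<le> d + ennreal u"
  shows "ennreal \<bar>u - v\<bar> \<le> d"
proof (cases d)
  case (real r)
  have "ennreal u \<le> ennreal (r + v)" "ennreal v \<le> ennreal (r + u)"
    using assms real by (simp_all add: ennreal_plus)
  moreover have "0 \<le> r + v" "0 \<le> r + u" using real assms(1,2) by simp_all
  ultimately have "u \<le> r + v" "v \<le> r + u"
    by (simp_all only: ennreal_le_iff)
  then show ?thesis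
    using real by (simp add: ennreal_le_iff abs_le_iff)
qed simp

text \<open>Compactness of \<open>C\<close> makes the sublevel sets of the distance to \<open>C\<close> projections along a compact factor.\<close>

lemma distance_to_compact_measurable:
  assumes X: "emm_space X" and C: "compactin (emm_top X) C"
  shows "(\<lambda>x. INF c\<in>C. emm_dist X x c) \<in> borel_measurable (emm_measure X)"
proof (rule borel_measurableI_less)
  fix y :: ennreal
  let ?T = "emm_top X" and ?S = "emm_carrier X"
  define P where "P b = {x \<in> ?S. \<exists>c\<in>C. emm_dist X x c \<le> b}" for b
  have CS: "C \<subseteq> ?S" using compactin_subset_topspace[OF C] .
  have "closedin ?T (P b)" for b
  proof -
    have "openin (prod_topology ?T ?T) {p \<in> topspace (prod_topology ?T ?T). b < (\<lambda>(x, y). emm_dist X x y) p}"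
      using X unfolding emm_space_def lower_semicontinuous_in_def by simp
    then have "closedin (prod_topology ?T ?T) (topspace (prod_topology ?T ?T) - {p \<in> topspace (prod_topology ?T ?T). b < (\<lambda>(x, y). emm_dist X x y) p})"
      by blast
    moreover have "topspace (prod_topology ?T ?T) - {p \<in> topspace (prod_topology ?T ?T). b < (\<lambda>(x, y). emm_dist X x y) p}
        = {p \<in> ?S \<times> ?S. (\<lambda>(x, y). emm_dist X x y) p \<le> b}"
      by auto
    ultimately have L: "closedin (prod_topology ?T ?T) {p \<in> ?S \<times> ?S. (\<lambda>(x, y). emm_dist X x y) p \<le> b}"
      by simp
    have sub: "prod_topology ?T (subtopology ?T C) = subtopology (prod_topology ?T ?T) (?S \<times> C)"
      by (metis subtopology_Times subtopology_topspace)
    have "closedin (prod_topology ?T (subtopology ?T C)) ({p \<in> ?S \<times> ?S. (\<lambda>(x, y). emm_dist X x y) p \<le> b} \<inter> (?S \<times> C))"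
      unfolding sub closedin_subtopology using L by blast
    moreover have "closed_map (prod_topology ?T (subtopology ?T C)) ?T fst"
      by (rule closed_map_fst) (use C in \<open>simp add: compact_space_subtopology\<close>)
    ultimately have "closedin ?T (fst ` ({p \<in> ?S \<times> ?S. (\<lambda>(x, y). emm_dist X x y) p \<le> b} \<inter> (?S \<times> C)))"
      unfolding closed_map_def by simp
    moreover have "fst ` ({p \<in> ?S \<times> ?S. (\<lambda>(x, y). emm_dist X x y) p \<le> b} \<inter> (?S \<times> C)) = P b"
      unfolding P_def using CS by force
    ultimately show ?thesis by simp
  qed
  then have Pm: "P b \<in> sets (emm_measure X)" for b
    using borel_of_closed emm_spaceD(6)[OF X] by blast
  \<comment> \<open>Rational thresholds below \<open>y\<close> write the strict sublevel set as a
    countable union of the closed sets \<open>P b\<close>.\<close>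
  have "{x \<in> space (emm_measure X). (INF c\<in>C. emm_dist X x c) < y} = (\<Union>q\<in>{q :: rat. ennreal (real_of_rat q) < y}. P (ennreal (real_of_rat q)))"
  proof (intro set_eqI iffI)
    fix x assume "x \<in> {x \<in> space (emm_measure X). (INF c\<in>C. emm_dist X x c) < y}"
    then have x: "x \<in> ?S" "(INF c\<in>C. emm_dist X x c) < y" using emm_spaceD(2)[OF X] by auto
    then obtain c where c: "c \<in> C" "emm_dist X x c < y" by (auto simp: INF_less_iff)
    obtain q :: rat where "emm_dist X x c < ennreal (real_of_rat q)" "ennreal (real_of_rat q) < y"
      using ennreal_rat_dense[OF c(2)] by blast
    then show "x \<in> (\<Union>q\<in>{q :: rat. ennreal (real_of_rat q) < y}. P (ennreal (real_of_rat q)))"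
      using x(1) c(1) unfolding P_def by (auto intro: less_imp_le)
  next
    fix x assume "x \<in> (\<Union>q\<in>{q :: rat. ennreal (real_of_rat q) < y}. P (ennreal (real_of_rat q)))"
    then obtain q c where "ennreal (real_of_rat q) < y" "x \<in> ?S" "c \<in> C" "emm_dist X x c \<le> ennreal (real_of_rat q)"
      unfolding P_def by auto
    then show "x \<in> {x \<in> space (emm_measure X). (INF c\<in>C. emm_dist X x c) < y}"
      using emm_spaceD(2)[OF X] by (auto simp: INF_less_iff intro: le_less_trans)
  qed
  also have "\<dots> \<in> sets (emm_measure X)"
    by (rule sets.countable_UN'') (use Pm in auto)
  finally show "{x \<in> space (emm_measure X). (INF c\<in>C. emm_dist X x c) < y} \<in> sets (emm_measure X)" .
qed

text \<open>The cut at \<open>R\<close> makes a possibly infinite distance real-valued. For empty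
  \<open>C\<close> the infimum is \<open>top\<close>, and the function is the constant
  \<open>R\<close>.\<close>

definition trunc_dist :: "'a emm \<Rightarrow> 'a set \<Rightarrow> nat \<Rightarrow> 'a \<Rightarrow> real" where
  "trunc_dist X C R x = enn2real (min (of_nat R) (INF c\<in>C. emm_dist X x c))"

lemma ennreal_trunc_dist: "ennreal (trunc_dist X C R x) = min (of_nat R) (INF c\<in>C. emm_dist X x c)"
  unfolding trunc_dist_def by (rule ennreal_enn2real) (simp add: min_less_iff_disj of_nat_less_top)

lemma trunc_dist_lipschitz:
  assumes X: "emm_space X" and C: "C \<subseteq> emm_carrier X" and xy: "x \<in> emm_carrier X" "y \<in> emm_carrier X"
  shows "ennreal \<bar>trunc_dist X C R x - trunc_dist X C R y\<bar> \<le> emm_dist X x y"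
proof -
  have sym: "emm_dist X a b = emm_dist X b a" and tri: "emm_dist X a c \<le> emm_dist X a b + emm_dist X b c"
    if "a \<in> emm_carrier X" "b \<in> emm_carrier X" "c \<in> emm_carrier X" for a b c
    using emm_spaceD(5)[OF X] that unfolding extended_distance_def by auto
  have le: "ennreal (trunc_dist X C R a) \<le> emm_dist X a b + ennreal (trunc_dist X C R b)"
    if ab: "a \<in> emm_carrier X" "b \<in> emm_carrier X" for a b
  proof (cases "C = {}")
    case True
    then show ?thesis by (simp add: ennreal_trunc_dist)
  next
    case False
    have 1: "(INF c\<in>C. emm_dist X a c) \<le> emm_dist X a b + (INF c\<in>C. emm_dist X b c)"
    proof (cases "emm_dist X a b = top")
      case False
      have "(INF c\<in>C. emm_dist X a c) - emm_dist X a b \<le> (INF c\<in>C. emm_dist X b c)"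
      proof (rule INF_greatest)
        fix c assume c: "c \<in> C"
        have "(INF c\<in>C. emm_dist X a c) \<le> emm_dist X a c" by (rule INF_lower[OF c])
        also have "\<dots> \<le> emm_dist X a b + emm_dist X b c" using tri[OF ab] C c by blast
        finally show "(INF c\<in>C. emm_dist X a c) - emm_dist X a b \<le> emm_dist X b c"
          using False by (simp add: ennreal_minus_le_iff)
      qed
      then show ?thesis using False by (simp add: ennreal_minus_le_iff)
    qed simp
    show ?thesis
      unfolding ennreal_trunc_dist min_add_distrib_right
      using 1 by (auto simp: min_def intro: order_trans add_increasing)
  qed
  show ?thesis
    by (rule ennreal_abs_diff_le)
      (use le[OF xy] le[OF xy(2,1)] sym[OF xy xy(1)] in \<open>simp_all add: trunc_dist_def\<close>)
qed

lemma trunc_dist_Lip1: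
  assumes X: "emm_space X" and C: "compactin (emm_top X) C"
  shows "trunc_dist X C R \<in> Lip1 X"
proof -
  have "trunc_dist X C R \<in> borel_measurable (emm_measure X)"
    unfolding trunc_dist_def using distance_to_compact_measurable[OF X C] by measurable
  then have "trunc_dist X C R \<in> borel_measurable (emm_completion X)"
    by (rule measurable_completion)
  moreover have "AE x in emm_completion X. x \<in> emm_carrier X"
    using emm_spaceD(2)[OF X] by (intro AE_I2) simp
  moreover have "\<forall>x\<in>emm_carrier X. \<forall>y\<in>emm_carrier X. ennreal \<bar>trunc_dist X C R x - trunc_dist X C R y\<bar> \<le> emm_dist X x y"
    using trunc_dist_lipschitz[OF X compactin_subset_topspace[OF C]] by (intro ballI)
  ultimately show ?thesis
    unfolding Lip1_iff[OF X] by (intro conjI exI[of _ "emm_carrier X"])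
qed

text \<open>If \<open>b\<close> is below the distance of \<open>x\<close> and \<open>y\<close>,
  lower semicontinuity keeps it below the distance of \<open>u\<close> and \<open>y\<close> for all
  \<open>u\<close> near \<open>x\<close>. The distance to a compact piece of such a neighbourhood of
  \<open>x\<close> is then 0 at \<open>x\<close> and at least \<open>b\<close> at \<open>y\<close>.
  Countably many pieces suffice since the topology has a countable base, although the distance
  itself need not be separable.\<close>

lemma exists_generating:
  assumes X: "emm_space X"
  shows "\<exists>f. generating X f \<and> (\<forall>n. f n \<in> Lip1 X)"
proof -
  let ?T = "emm_top X" and ?S = "emm_carrier X"
  interpret prob_space "emm_measure X" using emm_spaceD[OF X] by simp
  note P = emm_spaceD(1)[OF X] and spX = emm_spaceD(2)[OF X]
  have "\<forall>j. \<exists>K. compactin ?T K \<and> measure (emm_measure X) (space (emm_measure X) - K) < 1 / real (Suc j)"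
    using polish_prob_tight[OF P] by (intro allI) simp
  from choice[OF this] obtain K where K: "\<forall>j. compactin ?T (K j) \<and> measure (emm_measure X) (space (emm_measure X) - K j) < 1 / real (Suc j)" ..
  have Kc: "closedin ?T (K j)" for j
    using K emm_space_second_countable(2)[OF X] compactin_imp_closedin by blast
  then have Km: "K j \<in> sets (emm_measure X)" for j
    using borel_of_closed emm_spaceD(6)[OF X] by blast
  define E where "E = (\<Union>j. K j)"
  have Em: "E \<in> sets (emm_measure X)" unfolding E_def using Km by blast
  have "measure (emm_measure X) (space (emm_measure X) - E) = 0"
  proof (rule ccontr)
    assume "measure (emm_measure X) (space (emm_measure X) - E) \<noteq> 0"
    then have "0 < measure (emm_measure X) (space (emm_measure X) - E)" by (simp add: less_le)
    then obtain n :: nat where n: "1 / real (Suc n) < measure (emm_measure X) (space (emm_measure X) - E)" by (rule nat_approx_posE)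
    have "measure (emm_measure X) (space (emm_measure X) - E) \<le> measure (emm_measure X) (space (emm_measure X) - K n)"
      by (rule finite_measure_mono) (use Km[of n] in \<open>auto simp: E_def\<close>)
    then show False using n K by (meson less_le_trans not_less_iff_gr_or_eq order_less_trans)
  qed
  then have "measure (emm_measure X) E = 1"
    using prob_compl[OF Em] by simp
  then have AE0: "AE x in emm_measure X. x \<in> E" by (rule AE_prob_1)
  have AEE: "AE x in emm_completion X. x \<in> E" by (rule AE_completion[OF AE0])
  have ES: "E \<subseteq> ?S" using sets.sets_into_space[OF Em] spX by simp
  from emm_space_second_countable(1)[OF X, unfolded second_countable_def]
  obtain \<B> where \<B>: "countable \<B> \<and> (\<forall>V\<in>\<B>. openin ?T V) \<and> (\<forall>U x. openin ?T U \<and> x \<in> U \<longrightarrow> (\<exists>V\<in>\<B>. x \<in> V \<and> V \<subseteq> U))" ..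
  define V where "V = from_nat_into (insert {} \<B>)"
  have rV: "range V = insert {} \<B>"
    unfolding V_def by (rule range_from_nat_into) (use \<B> in auto)
  \<comment> \<open>A closure is taken because a closed subset of \<open>K j\<close> is compact;
    regularity of the topology later keeps the closure of a small \<open>V n\<close> inside a given
    open set.\<close>
  define C where "C j n = (?T closure_of V n) \<inter> K j" for j n
  have Ccpt: "compactin ?T (C j n)" for j n
    unfolding C_def using K by (intro closed_Int_compactin) auto
  define f where "f k = (case from_nat k :: nat \<times> nat \<times> nat of (j, n, R) \<Rightarrow> trunc_dist X (C j n) R)" for k
  have f: "f n \<in> Lip1 X" for n
    unfolding f_def using trunc_dist_Lip1[OF X Ccpt] by (auto split: prod.split)
  have fk: "f (to_nat (j, n, R)) = trunc_dist X (C j n) R" for j n R by (simp add: f_def)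
  have reg: "neighbourhood_base_of (closedin ?T) ?T"
    unfolding neighbourhood_base_of_closedin
    using X completely_metrizable_imp_metrizable_space metrizable_imp_regular_space by (auto simp: emm_space_def)
  have gen: "emm_dist X x y \<le> (SUP n. ennreal \<bar>f n x - f n y\<bar>)" if xy: "x \<in> E" "y \<in> E" for x y
    unfolding le_SUP_iff
  proof (intro allI impI)
    fix a assume "a < emm_dist X x y"
    then obtain b where b: "a < b" "b < emm_dist X x y" using dense by blast
    have sym: "emm_dist X u y = emm_dist X y u" if "u \<in> ?S" for u
      using emm_spaceD(5)[OF X] that xy(2) ES unfolding extended_distance_def by auto
    define W where "W = {u \<in> ?S. b < emm_dist X u y}"
    have Wo: "openin ?T W"
    proof -
      have o: "openin (prod_topology ?T ?T) {p \<in> topspace (prod_topology ?T ?T). b < (\<lambda>(x, y). emm_dist X x y) p}"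
        using X unfolding emm_space_def lower_semicontinuous_in_def by simp
      have c: "continuous_map ?T (prod_topology ?T ?T) (\<lambda>u. (u, y))"
        using xy(2) ES by (intro continuous_map_pairedI) auto
      have "openin ?T {u \<in> topspace ?T. (u, y) \<in> {p \<in> topspace (prod_topology ?T ?T). b < (\<lambda>(x, y). emm_dist X x y) p}}"
        using openin_continuous_map_preimage[OF c o] .
      moreover have "{u \<in> topspace ?T. (u, y) \<in> {p \<in> topspace (prod_topology ?T ?T). b < (\<lambda>(x, y). emm_dist X x y) p}} = W"
        using xy(2) ES unfolding W_def by auto
      ultimately show ?thesis by simp
    qed
    have xW: "x \<in> W" using b xy ES by (auto simp: W_def)
    obtain U Z where UZ: "openin ?T U" "closedin ?T Z" "x \<in> U" "U \<subseteq> Z" "Z \<subseteq> W"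
      using reg[unfolded neighbourhood_base_of, rule_format, OF conjI[OF Wo xW]] by blast
    obtain B where B: "B \<in> \<B>" "x \<in> B" "B \<subseteq> U" using \<B> UZ(1,3) by blast
    have "B \<in> range V" unfolding rV using B(1) by simp
    then obtain n where n: "B = V n" by blast
    obtain j where j: "x \<in> K j" using xy(1) unfolding E_def by blast
    have cl: "?T closure_of V n \<subseteq> W"
      using closure_of_minimal[of "V n" Z ?T] UZ B n by blast
    have Bsub: "V n \<subseteq> ?S" using \<B> B(1) n openin_subset by blast
    have xC: "x \<in> C j n"
      unfolding C_def using j B(2) n closure_of_subset[OF Bsub] by blast
    \<comment> \<open>The truncation level must exceed \<open>b\<close>, so that cutting at
      \<open>R\<close> does not destroy the lower bound.\<close>
    obtain R where R: "b < of_nat R"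
      using ennreal_Ex_less_of_nat[of b] b(2) less_le_trans[OF b(2) top_greatest] by blast
    have "emm_dist X x x = 0" using extended_distance_zero[OF X] xy ES by auto
    then have "(INF c\<in>C j n. emm_dist X x c) \<le> 0" using INF_lower[OF xC, of "\<lambda>c. emm_dist X x c"] by simp
    then have x0: "trunc_dist X (C j n) R x = 0" by (simp add: trunc_dist_def)
    have "b \<le> (INF c\<in>C j n. emm_dist X y c)"
    proof (rule INF_greatest)
      fix c assume "c \<in> C j n"
      then have "c \<in> W" using cl unfolding C_def by blast
      then show "b \<le> emm_dist X y c" using sym[of c] by (simp add: W_def less_imp_le)
    qed
    then have "b \<le> ennreal (trunc_dist X (C j n) R y)"
      unfolding ennreal_trunc_dist using R by (simp add: less_imp_le)
    also have "\<dots> = ennreal \<bar>f (to_nat (j, n, R)) x - f (to_nat (j, n, R)) y\<bar>"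
      unfolding fk x0 by (simp add: trunc_dist_def)
    finally have "a < ennreal \<bar>f (to_nat (j, n, R)) x - f (to_nat (j, n, R)) y\<bar>"
      using b(1) by (rule less_le_trans[rotated])
    then show "\<exists>n\<in>UNIV. a < ennreal \<bar>f n x - f n y\<bar>" by blast
  qed
  have "generating X f"
    unfolding generating_def
  proof (intro conjI allI exI[of _ E] ballI AEE gen)
    show "f n \<in> borel_measurable (emm_completion X)" for n using f[of n] unfolding Lip1_iff[OF X] by (rule conjunct1)
  qed
  then show ?thesis using f by (intro exI[of _ f] conjI allI)
qed

section \<open>Laws of sequences of functions\<close>

text \<open>Test functions for laws on the sequence space. The sum over \<open>i < n\<close> makes
  \<open>h\<close> depend on finitely many coordinates, and the explicit \<open>L\<close> and
  \<open>n\<close> turn closeness of the coordinates into closeness of integrals.\<close>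

definition lip_cylinder :: "((nat \<Rightarrow> real) \<Rightarrow> real) \<Rightarrow> bool" where
  "lip_cylinder h \<longleftrightarrow> (\<forall>z. 0 \<le> h z \<and> h z \<le> 1) \<and>
     (\<exists>n L. 0 \<le> L \<and> (\<forall>z z'. \<bar>h z - h z'\<bar> \<le> L * (\<Sum>i<n. \<bar>z i - z' i\<bar>)))"

lemma lip_cylinder_measurable:
  assumes "lip_cylinder h"
  shows "h \<in> borel_measurable borel"
proof -
  from assms[unfolded lip_cylinder_def, THEN conjunct2]
  obtain n L where L: "0 \<le> L" "\<And>z z'. \<bar>h z - h z'\<bar> \<le> L * (\<Sum>i<n. \<bar>z i - z' i\<bar>)" by auto
  have "continuous_on UNIV h"
    unfolding continuous_on_def
  proof (intro ballI)
    fix z :: "nat \<Rightarrow> real"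
    have c: "((\<lambda>z'. z' i) \<longlongrightarrow> z i) (at z)" for i :: nat
      using continuous_on_product_coordinates[of i] unfolding continuous_on_def by auto
    have "((\<lambda>z'. L * (\<Sum>i<n. \<bar>z' i - z i\<bar>)) \<longlongrightarrow> L * (\<Sum>i<n. \<bar>z i - z i\<bar>)) (at z)"
      by (intro tendsto_intros c)
    then have "((\<lambda>z'. L * (\<Sum>i<n. \<bar>z' i - z i\<bar>)) \<longlongrightarrow> 0) (at z)" by simp
    then have "((\<lambda>z'. h z' - h z) \<longlongrightarrow> 0) (at z)"
      by (rule Lim_null_comparison[rotated]) (use L(2) in \<open>auto intro!: always_eventually\<close>)
    then show "(h \<longlongrightarrow> h z) (at z)" by (simp add: LIM_zero_iff)
  qed
  then show ?thesis by (rule borel_measurable_continuous_onI)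
qed

definition lower_box :: "nat \<Rightarrow> (nat \<Rightarrow> real) \<Rightarrow> (nat \<Rightarrow> real) set" where
  "lower_box n a = {z. \<forall>i<n. z i \<le> a i}"

lemma lower_box_borel: "lower_box n a \<in> sets borel"
proof -
  have "(\<lambda>z::nat\<Rightarrow>real. z i) \<in> borel_measurable borel" for i
    by (rule borel_measurable_continuous_onI[OF continuous_on_product_coordinates])
  then have "{z \<in> space borel. \<forall>i\<in>{..<n}. z i \<le> a i} \<in> sets (borel :: (nat \<Rightarrow> real) measure)"
    by (intro sets.sets_Collect_finite_All) (auto intro: borel_measurable_le)
  then show ?thesis by (simp add: lower_box_def lessThan_def)
qed

lemma sigma_sets_lower_box: "sigma_sets UNIV (range (\<lambda>(n, a). lower_box n a)) = sets borel"
proof -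
  let ?M = "sigma UNIV (range (\<lambda>(n, a). lower_box n a))"
  have sM: "sets ?M = sigma_sets UNIV (range (\<lambda>(n, a). lower_box n a))" by (rule sets_measure_of) simp
  have "(\<lambda>z. z) \<in> measurable ?M borel"
  proof (rule measurable_coordinatewise_then_product, rule borel_measurableI_le)
    fix i and y :: real
    \<comment> \<open>A lower box constrains all coordinates before \<open>i\<close> as well; they
      are released by letting their bound \<open>k\<close> grow.\<close>
    have "{z \<in> space ?M. z i \<le> y} = (\<Union>k. lower_box (Suc i) (\<lambda>j. if j = i then y else real k))"
    proof (intro set_eqI iffI)
      fix z assume z: "z \<in> {z \<in> space ?M. z i \<le> y}"
      obtain k :: nat where k: "(\<Sum>j<Suc i. \<bar>z j\<bar>) \<le> real k" using real_arch_simple by blast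
      have "z j \<le> real k" if "j < Suc i" for j
        using member_le_sum[of j "{..<Suc i}" "\<lambda>j. \<bar>z j\<bar>"] that k by simp
      then show "z \<in> (\<Union>k. lower_box (Suc i) (\<lambda>j. if j = i then y else real k))"
        using z by (intro UN_I[of k]) (auto simp: lower_box_def)
    next
      fix z assume "z \<in> (\<Union>k. lower_box (Suc i) (\<lambda>j. if j = i then y else real k))"
      then show "z \<in> {z \<in> space ?M. z i \<le> y}" by (auto simp: lower_box_def space_measure_of_conv)
    qed
    also have "\<dots> \<in> sets ?M"
      unfolding sM by (intro sigma_sets.Union sigma_sets.Basic) auto
    finally show "{z \<in> space ?M. z i \<le> y} \<in> sets ?M" .
  qed
  then have "sets borel \<subseteq> sets ?M"
    using measurable_sets[of "\<lambda>z. z" ?M borel] by (auto simp: space_measure_of_conv)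
  moreover have "sigma_sets UNIV (range (\<lambda>(n, a). lower_box n a)) \<subseteq> sets borel"
  proof -
    have "range (\<lambda>(n, a). lower_box n a) \<subseteq> sets borel" using lower_box_borel by auto
    from sets.sigma_sets_subset[OF this] show ?thesis by simp
  qed
  ultimately show ?thesis unfolding sM by blast
qed

text \<open>Indicators of lower boxes are decreasing limits of Lipschitz cylinder functions, and the
  boxes form an intersection-stable generator of the Borel sets.\<close>

lemma measure_eq_of_lip_cylinders:
  fixes \<mu> \<nu> :: "(nat \<Rightarrow> real) measure"
  assumes "prob_space \<mu>" "prob_space \<nu>" and s[measurable_cong]: "sets \<mu> = sets borel" "sets \<nu> = sets borel"
    and eq: "\<And>h. lip_cylinder h \<Longrightarrow> integral\<^sup>L \<mu> h = integral\<^sup>L \<nu> h"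
  shows "\<mu> = \<nu>"
proof (rule measure_eqI_generator_eq[where E = "range (\<lambda>(n, a). lower_box n a)" and \<Omega> = UNIV and A = "\<lambda>_. UNIV"])
  interpret \<mu>: prob_space \<mu> by fact
  interpret \<nu>: prob_space \<nu> by fact
  show "Int_stable (range (\<lambda>(n, a). lower_box n a))"
  proof (rule Int_stableI)
    fix A B assume "A \<in> range (\<lambda>(n, a). lower_box n a)" "B \<in> range (\<lambda>(n, a). lower_box n a)"
    then obtain n a m b where AB: "A = lower_box n a" "B = lower_box m b" by auto
    have "A \<inter> B = lower_box (max n m) (\<lambda>i. if i < n then (if i < m then min (a i) (b i) else a i) else b i)"
      unfolding AB lower_box_def by (auto simp: less_max_iff_disj)
    then show "A \<inter> B \<in> range (\<lambda>(n, a). lower_box n a)" by auto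
  qed
  show "emeasure \<mu> B = emeasure \<nu> B" if BR: "B \<in> range (\<lambda>(n, a). lower_box n a)" for B
  proof -
    obtain p where "B = (\<lambda>(n, a). lower_box n a) p" using BR by blast
    then obtain n a where B: "B = lower_box n a" by (cases p) auto
    \<comment> \<open>Equal to 1 on the box, and 0 as soon as the total excess over \<open>a\<close>
      reaches \<open>1 / m\<close>.\<close>
    define h where "h m z = max 0 (1 - real m * (\<Sum>i<n. max 0 (z i - a i)))" for m :: nat and z :: "nat \<Rightarrow> real"
    have h01: "0 \<le> h m z" "h m z \<le> 1" for m z
      unfolding h_def by (auto intro!: mult_nonneg_nonneg sum_nonneg)
    have lc: "lip_cylinder (h m)" for m
      unfolding lip_cylinder_def
    proof (intro conjI allI exI[of _ n] exI[of _ "real m"] h01)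
      fix z z' :: "nat \<Rightarrow> real"
      have "\<bar>h m z - h m z'\<bar> \<le> \<bar>real m * (\<Sum>i<n. max 0 (z i - a i)) - real m * (\<Sum>i<n. max 0 (z' i - a i))\<bar>"
        unfolding h_def by linarith
      also have "\<dots> = real m * \<bar>\<Sum>i<n. max 0 (z i - a i) - max 0 (z' i - a i)\<bar>"
        by (simp add: right_diff_distrib[symmetric] abs_mult sum_subtractf)
      also have "\<dots> \<le> real m * (\<Sum>i<n. \<bar>max 0 (z i - a i) - max 0 (z' i - a i)\<bar>)"
        by (intro mult_left_mono sum_abs) simp
      also have "\<dots> \<le> real m * (\<Sum>i<n. \<bar>z i - z' i\<bar>)"
        by (intro mult_left_mono sum_mono) auto
      finally show "\<bar>h m z - h m z'\<bar> \<le> real m * (\<Sum>i<n. \<bar>z i - z' i\<bar>)" .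
    qed simp
    have lim: "(\<lambda>m. h m z) \<longlonglongrightarrow> indicator B z" for z
    proof (cases "z \<in> B")
      case True
      then have "(\<Sum>i<n. max 0 (z i - a i)) = 0" by (intro sum.neutral) (auto simp: B lower_box_def)
      then show ?thesis using True by (simp add: h_def)
    next
      case False
      then obtain i where i: "i < n" "a i < z i" by (auto simp: B lower_box_def not_le)
      define s where "s = (\<Sum>i<n. max 0 (z i - a i))"
      have "max 0 (z i - a i) \<le> s"
        unfolding s_def by (rule member_le_sum) (use i in auto)
      then have s: "0 < s" using i(2) by linarith
      obtain M :: nat where M: "1 / s \<le> real M" using real_arch_simple by blast
      have "h m z = 0" if "m \<ge> M" for m
      proof -
        have "1 / s \<le> real m" using M that by linarith
        then have "1 \<le> real m * s" using s by (simp add: divide_le_eq)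
        then show ?thesis by (simp add: h_def s_def)
      qed
      then have "eventually (\<lambda>m. h m z = 0) sequentially" unfolding eventually_sequentially by blast
      then show ?thesis using False by (simp add: tendsto_eventually)
    qed
    have Bb: "B \<in> sets borel" unfolding B by (rule lower_box_borel)
    have conv: "(\<lambda>m. integral\<^sup>L M (h m)) \<longlonglongrightarrow> measure M B" if "prob_space M" "sets M = sets borel" for M
    proof -
      interpret prob_space M by fact
      have Bs: "B \<in> sets M" using Bb that(2) by simp
      have "(\<lambda>m. integral\<^sup>L M (h m)) \<longlonglongrightarrow> integral\<^sup>L M (indicator B :: _ \<Rightarrow> real)"
      proof (rule integral_dominated_convergence[where w = "\<lambda>_. 1"])
        show "h m \<in> borel_measurable M" for m
          using lip_cylinder_measurable[OF lc] measurable_cong_sets[OF that(2) refl] by blast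
        show "(indicator B :: _ \<Rightarrow> real) \<in> borel_measurable M" using Bs by simp
        show "AE x in M. norm (h m x) \<le> 1" for m using h01 by auto
      qed (use lim in auto)
      moreover have "integral\<^sup>L M (indicator B :: _ \<Rightarrow> real) = measure M B"
        using Bs by simp
      ultimately show ?thesis by simp
    qed
    have "measure \<mu> B = measure \<nu> B"
      by (rule LIMSEQ_unique[OF conv[OF assms(1) s(1)]]) (use conv[OF assms(2) s(2)] eq[OF lc] in simp)
    then show ?thesis by (simp add: \<mu>.emeasure_eq_measure \<nu>.emeasure_eq_measure)
  qed
  show "sets \<mu> = sigma_sets UNIV (range (\<lambda>(n, a). lower_box n a))" "sets \<nu> = sigma_sets UNIV (range (\<lambda>(n, a). lower_box n a))"
    unfolding sigma_sets_lower_box by (fact s)+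
  have "lower_box 0 a = UNIV" for a by (simp add: lower_box_def)
  then show "range (\<lambda>_. UNIV) \<subseteq> range (\<lambda>(n, a). lower_box n a)"
    by (metis (mono_tags, lifting) case_prod_conv image_subsetI rangeI)
  show "emeasure \<mu> UNIV \<noteq> \<infinity>" by simp
qed auto

text \<open>Outside \<open>n\<close> exceptional sets of measure at most \<open>e\<close> all
  relevant coordinates move by at most \<open>e\<close>, which changes \<open>h\<close> by at most
  \<open>L * n * e\<close>; on these sets it changes by at most 1, which adds
  \<open>n * e\<close>.\<close>

lemma (in prob_space) lip_cylinder_integral_tendsto:
  assumes h: "lip_cylinder h" and [measurable]: "\<And>k i. u k i \<in> borel_measurable M" "\<And>i. v i \<in> borel_measurable M"
    and lim: "\<And>i. (\<lambda>k. kfan M (u k i) (v i)) \<longlonglongrightarrow> 0"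
  shows "(\<lambda>k. integral\<^sup>L M (\<lambda>x. h (\<lambda>i. u k i x))) \<longlonglongrightarrow> integral\<^sup>L M (\<lambda>x. h (\<lambda>i. v i x))"
proof (rule tendstoI)
  fix \<epsilon> :: real assume \<epsilon>: "0 < \<epsilon>"
  from h[unfolded lip_cylinder_def, THEN conjunct2]
  obtain n L where L: "0 \<le> L" "\<And>z z'. \<bar>h z - h z'\<bar> \<le> L * (\<Sum>i<n. \<bar>z i - z' i\<bar>)" by auto
  have h01: "0 \<le> h z" "h z \<le> 1" for z using h by (simp_all add: lip_cylinder_def)
  have [measurable]: "h \<in> borel_measurable borel" by (rule lip_cylinder_measurable[OF h])
  have um[measurable]: "(\<lambda>x i. u k i x) \<in> borel_measurable M" for k
    by (rule measurable_coordinatewise_then_product) simp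
  have vm[measurable]: "(\<lambda>x i. v i x) \<in> borel_measurable M"
    by (rule measurable_coordinatewise_then_product) simp
  \<comment> \<open>The summand 1 keeps the denominator positive for \<open>n = 0\<close>, and the
    factor 2 makes the final inequality strict.\<close>
  define e where "e = \<epsilon> / (2 * (L * real n + real n + 1))"
  have den: "0 < L * real n + real n + 1" using L(1) by (intro add_nonneg_pos add_nonneg_nonneg mult_nonneg_nonneg) auto
  have e: "0 < e" using \<epsilon> den by (simp add: e_def)
  have small: "(L * real n + real n) * e < \<epsilon>"
  proof -
    have "(L * real n + real n) * e \<le> (L * real n + real n + 1) * e" using e by (intro mult_right_mono) auto
    also have "\<dots> = \<epsilon> / 2" using den by (simp add: e_def field_simps)
    finally show ?thesis using \<epsilon> by simp
  qed
  have "eventually (\<lambda>k. \<forall>i\<in>{..<n}. kfan M (u k i) (v i) < e) sequentially"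
  proof (rule eventually_ball_finite, simp, rule ballI)
    show "eventually (\<lambda>k. kfan M (u k i) (v i) < e) sequentially" for i
      by (rule order_tendstoD(2)[OF lim e])
  qed
  then show "eventually (\<lambda>k. dist (integral\<^sup>L M (\<lambda>x. h (\<lambda>i. u k i x))) (integral\<^sup>L M (\<lambda>x. h (\<lambda>i. v i x))) < \<epsilon>) sequentially"
  proof (rule eventually_mono)
    fix k assume k: "\<forall>i\<in>{..<n}. kfan M (u k i) (v i) < e"
    define A where "A i = {x \<in> space M. e < \<bar>u k i x - v i x\<bar>}" for i
    have Am[measurable]: "A i \<in> sets M" for i unfolding A_def by measurable
    have mA: "measure M (A i) \<le> e" if "i < n" for i
      unfolding A_def using kfan_less[of "u k i" "v i" e] k that by (simp add: less_imp_le)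
    have ih1: "integrable M (\<lambda>x. h (\<lambda>i. u k i x))"
      by (rule integrable_const_bound[of _ 1]) (use h01 in auto)
    have ih2: "integrable M (\<lambda>x. h (\<lambda>i. v i x))"
      by (rule integrable_const_bound[of _ 1]) (use h01 in auto)
    have iA: "integrable M (\<lambda>x. L * real n * e + (\<Sum>i<n. indicator (A i) x))"
      by (intro Bochner_Integration.integrable_add Bochner_Integration.integrable_sum integrable_const integrable_real_indicator)
        (auto simp: less_top[symmetric])
    have pt: "\<bar>h (\<lambda>i. u k i x) - h (\<lambda>i. v i x)\<bar> \<le> L * real n * e + (\<Sum>i<n. indicator (A i) x)" if x: "x \<in> space M" for x
    proof (cases "\<exists>i<n. x \<in> A i")
      case True
      then obtain i where i: "i < n" "x \<in> A i" by blast
      have "indicator (A i) x \<le> (\<Sum>i<n. indicator (A i) x :: real)"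
        by (rule member_le_sum) (use i in auto)
      then have "1 \<le> (\<Sum>i<n. indicator (A i) x :: real)" using i(2) by simp
      moreover have "\<bar>h (\<lambda>i. u k i x) - h (\<lambda>i. v i x)\<bar> \<le> 1"
        using h01[of "\<lambda>i. u k i x"] h01[of "\<lambda>i. v i x"] by linarith
      moreover have "0 \<le> L * real n * e" using L(1) e by simp
      ultimately show ?thesis by linarith
    next
      case False
      have "\<bar>u k i x - v i x\<bar> \<le> e" if "i < n" for i
      proof -
        have "x \<notin> A i" using False that by blast
        then show ?thesis using x by (simp add: A_def not_less)
      qed
      then have "(\<Sum>i<n. \<bar>u k i x - v i x\<bar>) \<le> (\<Sum>i<n. e)" by (intro sum_mono) auto
      then have "L * (\<Sum>i<n. \<bar>u k i x - v i x\<bar>) \<le> L * (real n * e)"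
        using L(1) by (intro mult_left_mono) auto
      moreover have "0 \<le> (\<Sum>i<n. indicator (A i) x :: real)" by (intro sum_nonneg) auto
      ultimately show ?thesis
        using L(2)[of "\<lambda>i. u k i x" "\<lambda>i. v i x"] by (simp add: mult.assoc)
    qed
    have "\<bar>integral\<^sup>L M (\<lambda>x. h (\<lambda>i. u k i x)) - integral\<^sup>L M (\<lambda>x. h (\<lambda>i. v i x))\<bar>
        = \<bar>integral\<^sup>L M (\<lambda>x. h (\<lambda>i. u k i x) - h (\<lambda>i. v i x))\<bar>"
      using ih1 ih2 by simp
    also have "\<dots> \<le> integral\<^sup>L M (\<lambda>x. \<bar>h (\<lambda>i. u k i x) - h (\<lambda>i. v i x)\<bar>)"
      by (rule integral_abs_bound)
    also have "\<dots> \<le> integral\<^sup>L M (\<lambda>x. L * real n * e + (\<Sum>i<n. indicator (A i) x))"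
      by (rule integral_mono[OF _ iA pt]) (use ih1 ih2 in auto)
    also have "\<dots> = L * real n * e + (\<Sum>i<n. measure M (A i))"
    proof -
      have "integral\<^sup>L M (\<lambda>x. L * real n * e + (\<Sum>i<n. indicator (A i) x)) = L * real n * e + integral\<^sup>L M (\<lambda>x. \<Sum>i<n. indicator (A i) x)"
        by (subst Bochner_Integration.integral_add)
          (auto simp: prob_space less_top[symmetric] intro!: Bochner_Integration.integrable_sum integrable_real_indicator)
      also have "integral\<^sup>L M (\<lambda>x. \<Sum>i<n. indicator (A i) x) = (\<Sum>i<n. measure M (A i))"
        by (subst Bochner_Integration.integral_sum) (auto simp: less_top[symmetric] intro!: integrable_real_indicator)
      finally show ?thesis .
    qed
    also have "\<dots> \<le> L * real n * e + (\<Sum>i<n. e)"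
      by (intro add_left_mono sum_mono mA) simp
    also have "\<dots> = (L * real n + real n) * e" by (simp add: algebra_simps)
    also have "\<dots> < \<epsilon>" by (rule small)
    finally show "dist (integral\<^sup>L M (\<lambda>x. h (\<lambda>i. u k i x))) (integral\<^sup>L M (\<lambda>x. h (\<lambda>i. v i x))) < \<epsilon>"
      by (simp add: dist_real_def)
  qed
qed

lemma (in prob_space) tail_tendsto_zero:
  assumes [measurable]: "f \<in> borel_measurable M"
  shows "(\<lambda>n. measure M {x \<in> space M. real n < \<bar>f x\<bar>}) \<longlonglongrightarrow> 0"
proof -
  have "(\<lambda>n. measure M {x \<in> space M. real n < \<bar>f x\<bar>}) \<longlonglongrightarrow> measure M (\<Inter>n. {x \<in> space M. real n < \<bar>f x\<bar>})"
    by (rule finite_Lim_measure_decseq) (auto simp: decseq_def)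
  moreover have "(\<Inter>n. {x \<in> space M. real n < \<bar>f x\<bar>}) = {}"
  proof -
    have "\<exists>n. \<not> real n < \<bar>f x\<bar>" for x using real_arch_simple[of "\<bar>f x\<bar>"] by (auto simp: not_less)
    then show ?thesis by blast
  qed
  ultimately show ?thesis by simp
qed

lemma (in prob_space) three_small_sets:
  assumes "A \<in> sets M" "B \<in> sets M" "C \<in> sets M" "measure M A < 1/4" "measure M B < 1/4" "measure M C < 1/4"
  shows "\<exists>x\<in>space M. x \<notin> A \<and> x \<notin> B \<and> x \<notin> C"
proof (rule ccontr)
  assume "\<not> ?thesis"
  then have "space M \<subseteq> A \<union> (B \<union> C)" by blast
  then have "measure M (space M) \<le> measure M (A \<union> (B \<union> C))"
    by (rule finite_measure_mono) (use assms in auto)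
  also have "\<dots> \<le> measure M A + measure M (B \<union> C)" by (rule measure_Un_le) (use assms in auto)
  also have "measure M (B \<union> C) \<le> measure M B + measure M C" by (rule measure_Un_le) (use assms in auto)
  finally show False using assms prob_space by simp
qed

text \<open>Compactness only controls the functions modulo constants; tightness keeps the constants bounded.\<close>

lemma L1_compact_tight_subsequence:
  assumes X: "emm_space X" and cpt: "compact_space (mtopology_of (L1 X))"
    and u: "\<And>k. u k \<in> Lip1 X"
    and tight: "eventually (\<lambda>k. measure (emm_completion X) {x \<in> space (emm_completion X). B < \<bar>u k x\<bar>} < 1/4) sequentially"
  shows "\<exists>r G. strict_mono (r :: nat \<Rightarrow> nat) \<and> G \<in> Lip1 X \<and> (\<lambda>k. kfan (emm_completion X) (u (r k)) G) \<longlonglongrightarrow> 0"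
proof -
  let ?N = "emm_completion X"
  interpret prob_space ?N using emm_spaceD[OF X] by simp
  interpret L: Metric_space "mspace (L1 X)" "mdist (L1 X)" by simp
  have L0: "h \<in> Lip1 X \<Longrightarrow> h \<in> L0 X" for h using Lip1_subset_L0 by blast
  have m: "h \<in> Lip1 X \<Longrightarrow> h \<in> borel_measurable ?N" for h using L0 by (simp add: L0_def)
  note um[measurable] = m[OF u]
  have "range (\<lambda>k. L1_class X (u k)) \<subseteq> mspace (L1 X)" using u by (auto simp: mspace_L1[OF X])
  from cpt[unfolded mtopology_of_def L.compact_space_sequentially, rule_format, OF this]
  obtain l r where lr: "l \<in> mspace (L1 X)" "strict_mono r" "limitin L.mtopology ((\<lambda>k. L1_class X (u k)) \<circ> r) l sequentially"
    by blast
  obtain G where G: "G \<in> Lip1 X" "l = L1_class X G" using lr(1) unfolding mspace_L1[OF X] by blast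
  note Gm[measurable] = m[OF G(1)]
  have lim: "(\<lambda>k. kfan_mod ?N (u (r k)) G) \<longlonglongrightarrow> 0"
    using lr(3) unfolding L.limitin_metric_dist_null G(2) o_def mdist_L1[OF X L0[OF u] L0[OF G(1)]] by simp
  have "\<forall>k. \<exists>c. kfan ?N (u (r k)) (\<lambda>x. G x + c) < kfan_mod ?N (u (r k)) G + 1 / real (Suc k)"
    by (intro allI kfan_mod_less) simp
  from choice[OF this] obtain c where c: "\<And>k. kfan ?N (u (r k)) (\<lambda>x. G x + c k) < kfan_mod ?N (u (r k)) G + 1 / real (Suc k)"
    by blast
  have lim2: "(\<lambda>k. kfan ?N (u (r k)) (\<lambda>x. G x + c k)) \<longlonglongrightarrow> 0"
  proof (rule tendsto_sandwich[OF _ _ tendsto_const])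
    show "(\<lambda>k. kfan_mod ?N (u (r k)) G + 1 / real (Suc k)) \<longlonglongrightarrow> 0"
      using tendsto_add[OF lim LIMSEQ_Suc[OF lim_1_over_n]] by simp
  qed (use c kfan_nonneg in \<open>auto intro!: always_eventually less_imp_le\<close>)
  obtain B' :: nat where B': "measure ?N {x \<in> space ?N. real B' < \<bar>G x\<bar>} < 1/4"
    using order_tendstoD(2)[OF tail_tendsto_zero[OF Gm], of "1/4"] unfolding eventually_sequentially by auto
  have quarter: "(0::real) < 1/4" by simp
  \<comment> \<open>Three exceptional sets of measure below \<open>1/4\<close> cannot cover the
    space. At a point outside all of them \<open>u (r k)\<close> and \<open>G\<close> are bounded
    and \<open>G + c k\<close> is close to \<open>u (r k)\<close>, so \<open>c k\<close> is
    bounded.\<close>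
  have "eventually (\<lambda>k. \<bar>c k\<bar> \<le> B + real B' + 1/4) sequentially"
    using eventually_subseq[OF lr(2) tight] order_tendstoD(2)[OF lim2 quarter]
  proof eventually_elim
    case (elim k)
    have "measure ?N {x \<in> space ?N. 1/4 < \<bar>u (r k) x - (G x + c k)\<bar>} < 1/4"
      by (rule kfan_less[OF um _ elim(2)]) simp
    moreover have "{x \<in> space ?N. B < \<bar>u (r k) x\<bar>} \<in> sets ?N" "{x \<in> space ?N. real B' < \<bar>G x\<bar>} \<in> sets ?N"
      "{x \<in> space ?N. 1/4 < \<bar>u (r k) x - (G x + c k)\<bar>} \<in> sets ?N"
      by measurable
    ultimately have "\<exists>x\<in>space ?N. x \<notin> {x \<in> space ?N. B < \<bar>u (r k) x\<bar>} \<and> x \<notin> {x \<in> space ?N. real B' < \<bar>G x\<bar>}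
        \<and> x \<notin> {x \<in> space ?N. 1/4 < \<bar>u (r k) x - (G x + c k)\<bar>}"
      using elim(1) B' by (intro three_small_sets)
    then
    obtain x where "x \<in> space ?N" "\<not> B < \<bar>u (r k) x\<bar>" "\<not> real B' < \<bar>G x\<bar>" "\<not> 1/4 < \<bar>u (r k) x - (G x + c k)\<bar>"
      by auto
    then show ?case by linarith
  qed
  then obtain K where K: "\<And>k. k \<ge> K \<Longrightarrow> \<bar>c k\<bar> \<le> B + real B' + 1/4" unfolding eventually_sequentially by blast
  have "compact {- (B + real B' + 1/4)..B + real B' + 1/4}" by (rule compact_Icc)
  moreover have "\<forall>k. c (k + K) \<in> {- (B + real B' + 1/4)..B + real B' + 1/4}"
    using K by (auto simp: abs_le_iff) (smt (verit) le_add2)+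
  ultimately obtain c0 s where s: "strict_mono s" "((\<lambda>k. c (k + K)) \<circ> s) \<longlonglongrightarrow> c0"
    by (metis compact_imp_seq_compact seq_compactE)
  \<comment> \<open>The constants are bounded only from \<open>K\<close> on, so the convergent
    subsequence is taken from the shifted sequence.\<close>
  define t where "t k = s k + K" for k
  have tm: "strict_mono t" using s(1) by (auto simp: t_def strict_mono_def)
  have ct: "(\<lambda>k. c (t k)) \<longlonglongrightarrow> c0" using s(2) by (simp add: t_def o_def)
  have GL: "(\<lambda>x. G x + c0) \<in> Lip1 X"
    using G(1) unfolding Lip1_iff[OF X] by (auto simp: m[OF G(1)])
  have lim3: "(\<lambda>k. kfan ?N (u (r (t k))) (\<lambda>x. G x + c (t k))) \<longlonglongrightarrow> 0"
    using LIMSEQ_subseq_LIMSEQ[OF lim2 tm] by (simp add: o_def)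
  have "(\<lambda>k. kfan ?N (u ((r \<circ> t) k)) (\<lambda>x. G x + c0)) \<longlonglongrightarrow> 0"
  proof (rule tendsto_sandwich[OF _ _ tendsto_const])
    have "(\<lambda>k. \<bar>c (t k) - c0\<bar>) \<longlonglongrightarrow> 0"
      using tendsto_rabs_zero[OF LIM_zero[OF ct]] .
    from tendsto_add[OF lim3 this]
    show "(\<lambda>k. kfan ?N (u (r (t k))) (\<lambda>x. G x + c (t k)) + \<bar>c (t k) - c0\<bar>) \<longlonglongrightarrow> 0" by simp
    have "kfan ?N (u ((r \<circ> t) k)) (\<lambda>x. G x + c0) \<le> kfan ?N (u (r (t k))) (\<lambda>x. G x + c (t k)) + \<bar>c (t k) - c0\<bar>" for k
    proof -
      have "kfan ?N (u (r (t k))) (\<lambda>x. G x + c0) \<le> kfan ?N (u (r (t k))) (\<lambda>x. G x + c (t k)) + kfan ?N (\<lambda>x. G x + c (t k)) (\<lambda>x. G x + c0)"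
        by (rule kfan_triangle) simp_all
      then show ?thesis using kfan_const_le[of G "c (t k)" c0] by simp
    qed
    then show "eventually (\<lambda>k. kfan ?N (u ((r \<circ> t) k)) (\<lambda>x. G x + c0) \<le> kfan ?N (u (r (t k))) (\<lambda>x. G x + c (t k)) + \<bar>c (t k) - c0\<bar>) sequentially"
      by (intro always_eventually allI)
  qed (use kfan_nonneg in \<open>auto intro!: always_eventually\<close>)
  then show ?thesis
    using strict_mono_o[OF lr(2) tm] GL by (intro exI[of _ "r \<circ> t"] exI[of _ "\<lambda>x. G x + c0"] conjI)
qed

text \<open>A Lipschitz substitute for a tail indicator: it lies between the indicators of
  \<open>\<bar>z i\<bar> > B + 1\<close> and \<open>\<bar>z i\<bar> > B\<close>.\<close>

lemma lip_cylinder_tail: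
  assumes "0 \<le> B"
  shows "lip_cylinder (\<lambda>z. min 1 (max 0 (\<bar>z i\<bar> - B)))"
  unfolding lip_cylinder_def
proof (intro conjI allI exI[of _ "Suc i"] exI[of _ 1])
  fix z z' :: "nat \<Rightarrow> real"
  have "\<bar>z i - z' i\<bar> \<le> (\<Sum>i<Suc i. \<bar>z i - z' i\<bar>)"
    by (rule member_le_sum) auto
  then show "\<bar>min 1 (max 0 (\<bar>z i\<bar> - B)) - min 1 (max 0 (\<bar>z' i\<bar> - B))\<bar> \<le> 1 * (\<Sum>i<Suc i. \<bar>z i - z' i\<bar>)"
    by linarith
qed auto

text \<open>Convergence of the laws makes each coordinate tight, so compactness of
  \<open>L1 X\<close> yields Ky Fan limits in \<open>Lip1 X\<close> along subsequences, and a
  diagonal sequence serves all coordinates at once. The law of these limits must be the given limit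
  law.\<close>

lemma limit_law_realized:
  assumes X: "emm_space X" and cpt: "compact_space (mtopology_of (L1 X))"
    and g: "\<And>k n. g k n \<in> Lip1 X" and N: "prob_space N" and f[measurable]: "\<And>n. f n \<in> borel_measurable N"
    and conv: "\<And>h. lip_cylinder h \<Longrightarrow>
      (\<lambda>k. integral\<^sup>L (emm_completion X) (\<lambda>x. h (\<lambda>n. g k n x))) \<longlonglongrightarrow> integral\<^sup>L N (\<lambda>x. h (\<lambda>n. f n x))"
  shows "\<exists>G. (\<forall>n. G n \<in> Lip1 X) \<and> distr N borel (\<lambda>x n. f n x) = distr (emm_completion X) borel (\<lambda>x n. G n x)"
proof -
  let ?N = "emm_completion X"
  interpret prob_space ?N using emm_spaceD[OF X] by simp
  interpret N: prob_space N by fact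
  have m: "h \<in> Lip1 X \<Longrightarrow> h \<in> borel_measurable ?N" for h unfolding Lip1_iff[OF X] by (rule conjunct1)
  note gm[measurable] = m[OF g]
  have vm[measurable]: "(\<lambda>x i. f i x) \<in> borel_measurable N"
    by (rule measurable_coordinatewise_then_product) simp
  \<comment> \<open>The tail of the limit law bounds those of the approximating laws through a
    cylinder function; passing from it back to an indicator costs an increase of the threshold by
    1.\<close>
  have "\<exists>B. eventually (\<lambda>k. measure ?N {x \<in> space ?N. B < \<bar>g k n x\<bar>} < 1/4) sequentially" for n
  proof -
    obtain B :: nat where B: "measure N {x \<in> space N. real B < \<bar>f n x\<bar>} < 1/4"
      using order_tendstoD(2)[OF N.tail_tendsto_zero[OF f[of n]], of "1/4"] unfolding eventually_sequentially by auto
    define h where "h = (\<lambda>z::nat\<Rightarrow>real. min 1 (max 0 (\<bar>z n\<bar> - real B)))"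
    have lc: "lip_cylinder h" unfolding h_def by (rule lip_cylinder_tail) simp
    note hm[measurable] = lip_cylinder_measurable[OF lc]
    have "integral\<^sup>L N (\<lambda>x. h (\<lambda>n. f n x)) \<le> integral\<^sup>L N (indicator {x \<in> space N. real B < \<bar>f n x\<bar>})"
    proof (rule integral_mono)
      show "integrable N (\<lambda>x. h (\<lambda>n. f n x))"
        by (rule N.integrable_const_bound[of _ 1]) (auto simp: h_def)
      show "integrable N (indicator {x \<in> space N. real B < \<bar>f n x\<bar>} :: _ \<Rightarrow> real)"
        by (rule integrable_real_indicator) (auto simp: less_top[symmetric])
      show "h (\<lambda>n. f n x) \<le> indicator {x \<in> space N. real B < \<bar>f n x\<bar>} x" if "x \<in> space N" for x
        using that by (auto simp: h_def indicator_def)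
    qed
    also have "\<dots> = measure N {x \<in> space N. real B < \<bar>f n x\<bar>}" by simp
    finally have "integral\<^sup>L N (\<lambda>x. h (\<lambda>n. f n x)) < 1/4" using B by simp
    from order_tendstoD(2)[OF conv[OF lc] this]
    have "eventually (\<lambda>k. measure ?N {x \<in> space ?N. real B + 1 < \<bar>g k n x\<bar>} < 1/4) sequentially"
    proof eventually_elim
      case (elim k)
      have gkm[measurable]: "(\<lambda>x i. g k i x) \<in> borel_measurable ?N"
        by (rule measurable_coordinatewise_then_product) simp
      define S where "S = {x \<in> space ?N. real B + 1 < \<bar>g k n x\<bar>}"
      have Sm: "S \<in> sets ?N" unfolding S_def by measurable
      have "S \<inter> space ?N = S" by (auto simp: S_def)
      then have "measure ?N S = integral\<^sup>L ?N (indicator S)"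
        using Bochner_Integration.integral_indicator[of ?N S] by metis
      also have "\<dots> \<le> integral\<^sup>L ?N (\<lambda>x. h (\<lambda>n. g k n x))"
      proof (rule integral_mono)
        show "integrable ?N (\<lambda>x. h (\<lambda>n. g k n x))"
          by (rule integrable_const_bound[of _ 1]) (auto simp: h_def)
        show "integrable ?N (indicator S :: _ \<Rightarrow> real)"
          by (rule integrable_real_indicator[OF Sm]) (simp add: less_top[symmetric])
        show "indicator S x \<le> h (\<lambda>n. g k n x)" for x
          by (auto simp: h_def indicator_def S_def)
      qed
      finally have "measure ?N S < 1/4" using elim by linarith
      then show ?case by (simp only: S_def)
    qed
    then show ?thesis ..
  qed
  then have "\<forall>n. \<exists>B. eventually (\<lambda>k. measure ?N {x \<in> space ?N. B < \<bar>g k n x\<bar>} < 1/4) sequentially" ..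
  from choice[OF this] obtain B where B: "\<And>n. eventually (\<lambda>k. measure ?N {x \<in> space ?N. B n < \<bar>g k n x\<bar>} < 1/4) sequentially"
    by blast
  define P where "P n s \<longleftrightarrow> (\<exists>G\<in>Lip1 X. (\<lambda>k. kfan ?N (g (s k) n) G) \<longlonglongrightarrow> 0)" for n and s :: "nat \<Rightarrow> nat"
  interpret S: subseqs P
  proof
    fix n and s :: "nat \<Rightarrow> nat" assume s: "strict_mono s"
    from L1_compact_tight_subsequence[OF X cpt, of "\<lambda>k. g (s k) n", OF g eventually_subseq[OF s B]]
    obtain r G where "strict_mono (r :: nat \<Rightarrow> nat)" "G \<in> Lip1 X" "(\<lambda>k. kfan ?N (g (s (r k)) n) G) \<longlonglongrightarrow> 0" by blast
    then show "\<exists>r. strict_mono r \<and> P n (s \<circ> r)"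
      unfolding P_def o_def by (intro exI[of _ r] conjI bexI[of _ G])
  qed
  define d where "d = S.diagseq"
  have dm: "strict_mono d" unfolding d_def by (rule S.subseq_diagseq)
  have "\<exists>G\<in>Lip1 X. (\<lambda>k. kfan ?N (g (d k) n) G) \<longlonglongrightarrow> 0" for n
  proof -
    \<comment> \<open>The diagonal sequence satisfies the requirement of coordinate \<open>n\<close>
      only after dropping its first \<open>Suc n\<close> terms; limits are unaffected.\<close>
    have "P n (d \<circ> ((+) (Suc n)))"
      unfolding d_def
    proof (rule S.diagseq_holds)
      fix r s :: "nat \<Rightarrow> nat" and n assume r: "strict_mono r" and "P n s"
      then obtain G where "G \<in> Lip1 X" "(\<lambda>k. kfan ?N (g (s k) n) G) \<longlonglongrightarrow> 0" unfolding P_def by blast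
      then show "P n (s \<circ> r)"
        unfolding P_def using LIMSEQ_subseq_LIMSEQ[OF _ r, of "\<lambda>k. kfan ?N (g (s k) n) G"] by (auto simp: o_def)
    qed
    then obtain G where G: "G \<in> Lip1 X" "(\<lambda>k. kfan ?N (g (d (Suc n + k)) n) G) \<longlonglongrightarrow> 0" unfolding P_def o_def by blast
    have "(\<lambda>k. kfan ?N (g (d k) n) G) \<longlonglongrightarrow> 0"
      by (rule LIMSEQ_offset[of _ "Suc n"]) (use G(2) in \<open>simp add: add.commute\<close>)
    then show ?thesis using G(1) by blast
  qed
  then have "\<forall>n. \<exists>G. G \<in> Lip1 X \<and> (\<lambda>k. kfan ?N (g (d k) n) G) \<longlonglongrightarrow> 0" by blast
  from choice[OF this] obtain G where G: "\<And>n. G n \<in> Lip1 X" "\<And>n. (\<lambda>k. kfan ?N (g (d k) n) (G n)) \<longlonglongrightarrow> 0" by blast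
  note Gm[measurable] = m[OF G(1)]
  have GM: "(\<lambda>x n. G n x) \<in> borel_measurable ?N"
    by (rule measurable_coordinatewise_then_product) simp
  have "distr N borel (\<lambda>x n. f n x) = distr ?N borel (\<lambda>x n. G n x)"
  proof (rule measure_eq_of_lip_cylinders)
    show "prob_space (distr N borel (\<lambda>x n. f n x))" by (rule N.prob_space_distr[OF vm])
    show "prob_space (distr ?N borel (\<lambda>x n. G n x))" by (rule prob_space_distr[OF GM])
    fix h assume h: "lip_cylinder h"
    note hm = lip_cylinder_measurable[OF h]
    have "(\<lambda>k. integral\<^sup>L ?N (\<lambda>x. h (\<lambda>i. g (d k) i x))) \<longlonglongrightarrow> integral\<^sup>L ?N (\<lambda>x. h (\<lambda>i. G i x))"
      by (rule lip_cylinder_integral_tendsto[OF h gm Gm G(2)])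
    moreover have "(\<lambda>k. integral\<^sup>L ?N (\<lambda>x. h (\<lambda>i. g (d k) i x))) \<longlonglongrightarrow> integral\<^sup>L N (\<lambda>x. h (\<lambda>i. f i x))"
      using LIMSEQ_subseq_LIMSEQ[OF conv[OF h] dm] by (simp add: o_def)
    ultimately have "integral\<^sup>L N (\<lambda>x. h (\<lambda>i. f i x)) = integral\<^sup>L ?N (\<lambda>x. h (\<lambda>i. G i x))"
      using LIMSEQ_unique by blast
    then show "integral\<^sup>L (distr N borel (\<lambda>x n. f n x)) h = integral\<^sup>L (distr ?N borel (\<lambda>x n. G n x)) h"
      by (simp add: integral_distr[OF vm hm] integral_distr[OF GM hm])
  qed simp_all
  then show ?thesis using G(1) by (intro exI[of _ G] conjI allI)
qed

section \<open>Mm-spaces\<close>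

lemma mm_spaceD:
  assumes "mm_space X"
  shows "polish_prob (mtopology_of (mm_metric X)) (mm_measure X)"
    "space (mm_measure X) = mspace (mm_metric X)" "prob_space (mm_measure X)"
    "sets (mm_measure X) = sets (borel_of (mtopology_of (mm_metric X)))"
    "separable_space (mtopology_of (mm_metric X))" "mspace (mm_metric X) \<noteq> {}"
    "mcomplete_of (mm_metric X)"
proof -
  show P: "polish_prob (mtopology_of (mm_metric X)) (mm_measure X)"
    using assms Metric_space.completely_metrizable_space_mtopology[OF Metric_space_mspace_mdist]
    unfolding mm_space_def polish_prob_def mcomplete_of_def mtopology_of_def by blast
  show "space (mm_measure X) = mspace (mm_metric X)" "prob_space (mm_measure X)" "mspace (mm_metric X) \<noteq> {}"
    "sets (mm_measure X) = sets (borel_of (mtopology_of (mm_metric X)))"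
    using polish_probD[OF P] by simp_all
  show "separable_space (mtopology_of (mm_metric X))" "mcomplete_of (mm_metric X)"
    using assms by (simp_all add: mm_space_def)
qed

lemma emm_of_mm_simps [simp]:
  "emm_top (emm_of_mm X) = mtopology_of (mm_metric X)"
  "emm_dist (emm_of_mm X) x y = ennreal (mdist (mm_metric X) x y)"
  "emm_measure (emm_of_mm X) = mm_measure X"
  by (simp_all add: emm_of_mm_def)

lemma emm_space_emm_of_mm:
  assumes X: "mm_space X"
  shows "emm_space (emm_of_mm X)"
proof -
  let ?m = "mm_metric X" and ?T = "mtopology_of (mm_metric X)"
  interpret M: Metric_space "mspace ?m" "mdist ?m" by simp
  have T: "?T = M.mtopology" by (simp add: mtopology_of_def)
  have dist: "extended_distance (mspace ?m) (\<lambda>x y. ennreal (mdist ?m x y))"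
    unfolding extended_distance_def
    by (auto simp: mdist_commute ennreal_plus[symmetric] ennreal_le_iff mdist_triangle ennreal_eq_0_iff
        mdist_nonneg antisym_conv simp del: ennreal_plus)
  have complete: "extended_complete (mspace ?m) (\<lambda>x y. ennreal (mdist ?m x y))"
    unfolding extended_complete_def
  proof (intro allI impI)
    fix s :: "nat \<Rightarrow> 'a"
    assume s: "range s \<subseteq> mspace ?m \<and> (\<forall>e>0. \<exists>N. \<forall>i\<ge>N. \<forall>j\<ge>N. ennreal (mdist ?m (s i) (s j)) < e)"
    have "M.MCauchy s"
      unfolding M.MCauchy_def
    proof (intro conjI allI impI)
      show "range s \<subseteq> mspace ?m" using s by simp
      fix e :: real assume e: "0 < e"
      then have "0 < ennreal e" by simp
      with s obtain N where N: "\<forall>i\<ge>N. \<forall>j\<ge>N. ennreal (mdist ?m (s i) (s j)) < ennreal e" by meson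
      show "\<exists>N. \<forall>n n'. N \<le> n \<longrightarrow> N \<le> n' \<longrightarrow> mdist ?m (s n) (s n') < e"
        by (rule exI[of _ N]) (use N e in \<open>simp add: ennreal_less_iff\<close>)
    qed
    then obtain x where x: "limitin M.mtopology s x sequentially"
      using mm_spaceD(7)[OF X] unfolding mcomplete_of_def M.mcomplete_def by blast
    have "(\<lambda>n. mdist ?m (s n) x) \<longlonglongrightarrow> 0"
      using x unfolding M.limitin_metric_dist_null by simp
    then have "(\<lambda>n. ennreal (mdist ?m (s n) x)) \<longlonglongrightarrow> ennreal 0" by (rule tendsto_ennrealI)
    then show "\<exists>x\<in>mspace ?m. (\<lambda>n. ennreal (mdist ?m (s n) x)) \<longlonglongrightarrow> 0"
      using x unfolding M.limitin_metric_dist_null by (intro bexI[of _ x]) simp_all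
  qed
  have lsc: "lower_semicontinuous_in (prod_topology ?T ?T) (\<lambda>(x, y). ennreal (mdist ?m x y))"
    unfolding lower_semicontinuous_in_def
  proof
    fix a :: ennreal
    have c: "continuous_map (prod_topology ?T ?T) euclideanreal (\<lambda>p. mdist ?m (fst p) (snd p))"
      by (intro continuous_map_mdist continuous_map_fst continuous_map_snd)
    show "openin (prod_topology ?T ?T) {p \<in> topspace (prod_topology ?T ?T). a < (\<lambda>(x, y). ennreal (mdist ?m x y)) p}"
    proof (cases a)
      case (real r)
      have "openin (prod_topology ?T ?T) {p \<in> topspace (prod_topology ?T ?T). mdist ?m (fst p) (snd p) \<in> {r<..}}"
        by (rule openin_continuous_map_preimage[OF c]) simp
      moreover have "{p \<in> topspace (prod_topology ?T ?T). mdist ?m (fst p) (snd p) \<in> {r<..}}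
          = {p \<in> topspace (prod_topology ?T ?T). a < (\<lambda>(x, y). ennreal (mdist ?m x y)) p}"
        using real by (auto simp: ennreal_less_iff)
      ultimately show ?thesis by simp
    next
      case top
      then have "{p \<in> topspace (prod_topology ?T ?T). a < (\<lambda>(x, y). ennreal (mdist ?m x y)) p} = {}" by auto
      then show ?thesis by (simp only: openin_empty)
    qed
  qed
  have fine: "openin (extended_dist_topology (mspace ?m) (\<lambda>x y. ennreal (mdist ?m x y))) U" if Uo: "openin ?T U" for U
    unfolding openin_extended_dist_topology
  proof (intro conjI ballI)
    show "U \<subseteq> mspace ?m" using openin_subset[OF Uo] by simp
    fix x assume x: "x \<in> U"
    obtain r where r: "r > 0" "M.mball x r \<subseteq> U"
      using Uo[unfolded T M.openin_mtopology, THEN conjunct2, rule_format, OF x] by blast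
    have "{y \<in> mspace ?m. ennreal (mdist ?m x y) < ennreal r} \<subseteq> M.mball x r"
      using x openin_subset[OF Uo] r(1) by (auto simp: ennreal_less_iff)
    then show "\<exists>r>0. {y \<in> mspace ?m. ennreal (mdist ?m x y) < r} \<subseteq> U"
      using r by (intro exI[of _ "ennreal r"]) auto
  qed
  show ?thesis
    unfolding emm_space_def emm_of_mm_def emm.sel topspace_mtopology_of
    using dist complete lsc fine mm_spaceD[OF X] by (simp add: polish_prob_def)
qed

lemma closed_sets_measurableI:
  assumes f: "f \<in> space N \<rightarrow> topspace T" and C: "\<And>C. closedin T C \<Longrightarrow> f -` C \<inter> space N \<in> sets N"
  shows "f \<in> measurable N (borel_of T)"
proof (rule measurable_borel_ofI[OF f])
  fix U assume U: "openin T U"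
  have "f -` U \<inter> space N = space N - (f -` (topspace T - U) \<inter> space N)"
    using f by auto
  also have "\<dots> \<in> sets N"
    using C[of "topspace T - U"] U by (intro sets.compl_sets) blast
  finally show "f -` U \<inter> space N \<in> sets N" .
qed

lemma support_closed: "closedin T (measure_support T M)"
proof -
  have "openin T (topspace T - measure_support T M)"
  proof (subst openin_subopen, intro ballI)
    fix x assume x: "x \<in> topspace T - measure_support T M"
    then obtain U where U: "openin T U" "x \<in> U" "\<not> 0 < emeasure M U" unfolding measure_support_def by blast
    have "U \<subseteq> topspace T - measure_support T M"
      using U openin_subset[OF U(1)] unfolding measure_support_def by blast
    then show "\<exists>V. openin T V \<and> x \<in> V \<and> V \<subseteq> topspace T - measure_support T M" using U by blast
  qed
  moreover have "measure_support T M \<subseteq> topspace T" unfolding measure_support_def by blast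
  ultimately show ?thesis by (simp add: closedin_def)
qed

text \<open>The complement of the support is covered by those members of a countable base that have
  measure 0.\<close>

lemma support_AE:
  assumes P: "polish_prob T M"
  shows "AE x in M. x \<in> measure_support T M"
proof -
  have "second_countable T"
    using P completely_metrizable_imp_metrizable_space separable_metrizable_second_countable
    unfolding polish_prob_def by blast
  then obtain \<B> where \<B>: "countable \<B> \<and> (\<forall>V\<in>\<B>. openin T V) \<and> (\<forall>U x. openin T U \<and> x \<in> U \<longrightarrow> (\<exists>V\<in>\<B>. x \<in> V \<and> V \<subseteq> U))"
    unfolding second_countable_def ..
  define \<N> where "\<N> = {V \<in> \<B>. emeasure M V = 0}"
  have m: "U \<in> sets M" if "openin T U" for U using borel_of_open[OF that] polish_probD(1)[OF P] by simp
  have "(\<Union>V\<in>\<N>. V) \<in> null_sets M"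
  proof (rule null_sets_UN')
    show "countable \<N>" using \<B> unfolding \<N>_def by simp
    show "V \<in> null_sets M" if "V \<in> \<N>" for V using that \<B> m unfolding \<N>_def by (intro null_setsI) auto
  qed
  then have "AE x in M. x \<notin> (\<Union>V\<in>\<N>. V)" by (rule AE_not_in)
  then show ?thesis
  proof (rule AE_mp, intro AE_I2 impI)
    fix x assume x: "x \<in> space M" "x \<notin> (\<Union>V\<in>\<N>. V)"
    show "x \<in> measure_support T M"
      unfolding measure_support_def
    proof (intro CollectI conjI allI impI)
      show "x \<in> topspace T" using x(1) polish_probD(2)[OF P] by simp
      fix U assume U: "openin T U \<and> x \<in> U"
      then obtain V where V: "V \<in> \<B>" "x \<in> V" "V \<subseteq> U" using \<B> by meson
      then have "emeasure M V \<noteq> 0" using x(2) unfolding \<N>_def by blast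
      moreover have "emeasure M V \<le> emeasure M U" using V U m by (intro emeasure_mono) auto
      ultimately show "0 < emeasure M U" by (metis le_zero_eq zero_less_iff_neq_zero)
    qed
  qed
qed

lemma support_subset_closed:
  assumes P: "polish_prob T M" and C: "closedin T C" and ae: "AE x in M. x \<in> C"
  shows "measure_support T M \<subseteq> C"
proof
  fix x assume x: "x \<in> measure_support T M"
  show "x \<in> C"
  proof (rule ccontr)
    assume "x \<notin> C"
    have o: "openin T (topspace T - C)" using C by blast
    have xx: "x \<in> topspace T - C" using x \<open>x \<notin> C\<close> unfolding measure_support_def by blast
    have pos: "0 < emeasure M (topspace T - C)" using x o xx unfolding measure_support_def by blast
    have "topspace T - C \<in> sets M" using borel_of_open[OF o] polish_probD(1)[OF P] by simp
    moreover have "AE x in M. x \<notin> topspace T - C" using ae by eventually_elim simp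
    ultimately have "emeasure M (topspace T - C) = 0"
      by (subst (asm) AE_iff_null_sets[symmetric]) auto
    then show False using pos by simp
  qed
qed

lemma mm_iso_imp_emm_iso:
  assumes X: "mm_space X" and XY: "mm_iso X Y"
  shows "emm_iso (emm_of_mm X) (emm_of_mm Y)"
proof -
  let ?S = "measure_support (mtopology_of (mm_metric X)) (mm_measure X)"
  obtain F where F: "F \<in> measurable (mm_measure X) (mm_measure Y)" and
     F2: "distr (mm_measure X) (mm_measure Y) F = mm_measure Y \<and>
        (\<forall>x\<in>?S. \<forall>y\<in>?S. mdist (mm_metric Y) (F x) (F y) = mdist (mm_metric X) x y)"
    using XY unfolding mm_iso_def Let_def ..
  show ?thesis
    unfolding emm_iso_iff[OF emm_space_emm_of_mm[OF X]] emm_of_mm_simps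
  proof (intro exI[of _ F] conjI exI[of _ ?S])
    show "F \<in> measurable (completion (mm_measure X)) (mm_measure Y)" by (rule measurable_completion[OF F])
    show "distr (completion (mm_measure X)) (mm_measure Y) F = mm_measure Y"
      using distr_completion[OF F] F2 by simp
    show "AE x in completion (mm_measure X). x \<in> ?S" by (rule AE_completion[OF support_AE[OF mm_spaceD(1)[OF X]]])
    show "\<forall>x\<in>?S. \<forall>y\<in>?S. ennreal (mdist (mm_metric Y) (F x) (F y)) = ennreal (mdist (mm_metric X) x y)"
      using F2 by simp
  qed
qed

lemma mm_iso_refl: "mm_iso X X"
  unfolding mm_iso_def by (intro bexI[of _ "\<lambda>x. x"]) (simp_all add: distr_id2 Let_def)

text \<open>The image of the support under the isomorphism is complete, hence closed, and of full measure.\<close>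

lemma mm_iso_sym:
  assumes X: "mm_space X" and Y: "mm_space Y" and XY: "mm_iso X Y"
  shows "mm_iso Y X"
proof -
  let ?mX = "mm_metric X" and ?mY = "mm_metric Y"
  let ?TX = "mtopology_of ?mX" and ?TY = "mtopology_of ?mY"
  let ?S = "measure_support ?TX (mm_measure X)"
  interpret MX: Metric_space "mspace ?mX" "mdist ?mX" by simp
  interpret MY: Metric_space "mspace ?mY" "mdist ?mY" by simp
  have TX: "?TX = MX.mtopology" and TY: "?TY = MY.mtopology" by (simp_all add: mtopology_of_def)
  obtain F where F: "F \<in> measurable (mm_measure X) (mm_measure Y)" and
     F2: "distr (mm_measure X) (mm_measure Y) F = mm_measure Y \<and>
        (\<forall>x\<in>?S. \<forall>y\<in>?S. mdist ?mY (F x) (F y) = mdist ?mX x y)"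
    using XY unfolding mm_iso_def Let_def ..
  have Fd: "distr (mm_measure X) (mm_measure Y) F = mm_measure Y" using F2 by simp
  have Fi: "mdist ?mY (F x) (F y) = mdist ?mX x y" if "x \<in> ?S" "y \<in> ?S" for x y using F2 that by simp
  have SX: "?S \<subseteq> mspace ?mX" unfolding measure_support_def by auto
  have Fsp: "F x \<in> mspace ?mY" if "x \<in> mspace ?mX" for x
    using measurable_space[OF F, of x] that mm_spaceD(2)[OF X] mm_spaceD(2)[OF Y] by simp
  have Sc: "closedin ?TX ?S" by (rule support_closed)
  \<comment> \<open>Proved for every closed \<open>C\<close>, because preimages under the inverse
    \<open>G\<close> are such images. A sequence in the image that converges pulls back to a Cauchy
    sequence, which has a limit by completeness of \<open>X\<close>.\<close>
  have closed: "closedin ?TY (F ` (C \<inter> ?S))" if C: "closedin ?TX C" for C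
    unfolding TY MY.metric_closedin_iff_sequentially_closed
  proof (intro conjI allI impI)
    show "F ` (C \<inter> ?S) \<subseteq> mspace ?mY" using Fsp SX by blast
    fix \<sigma> l assume \<sigma>: "range \<sigma> \<subseteq> F ` (C \<inter> ?S) \<and> limitin MY.mtopology \<sigma> l sequentially"
    then have "\<forall>n. \<exists>x. x \<in> C \<inter> ?S \<and> \<sigma> n = F x" by blast
    from choice[OF this] obtain x where x: "\<forall>n. x n \<in> C \<inter> ?S \<and> \<sigma> n = F (x n)" ..
    have xX: "x n \<in> mspace ?mX" for n using x SX by blast
    have r\<sigma>: "range \<sigma> \<subseteq> mspace ?mY" using x xX Fsp by auto
    have "MY.MCauchy \<sigma>" by (rule MY.convergent_imp_MCauchy[OF r\<sigma> conjunct2[OF \<sigma>]])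
    then have "MX.MCauchy x"
      unfolding MX.MCauchy_def MY.MCauchy_def using x Fi xX by auto
    then obtain z where z: "limitin MX.mtopology x z sequentially"
      using mm_spaceD(7)[OF X] unfolding mcomplete_of_def MX.mcomplete_def by blast
    have "closedin MX.mtopology (C \<inter> ?S)" using C Sc TX by (simp add: closedin_Int)
    then have zC: "z \<in> C \<inter> ?S"
      using z x unfolding MX.metric_closedin_iff_sequentially_closed by blast
    have "(\<lambda>n. mdist ?mX (x n) z) \<longlonglongrightarrow> 0" using z unfolding MX.limitin_metric_dist_null by simp
    moreover have "mdist ?mY (\<sigma> n) (F z) = mdist ?mX (x n) z" for n
      using x zC Fi by simp
    ultimately have "limitin MY.mtopology \<sigma> (F z) sequentially"
      unfolding MY.limitin_metric_dist_null using Fsp zC SX range_subsetD[OF r\<sigma>]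
      by (intro conjI always_eventually allI) auto
    then have "l = F z" using MY.limitin_metric_unique \<sigma> by (metis trivial_limit_sequentially)
    then show "l \<in> F ` (C \<inter> ?S)" using zC by blast
  qed
  define B where "B = F ` ?S"
  have Bc: "closedin ?TY B" using closed[OF Sc] by (simp add: B_def)
  have mYs: "C \<in> sets (mm_measure Y)" if "closedin ?TY C" for C using borel_of_closed[OF that] mm_spaceD(4)[OF Y] by simp
  have AES: "AE x in mm_measure X. x \<in> ?S" by (rule support_AE[OF mm_spaceD(1)[OF X]])
  have AEB: "AE y in mm_measure Y. y \<in> B"
  proof -
    have "AE x in mm_measure X. F x \<in> B" using AES by eventually_elim (simp add: B_def)
    then have "AE y in distr (mm_measure X) (mm_measure Y) F. y \<in> B"
      by (subst AE_distr_iff[OF F]) (use mYs[OF Bc] in auto)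
    then show ?thesis unfolding Fd .
  qed
  have inj: "inj_on F ?S"
  proof (rule inj_onI)
    fix x y assume "x \<in> ?S" "y \<in> ?S" "F x = F y"
    then show "x = y" using Fi[of x y] SX Fsp[of y] by (metis mdist_zero subsetD)
  qed
  obtain x0 where x0: "x0 \<in> mspace ?mX" using mm_spaceD(6)[OF X] by blast
  define G where "G y = (if y \<in> B then inv_into ?S F y else x0)" for y
  have GS: "G y \<in> ?S" "F (G y) = y" if "y \<in> B" for y
    using that by (auto simp: G_def B_def inv_into_into f_inv_into_f)
  have GF: "G (F x) = x" if "x \<in> ?S" for x
    using that inj by (auto simp: G_def B_def)
  have Gm0: "G \<in> measurable (mm_measure Y) (borel_of ?TX)"
  proof (rule closed_sets_measurableI)
    show "G \<in> space (mm_measure Y) \<rightarrow> topspace ?TX"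
    proof
      fix y show "G y \<in> topspace ?TX"
        using GS(1)[of y] SX x0 by (cases "y \<in> B") (auto simp: G_def)
    qed
    fix C assume C: "closedin ?TX C"
    have "G -` C \<inter> space (mm_measure Y) = F ` (C \<inter> ?S) \<union> (if x0 \<in> C then space (mm_measure Y) - B else {})"
    proof (intro set_eqI iffI)
      fix y assume y: "y \<in> G -` C \<inter> space (mm_measure Y)"
      show "y \<in> F ` (C \<inter> ?S) \<union> (if x0 \<in> C then space (mm_measure Y) - B else {})"
      proof (cases "y \<in> B")
        case True
        then have "y = F (G y)" "G y \<in> C \<inter> ?S" using GS[OF True] y by auto
        then show ?thesis by blast
      next
        case False then show ?thesis using y by (auto simp: G_def)
      qed
    next
      fix y assume y: "y \<in> F ` (C \<inter> ?S) \<union> (if x0 \<in> C then space (mm_measure Y) - B else {})"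
      show "y \<in> G -` C \<inter> space (mm_measure Y)"
      proof (cases "y \<in> F ` (C \<inter> ?S)")
        case True
        then obtain x where x: "x \<in> C" "x \<in> ?S" "y = F x" by blast
        then show ?thesis using GF[OF x(2)] Fsp SX mm_spaceD(2)[OF Y] by auto
      next
        case False
        then have "x0 \<in> C" "y \<in> space (mm_measure Y) - B" using y by (auto split: if_splits)
        then show ?thesis by (simp add: G_def)
      qed
    qed
    also have "\<dots> \<in> sets (mm_measure Y)"
      using mYs[OF closed[OF C]] sets.compl_sets[OF mYs[OF Bc]] by auto
    finally show "G -` C \<inter> space (mm_measure Y) \<in> sets (mm_measure Y)" .
  qed
  then have Gm: "G \<in> measurable (mm_measure Y) (mm_measure X)"
    using measurable_cong_sets[OF refl mm_spaceD(4)[OF X]] by blast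
  have "distr (mm_measure Y) (mm_measure X) G = distr (mm_measure X) (mm_measure X) (G \<circ> F)"
    using distr_distr[OF Gm F] Fd by simp
  also have "\<dots> = distr (mm_measure X) (mm_measure X) (\<lambda>x. x)"
  proof (rule distr_cong_AE[OF refl refl])
    show "AE x in mm_measure X. (G \<circ> F) x = x" using AES by eventually_elim (simp add: GF)
  qed (use F Gm in simp_all)
  also have "\<dots> = mm_measure X" by (simp add: distr_id2)
  finally have Gd: "distr (mm_measure Y) (mm_measure X) G = mm_measure X" .
  have SB: "measure_support ?TY (mm_measure Y) \<subseteq> B"
    by (rule support_subset_closed[OF mm_spaceD(1)[OF Y] Bc AEB])
  have "mdist ?mX (G x) (G y) = mdist ?mY x y" if "x \<in> B" "y \<in> B" for x y
    using Fi[OF GS(1)[OF that(1)] GS(1)[OF that(2)]] GS(2) that by simp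
  then show ?thesis
    unfolding mm_iso_def Let_def using Gm Gd SB by (intro bexI[of _ G] conjI ballI) auto
qed

text \<open>Membership in the sets of a countable base, summed as a ternary series, codes the points
  injectively and measurably by reals. The coded law on the line is the image of Lebesgue measure
  under its quantile function, and decoding is measurable by
  \<open>polish_injection_inverse\<close>.\<close>

lemma polish_prob_parameter:
  assumes P: "polish_prob T M"
  shows "\<exists>\<iota>. \<iota> \<in> measurable unit_leb M \<and> distr unit_leb M \<iota> = M"
proof -
  interpret prob_space M using polish_probD[OF P] by simp
  interpret C: prob_space "completion M" using polish_probD[OF P] by simp
  have spM: "space M = topspace T" and sM: "sets M = sets (borel_of T)" and HT: "Hausdorff_space T"
    using polish_probD[OF P] by auto
  have "second_countable T"
    using P completely_metrizable_imp_metrizable_space separable_metrizable_second_countable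
    unfolding polish_prob_def by blast
  then obtain \<B> where \<B>: "countable \<B> \<and> (\<forall>V\<in>\<B>. openin T V) \<and> (\<forall>U x. openin T U \<and> x \<in> U \<longrightarrow> (\<exists>V\<in>\<B>. x \<in> V \<and> V \<subseteq> U))"
    unfolding second_countable_def ..
  define V where "V = from_nat_into (insert {} \<B>)"
  have rV: "range V = insert {} \<B>"
    unfolding V_def by (rule range_from_nat_into) (use \<B> in auto)
  have Vm: "V n \<in> sets M" for n
  proof -
    have "openin T (V n)" using rV \<B> by (metis insertE openin_empty rangeI)
    then show ?thesis using borel_of_open sM by blast
  qed
  define h where "h x = (\<Sum>k. if k \<in> {n. x \<in> V n} then (1/3::real) ^ k else 0)" for x
  have hm: "h \<in> borel_measurable M"
    unfolding h_def mem_Collect_eq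
    by (intro borel_measurable_suminf measurable_If borel_measurable_const) (use Vm in auto)
  have inj: "inj_on h (space M)"
  proof (rule inj_onI, rule ccontr)
    fix x y assume xy: "x \<in> space M" "y \<in> space M" "h x = h y" "x \<noteq> y"
    from injD[OF inj_ternary_series xy(3)[unfolded h_def]] have eq: "{n. x \<in> V n} = {n. y \<in> V n}" .
    have "x \<in> topspace T \<and> y \<in> topspace T \<and> x \<noteq> y" using xy spM by simp
    from HT[unfolded Hausdorff_space_def, rule_format, OF this]
    obtain U W where UW: "openin T U" "openin T W" "x \<in> U" "y \<in> W" "disjnt U W"
      by blast
    from \<B>[THEN conjunct2, THEN conjunct2, rule_format, OF conjI[OF UW(1,3)]]
    obtain B where B: "B \<in> \<B>" "x \<in> B" "B \<subseteq> U" by blast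
    have "B \<in> range V" unfolding rV using B(1) by simp
    then obtain n where "B = V n" by blast
    then have "y \<in> B" using eq B(2) by blast
    then show False using B(3) UW(4,5) unfolding disjnt_def by blast
  qed
  have "h \<in> measurable (completion M) (borel_of euclidean)"
    using measurable_completion[OF hm] measurable_cong_sets[OF refl sets_borel_of_euclidean] by blast
  note hc = this
  have spA: "space M \<in> sets (completion M)" "measure (completion M) (space M) = 1"
    using prob_space by auto
  from polish_injection_inverse[OF P Hausdorff_space_euclidean second_countable_euclidean hc spA inj]
  obtain B where "\<exists>G. B \<in> sets (borel_of euclidean) \<and> G \<in> measurable (borel_of euclidean) M \<and>
    (\<forall>y\<in>B. G y \<in> space M \<and> h (G y) = y) \<and> (AE x in completion M. h x \<in> B)" ..
  then obtain G where BG: "B \<in> sets (borel_of euclidean) \<and> G \<in> measurable (borel_of euclidean) M \<and>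
    (\<forall>y\<in>B. G y \<in> space M \<and> h (G y) = y) \<and> (AE x in completion M. h x \<in> B)" ..
  have G: "G \<in> measurable borel M"
    using BG measurable_cong_sets[OF sets_borel_of_euclidean refl] by blast
  have AEB: "AE x in M. h x \<in> B"
    using BG AE_completion_iff[of "\<lambda>x. h x \<in> B"] by simp
  have AEid: "AE x in M. G (h x) = x"
    using AEB AE_space
  proof eventually_elim
    case (elim x)
    have "G (h x) \<in> space M" "h (G (h x)) = h x" using BG elim(1) by simp_all
    then show ?case using inj_onD[OF inj _ _ elim(2)] by simp
  qed
  let ?\<nu> = "distr M borel h"
  have "real_distribution ?\<nu>"
    by (rule real_distribution_distr[OF hm])
  then interpret \<nu>: cdf_distribution ?\<nu> by (simp add: cdf_distribution_def)
  \<comment> \<open>The quantile function \<open>\<nu>.I\<close> is used on the open interval only;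
    the remaining point 0 of the parameter interval is a null set and gets an arbitrary
    value.\<close>
  define J where "J s = (if s \<in> {0<..<1} then \<nu>.I s else 0)" for s :: real
  have Jb: "J \<in> borel_measurable borel"
    unfolding J_def using \<nu>.measurable_CI by (subst measurable_restrict_space_iff[symmetric]) auto
  have J: "J \<in> borel_measurable unit_leb"
    using Jb by (intro measurable_restrict_space1) simp
  have "distr unit_leb borel J = ?\<nu>"
  proof (rule measure_eqI)
    fix A :: "real set" assume "A \<in> sets (distr unit_leb borel J)"
    then have A: "A \<in> sets borel" by simp
    have m1: "J -` A \<inter> {0..<1} \<in> sets lborel" using measurable_sets[OF Jb A] by simp
    have m2: "\<nu>.I -` A \<inter> {0<..<1} \<in> sets lborel"
    proof -
      have "\<nu>.I -` A \<inter> {0<..<1} = J -` A \<inter> {0<..<1}" by (auto simp: J_def)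
      then show ?thesis using measurable_sets[OF Jb A] by simp
    qed
    have "emeasure (distr unit_leb borel J) A = emeasure unit_leb (J -` A \<inter> space unit_leb)"
      by (rule emeasure_distr[OF J A])
    also have "\<dots> = emeasure lborel (J -` A \<inter> {0..<1})"
      by (subst emeasure_restrict_space) (auto simp: space_restrict_space)
    also have "\<dots> = emeasure lborel (\<nu>.I -` A \<inter> {0<..<1})"
      by (rule emeasure_eq_AE[OF _ m1 m2]) (use AE_lborel_singleton[of "0::real"] in \<open>auto simp: J_def\<close>)
    also have "\<dots> = emeasure (distr (restrict_space lborel {0<..<1}) borel \<nu>.I) A"
      using A \<nu>.measurable_CI by (subst emeasure_distr) (auto simp: space_restrict_space emeasure_restrict_space
        measurable_cong_sets[OF sets_restrict_space_cong[OF sets_lborel] refl])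
    also have "\<dots> = emeasure ?\<nu> A" using \<nu>.distr_I_eq_M by simp
    finally show "emeasure (distr unit_leb borel J) A = emeasure ?\<nu> A" .
  qed simp
  then have "distr unit_leb M (G \<circ> J) = distr M M (G \<circ> h)"
    using distr_distr[OF G J] distr_distr[OF G hm] by simp
  also have "\<dots> = distr M M (\<lambda>x. x)"
  proof (rule distr_cong_AE[OF refl refl])
    show "AE x in M. (G \<circ> h) x = x" using AEid by simp
  qed (use hm G in simp_all)
  finally show ?thesis
    using measurable_comp[OF J G] by (intro exI[of _ "G \<circ> J"]) (simp add: distr_id2)
qed

lemma parameters_nonempty: "mm_space X \<Longrightarrow> parameters X \<noteq> {}"
  using polish_prob_parameter[OF mm_spaceD(1)] unfolding parameters_def by blast

section \<open>Lipschitz functions on mm-spaces\<close>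

lemma lipschitz_measurable:
  assumes X: "mm_space X" and g: "\<And>x y. x \<in> mspace (mm_metric X) \<Longrightarrow> y \<in> mspace (mm_metric X) \<Longrightarrow>
    \<bar>g x - g y\<bar> \<le> mdist (mm_metric X) x y"
  shows "g \<in> borel_measurable (mm_measure X)"
proof -
  have "Lipschitz_continuous_map (mm_metric X) euclidean_metric g"
    unfolding Lipschitz_continuous_map_def
    by (intro conjI exI[of _ 1] ballI) (use g in \<open>auto simp: dist_real_def\<close>)
  then have "continuous_map (mtopology_of (mm_metric X)) euclidean g"
    using Lipschitz_continuous_imp_continuous_map by fastforce
  then have "g \<in> measurable (borel_of (mtopology_of (mm_metric X))) (borel_of euclidean)"
    by (rule continuous_map_measurable)
  then show ?thesis
    using measurable_cong_sets[OF mm_spaceD(4)[OF X, symmetric] sets_borel_of_euclidean] by blast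
qed

lemma lipschitz_in_Lip1:
  assumes X: "mm_space X" and g: "\<And>x y. x \<in> mspace (mm_metric X) \<Longrightarrow> y \<in> mspace (mm_metric X) \<Longrightarrow>
    \<bar>g x - g y\<bar> \<le> mdist (mm_metric X) x y"
  shows "g \<in> Lip1 (emm_of_mm X)"
  unfolding Lip1_iff[OF emm_space_emm_of_mm[OF X]] emm_of_mm_simps
proof (intro conjI exI[of _ "mspace (mm_metric X)"] ballI)
  show "g \<in> borel_measurable (completion (mm_measure X))"
    by (rule measurable_completion[OF lipschitz_measurable[OF X g]])
  show "AE x in completion (mm_measure X). x \<in> mspace (mm_metric X)"
    using mm_spaceD(2)[OF X] by (intro AE_I2) simp
  show "ennreal \<bar>g x - g y\<bar> \<le> ennreal (mdist (mm_metric X) x y)"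
    if "x \<in> mspace (mm_metric X)" "y \<in> mspace (mm_metric X)" for x y
    by (rule ennreal_leI[OF g[OF that]])
qed

text \<open>McShane's infimum formula yields a 1-Lipschitz function whatever \<open>F\<close> is, as
  long as it is finite; the slack \<open>\<epsilon>\<close> only lets it drop below \<open>F\<close>
  on \<open>E\<close>. With \<open>\<epsilon> = 0\<close> this is an extension, with
  \<open>\<epsilon> > 0\<close> it repairs functions carried over by an almost isometry.\<close>

lemma mcshane_extension:
  assumes E: "E \<subseteq> mspace m" "E \<noteq> {}" and \<epsilon>: "0 \<le> \<epsilon>"
    and F: "\<And>x y. x \<in> E \<Longrightarrow> y \<in> E \<Longrightarrow> \<bar>F x - F y\<bar> \<le> mdist m x y + \<epsilon>"
  shows "\<exists>g. (\<forall>x\<in>mspace m. \<forall>y\<in>mspace m. \<bar>g x - g y\<bar> \<le> mdist m x y) \<and> (\<forall>x\<in>E. \<bar>g x - F x\<bar> \<le> \<epsilon>)"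
proof -
  define g where "g x = (INF e\<in>E. F e + mdist m x e)" for x
  obtain e0 where e0: "e0 \<in> E" using E(2) by blast
  have bdd: "bdd_below ((\<lambda>e. F e + mdist m x e) ` E)" if x: "x \<in> mspace m" for x
  proof (rule bdd_belowI2)
    fix e assume e: "e \<in> E"
    have "mdist m e0 e \<le> mdist m e0 x + mdist m x e"
      by (rule mdist_triangle[OF subsetD[OF E(1) e0] x subsetD[OF E(1) e]])
    then show "F e0 - mdist m e0 x - \<epsilon> \<le> F e + mdist m x e"
      using F[OF e0 e] by linarith
  qed
  have le: "g x \<le> F e + mdist m x e" if "x \<in> mspace m" "e \<in> E" for x e
    unfolding g_def by (rule cINF_lower[OF bdd[OF that(1)] that(2)])
  have ge: "c \<le> g x" if "\<And>e. e \<in> E \<Longrightarrow> c \<le> F e + mdist m x e" for c x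
    unfolding g_def using E(2) that by (rule cINF_greatest)
  have lip: "g x - mdist m x y \<le> g y" if xy: "x \<in> mspace m" "y \<in> mspace m" for x y
  proof (rule ge)
    fix e assume e: "e \<in> E"
    have "mdist m x e \<le> mdist m x y + mdist m y e" by (rule mdist_triangle[OF xy subsetD[OF E(1) e]])
    then show "g x - mdist m x y \<le> F e + mdist m y e" using le[OF xy(1) e] by linarith
  qed
  have "\<bar>g x - g y\<bar> \<le> mdist m x y" if "x \<in> mspace m" "y \<in> mspace m" for x y
    using lip[OF that] lip[OF that(2,1)] mdist_commute[of m x y] by linarith
  moreover have "\<bar>g x - F x\<bar> \<le> \<epsilon>" if x: "x \<in> E" for x
  proof -
    have xm: "x \<in> mspace m" using x E(1) by blast
    have "mdist m x x = 0" using xm by simp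
    then have "g x \<le> F x" using le[OF xm x] by simp
    moreover have "F x - \<epsilon> \<le> g x"
    proof (rule ge)
      fix e assume "e \<in> E"
      from F[OF x this] show "F x - \<epsilon> \<le> F e + mdist m x e" by linarith
    qed
    ultimately show ?thesis using \<epsilon> by linarith
  qed
  ultimately show ?thesis by (intro exI[of _ g] conjI ballI)
qed

text \<open>In a finite separable metric every class has a representative that is Lipschitz
  everywhere and vanishes at \<open>a\<close>. Ascoli's argument gives a pointwise convergent
  subsequence, which converges in the Ky Fan distance. This puts the spaces \<open>L1\<close> of all
  members of a pyramid among the compact ones.\<close>

lemma L1_mm_compact:
  assumes X: "mm_space X"
  shows "compact_space (mtopology_of (L1 (emm_of_mm X)))"
proof -
  let ?X = "emm_of_mm X" and ?m = "mm_metric X" and ?N = "completion (mm_measure X)"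
  note eX = emm_space_emm_of_mm[OF X]
  interpret prob_space ?N using emm_spaceD(3)[OF eX] by simp
  interpret L: Metric_space "mspace (L1 ?X)" "mdist (L1 ?X)" by simp
  have L0: "h \<in> Lip1 ?X \<Longrightarrow> h \<in> L0 ?X" for h using Lip1_subset_L0 by blast
  have Lm: "h \<in> Lip1 ?X \<Longrightarrow> h \<in> borel_measurable ?N" for h using L0 by (simp add: L0_def)
  obtain a where a: "a \<in> mspace ?m" using mm_spaceD(6)[OF X] by blast
  have rep: "\<exists>h. (\<forall>x\<in>mspace ?m. \<forall>y\<in>mspace ?m. \<bar>h x - h y\<bar> \<le> mdist ?m x y) \<and> h a = 0 \<and> c = L1_class ?X h"
    if c: "c \<in> mspace (L1 ?X)" for c
  proof -
    obtain f where f: "f \<in> Lip1 ?X" "c = L1_class ?X f" using c unfolding mspace_L1[OF eX] by blast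
    from f(1)[unfolded Lip1_def L0_def mem_Collect_eq, THEN conjunct2]
    obtain E where E: "E \<in> sets (emm_completion ?X)" "emeasure (emm_completion ?X) E = 1 \<and>
      (\<forall>x\<in>E. \<forall>y\<in>E. ennreal \<bar>f x - f y\<bar> \<le> emm_dist ?X x y)" ..
    have Es: "E \<subseteq> mspace ?m" using sets.sets_into_space[OF E(1)] mm_spaceD(2)[OF X] by simp
    have Ene: "E \<noteq> {}" using E(2) by auto
    have lip: "\<bar>f x - f y\<bar> \<le> mdist ?m x y + 0" if "x \<in> E" "y \<in> E" for x y
    proof -
      have "ennreal \<bar>f x - f y\<bar> \<le> ennreal (mdist ?m x y)" using E(2) that by simp
      then show ?thesis by (simp add: ennreal_le_iff)
    qed
    obtain g where g: "(\<forall>x\<in>mspace ?m. \<forall>y\<in>mspace ?m. \<bar>g x - g y\<bar> \<le> mdist ?m x y) \<and> (\<forall>x\<in>E. \<bar>g x - f x\<bar> \<le> 0)"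
      using mcshane_extension[OF Es Ene order_refl lip] ..
    define h where "h x = g x - g a" for x
    have h: "\<forall>x\<in>mspace ?m. \<forall>y\<in>mspace ?m. \<bar>h x - h y\<bar> \<le> mdist ?m x y" using g by (simp add: h_def)
    have hL: "h \<in> Lip1 ?X" by (rule lipschitz_in_Lip1[OF X]) (use h in simp)
    have "AE x in emm_completion ?X. x \<in> E"
      unfolding emm_of_mm_simps by (rule AE_of_full_set) (use E in simp_all)
    then have "AE x in emm_completion ?X. f x = h x + g a"
      by eventually_elim (use g in \<open>simp add: h_def\<close>)
    then have "L1_class ?X f = L1_class ?X h"
      using L1_class_eq_iff[OF eX L0[OF f(1)] L0[OF hL]] by blast
    then show ?thesis using h f(2) by (intro exI[of _ h]) (simp add: h_def)
  qed
  show ?thesis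
    unfolding mtopology_of_def L.compact_space_sequentially
  proof (intro allI impI)
    fix \<sigma> :: "nat \<Rightarrow> ('a \<Rightarrow> real) set" assume \<sigma>: "range \<sigma> \<subseteq> mspace (L1 ?X)"
    have "\<forall>n. \<exists>h. (\<forall>x\<in>mspace ?m. \<forall>y\<in>mspace ?m. \<bar>h x - h y\<bar> \<le> mdist ?m x y) \<and> h a = 0 \<and> \<sigma> n = L1_class ?X h"
      using \<sigma> by (intro allI rep) blast
    from choice[OF this] obtain h where h: "\<forall>n. (\<forall>x\<in>mspace ?m. \<forall>y\<in>mspace ?m. \<bar>h n x - h n y\<bar> \<le> mdist ?m x y) \<and> h n a = 0 \<and> \<sigma> n = L1_class ?X (h n)" ..
    have lip: "\<bar>h n x - h n y\<bar> \<le> mdist ?m x y" if "x \<in> mspace ?m" "y \<in> mspace ?m" for n x y using h that by simp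
    have bd: "\<bar>h n a\<bar> \<le> 0" for n using h by simp
    have "\<exists>r g. strict_mono (r :: nat \<Rightarrow> nat) \<and> (\<forall>x\<in>mspace ?m. (\<lambda>k. h (r k) x) \<longlonglongrightarrow> g x)"
    proof (rule lipschitz_pointwise_convergent_subsequence[where f = h, OF mm_spaceD(5)[OF X] lip a bd])
      fix r g assume "strict_mono (r :: nat \<Rightarrow> nat)" "\<And>x. x \<in> mspace ?m \<Longrightarrow> (\<lambda>k. h (r k) x) \<longlonglongrightarrow> g x"
      then show "\<exists>r g. strict_mono (r :: nat \<Rightarrow> nat) \<and> (\<forall>x\<in>mspace ?m. (\<lambda>k. h (r k) x) \<longlonglongrightarrow> g x)"
        by (intro exI[of _ r] exI[of _ g]) simp
    qed
    then obtain r g where r: "strict_mono (r :: nat \<Rightarrow> nat)" and g: "\<And>x. x \<in> mspace ?m \<Longrightarrow> (\<lambda>k. h (r k) x) \<longlonglongrightarrow> g x" by blast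
    have g_lip: "\<bar>g x - g y\<bar> \<le> mdist ?m x y" if "x \<in> mspace ?m" "y \<in> mspace ?m" for x y
    proof (rule LIMSEQ_le_const2)
      show "(\<lambda>k. \<bar>h (r k) x - h (r k) y\<bar>) \<longlonglongrightarrow> \<bar>g x - g y\<bar>" by (intro tendsto_intros g that)
    qed (use lip[OF that] in blast)
    have gL: "g \<in> Lip1 ?X" by (rule lipschitz_in_Lip1[OF X g_lip])
    have hL: "h n \<in> Lip1 ?X" for n by (rule lipschitz_in_Lip1[OF X lip])
    have "AE x in ?N. x \<in> mspace ?m" using mm_spaceD(2)[OF X] by (intro AE_I2) simp
    then have "AE x in ?N. (\<lambda>k. h (r k) x) \<longlonglongrightarrow> g x" by eventually_elim (rule g)
    from kfan_tendsto_zero[OF Lm[OF hL] Lm[OF gL] this]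
    have lim: "(\<lambda>k. kfan ?N (h (r k)) g) \<longlonglongrightarrow> 0" .
    have "(\<lambda>k. kfan_mod ?N (h (r k)) g) \<longlonglongrightarrow> 0"
      by (rule tendsto_sandwich[OF _ _ tendsto_const lim]) (simp_all add: kfan_mod_nonneg kfan_mod_le0)
    then have "(\<lambda>k. mdist (L1 ?X) (\<sigma> (r k)) (L1_class ?X g)) \<longlonglongrightarrow> 0"
      using mdist_L1[OF eX L0[OF hL] L0[OF gL]] h by simp
    moreover have gm: "L1_class ?X g \<in> mspace (L1 ?X)" using gL unfolding mspace_L1[OF eX] by (rule imageI)
    moreover have "\<sigma> (r k) \<in> mspace (L1 ?X)" for k using \<sigma> by blast
    ultimately have "limitin L.mtopology (\<sigma> \<circ> r) (L1_class ?X g) sequentially"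
      unfolding L.limitin_metric_dist_null o_def by (intro conjI always_eventually allI)
    then show "\<exists>l r. l \<in> mspace (L1 ?X) \<and> strict_mono r \<and> limitin L.mtopology (\<sigma> \<circ> r) l sequentially"
      using gm r by (intro exI[of _ "L1_class ?X g"] exI[of _ r] conjI)
  qed
qed

section \<open>Classes of mm-spaces and the box distance\<close>

definition mm_class :: "real mm \<Rightarrow> real mm set" where
  "mm_class X = {(X, Y). mm_space X \<and> mm_space Y \<and> mm_iso X Y} `` {X}"

lemma mm_class_in_classes: "mm_space X \<Longrightarrow> mm_class X \<in> mm_classes"
  unfolding mm_class_def mm_classes_def by (rule quotientI) simp

lemma mm_class_self: "mm_space X \<Longrightarrow> X \<in> mm_class X"
  by (simp add: mm_class_def mm_iso_refl)

lemma mm_classesE: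
  assumes "\<X> \<in> mm_classes"
  obtains X where "mm_space X" "\<X> = mm_class X"
  using assms unfolding mm_classes_def mm_class_def by (auto elim: quotientE)

lemma mm_class_member:
  assumes "\<X> \<in> mm_classes" "X \<in> \<X>" "Y \<in> \<X>"
  shows "mm_space X" "emm_of_mm X \<prec>\<^sub>L emm_of_mm Y"
    "\<exists>Z :: real mm. mm_space Z \<and> mm_iso Z X \<and> mm_iso Z Y"
proof -
  obtain Z where Z: "mm_space Z" "\<X> = mm_class Z" using mm_classesE[OF assms(1)] .
  then have X: "mm_space X" "mm_iso Z X" and Y: "mm_space Y" "mm_iso Z Y"
    using assms(2,3) by (auto simp: mm_class_def)
  show "mm_space X" by fact
  show "\<exists>Z :: real mm. mm_space Z \<and> mm_iso Z X \<and> mm_iso Z Y" using Z(1) X(2) Y(2) by (intro exI[of _ Z] conjI)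
  have "emm_of_mm X \<prec>\<^sub>L emm_of_mm Z"
    by (rule emm_iso_imp_dominated[OF mm_iso_imp_emm_iso[OF Z(1) X(2)]])
  moreover have "emm_of_mm Z \<prec>\<^sub>L emm_of_mm Y"
    by (rule emm_iso_imp_dominated[OF mm_iso_imp_emm_iso[OF Y(1) mm_iso_sym[OF Z(1) Y]]])
  ultimately show "emm_of_mm X \<prec>\<^sub>L emm_of_mm Y"
    by (rule dominated_trans[OF emm_space_emm_of_mm[OF Y(1)] emm_space_emm_of_mm[OF Z(1)]])
qed

text \<open>The definition of \<open>below\<close> asks for one representative of the class;
  isomorphic representatives dominate each other, so any will do.\<close>

lemma below_member:
  assumes X: "emm_space X" and \<Y>: "\<Y> \<in> below X" and Y: "Y \<in> \<Y>"
  shows "emm_of_mm Y \<prec>\<^sub>L X" "mm_space Y"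
proof -
  obtain Y' where Y': "\<Y> \<in> mm_classes" "Y' \<in> \<Y>" "emm_of_mm Y' \<prec>\<^sub>L X"
    using \<Y> unfolding below_def by blast
  show "mm_space Y" by (rule mm_class_member(1)[OF Y'(1) Y Y])
  show "emm_of_mm Y \<prec>\<^sub>L X"
    by (rule dominated_trans[OF X emm_space_emm_of_mm[OF mm_class_member(1)[OF Y'(1,2,2)]] mm_class_member(2)[OF Y'(1) Y Y'(2)] Y'(3)])
qed

lemma mm_class_below:
  assumes "mm_space Y" "emm_of_mm Y \<prec>\<^sub>L X"
  shows "mm_class Y \<in> below X"
  unfolding below_def using assms mm_class_in_classes mm_class_self by blast

section \<open>The box distance on classes\<close>

definition box_candidates :: "'a mm \<Rightarrow> 'b mm \<Rightarrow> (real \<Rightarrow> 'a) \<Rightarrow> (real \<Rightarrow> 'b) \<Rightarrow> real set" where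
  "box_candidates X Y i j = {\<epsilon>. 0 \<le> \<epsilon> \<and>
     (\<exists>I \<in> sets unit_leb. measure unit_leb I \<ge> 1 - \<epsilon> \<and>
        (\<forall>s\<in>I. \<forall>t\<in>I. \<bar>mdist (mm_metric X) (i s) (i t) - mdist (mm_metric Y) (j s) (j t)\<bar> \<le> \<epsilon>))}"

lemma box_distance_alt: "box_distance X Y = (INF p\<in>parameters X \<times> parameters Y. Inf (box_candidates X Y (fst p) (snd p)))"
  unfolding box_distance_def box_candidates_def by (simp add: case_prod_unfold)

lemma box_candidates_nonempty: "box_candidates X Y i j \<noteq> {}"
proof -
  \<comment> \<open>With the empty set of parameters the value 1 always qualifies.\<close>
  have "1 \<in> box_candidates X Y i j"
    unfolding box_candidates_def by (auto intro!: bexI[of _ "{}"])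
  then show ?thesis by blast
qed

lemma box_candidates_bdd: "bdd_below (box_candidates X Y i j)"
  by (rule bdd_belowI[of _ 0]) (simp add: box_candidates_def)

lemma Inf_box_candidates_nonneg: "0 \<le> Inf (box_candidates X Y i j)"
  by (rule cInf_greatest[OF box_candidates_nonempty]) (simp add: box_candidates_def)

lemma box_distance_le:
  assumes "i \<in> parameters X" "j \<in> parameters Y"
  shows "box_distance X Y \<le> Inf (box_candidates X Y i j)"
proof -
  have "box_distance X Y \<le> Inf (box_candidates X Y (fst (i, j)) (snd (i, j)))"
    unfolding box_distance_alt
    by (rule cINF_lower) (use assms Inf_box_candidates_nonneg in \<open>auto intro!: bdd_belowI[of _ 0]\<close>)
  then show ?thesis by simp
qed

lemma prob_space_unit_leb: "prob_space unit_leb"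
  by (rule prob_spaceI) (simp add: emeasure_restrict_space space_restrict_space)

text \<open>An isomorphism preserves distances only on the support; almost all parameter values map
  there, and they form the set \<open>S\<close>.\<close>

lemma mm_iso_parameter:
  assumes X: "mm_space X" and iso: "mm_iso X X'" and i: "i \<in> parameters X"
  shows "\<exists>i' S. i' \<in> parameters X' \<and> S \<in> sets unit_leb \<and> measure unit_leb S = 1 \<and>
    (\<forall>s\<in>S. \<forall>t\<in>S. mdist (mm_metric X') (i' s) (i' t) = mdist (mm_metric X) (i s) (i t))"
proof -
  interpret U: prob_space unit_leb by (rule prob_space_unit_leb)
  let ?S = "measure_support (mtopology_of (mm_metric X)) (mm_measure X)"
  obtain F where F: "F \<in> measurable (mm_measure X) (mm_measure X')" and
     F2: "distr (mm_measure X) (mm_measure X') F = mm_measure X' \<and>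
        (\<forall>x\<in>?S. \<forall>y\<in>?S. mdist (mm_metric X') (F x) (F y) = mdist (mm_metric X) x y)"
    using iso unfolding mm_iso_def Let_def ..
  have im: "i \<in> measurable unit_leb (mm_measure X)" and id: "distr unit_leb (mm_measure X) i = mm_measure X"
    using i by (auto simp: parameters_def)
  have "AE x in distr unit_leb (mm_measure X) i. x \<in> ?S"
    unfolding id by (rule support_AE[OF mm_spaceD(1)[OF X]])
  from AE_distrD[OF im this] have ae: "AE s in unit_leb. i s \<in> ?S" .
  obtain S where S: "S \<in> sets unit_leb" "emeasure unit_leb S = 1 \<and> (\<forall>s\<in>S. s \<in> space unit_leb \<and> i s \<in> ?S)"
    using U.full_set_of_AE[OF ae] ..
  have "F \<circ> i \<in> parameters X'"
    unfolding parameters_def using measurable_comp[OF im F] distr_distr[OF F im] id F2 by simp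
  moreover have "measure unit_leb S = 1" using S by (simp add: measure_def)
  moreover have "\<forall>s\<in>S. \<forall>t\<in>S. mdist (mm_metric X') ((F \<circ> i) s) ((F \<circ> i) t) = mdist (mm_metric X) (i s) (i t)"
    using F2 S(2) by simp
  ultimately show ?thesis using S(1) by (intro exI[of _ "F \<circ> i"] exI[of _ S] conjI)
qed

text \<open>Composing parameters with the isomorphisms keeps every candidate admissible once the set
  \<open>I\<close> is shrunk by a null set. The inequality, used in both directions, makes the box
  distance well defined on classes.\<close>

lemma box_distance_iso_le:
  assumes X: "mm_space X" "mm_iso X X'" and Y: "mm_space Y" "mm_iso Y Y'"
  shows "box_distance X' Y' \<le> box_distance X Y"
proof -
  interpret U: prob_space unit_leb by (rule prob_space_unit_leb)
  have ne: "parameters X \<times> parameters Y \<noteq> {}"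
    using parameters_nonempty[OF X(1)] parameters_nonempty[OF Y(1)] by blast
  show ?thesis
    unfolding box_distance_alt[of X Y]
  proof (rule cINF_greatest[OF ne])
    fix p assume p: "p \<in> parameters X \<times> parameters Y"
    define i j where "i = fst p" and "j = snd p"
    have ij: "i \<in> parameters X" "j \<in> parameters Y" using p by (auto simp: i_def j_def)
    obtain i' where "\<exists>S. i' \<in> parameters X' \<and> S \<in> sets unit_leb \<and> measure unit_leb S = 1 \<and>
      (\<forall>s\<in>S. \<forall>t\<in>S. mdist (mm_metric X') (i' s) (i' t) = mdist (mm_metric X) (i s) (i t))"
      using mm_iso_parameter[OF X ij(1)] ..
    then obtain S where S: "i' \<in> parameters X' \<and> S \<in> sets unit_leb \<and> measure unit_leb S = 1 \<and>
      (\<forall>s\<in>S. \<forall>t\<in>S. mdist (mm_metric X') (i' s) (i' t) = mdist (mm_metric X) (i s) (i t))" ..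
    obtain j' where "\<exists>S. j' \<in> parameters Y' \<and> S \<in> sets unit_leb \<and> measure unit_leb S = 1 \<and>
      (\<forall>s\<in>S. \<forall>t\<in>S. mdist (mm_metric Y') (j' s) (j' t) = mdist (mm_metric Y) (j s) (j t))"
      using mm_iso_parameter[OF Y ij(2)] ..
    then obtain R where R: "j' \<in> parameters Y' \<and> R \<in> sets unit_leb \<and> measure unit_leb R = 1 \<and>
      (\<forall>s\<in>R. \<forall>t\<in>R. mdist (mm_metric Y') (j' s) (j' t) = mdist (mm_metric Y) (j s) (j t))" ..
    have aeS: "AE s in unit_leb. s \<in> S" using S by (intro U.AE_prob_1) simp
    have aeR: "AE s in unit_leb. s \<in> R" using R by (intro U.AE_prob_1) simp
    have "box_candidates X Y i j \<subseteq> box_candidates X' Y' i' j'"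
    proof
      fix \<epsilon> assume "\<epsilon> \<in> box_candidates X Y i j"
      then have \<epsilon>: "0 \<le> \<epsilon>" and "\<exists>I \<in> sets unit_leb. measure unit_leb I \<ge> 1 - \<epsilon> \<and>
        (\<forall>s\<in>I. \<forall>t\<in>I. \<bar>mdist (mm_metric X) (i s) (i t) - mdist (mm_metric Y) (j s) (j t)\<bar> \<le> \<epsilon>)"
        unfolding box_candidates_def by simp_all
      then obtain I where I: "I \<in> sets unit_leb" "measure unit_leb I \<ge> 1 - \<epsilon> \<and>
        (\<forall>s\<in>I. \<forall>t\<in>I. \<bar>mdist (mm_metric X) (i s) (i t) - mdist (mm_metric Y) (j s) (j t)\<bar> \<le> \<epsilon>)" by blast
      have "measure unit_leb (I \<inter> (S \<inter> R)) = measure unit_leb I"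
      proof (rule U.finite_measure_eq_AE)
        show "AE s in unit_leb. (s \<in> I \<inter> (S \<inter> R)) = (s \<in> I)"
          using aeS aeR by eventually_elim simp
      qed (use I S R in auto)
      moreover have "I \<inter> (S \<inter> R) \<in> sets unit_leb" using I(1) S R by blast
      moreover have "\<forall>s\<in>I \<inter> (S \<inter> R). \<forall>t\<in>I \<inter> (S \<inter> R).
          \<bar>mdist (mm_metric X') (i' s) (i' t) - mdist (mm_metric Y') (j' s) (j' t)\<bar> \<le> \<epsilon>"
        using I(2) S R by simp
      ultimately show "\<epsilon> \<in> box_candidates X' Y' i' j'"
        unfolding box_candidates_def using \<epsilon> I(2) by (intro CollectI conjI bexI[of _ "I \<inter> (S \<inter> R)"]) simp_all
    qed
    then have "Inf (box_candidates X' Y' i' j') \<le> Inf (box_candidates X Y i j)"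
      by (rule cInf_superset_mono[OF box_candidates_nonempty box_candidates_bdd])
    moreover have "box_distance X' Y' \<le> Inf (box_candidates X' Y' i' j')"
      using S R by (intro box_distance_le) simp_all
    ultimately show "box_distance X' Y' \<le> Inf (box_candidates X Y (fst p) (snd p))"
      by (simp add: i_def j_def)
  qed
qed

lemma box_class_distance_eq:
  assumes \<X>: "\<X> \<in> mm_classes" "X \<in> \<X>" and \<Y>: "\<Y> \<in> mm_classes" "Y \<in> \<Y>"
  shows "box_class_distance \<X> \<Y> = box_distance X Y"
proof -
  have le: "box_distance A B \<le> box_distance A' B'" if AB: "A \<in> \<X>" "A' \<in> \<X>" "B \<in> \<Y>" "B' \<in> \<Y>" for A A' B B'
  proof -
    obtain P :: "real mm" where P: "mm_space P \<and> mm_iso P A \<and> mm_iso P A'" using mm_class_member(3)[OF \<X>(1) AB(1,2)] ..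
    obtain Q :: "real mm" where Q: "mm_space Q \<and> mm_iso Q B \<and> mm_iso Q B'" using mm_class_member(3)[OF \<Y>(1) AB(3,4)] ..
    have A': "mm_space A'" and B': "mm_space B'"
      using mm_class_member(1)[OF \<X>(1) AB(2,2)] mm_class_member(1)[OF \<Y>(1) AB(4,4)] by simp_all
    have "box_distance A B \<le> box_distance P Q"
      by (rule box_distance_iso_le) (use P Q in simp_all)
    also have "\<dots> \<le> box_distance A' B'"
    proof (rule box_distance_iso_le[OF A' _ B'])
      show "mm_iso A' P" by (rule mm_iso_sym) (use P A' in simp_all)
      show "mm_iso B' Q" by (rule mm_iso_sym) (use Q B' in simp_all)
    qed
    finally show ?thesis .
  qed
  have "{box_distance X Y | X Y. X \<in> \<X> \<and> Y \<in> \<Y>} = {box_distance X Y}"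
  proof (intro set_eqI iffI)
    fix r assume "r \<in> {box_distance X Y | X Y. X \<in> \<X> \<and> Y \<in> \<Y>}"
    then obtain A B where "r = box_distance A B" "A \<in> \<X>" "B \<in> \<Y>" by blast
    then show "r \<in> {box_distance X Y}" using le[of A X B Y] le[of X A Y B] \<X>(2) \<Y>(2) by simp
  qed (use \<X>(2) \<Y>(2) in blast)
  then show ?thesis unfolding box_class_distance_def by simp
qed

lemma box_distance_self:
  assumes "mm_space X"
  shows "box_distance X X \<le> 0"
proof -
  interpret U: prob_space unit_leb by (rule prob_space_unit_leb)
  obtain i where i: "i \<in> parameters X" using parameters_nonempty[OF assms] by blast
  have "0 \<in> box_candidates X X i i"
    unfolding box_candidates_def using U.prob_space by (auto intro!: bexI[of _ "space unit_leb"])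
  then have "Inf (box_candidates X X i i) \<le> 0"
    by (rule cInf_lower[OF _ box_candidates_bdd])
  then show ?thesis using box_distance_le[OF i i] by linarith
qed

lemma below_subset_box_closure: "below X \<subseteq> box_closure (below X)"
proof
  fix \<Y> assume \<Y>: "\<Y> \<in> below X"
  then have c: "\<Y> \<in> mm_classes" by (simp add: below_def)
  obtain Y where Y: "mm_space Y" "\<Y> = mm_class Y" using mm_classesE[OF c] .
  have "Y \<in> \<Y>" using mm_class_self Y by simp
  then have "box_class_distance \<Y> \<Y> \<le> 0"
    using box_class_distance_eq[OF c _ c] box_distance_self[OF Y(1)] by simp
  then show "\<Y> \<in> box_closure (below X)"
    unfolding box_closure_def using c \<Y> by (intro CollectI conjI allI impI bexI[of _ \<Y>]) simp_all
qed

lemma box_distance_lessD: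
  assumes X: "mm_space X" and Y: "mm_space Y" and less: "box_distance X Y < e"
  shows "\<exists>i j \<epsilon> I. i \<in> parameters X \<and> j \<in> parameters Y \<and> 0 \<le> \<epsilon> \<and> \<epsilon> < e \<and> I \<in> sets unit_leb \<and>
    1 - \<epsilon> \<le> measure unit_leb I \<and>
    (\<forall>s\<in>I. \<forall>t\<in>I. \<bar>mdist (mm_metric X) (i s) (i t) - mdist (mm_metric Y) (j s) (j t)\<bar> \<le> \<epsilon>)"
proof -
  have ne: "(\<lambda>p. Inf (box_candidates X Y (fst p) (snd p))) ` (parameters X \<times> parameters Y) \<noteq> {}"
    using parameters_nonempty[OF X] parameters_nonempty[OF Y] by blast
  from cInf_lessD[OF ne less[unfolded box_distance_alt]]
  obtain p where p: "p \<in> parameters X \<times> parameters Y" "Inf (box_candidates X Y (fst p) (snd p)) < e" by blast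
  from cInf_lessD[OF box_candidates_nonempty p(2)]
  obtain \<epsilon> where \<epsilon>: "\<epsilon> \<in> box_candidates X Y (fst p) (snd p)" "\<epsilon> < e" ..
  from \<epsilon>(1) have "0 \<le> \<epsilon>" and "\<exists>I\<in>sets unit_leb. measure unit_leb I \<ge> 1 - \<epsilon> \<and>
        (\<forall>s\<in>I. \<forall>t\<in>I. \<bar>mdist (mm_metric X) (fst p s) (fst p t) - mdist (mm_metric Y) (snd p s) (snd p t)\<bar> \<le> \<epsilon>)"
    unfolding box_candidates_def by simp_all
  from this(2) obtain I where I: "I \<in> sets unit_leb" "measure unit_leb I \<ge> 1 - \<epsilon> \<and>
        (\<forall>s\<in>I. \<forall>t\<in>I. \<bar>mdist (mm_metric X) (fst p s) (fst p t) - mdist (mm_metric Y) (snd p s) (snd p t)\<bar> \<le> \<epsilon>)" ..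
  have pp: "fst p \<in> parameters X" "snd p \<in> parameters Y" using p(1) by (simp_all add: mem_Times_iff)
  show ?thesis
    by (rule exI[of _ "fst p"], rule exI[of _ "snd p"], rule exI[of _ \<epsilon>], rule exI[of _ I])
      (intro conjI pp \<open>0 \<le> \<epsilon>\<close> \<epsilon>(2) I(1) I(2)[THEN conjunct1] I(2)[THEN conjunct2])
qed

section \<open>Joint realizations\<close>

text \<open>The product with the maximum metric, carried along an injection \<open>c\<close> because
  representatives of classes live on the reals. With the maximum metric a pair of 1-Lipschitz maps
  is 1-Lipschitz, and so are the projections.\<close>

definition coded_product :: "('a \<times> 'b \<Rightarrow> 'c) \<Rightarrow> 'a metric \<Rightarrow> 'b metric \<Rightarrow> 'c metric" where
  "coded_product c m1 m2 = metric (c ` (mspace m1 \<times> mspace m2),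
     \<lambda>u v. max (mdist m1 (fst (inv c u)) (fst (inv c v))) (mdist m2 (snd (inv c u)) (snd (inv c v))))"

lemma coded_product:
  assumes c: "inj c"
  shows mspace_coded_product: "mspace (coded_product c m1 m2) = c ` (mspace m1 \<times> mspace m2)"
    and mdist_coded_product: "\<And>a b a' b'. a \<in> mspace m1 \<Longrightarrow> a' \<in> mspace m1 \<Longrightarrow> b \<in> mspace m2 \<Longrightarrow> b' \<in> mspace m2 \<Longrightarrow>
      mdist (coded_product c m1 m2) (c (a, b)) (c (a', b')) = max (mdist m1 a a') (mdist m2 b b')"
proof -
  let ?d = "\<lambda>u v. max (mdist m1 (fst (inv c u)) (fst (inv c v))) (mdist m2 (snd (inv c u)) (snd (inv c v)))"
  have inv: "inv c (c p) = p" for p using c by simp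
  interpret Metric_space "c ` (mspace m1 \<times> mspace m2)" ?d
  proof
    fix u v w
    show "0 \<le> ?d u v" by (simp add: le_max_iff_disj)
    show "?d u v = ?d v u" by (simp add: mdist_commute)
    assume u: "u \<in> c ` (mspace m1 \<times> mspace m2)" and v: "v \<in> c ` (mspace m1 \<times> mspace m2)"
    have max_zero: "max x y = 0 \<longleftrightarrow> x = 0 \<and> y = 0" if "0 \<le> x" "0 \<le> y" for x y :: real using that by linarith
    show "?d u v = 0 \<longleftrightarrow> u = v"
      using u v unfolding max_zero[OF mdist_nonneg mdist_nonneg] by (auto simp: inv)
    assume w: "w \<in> c ` (mspace m1 \<times> mspace m2)"
    from u v w obtain a b a' b' a'' b'' where e: "u = c (a, b)" "v = c (a', b')" "w = c (a'', b'')"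
      "a \<in> mspace m1" "a' \<in> mspace m1" "a'' \<in> mspace m1" "b \<in> mspace m2" "b' \<in> mspace m2" "b'' \<in> mspace m2"
      by auto
    show "?d u w \<le> ?d u v + ?d v w"
      using mdist_triangle[OF e(4,5,6)] mdist_triangle[OF e(7,8,9)] unfolding e(1-3) inv fst_conv snd_conv by linarith
  qed
  show "mspace (coded_product c m1 m2) = c ` (mspace m1 \<times> mspace m2)"
    by (simp add: coded_product_def)
  show "mdist (coded_product c m1 m2) (c (a, b)) (c (a', b')) = max (mdist m1 a a') (mdist m2 b b')"
    if "a \<in> mspace m1" "a' \<in> mspace m1" "b \<in> mspace m2" "b' \<in> mspace m2" for a b a' b'
    by (simp add: coded_product_def inv)
qed

lemma coded_product_mcomplete:
  assumes c: "inj c" and m: "mcomplete_of m1" "mcomplete_of m2"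
  shows "mcomplete_of (coded_product c m1 m2)"
proof -
  let ?m = "coded_product c m1 m2"
  interpret P: Metric_space "mspace ?m" "mdist ?m" by simp
  interpret M1: Metric_space "mspace m1" "mdist m1" by simp
  interpret M2: Metric_space "mspace m2" "mdist m2" by simp
  note md = mdist_coded_product[OF c, of _ m1 _ _ m2]
  have "\<exists>x. limitin P.mtopology \<sigma> x sequentially" if \<sigma>: "P.MCauchy \<sigma>" for \<sigma>
  proof -
    have "\<forall>n. \<exists>p. \<sigma> n = c p \<and> fst p \<in> mspace m1 \<and> snd p \<in> mspace m2"
    proof
      fix n
      have "\<sigma> n \<in> mspace ?m" using \<sigma> by (auto simp: P.MCauchy_def)
      then show "\<exists>p. \<sigma> n = c p \<and> fst p \<in> mspace m1 \<and> snd p \<in> mspace m2"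
        unfolding mspace_coded_product[OF c] by (auto simp: mem_Times_iff)
    qed
    from choice[OF this] obtain p where p: "\<And>n. \<sigma> n = c (fst (p n), snd (p n))"
      "\<And>n. fst (p n) \<in> mspace m1" "\<And>n. snd (p n) \<in> mspace m2" by auto
    have dd: "mdist ?m (\<sigma> n) (\<sigma> k) = max (mdist m1 (fst (p n)) (fst (p k))) (mdist m2 (snd (p n)) (snd (p k)))" for n k
      unfolding p(1) by (rule md[OF p(2,2,3,3)])
    have "M1.MCauchy (\<lambda>n. fst (p n))" "M2.MCauchy (\<lambda>n. snd (p n))"
      using \<sigma> p(2,3) unfolding P.MCauchy_def M1.MCauchy_def M2.MCauchy_def dd image_subset_iff max_less_iff_conj
      by meson+
    then obtain x y where x: "limitin M1.mtopology (\<lambda>n. fst (p n)) x sequentially"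
      and y: "limitin M2.mtopology (\<lambda>n. snd (p n)) y sequentially"
      using m unfolding mcomplete_of_def M1.mcomplete_def M2.mcomplete_def by blast
    have xy: "x \<in> mspace m1" "y \<in> mspace m2" using x y by (simp_all add: M1.limitin_metric M2.limitin_metric)
    have "limitin P.mtopology \<sigma> (c (x, y)) sequentially"
      unfolding P.limitin_metric
    proof (intro conjI allI impI)
      show "c (x, y) \<in> mspace ?m" using xy by (simp add: mspace_coded_product[OF c])
      fix e :: real assume e: "0 < e"
      have "\<forall>\<^sub>F n in sequentially. fst (p n) \<in> mspace m1 \<and> mdist m1 (fst (p n)) x < e"
        using x e by (simp add: M1.limitin_metric)
      moreover have "\<forall>\<^sub>F n in sequentially. snd (p n) \<in> mspace m2 \<and> mdist m2 (snd (p n)) y < e"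
        using y e by (simp add: M2.limitin_metric)
      ultimately show "\<forall>\<^sub>F n in sequentially. \<sigma> n \<in> mspace ?m \<and> mdist ?m (\<sigma> n) (c (x, y)) < e"
        by eventually_elim (simp add: p(1) mspace_coded_product[OF c] md xy del: prod.collapse)
    qed
    then show ?thesis ..
  qed
  then show ?thesis by (simp add: mcomplete_of_def P.mcomplete_def)
qed

lemma dense_sequence:
  fixes m :: "'a metric"
  assumes "separable_space (mtopology_of m)" "mspace m \<noteq> {}"
  shows "\<exists>q :: nat \<Rightarrow> 'a. range q \<subseteq> mspace m \<and> (\<forall>x\<in>mspace m. \<forall>e>0. \<exists>n. mdist m x (q n) < e)"
proof (rule separable_metric_dense_sequence[OF assms])
  fix q :: "nat \<Rightarrow> 'a"
  assume "range q \<subseteq> mspace m" "\<And>x e. x \<in> mspace m \<Longrightarrow> 0 < e \<Longrightarrow> \<exists>n. mdist m x (q n) < e"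
  then show ?thesis by (intro exI[of _ q] conjI ballI allI impI)
qed

lemma separable_metricI:
  fixes q :: "nat \<Rightarrow> 'a"
  assumes "range q \<subseteq> mspace m" "\<And>x e. x \<in> mspace m \<Longrightarrow> 0 < e \<Longrightarrow> \<exists>n. mdist m x (q n) < e"
  shows "separable_space (mtopology_of m)"
proof -
  interpret Metric_space "mspace m" "mdist m" by simp
  have "mtopology closure_of range q = mspace m"
    unfolding metric_closure_of using assms by (fastforce simp: image_subset_iff)
  then show ?thesis
    unfolding separable_space_def mtopology_of_def topspace_mtopology
    using assms(1) by (intro exI[of _ "range q"]) simp
qed

lemma coded_product_separable:
  fixes m1 :: "'a metric" and m2 :: "'b metric"
  assumes c: "inj c" and m: "separable_space (mtopology_of m1)" "separable_space (mtopology_of m2)"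
    and ne: "mspace m1 \<noteq> {}" "mspace m2 \<noteq> {}"
  shows "separable_space (mtopology_of (coded_product c m1 m2))"
proof -
  obtain q1 :: "nat \<Rightarrow> 'a" where q10: "range q1 \<subseteq> mspace m1 \<and> (\<forall>x\<in>mspace m1. \<forall>e>0. \<exists>n. mdist m1 x (q1 n) < e)"
    using dense_sequence[OF m(1) ne(1)] ..
  note q1 = q10[THEN conjunct1] q10[THEN conjunct2, rule_format]
  obtain q2 :: "nat \<Rightarrow> 'b" where q20: "range q2 \<subseteq> mspace m2 \<and> (\<forall>x\<in>mspace m2. \<forall>e>0. \<exists>n. mdist m2 x (q2 n) < e)"
    using dense_sequence[OF m(2) ne(2)] ..
  note q2 = q20[THEN conjunct1] q20[THEN conjunct2, rule_format]
  show ?thesis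
  proof (rule separable_metricI[where q = "\<lambda>n. c (q1 (fst (prod_decode n)), q2 (snd (prod_decode n)))"])
    show "range (\<lambda>n. c (q1 (fst (prod_decode n)), q2 (snd (prod_decode n)))) \<subseteq> mspace (coded_product c m1 m2)"
      unfolding mspace_coded_product[OF c] using q1(1) q2(1) by (intro image_subsetI imageI SigmaI) blast+
    fix x and e :: real assume x: "x \<in> mspace (coded_product c m1 m2)" and e: "0 < e"
    then obtain a b where ab: "x = c (a, b)" "a \<in> mspace m1" "b \<in> mspace m2"
      unfolding mspace_coded_product[OF c] by blast
    obtain i where i: "mdist m1 a (q1 i) < e" using q1(2)[OF ab(2) e] ..
    obtain j where j: "mdist m2 b (q2 j) < e" using q2(2)[OF ab(3) e] ..
    have "q1 i \<in> mspace m1" "q2 j \<in> mspace m2" using q1(1) q2(1) by blast+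
    then have "mdist (coded_product c m1 m2) x (c (q1 i, q2 j)) < e"
      using i j ab by (simp add: mdist_coded_product[OF c])
    then show "\<exists>n. mdist (coded_product c m1 m2) x (c (q1 (fst (prod_decode n)), q2 (snd (prod_decode n)))) < e"
      by (intro exI[of _ "prod_encode (i, j)"]) simp
  qed
qed

text \<open>Every open set is a countable union of balls around points of a dense sequence. For the
  maximum metric the preimage of a ball splits into conditions on the two components.\<close>

lemma measurable_into_separable_metric:
  fixes m :: "'a metric"
  assumes sep: "separable_space (mtopology_of m)" and f: "f \<in> space N \<rightarrow> mspace m"
    and b: "\<And>a r. a \<in> mspace m \<Longrightarrow> {x \<in> space N. mdist m a (f x) < r} \<in> sets N"
  shows "f \<in> measurable N (borel_of (mtopology_of m))"
proof (cases "mspace m = {}")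
  case True
  then have "space N = {}" using f by blast
  then show ?thesis by (simp add: measurable_def)
next
  case False
  interpret Metric_space "mspace m" "mdist m" by simp
  obtain q :: "nat \<Rightarrow> 'a" where q0: "range q \<subseteq> mspace m \<and> (\<forall>x\<in>mspace m. \<forall>e>0. \<exists>n. mdist m x (q n) < e)"
    using dense_sequence[OF sep False] ..
  note q = q0[THEN conjunct1] q0[THEN conjunct2, rule_format]
  show ?thesis
  proof (rule measurable_borel_ofI)
    show "f \<in> space N \<rightarrow> topspace (mtopology_of m)" using f by simp
    fix U assume "openin (mtopology_of m) U"
    then have U: "U \<subseteq> mspace m" "\<And>x. x \<in> U \<Longrightarrow> \<exists>r>0. mball x r \<subseteq> U"
      by (auto simp: mtopology_of_def openin_mtopology)
    define J where "J = {(n, k :: nat). mball (q n) (1 / (real k + 1)) \<subseteq> U}"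
    have qm: "q n \<in> mspace m" for n using q(1) by blast
    have "f -` U \<inter> space N = (\<Union>(n, k)\<in>J. {x \<in> space N. mdist m (q n) (f x) < 1 / (real k + 1)})"
    proof (intro set_eqI iffI)
      fix x assume x: "x \<in> f -` U \<inter> space N"
      then have fx: "f x \<in> mspace m" using U(1) by blast
      from x obtain r where r: "0 < r" "mball (f x) r \<subseteq> U" using U(2)[of "f x"] by blast
      obtain k :: nat where k: "1 / (real k + 1) < r / 2"
        using nat_approx_posE[of "r / 2"] r(1) by (metis add.commute half_gt_zero of_nat_Suc)
      obtain n where n: "mdist m (f x) (q n) < 1 / (real k + 1)" using q(2)[OF fx, of "1 / (real k + 1)"] by auto
      have "mball (q n) (1 / (real k + 1)) \<subseteq> mball (f x) r"
      proof
        fix y assume y: "y \<in> mball (q n) (1 / (real k + 1))"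
        then have "mdist m (f x) y \<le> mdist m (f x) (q n) + mdist m (q n) y" by (intro mdist_triangle fx qm) simp
        also have "\<dots> < r" using n k y by simp
        finally show "y \<in> mball (f x) r" using fx y by simp
      qed
      then have "(n, k) \<in> J" using r(2) by (auto simp: J_def)
      then show "x \<in> (\<Union>(n, k)\<in>J. {x \<in> space N. mdist m (q n) (f x) < 1 / (real k + 1)})"
        using n x by (intro UN_I[of "(n, k)"]) (auto simp: mdist_commute)
    next
      fix x assume "x \<in> (\<Union>(n, k)\<in>J. {x \<in> space N. mdist m (q n) (f x) < 1 / (real k + 1)})"
      then obtain n k where nk: "(n, k) \<in> J" "x \<in> space N" "mdist m (q n) (f x) < 1 / (real k + 1)" by blast
      then have "f x \<in> mball (q n) (1 / (real k + 1))" using f qm by auto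
      then show "x \<in> f -` U \<inter> space N" using nk by (auto simp: J_def)
    qed
    also have "\<dots> \<in> sets N"
      by (rule sets.countable_UN') (use b[OF qm] in \<open>auto simp: case_prod_beta intro: countableI_type\<close>)
    finally show "f -` U \<inter> space N \<in> sets N" .
  qed
qed

lemma mdist_measurable:
  assumes "mm_space Y" "a \<in> mspace (mm_metric Y)" "\<phi> \<in> measurable N (mm_measure Y)"
  shows "{x \<in> space N. mdist (mm_metric Y) a (\<phi> x) < r} \<in> sets N"
proof -
  have [measurable]: "mdist (mm_metric Y) a \<in> borel_measurable (mm_measure Y)"
  proof (rule lipschitz_measurable[OF assms(1)])
    fix x y assume xy: "x \<in> mspace (mm_metric Y)" "y \<in> mspace (mm_metric Y)"
    show "\<bar>mdist (mm_metric Y) a x - mdist (mm_metric Y) a y\<bar> \<le> mdist (mm_metric Y) x y"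
      using mdist_triangle[OF assms(2) xy] mdist_triangle[OF assms(2) xy(2,1)] mdist_commute[of "mm_metric Y" x y]
      by linarith
  qed
  have [measurable]: "\<phi> \<in> measurable N (mm_measure Y)" by (rule assms(3))
  show ?thesis by measurable
qed

text \<open>The pushed forward measure makes the target an mm-space and preservation of measure
  automatic; the Lipschitz bound is the only thing to provide.\<close>

lemma mm_space_of_map:
  assumes X: "emm_space X" and m: "mcomplete_of m" "separable_space (mtopology_of m)"
    and \<phi>: "\<phi> \<in> measurable (emm_completion X) (borel_of (mtopology_of m))"
    and lip: "\<exists>E. (AE x in emm_completion X. x \<in> E) \<and> (\<forall>x\<in>E. \<forall>y\<in>E. ennreal (mdist m (\<phi> x) (\<phi> y)) \<le> emm_dist X x y)"
  defines "Z \<equiv> MM m (distr (emm_completion X) (borel_of (mtopology_of m)) \<phi>)"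
  shows "mm_space Z" "dom_map X (emm_of_mm Z) \<phi>"
proof -
  interpret prob_space "emm_completion X" by (rule emm_spaceD(3)[OF X])
  show "mm_space Z"
    unfolding mm_space_def Z_def using m prob_space_distr[OF \<phi>] by simp
  have s: "sets (mm_measure Z) = sets (borel_of (mtopology_of m))" by (simp add: Z_def)
  have "distr (emm_completion X) (mm_measure Z) \<phi> = distr (emm_completion X) (borel_of (mtopology_of m)) \<phi>"
    by (rule distr_cong) (simp_all add: s)
  then show "dom_map X (emm_of_mm Z) \<phi>"
    unfolding dom_map_def emm_of_mm_simps using \<phi> lip measurable_cong_sets[OF refl s]
    by (simp add: Z_def)
qed

lemma exists_inj_real_pair: "\<exists>c :: real \<times> real \<Rightarrow> real. inj c"
proof -
  have "separable_space (mtopology_of (euclidean_metric :: (real \<times> real) metric))"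
    unfolding mtopology_of_euclidean by (rule second_countable_imp_separable_space[OF second_countable_euclidean])
  from separable_metric_inj_real[OF this] obtain c :: "real \<times> real \<Rightarrow> real" where "inj_on c (mspace euclidean_metric)" .
  then show ?thesis by auto
qed

text \<open>The joint law of \<open>\<phi>1\<close> and \<open>\<phi>2\<close> on the product is an
  upper bound of \<open>Y1\<close> and \<open>Y2\<close> below \<open>X\<close>. The projections
  \<open>p1\<close> and \<open>p2\<close> satisfy their bounds on the whole carrier, so functions on
  \<open>Y1\<close> and \<open>Y2\<close> can be pulled back to it.\<close>

lemma joint_domination:
  fixes Y1 Y2 :: "real mm"
  assumes X: "emm_space X" and Y1: "mm_space Y1" "dom_map X (emm_of_mm Y1) \<phi>1"
    and Y2: "mm_space Y2" "dom_map X (emm_of_mm Y2) \<phi>2"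
  shows "\<exists>(Z :: real mm) \<phi> p1 p2. mm_space Z \<and> dom_map X (emm_of_mm Z) \<phi> \<and> (\<forall>x. p1 (\<phi> x) = \<phi>1 x) \<and> (\<forall>x. p2 (\<phi> x) = \<phi>2 x) \<and>
    (\<forall>x\<in>mspace (mm_metric Z). p1 x \<in> mspace (mm_metric Y1) \<and> p2 x \<in> mspace (mm_metric Y2)) \<and>
    (\<forall>x\<in>mspace (mm_metric Z). \<forall>y\<in>mspace (mm_metric Z).
      mdist (mm_metric Y1) (p1 x) (p1 y) \<le> mdist (mm_metric Z) x y \<and> mdist (mm_metric Y2) (p2 x) (p2 y) \<le> mdist (mm_metric Z) x y)"
proof -
  obtain c :: "real \<times> real \<Rightarrow> real" where c: "inj c" using exists_inj_real_pair ..
  let ?N = "emm_completion X"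
  define m where "m = coded_product c (mm_metric Y1) (mm_metric Y2)"
  define \<phi> where "\<phi> x = c (\<phi>1 x, \<phi>2 x)" for x
  note D1 = dom_mapD[OF Y1(2), unfolded emm_of_mm_simps] and D2 = dom_mapD[OF Y2(2), unfolded emm_of_mm_simps]
  note ms = mspace_coded_product[OF c, of "mm_metric Y1" "mm_metric Y2", folded m_def]
  note md = mdist_coded_product[OF c, of _ "mm_metric Y1" _ _ "mm_metric Y2", folded m_def]
  have in1: "\<phi>1 x \<in> mspace (mm_metric Y1)" and in2: "\<phi>2 x \<in> mspace (mm_metric Y2)" if "x \<in> space ?N" for x
    using measurable_space[OF D1(1) that] measurable_space[OF D2(1) that] mm_spaceD(2)[OF Y1(1)] mm_spaceD(2)[OF Y2(1)] by simp_all
  have sep: "separable_space (mtopology_of m)"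
    unfolding m_def by (rule coded_product_separable[OF c mm_spaceD(5)[OF Y1(1)] mm_spaceD(5)[OF Y2(1)] mm_spaceD(6)[OF Y1(1)] mm_spaceD(6)[OF Y2(1)]])
  have cpl: "mcomplete_of m"
    unfolding m_def by (rule coded_product_mcomplete[OF c mm_spaceD(7)[OF Y1(1)] mm_spaceD(7)[OF Y2(1)]])
  have meas: "\<phi> \<in> measurable ?N (borel_of (mtopology_of m))"
  proof (rule measurable_into_separable_metric[OF sep])
    show "\<phi> \<in> space ?N \<rightarrow> mspace m" using in1 in2 by (auto simp: \<phi>_def ms)
    fix z r assume "z \<in> mspace m"
    then obtain a b where ab: "z = c (a, b)" "a \<in> mspace (mm_metric Y1)" "b \<in> mspace (mm_metric Y2)" unfolding ms by blast
    have "{x \<in> space ?N. mdist m z (\<phi> x) < r} =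
      {x \<in> space ?N. mdist (mm_metric Y1) a (\<phi>1 x) < r} \<inter> {x \<in> space ?N. mdist (mm_metric Y2) b (\<phi>2 x) < r}"
      using md[OF ab(2) in1 ab(3) in2] by (auto simp: ab(1) \<phi>_def)
    also have "\<dots> \<in> sets ?N"
      by (intro sets.Int mdist_measurable[OF Y1(1) ab(2) D1(1)] mdist_measurable[OF Y2(1) ab(3) D2(1)])
    finally show "{x \<in> space ?N. mdist m z (\<phi> x) < r} \<in> sets ?N" .
  qed
  obtain E1 where E1: "AE x in ?N. x \<in> E1"
    "\<forall>x\<in>E1. \<forall>y\<in>E1. ennreal (mdist (mm_metric Y1) (\<phi>1 x) (\<phi>1 y)) \<le> emm_dist X x y" using D1(3) by blast
  obtain E2 where E2: "AE x in ?N. x \<in> E2"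
    "\<forall>x\<in>E2. \<forall>y\<in>E2. ennreal (mdist (mm_metric Y2) (\<phi>2 x) (\<phi>2 y)) \<le> emm_dist X x y" using D2(3) by blast
  have "AE x in ?N. x \<in> E1 \<inter> E2 \<inter> space ?N" using E1(1) E2(1) AE_space by eventually_elim simp
  moreover have "ennreal (mdist m (\<phi> x) (\<phi> y)) \<le> emm_dist X x y"
    if "x \<in> E1 \<inter> E2 \<inter> space ?N" "y \<in> E1 \<inter> E2 \<inter> space ?N" for x y
  proof -
    have "mdist m (\<phi> x) (\<phi> y) = max (mdist (mm_metric Y1) (\<phi>1 x) (\<phi>1 y)) (mdist (mm_metric Y2) (\<phi>2 x) (\<phi>2 y))"
      unfolding \<phi>_def using that by (intro md in1 in2) simp_all
    then show ?thesis using E1(2) E2(2) that by (simp add: max_def)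
  qed
  ultimately have lip: "\<exists>E. (AE x in ?N. x \<in> E) \<and> (\<forall>x\<in>E. \<forall>y\<in>E. ennreal (mdist m (\<phi> x) (\<phi> y)) \<le> emm_dist X x y)"
    by blast
  note Z = mm_space_of_map[OF X cpl sep meas lip]
  let ?Z = "MM m (distr ?N (borel_of (mtopology_of m)) \<phi>)"
  have inv: "inv c (c p) = p" for p using c by simp
  show ?thesis
  proof (rule exI[of _ ?Z], rule exI[of _ \<phi>], rule exI[of _ "\<lambda>z. fst (inv c z)"], rule exI[of _ "\<lambda>z. snd (inv c z)"], intro conjI ballI allI)
    show "mm_space ?Z" "dom_map X (emm_of_mm ?Z) \<phi>" by (fact Z)+
    show "fst (inv c (\<phi> x)) = \<phi>1 x" "snd (inv c (\<phi> x)) = \<phi>2 x" for x by (simp_all add: \<phi>_def inv)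
    fix x assume "x \<in> mspace (mm_metric ?Z)"
    then obtain a b where ab: "x = c (a, b)" "a \<in> mspace (mm_metric Y1)" "b \<in> mspace (mm_metric Y2)" by (auto simp: ms)
    then show "fst (inv c x) \<in> mspace (mm_metric Y1)" "snd (inv c x) \<in> mspace (mm_metric Y2)" by (simp_all add: inv)
    fix y assume "y \<in> mspace (mm_metric ?Z)"
    then obtain a' b' where ab': "y = c (a', b')" "a' \<in> mspace (mm_metric Y1)" "b' \<in> mspace (mm_metric Y2)" by (auto simp: ms)
    show "mdist (mm_metric Y1) (fst (inv c x)) (fst (inv c y)) \<le> mdist (mm_metric ?Z) x y"
      "mdist (mm_metric Y2) (snd (inv c x)) (snd (inv c y)) \<le> mdist (mm_metric ?Z) x y"
      using ab ab' by (simp_all add: md inv)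
  qed
qed

lemma dom_map_lipschitz_factor:
  assumes X: "emm_space X" and Y: "mm_space Y" and Z: "mm_space Z"
    and \<phi>: "dom_map X (emm_of_mm Z) \<phi>" and \<psi>: "dom_map X (emm_of_mm Y) \<psi>" and p: "\<And>x. p (\<phi> x) = \<psi> x"
    and maps: "\<And>x. x \<in> mspace (mm_metric Z) \<Longrightarrow> p x \<in> mspace (mm_metric Y)"
    and lip: "\<And>x y. x \<in> mspace (mm_metric Z) \<Longrightarrow> y \<in> mspace (mm_metric Z) \<Longrightarrow>
      mdist (mm_metric Y) (p x) (p y) \<le> mdist (mm_metric Z) x y"
  shows "dom_map (emm_of_mm Z) (emm_of_mm Y) p"
  unfolding dom_map_def emm_of_mm_simps
proof (intro conjI exI[of _ "mspace (mm_metric Z)"] ballI)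
  let ?N = "emm_completion X"
  note D = dom_mapD[OF \<phi>, unfolded emm_of_mm_simps] and D' = dom_mapD[OF \<psi>, unfolded emm_of_mm_simps]
  have "Lipschitz_continuous_map (mm_metric Z) (mm_metric Y) p"
    unfolding Lipschitz_continuous_map_def
    by (intro conjI exI[of _ 1] ballI) (use maps lip in auto)
  then have "p \<in> measurable (borel_of (mtopology_of (mm_metric Z))) (borel_of (mtopology_of (mm_metric Y)))"
    by (intro continuous_map_measurable Lipschitz_continuous_imp_continuous_map)
  then have pm: "p \<in> measurable (mm_measure Z) (mm_measure Y)"
    using measurable_cong_sets[OF mm_spaceD(4)[OF Z, symmetric] mm_spaceD(4)[OF Y, symmetric]] by blast
  then show pm': "p \<in> measurable (completion (mm_measure Z)) (mm_measure Y)" by (rule measurable_completion)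
  have "distr (completion (mm_measure Z)) (mm_measure Y) p = distr (mm_measure Z) (mm_measure Y) p"
    using pm by (rule distr_completion)
  also have "\<dots> = distr (distr ?N (mm_measure Z) \<phi>) (mm_measure Y) p" unfolding D(2) ..
  also have "\<dots> = distr ?N (mm_measure Y) (p \<circ> \<phi>)" by (rule distr_distr[OF pm D(1)])
  also have "p \<circ> \<phi> = \<psi>" using p by auto
  finally show "distr (completion (mm_measure Z)) (mm_measure Y) p = mm_measure Y" unfolding D'(2) .
  show "AE x in completion (mm_measure Z). x \<in> mspace (mm_metric Z)"
    using mm_spaceD(2)[OF Z] by (intro AE_I2) simp
  fix x y assume "x \<in> mspace (mm_metric Z)" "y \<in> mspace (mm_metric Z)"
  then show "ennreal (mdist (mm_metric Y) (p x) (p y)) \<le> ennreal (mdist (mm_metric Z) x y)"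
    by (intro ennreal_leI lip)
qed

section \<open>Realizing finitely many Lipschitz functions\<close>

lemma real_line_image:
  assumes X: "emm_space X" and f: "f \<in> Lip1 X"
  shows "\<exists>Y :: real mm. mm_space Y \<and> dom_map X (emm_of_mm Y) f \<and> mm_metric Y = euclidean_metric"
proof -
  have "separable_space (mtopology_of (euclidean_metric :: real metric))"
    unfolding mtopology_of_euclidean by (rule second_countable_imp_separable_space[OF second_countable_euclidean])
  moreover have "mcomplete_of (euclidean_metric :: real metric)"
    by (simp add: mcomplete_of_def complete_UNIV)
  moreover have "f \<in> measurable (emm_completion X) (borel_of (mtopology_of euclidean_metric))"
    using f[unfolded Lip1_iff[OF X]] measurable_cong_sets[OF refl sets_borel_of_euclidean] by auto
  moreover have "\<exists>E. (AE x in emm_completion X. x \<in> E) \<and> (\<forall>x\<in>E. \<forall>y\<in>E. ennreal (mdist euclidean_metric (f x) (f y)) \<le> emm_dist X x y)"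
    using f[unfolded Lip1_iff[OF X]] by (simp add: dist_real_def)
  ultimately show ?thesis
    using mm_space_of_map[OF X, of euclidean_metric f] mm.sel(1) by blast
qed

lemma const_Lip1:
  assumes "emm_space X"
  shows "(\<lambda>x. c) \<in> Lip1 X"
  unfolding Lip1_iff[OF assms] by (intro conjI exI[of _ UNIV]) simp_all

text \<open>Each Lipschitz function is a domination map onto the line with its law.
  \<open>joint_domination\<close> adjoins one such map at a time, and the functions already realized
  are pulled back along \<open>p1\<close>.\<close>

lemma finite_joint_realization:
  fixes n :: nat
  assumes X: "emm_space X" and f: "\<And>i. i < n \<Longrightarrow> f i \<in> Lip1 X"
  shows "\<exists>(Z :: real mm) \<phi> u. mm_space Z \<and> dom_map X (emm_of_mm Z) \<phi> \<and>
    (\<forall>i<n. u i \<in> Lip1 (emm_of_mm Z) \<and> (\<forall>x. u i (\<phi> x) = f i x))"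
  using f
proof (induction n)
  case 0
  \<comment> \<open>Even without functions some mm-space below \<open>X\<close> is required: the
    point mass on the line, as image under a constant.\<close>
  obtain Y :: "real mm" where "mm_space Y \<and> dom_map X (emm_of_mm Y) (\<lambda>_. 0) \<and> mm_metric Y = euclidean_metric"
    using real_line_image[OF X const_Lip1[OF X]] ..
  then show ?case by blast
next
  case (Suc n)
  have "\<exists>(Z :: real mm) \<phi> u. mm_space Z \<and> dom_map X (emm_of_mm Z) \<phi> \<and>
    (\<forall>i<n. u i \<in> Lip1 (emm_of_mm Z) \<and> (\<forall>x. u i (\<phi> x) = f i x))"
    by (rule Suc.IH) (rule Suc.prems, simp)
  then obtain Z :: "real mm" and \<phi> u where Z: "mm_space Z" "dom_map X (emm_of_mm Z) \<phi>"
    and u: "\<forall>i<n. u i \<in> Lip1 (emm_of_mm Z) \<and> (\<forall>x. u i (\<phi> x) = f i x)" by blast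
  obtain Y :: "real mm" where Y: "mm_space Y \<and> dom_map X (emm_of_mm Y) (f n) \<and> mm_metric Y = euclidean_metric"
    using real_line_image[OF X Suc.prems[of n, OF lessI]] ..
  from joint_domination[OF X Z Y[THEN conjunct1] Y[THEN conjunct2, THEN conjunct1]]
  obtain W :: "real mm" and \<psi> p1 p2 where W: "mm_space W" "dom_map X (emm_of_mm W) \<psi>"
    and p: "\<forall>x. p1 (\<psi> x) = \<phi> x" "\<forall>x. p2 (\<psi> x) = f n x"
      "\<forall>x\<in>mspace (mm_metric W). p1 x \<in> mspace (mm_metric Z) \<and> p2 x \<in> mspace (mm_metric Y)"
      "\<forall>x\<in>mspace (mm_metric W). \<forall>y\<in>mspace (mm_metric W).
      mdist (mm_metric Z) (p1 x) (p1 y) \<le> mdist (mm_metric W) x y \<and> mdist (mm_metric Y) (p2 x) (p2 y) \<le> mdist (mm_metric W) x y"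
    by blast
  have p1: "dom_map (emm_of_mm W) (emm_of_mm Z) p1"
    by (rule dom_map_lipschitz_factor[OF X Z(1) W(1,2) Z(2)]) (simp_all add: p)
  have p2: "p2 \<in> Lip1 (emm_of_mm W)"
    by (rule lipschitz_in_Lip1[OF W(1)]) (use p(4) Y in \<open>simp add: dist_real_def\<close>)
  define v where "v i = (if i < n then (\<lambda>x. u i (p1 x)) else p2)" for i
  have "v i \<in> Lip1 (emm_of_mm W) \<and> (\<forall>x. v i (\<psi> x) = f i x)" if i: "i < Suc n" for i
  proof (cases "i < n")
    case True
    then have "(\<lambda>x. u i (p1 x)) \<in> Lip1 (emm_of_mm W)"
      using u by (intro Lip1_pullback[OF emm_space_emm_of_mm[OF W(1)] emm_space_emm_of_mm[OF Z(1)] p1]) simp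
    then show ?thesis using True u p(1) by (simp add: v_def)
  next
    case False
    then have "i = n" using i by simp
    then show ?thesis using p2 p(2) by (simp add: v_def)
  qed
  then show ?case using W by blast
qed

section \<open>Recovering domination from approximate laws\<close>

text \<open>On the set where the parameters almost preserve distances, transporting \<open>f n\<close> to \<open>Z\<close> gives functions that
  are Lipschitz up to a small error; McShane's formula makes them Lipschitz, and they are pulled back to \<open>X\<close>.\<close>

lemma box_approximation_law:
  fixes h :: "(nat \<Rightarrow> real) \<Rightarrow> real" and Y :: "'b mm" and Z :: "'c mm"
  assumes X: "emm_space X" and Y: "mm_space Y" and Z: "mm_space Z" and \<phi>: "dom_map X (emm_of_mm Z) \<phi>"
    and less: "box_distance Y Z < e" and e: "e \<le> 1"
    and f: "\<And>n x y. x \<in> mspace (mm_metric Y) \<Longrightarrow> y \<in> mspace (mm_metric Y) \<Longrightarrow> \<bar>f n x - f n y\<bar> \<le> mdist (mm_metric Y) x y"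
  shows "\<exists>G. (\<forall>n. G n \<in> Lip1 X) \<and> (\<forall>h n L. (\<forall>z. 0 \<le> h z \<and> h z \<le> (1::real)) \<longrightarrow> 0 \<le> L \<longrightarrow>
      (\<forall>z z'. \<bar>h z - h z'\<bar> \<le> L * (\<Sum>i<n. \<bar>z i - z' i\<bar>)) \<longrightarrow>
      \<bar>integral\<^sup>L (emm_completion X) (\<lambda>x. h (\<lambda>n. G n x)) - integral\<^sup>L (completion (mm_measure Y)) (\<lambda>x. h (\<lambda>n. f n x))\<bar>
        \<le> L * (real n * (2 * e)) + e)"
proof -
  interpret U: prob_space unit_leb by (rule prob_space_unit_leb)
  obtain i j \<epsilon> I where ij: "i \<in> parameters Y" "j \<in> parameters Z" and \<epsilon>: "0 \<le> \<epsilon>" "\<epsilon> < e"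
    and I: "I \<in> sets unit_leb" "1 - \<epsilon> \<le> measure unit_leb I"
    and close: "\<forall>s\<in>I. \<forall>t\<in>I. \<bar>mdist (mm_metric Y) (i s) (i t) - mdist (mm_metric Z) (j s) (j t)\<bar> \<le> \<epsilon>"
    using box_distance_lessD[OF Y Z less] by blast
  have i: "i \<in> measurable unit_leb (mm_measure Y)" "distr unit_leb (mm_measure Y) i = mm_measure Y"
    and j: "j \<in> measurable unit_leb (mm_measure Z)" "distr unit_leb (mm_measure Z) j = mm_measure Z"
    using ij by (simp_all add: parameters_def)
  have Isp: "I \<subseteq> space unit_leb" by (rule sets.sets_into_space[OF I(1)])
  have im: "i s \<in> mspace (mm_metric Y)" and jm: "j s \<in> mspace (mm_metric Z)" if "s \<in> I" for s
    using measurable_space[OF i(1), of s] measurable_space[OF j(1), of s] that Isp mm_spaceD(2)[OF Y] mm_spaceD(2)[OF Z] by blast+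
  \<comment> \<open>Here \<open>e \<le> 1\<close> enters: since \<open>\<epsilon> < e\<close>, the
    set \<open>I\<close> has positive measure, so it is not empty.\<close>
  have Ine: "j ` I \<noteq> {}" using I(2) \<epsilon> e by auto
  have sub: "j ` I \<subseteq> mspace (mm_metric Z)" using jm by blast
  \<comment> \<open>The parameter \<open>j\<close> need not be injective, so a parameter value over
    each point of its image is chosen.\<close>
  define t where "t z = inv_into I j z" for z
  have t: "t z \<in> I" "j (t z) = z" if "z \<in> j ` I" for z
    using that by (simp_all add: t_def inv_into_into f_inv_into_f)
  have "\<exists>g. (\<forall>x\<in>mspace (mm_metric Z). \<forall>y\<in>mspace (mm_metric Z). \<bar>g x - g y\<bar> \<le> mdist (mm_metric Z) x y) \<and>
      (\<forall>x\<in>j ` I. \<bar>g x - f n (i (t x))\<bar> \<le> \<epsilon>)" for n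
  proof (rule mcshane_extension[OF sub Ine \<epsilon>(1)])
    fix x y assume xy: "x \<in> j ` I" "y \<in> j ` I"
    have "\<bar>f n (i (t x)) - f n (i (t y))\<bar> \<le> mdist (mm_metric Y) (i (t x)) (i (t y))"
      by (intro f im t xy)
    also have "\<dots> \<le> mdist (mm_metric Z) (j (t x)) (j (t y)) + \<epsilon>"
      using close[rule_format, OF t(1)[OF xy(1)] t(1)[OF xy(2)]] by linarith
    finally show "\<bar>f n (i (t x)) - f n (i (t y))\<bar> \<le> mdist (mm_metric Z) x y + \<epsilon>" using t xy by simp
  qed
  then have "\<forall>n. \<exists>g. (\<forall>x\<in>mspace (mm_metric Z). \<forall>y\<in>mspace (mm_metric Z). \<bar>g x - g y\<bar> \<le> mdist (mm_metric Z) x y) \<and>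
      (\<forall>x\<in>j ` I. \<bar>g x - f n (i (t x))\<bar> \<le> \<epsilon>)" ..
  from choice[OF this] obtain g where g:
    "\<forall>n. (\<forall>x\<in>mspace (mm_metric Z). \<forall>y\<in>mspace (mm_metric Z). \<bar>g n x - g n y\<bar> \<le> mdist (mm_metric Z) x y) \<and>
      (\<forall>x\<in>j ` I. \<bar>g n x - f n (i (t x))\<bar> \<le> \<epsilon>)" ..
  have gl: "\<bar>g n x - g n y\<bar> \<le> mdist (mm_metric Z) x y" if "x \<in> mspace (mm_metric Z)" "y \<in> mspace (mm_metric Z)" for n x y
    using g that by blast
  \<comment> \<open>One \<open>\<epsilon>\<close> comes from McShane's formula. The other comes from
    replacing \<open>s\<close> by \<open>t (j s)\<close>: both have the same image under
    \<open>j\<close>, so their images under \<open>i\<close> are at most \<open>\<epsilon>\<close>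
    apart.\<close>
  have gf: "\<bar>g n (j s) - f n (i s)\<bar> \<le> 2 * \<epsilon>" if s: "s \<in> I" for n s
  proof -
    have js: "j s \<in> j ` I" using s by blast
    have "\<bar>f n (i (t (j s))) - f n (i s)\<bar> \<le> mdist (mm_metric Y) (i (t (j s))) (i s)"
      by (intro f im t js s)
    also have "\<dots> \<le> mdist (mm_metric Z) (j (t (j s))) (j s) + \<epsilon>"
      using close[rule_format, OF t(1)[OF js] s] by linarith
    also have "\<dots> = \<epsilon>" using t(2)[OF js] jm[OF s] by simp
    finally show ?thesis using g js by (smt (verit))
  qed
  have [measurable]: "g n \<in> borel_measurable (mm_measure Z)" for n by (rule lipschitz_measurable[OF Z gl])
  have [measurable]: "f n \<in> borel_measurable (mm_measure Y)" for n by (rule lipschitz_measurable[OF Y f])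
  have gm[measurable]: "(\<lambda>x n. g n x) \<in> borel_measurable (mm_measure Z)"
    by (rule measurable_coordinatewise_then_product) measurable
  have fm[measurable]: "(\<lambda>x n. f n x) \<in> borel_measurable (mm_measure Y)"
    by (rule measurable_coordinatewise_then_product) measurable
  note D = dom_mapD[OF \<phi>, unfolded emm_of_mm_simps]
  have "\<bar>integral\<^sup>L (emm_completion X) (\<lambda>x. h (\<lambda>n. g n (\<phi> x))) - integral\<^sup>L (completion (mm_measure Y)) (\<lambda>x. h (\<lambda>n. f n x))\<bar>
        \<le> L * (real n * (2 * e)) + e"
    if h: "\<forall>z. 0 \<le> h z \<and> h z \<le> (1::real)" and L: "0 \<le> L" "\<forall>z z'. \<bar>h z - h z'\<bar> \<le> L * (\<Sum>i<n. \<bar>z i - z' i\<bar>)" for h n L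
  proof -
    have "lip_cylinder h" unfolding lip_cylinder_def using h L by blast
    note hm[measurable] = lip_cylinder_measurable[OF this]
    have hg: "(\<lambda>z. h (\<lambda>n. g n z)) \<in> borel_measurable (mm_measure Z)"
      by (rule measurable_compose[OF gm hm])
    have hf: "(\<lambda>z. h (\<lambda>n. f n z)) \<in> borel_measurable (mm_measure Y)"
      by (rule measurable_compose[OF fm hm])
    have a: "(\<lambda>s. h (\<lambda>n. g n (j s))) \<in> borel_measurable unit_leb" by (rule measurable_compose[OF j(1) hg])
    have b: "(\<lambda>s. h (\<lambda>n. f n (i s))) \<in> borel_measurable unit_leb" by (rule measurable_compose[OF i(1) hf])
    have int: "integrable unit_leb (\<lambda>s. h (\<lambda>n. g n (j s)))" "integrable unit_leb (\<lambda>s. h (\<lambda>n. f n (i s)))"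
      using a b h by (auto intro!: U.integrable_const_bound[where B=1] AE_I2)
    have "integral\<^sup>L (emm_completion X) (\<lambda>x. h (\<lambda>n. g n (\<phi> x))) = integral\<^sup>L (distr (emm_completion X) (mm_measure Z) \<phi>) (\<lambda>z. h (\<lambda>n. g n z))"
      by (rule integral_distr[OF D(1) hg, symmetric])
    also have "\<dots> = integral\<^sup>L (distr unit_leb (mm_measure Z) j) (\<lambda>z. h (\<lambda>n. g n z))" unfolding D(2) j(2) ..
    also have "\<dots> = integral\<^sup>L unit_leb (\<lambda>s. h (\<lambda>n. g n (j s)))" by (rule integral_distr[OF j(1) hg])
    finally have 1: "integral\<^sup>L (emm_completion X) (\<lambda>x. h (\<lambda>n. g n (\<phi> x))) = integral\<^sup>L unit_leb (\<lambda>s. h (\<lambda>n. g n (j s)))" .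
    have "integral\<^sup>L (completion (mm_measure Y)) (\<lambda>x. h (\<lambda>n. f n x)) = integral\<^sup>L (distr unit_leb (mm_measure Y) i) (\<lambda>x. h (\<lambda>n. f n x))"
      unfolding i(2) by (rule integral_completion[OF hf])
    also have "\<dots> = integral\<^sup>L unit_leb (\<lambda>s. h (\<lambda>n. f n (i s)))" by (rule integral_distr[OF i(1) hf])
    finally have 2: "integral\<^sup>L (completion (mm_measure Y)) (\<lambda>x. h (\<lambda>n. f n x)) = integral\<^sup>L unit_leb (\<lambda>s. h (\<lambda>n. f n (i s)))" .
    have "\<bar>integral\<^sup>L unit_leb (\<lambda>s. h (\<lambda>n. g n (j s))) - integral\<^sup>L unit_leb (\<lambda>s. h (\<lambda>n. f n (i s)))\<bar>
      = \<bar>integral\<^sup>L unit_leb (\<lambda>s. h (\<lambda>n. g n (j s)) - h (\<lambda>n. f n (i s)))\<bar>"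
      using int by simp
    also have "\<dots> \<le> integral\<^sup>L unit_leb (\<lambda>s. \<bar>h (\<lambda>n. g n (j s)) - h (\<lambda>n. f n (i s))\<bar>)" by (rule integral_abs_bound)
    also have "\<dots> \<le> integral\<^sup>L unit_leb (\<lambda>s. L * (real n * (2 * \<epsilon>)) + indicator (space unit_leb - I) s)"
    proof (rule integral_mono)
      show "integrable unit_leb (\<lambda>s. \<bar>h (\<lambda>n. g n (j s)) - h (\<lambda>n. f n (i s))\<bar>)" using int by simp
      have Ic: "space unit_leb - I \<in> sets unit_leb" using I(1) by (rule sets.compl_sets)
      then show "integrable unit_leb (\<lambda>s. L * (real n * (2 * \<epsilon>)) + indicator (space unit_leb - I) s)"
        by (intro Bochner_Integration.integrable_add U.integrable_const integrable_real_indicator) (simp_all add: U.emeasure_eq_measure)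
      fix s assume s: "s \<in> space unit_leb"
      have hb: "\<bar>h (\<lambda>n. g n (j s)) - h (\<lambda>n. f n (i s))\<bar> \<le> 1"
        using h[rule_format, of "\<lambda>n. g n (j s)"] h[rule_format, of "\<lambda>n. f n (i s)"] by linarith
      have c0: "0 \<le> L * (real n * (2 * \<epsilon>))" using L(1) \<epsilon>(1) by simp
      show "\<bar>h (\<lambda>n. g n (j s)) - h (\<lambda>n. f n (i s))\<bar> \<le> L * (real n * (2 * \<epsilon>)) + indicator (space unit_leb - I) s"
      proof (cases "s \<in> I")
        case True
        have "\<bar>h (\<lambda>n. g n (j s)) - h (\<lambda>n. f n (i s))\<bar> \<le> L * (\<Sum>k<n. \<bar>g k (j s) - f k (i s)\<bar>)"
          using L(2) by blast
        also have "\<dots> \<le> L * (\<Sum>k<n. 2 * \<epsilon>)"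
          by (intro mult_left_mono sum_mono gf[OF True] L(1))
        finally show ?thesis using True by simp
      next
        case False
        then have "indicator (space unit_leb - I) s = (1 :: real)" using s by (intro indicator_eq_1_iff[THEN iffD2]) blast
        then show ?thesis using hb c0 by linarith
      qed
    qed
    also have "\<dots> = L * (real n * (2 * \<epsilon>)) + measure unit_leb (space unit_leb - I)"
    proof -
      have Ic: "space unit_leb - I \<in> sets unit_leb" using I(1) by (rule sets.compl_sets)
      have int: "integrable unit_leb (indicator (space unit_leb - I) :: real \<Rightarrow> real)"
        using Ic by (intro integrable_real_indicator) (simp_all add: U.emeasure_eq_measure)
      have "integral\<^sup>L unit_leb (\<lambda>s. L * (real n * (2 * \<epsilon>)) + indicator (space unit_leb - I) s)
        = integral\<^sup>L unit_leb (\<lambda>s. L * (real n * (2 * \<epsilon>))) + integral\<^sup>L unit_leb (indicator (space unit_leb - I))"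
        by (rule Bochner_Integration.integral_add[OF U.integrable_const int])
      also have "integral\<^sup>L unit_leb (\<lambda>s. L * (real n * (2 * \<epsilon>))) = L * (real n * (2 * \<epsilon>))"
        using U.prob_space by (simp only: lebesgue_integral_const scaleR_conv_of_real) simp
      also have "integral\<^sup>L unit_leb (indicator (space unit_leb - I) :: real \<Rightarrow> real) = measure unit_leb (space unit_leb - I)"
        by (rule has_bochner_integral_integral_eq[OF has_bochner_integral_real_indicator[OF Ic]]) (simp add: U.emeasure_eq_measure)
      finally show ?thesis .
    qed
    also have "\<dots> \<le> L * (real n * (2 * e)) + e"
    proof (rule add_mono)
      show "L * (real n * (2 * \<epsilon>)) \<le> L * (real n * (2 * e))"
        using \<epsilon>(2) by (intro mult_left_mono L(1)) simp_all
      show "measure unit_leb (space unit_leb - I) \<le> e" using U.prob_compl[OF I(1)] I(2) \<epsilon>(2) by linarith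
    qed
    finally show ?thesis unfolding 1 2 .
  qed
  moreover have "(\<lambda>x. g n (\<phi> x)) \<in> Lip1 X" for n
    by (rule Lip1_pullback[OF X emm_space_emm_of_mm[OF Z] \<phi> lipschitz_in_Lip1[OF Z gl]])
  ultimately show ?thesis by (intro exI[of _ "\<lambda>n x. g n (\<phi> x)"]) blast
qed

text \<open>Here the metric is finite and separable, and by the triangle inequality the distance to
  a point \<open>q n\<close> near \<open>x\<close> separates \<open>x\<close> from \<open>y\<close>
  by almost their full distance.\<close>

lemma distances_generating:
  assumes Y: "mm_space Y" and q: "range q \<subseteq> mspace (mm_metric Y)"
    "\<forall>x\<in>mspace (mm_metric Y). \<forall>e>0. \<exists>n. mdist (mm_metric Y) x (q n) < e"
    and f: "\<And>n. f n \<in> borel_measurable (completion (mm_measure Y))" "\<And>n x. f n x = mdist (mm_metric Y) (q n) x"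
  shows "generating (emm_of_mm Y) f"
  unfolding generating_def emm_of_mm_simps
proof (intro conjI allI f(1) exI[of _ "mspace (mm_metric Y)"] ballI)
  let ?m = "mm_metric Y"
  show "AE x in completion (mm_measure Y). x \<in> mspace ?m"
    using mm_spaceD(2)[OF Y] by (intro AE_I2) simp
  fix x y assume xy: "x \<in> mspace ?m" "y \<in> mspace ?m"
  show "ennreal (mdist ?m x y) \<le> (SUP n. ennreal \<bar>f n x - f n y\<bar>)"
  proof (rule ennreal_le_epsilon)
    fix e :: real assume e: "0 < e"
    then obtain n where n: "mdist ?m x (q n) < e / 2" using q(2) xy(1) by (meson half_gt_zero)
    have qn: "q n \<in> mspace ?m" using q(1) by blast
    have "mdist ?m x y \<le> \<bar>f n x - f n y\<bar> + e"
      using n mdist_triangle[OF xy(1) qn xy(2)] mdist_commute[of ?m x "q n"] unfolding f(2) by linarith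
    then have "ennreal (mdist ?m x y) \<le> ennreal (\<bar>f n x - f n y\<bar> + e)" by (rule ennreal_leI)
    also have "\<dots> = ennreal \<bar>f n x - f n y\<bar> + ennreal e" using e by (intro ennreal_plus) simp_all
    also have "\<dots> \<le> (SUP n. ennreal \<bar>f n x - f n y\<bar>) + ennreal e" by (intro add_right_mono SUP_upper UNIV_I)
    finally show "ennreal (mdist ?m x y) \<le> (SUP n. ennreal \<bar>f n x - f n y\<bar>) + ennreal e" .
  qed
qed

text \<open>For fixed \<open>n\<close> and \<open>L\<close> the error in
  \<open>box_approximation_law\<close> tends to 0. So the laws of suitable Lipschitz functions on
  \<open>X\<close> converge to the law of the distances to a dense sequence of \<open>Y\<close>, a
  generating family.\<close>

lemma domination_box_limit:
  fixes Y :: "real mm"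
  assumes X: "emm_space X" and cpt: "compact_space (mtopology_of (L1 X))" and Y: "mm_space Y"
    and near: "\<And>e. 0 < e \<Longrightarrow> \<exists>Z :: real mm. mm_space Z \<and> emm_of_mm Z \<prec>\<^sub>L X \<and> box_distance Y Z < e"
  shows "emm_of_mm Y \<prec>\<^sub>L X"
proof -
  let ?m = "mm_metric Y" and ?N = "completion (mm_measure Y)"
  obtain q :: "nat \<Rightarrow> real" where q: "range q \<subseteq> mspace ?m \<and> (\<forall>x\<in>mspace ?m. \<forall>e>0. \<exists>n. mdist ?m x (q n) < e)"
    using dense_sequence[OF mm_spaceD(5)[OF Y] mm_spaceD(6)[OF Y]] ..
  define f where "f n x = mdist ?m (q n) x" for n x
  have f: "\<bar>f n x - f n y\<bar> \<le> mdist ?m x y" if xy: "x \<in> mspace ?m" "y \<in> mspace ?m" for n x y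
  proof -
    have "q n \<in> mspace ?m" using q by blast
    then show ?thesis
      unfolding f_def using mdist_triangle[OF _ xy] mdist_triangle[OF _ xy(2,1)] mdist_commute[of ?m x y] by (smt (verit))
  qed
  have fm: "f n \<in> borel_measurable ?N" for n by (rule measurable_completion[OF lipschitz_measurable[OF Y f]])
  \<comment> \<open>The values stay at most 1, as \<open>box_approximation_law\<close>
    requires.\<close>
  define \<delta> where "\<delta> k = 1 / (real k + 1)" for k :: nat
  have "\<forall>k. \<exists>G. (\<forall>n. G n \<in> Lip1 X) \<and> (\<forall>h n L. (\<forall>z. 0 \<le> h z \<and> h z \<le> (1::real)) \<longrightarrow> 0 \<le> L \<longrightarrow>
      (\<forall>z z'. \<bar>h z - h z'\<bar> \<le> L * (\<Sum>i<n. \<bar>z i - z' i\<bar>)) \<longrightarrow>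
      \<bar>integral\<^sup>L (emm_completion X) (\<lambda>x. h (\<lambda>n. G n x)) - integral\<^sup>L ?N (\<lambda>x. h (\<lambda>n. f n x))\<bar>
        \<le> L * (real n * (2 * \<delta> k)) + \<delta> k)"
  proof
    fix k :: nat
    have \<delta>: "0 < \<delta> k" "\<delta> k \<le> 1" by (simp_all add: \<delta>_def)
    obtain Z :: "real mm" where Z: "mm_space Z \<and> emm_of_mm Z \<prec>\<^sub>L X \<and> box_distance Y Z < \<delta> k" using near[OF \<delta>(1)] ..
    then obtain \<phi> where \<phi>: "dom_map X (emm_of_mm Z) \<phi>" using dominated_iff[OF X] by blast
    show "\<exists>G. (\<forall>n. G n \<in> Lip1 X) \<and> (\<forall>h n L. (\<forall>z. 0 \<le> h z \<and> h z \<le> (1::real)) \<longrightarrow> 0 \<le> L \<longrightarrow>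
      (\<forall>z z'. \<bar>h z - h z'\<bar> \<le> L * (\<Sum>i<n. \<bar>z i - z' i\<bar>)) \<longrightarrow>
      \<bar>integral\<^sup>L (emm_completion X) (\<lambda>x. h (\<lambda>n. G n x)) - integral\<^sup>L ?N (\<lambda>x. h (\<lambda>n. f n x))\<bar>
        \<le> L * (real n * (2 * \<delta> k)) + \<delta> k)"
      by (rule box_approximation_law[OF X Y Z[THEN conjunct1] \<phi> Z[THEN conjunct2, THEN conjunct2] \<delta>(2) f])
  qed
  from choice[OF this] obtain G where G: "\<forall>k. (\<forall>n. G k n \<in> Lip1 X) \<and> (\<forall>h n L. (\<forall>z. 0 \<le> h z \<and> h z \<le> (1::real)) \<longrightarrow> 0 \<le> L \<longrightarrow>
      (\<forall>z z'. \<bar>h z - h z'\<bar> \<le> L * (\<Sum>i<n. \<bar>z i - z' i\<bar>)) \<longrightarrow>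
      \<bar>integral\<^sup>L (emm_completion X) (\<lambda>x. h (\<lambda>n. G k n x)) - integral\<^sup>L ?N (\<lambda>x. h (\<lambda>n. f n x))\<bar>
        \<le> L * (real n * (2 * \<delta> k)) + \<delta> k)" ..
  have \<delta>0: "\<delta> \<longlonglongrightarrow> 0" unfolding \<delta>_def using LIMSEQ_inverse_real_of_nat by (simp add: inverse_eq_divide add.commute)
  have "\<exists>H. (\<forall>n. H n \<in> Lip1 X) \<and> distr ?N borel (\<lambda>x n. f n x) = distr (emm_completion X) borel (\<lambda>x n. H n x)"
  proof (rule limit_law_realized[OF X cpt])
    show "G k n \<in> Lip1 X" for k n using G[rule_format, of k] by blast
    show "prob_space ?N" using emm_spaceD(3)[OF emm_space_emm_of_mm[OF Y]] by simp
    show "f n \<in> borel_measurable ?N" for n by (rule fm)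
    fix h assume "lip_cylinder h"
    then obtain n L where h: "\<forall>z. 0 \<le> h z \<and> h z \<le> 1" "0 \<le> L" "\<forall>z z'. \<bar>h z - h z'\<bar> \<le> L * (\<Sum>i<n. \<bar>z i - z' i\<bar>)"
      unfolding lip_cylinder_def by blast
    have bd: "\<bar>integral\<^sup>L (emm_completion X) (\<lambda>x. h (\<lambda>n. G k n x)) - integral\<^sup>L ?N (\<lambda>x. h (\<lambda>n. f n x))\<bar>
        \<le> L * (real n * (2 * \<delta> k)) + \<delta> k" for k
      using G[rule_format, of k, THEN conjunct2, rule_format, OF h(1)[rule_format] h(2) h(3)[rule_format]] .
    have "(\<lambda>k. L * (real n * (2 * \<delta> k)) + \<delta> k) \<longlonglongrightarrow> L * (real n * (2 * 0)) + 0"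
      by (intro tendsto_intros \<delta>0)
    then have lim: "(\<lambda>k. L * (real n * (2 * \<delta> k)) + \<delta> k) \<longlonglongrightarrow> 0" by simp
    have "(\<lambda>k. integral\<^sup>L (emm_completion X) (\<lambda>x. h (\<lambda>n. G k n x)) - integral\<^sup>L ?N (\<lambda>x. h (\<lambda>n. f n x))) \<longlonglongrightarrow> 0"
      by (rule Lim_null_comparison[OF _ lim]) (use bd in \<open>simp add: always_eventually\<close>)
    then show "(\<lambda>k. integral\<^sup>L (emm_completion X) (\<lambda>x. h (\<lambda>n. G k n x))) \<longlonglongrightarrow> integral\<^sup>L ?N (\<lambda>x. h (\<lambda>n. f n x))"
      by (rule LIM_zero_cancel)
  qed
  then obtain H where H: "\<forall>n. H n \<in> Lip1 X" "distr ?N borel (\<lambda>x n. f n x) = distr (emm_completion X) borel (\<lambda>x n. H n x)" by blast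
  have gen: "generating (emm_of_mm Y) f"
    by (rule distances_generating[OF Y q[THEN conjunct1] q[THEN conjunct2] fm f_def])
  have "\<exists>\<phi>. dom_map X (emm_of_mm Y) \<phi>"
    by (rule dom_map_of_equal_laws[OF emm_space_emm_of_mm[OF Y] X gen H(1)[rule_format]]) (simp add: H(2))
  then show ?thesis unfolding dominated_iff[OF X] .
qed

section \<open>Closedness and monotonicity of the set of dominated mm-spaces\<close>

lemma box_closure_below:
  assumes X: "emm_space X" and cpt: "compact_space (mtopology_of (L1 X))"
  shows "box_closure (below X) = below X"
proof
  show "below X \<subseteq> box_closure (below X)" by (rule below_subset_box_closure)
  show "box_closure (below X) \<subseteq> below X"
  proof
    fix \<Y> assume "\<Y> \<in> box_closure (below X)"
    then have \<Y>: "\<Y> \<in> mm_classes" "\<forall>\<epsilon>>0. \<exists>\<Z>\<in>below X. box_class_distance \<Y> \<Z> < \<epsilon>"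
      by (simp_all add: box_closure_def)
    obtain Y where Y: "mm_space Y" "\<Y> = mm_class Y" using mm_classesE[OF \<Y>(1)] .
    have Ym: "Y \<in> \<Y>" using mm_class_self[OF Y(1)] Y(2) by simp
    have "emm_of_mm Y \<prec>\<^sub>L X"
    proof (rule domination_box_limit[OF X cpt Y(1)])
      fix e :: real assume "0 < e"
      then obtain \<Z> where \<Z>: "\<Z> \<in> below X" "box_class_distance \<Y> \<Z> < e" using \<Y>(2) by blast
      have c: "\<Z> \<in> mm_classes" using \<Z>(1) by (simp add: below_def)
      obtain Z where Z: "mm_space Z" "\<Z> = mm_class Z" using mm_classesE[OF c] .
      have Zm: "Z \<in> \<Z>" using mm_class_self[OF Z(1)] Z(2) by simp
      have "box_distance Y Z < e" using \<Z>(2) box_class_distance_eq[OF \<Y>(1) Ym c Zm] by simp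
      then have "mm_space Z \<and> emm_of_mm Z \<prec>\<^sub>L X \<and> box_distance Y Z < e"
        using Z(1) below_member(1)[OF X \<Z>(1) Zm] by simp
      then show "\<exists>Z :: real mm. mm_space Z \<and> emm_of_mm Z \<prec>\<^sub>L X \<and> box_distance Y Z < e" ..
    qed
    then show "\<Y> \<in> below X" using mm_class_below[OF Y(1)] Y(2) by simp
  qed
qed

lemma below_mono:
  assumes X: "emm_space X" and Y: "emm_space Y" and "X \<prec>\<^sub>L Y"
  shows "below X \<subseteq> below Y"
proof
  fix \<Z> assume \<Z>: "\<Z> \<in> below X"
  then have c: "\<Z> \<in> mm_classes" by (simp add: below_def)
  obtain Z where Z: "mm_space Z" "\<Z> = mm_class Z" using mm_classesE[OF c] .
  have Zm: "Z \<in> \<Z>" using mm_class_self[OF Z(1)] Z(2) by simp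
  have "emm_of_mm Z \<prec>\<^sub>L Y" by (rule dominated_trans[OF Y X below_member(1)[OF X \<Z> Zm] assms(3)])
  then show "\<Z> \<in> below Y" using mm_class_below[OF Z(1)] Z(2) by simp
qed

text \<open>The first \<open>k\<close> functions factor through an mm-space \<open>Z\<close> in
  \<open>below X\<close>, which by assumption also lies below \<open>Y\<close>. Pulling the factored
  functions back to \<open>Y\<close> reproduces their joint law.\<close>

lemma finite_law_transfer:
  fixes k :: nat
  assumes X: "emm_space X" and Y: "emm_space Y" and sub: "below X \<subseteq> below Y" and f: "\<And>n. f n \<in> Lip1 X"
  shows "\<exists>g. (\<forall>n. g n \<in> Lip1 Y) \<and> (\<forall>h :: (nat \<Rightarrow> real) \<Rightarrow> real. h \<in> borel_measurable borel \<longrightarrow>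
    (\<forall>z z'. (\<forall>i<k. z i = z' i) \<longrightarrow> h z = h z') \<longrightarrow>
    integral\<^sup>L (emm_completion Y) (\<lambda>y. h (\<lambda>n. g n y)) = integral\<^sup>L (emm_completion X) (\<lambda>x. h (\<lambda>n. f n x)))"
proof -
  have "\<exists>(Z :: real mm) \<phi> u. mm_space Z \<and> dom_map X (emm_of_mm Z) \<phi> \<and>
      (\<forall>i<k. u i \<in> Lip1 (emm_of_mm Z) \<and> (\<forall>x. u i (\<phi> x) = f i x))"
    by (rule finite_joint_realization[OF X f])
  then obtain Z :: "real mm" and \<phi> u where Z: "mm_space Z" and \<phi>: "dom_map X (emm_of_mm Z) \<phi>"
    and u: "\<forall>i<k. u i \<in> Lip1 (emm_of_mm Z) \<and> (\<forall>x. u i (\<phi> x) = f i x)" by blast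
  note eZ = emm_space_emm_of_mm[OF Z]
  have "emm_of_mm Z \<prec>\<^sub>L X" unfolding dominated_iff[OF X] using \<phi> by blast
  then have "mm_class Z \<in> below Y" using mm_class_below[OF Z] sub by blast
  then have "emm_of_mm Z \<prec>\<^sub>L Y" by (rule below_member(1)[OF Y _ mm_class_self[OF Z]])
  then obtain \<psi> where \<psi>: "dom_map Y (emm_of_mm Z) \<psi>" unfolding dominated_iff[OF Y] ..
  \<comment> \<open>The admissible \<open>h\<close> do not look at coordinates from \<open>k\<close>
    on; the value 0 keeps these Lipschitz.\<close>
  define v where "v n = (if n < k then u n else (\<lambda>z. 0))" for n
  have v: "v n \<in> Lip1 (emm_of_mm Z)" for n using u const_Lip1[OF eZ] by (simp add: v_def)
  let ?C = "completion (mm_measure Z)"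
  have [measurable]: "v n \<in> borel_measurable ?C" for n using v[of n] unfolding Lip1_iff[OF eZ] by simp
  have vm: "(\<lambda>z n. v n z) \<in> borel_measurable ?C"
    by (rule measurable_coordinatewise_then_product) measurable
  have "integral\<^sup>L (emm_completion Y) (\<lambda>y. h (\<lambda>n. v n (\<psi> y))) = integral\<^sup>L (emm_completion X) (\<lambda>x. h (\<lambda>n. f n x))"
    if h: "h \<in> borel_measurable borel" and dep: "\<forall>z z'. (\<forall>i<k. z i = z' i) \<longrightarrow> h z = h z'" for h :: "(nat \<Rightarrow> real) \<Rightarrow> real"
  proof -
    have hv: "(\<lambda>z. h (\<lambda>n. v n z)) \<in> borel_measurable ?C" by (rule measurable_compose[OF vm h])
    note A = measure_preserving_completion[OF dom_mapD(1,2)[OF \<psi>, unfolded emm_of_mm_simps]]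
    note B = measure_preserving_completion[OF dom_mapD(1,2)[OF \<phi>, unfolded emm_of_mm_simps]]
    have "integral\<^sup>L (emm_completion Y) (\<lambda>y. h (\<lambda>n. v n (\<psi> y))) = integral\<^sup>L ?C (\<lambda>z. h (\<lambda>n. v n z))"
      using integral_distr[OF A(1) hv] unfolding A(2) by simp
    also have "\<dots> = integral\<^sup>L (emm_completion X) (\<lambda>x. h (\<lambda>n. v n (\<phi> x)))"
      using integral_distr[OF B(1) hv] unfolding B(2) by simp
    also have "(\<lambda>x. h (\<lambda>n. v n (\<phi> x))) = (\<lambda>x. h (\<lambda>n. f n x))"
      by (rule ext, rule dep[rule_format]) (use u in \<open>simp add: v_def\<close>)
    finally show ?thesis .
  qed
  moreover have "(\<lambda>y. v n (\<psi> y)) \<in> Lip1 Y" for n by (rule Lip1_pullback[OF Y eZ \<psi> v])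
  ultimately show ?thesis by (intro exI[of _ "\<lambda>n y. v n (\<psi> y)"] conjI allI impI)
qed

text \<open>The functions obtained on \<open>Y\<close> change with the number \<open>k\<close> of
  coordinates, so they form no single sequence. For a test function of \<open>n\<close> coordinates
  the integrals agree exactly from \<open>k = n\<close> on, so the laws converge, and compactness of
  \<open>L1 Y\<close> provides one sequence with the limit law.\<close>

lemma below_subset_imp_dominated:
  assumes X: "emm_space X" and Y: "emm_space Y" and cpt: "compact_space (mtopology_of (L1 Y))" and sub: "below X \<subseteq> below Y"
  shows "X \<prec>\<^sub>L Y"
proof -
  obtain f where f: "generating X f \<and> (\<forall>n. f n \<in> Lip1 X)" using exists_generating[OF X] ..
  have fL: "f n \<in> Lip1 X" for n using f by blast
  have "\<forall>k::nat. \<exists>g. (\<forall>n. g n \<in> Lip1 Y) \<and> (\<forall>h :: (nat \<Rightarrow> real) \<Rightarrow> real. h \<in> borel_measurable borel \<longrightarrow>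
    (\<forall>z z'. (\<forall>i<k. z i = z' i) \<longrightarrow> h z = h z') \<longrightarrow>
    integral\<^sup>L (emm_completion Y) (\<lambda>y. h (\<lambda>n. g n y)) = integral\<^sup>L (emm_completion X) (\<lambda>x. h (\<lambda>n. f n x)))"
    by (intro allI finite_law_transfer[OF X Y sub fL])
  from choice[OF this] obtain g where g: "\<forall>k::nat. (\<forall>n. g k n \<in> Lip1 Y) \<and> (\<forall>h :: (nat \<Rightarrow> real) \<Rightarrow> real. h \<in> borel_measurable borel \<longrightarrow>
    (\<forall>z z'. (\<forall>i<k. z i = z' i) \<longrightarrow> h z = h z') \<longrightarrow>
    integral\<^sup>L (emm_completion Y) (\<lambda>y. h (\<lambda>n. g k n y)) = integral\<^sup>L (emm_completion X) (\<lambda>x. h (\<lambda>n. f n x)))" ..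
  have "\<exists>G. (\<forall>n. G n \<in> Lip1 Y) \<and> distr (emm_completion X) borel (\<lambda>x n. f n x) = distr (emm_completion Y) borel (\<lambda>y n. G n y)"
  proof (rule limit_law_realized[OF Y cpt])
    show "g k n \<in> Lip1 Y" for k n using g[rule_format, of k] by blast
    show "prob_space (emm_completion X)" by (rule emm_spaceD(3)[OF X])
    show "f n \<in> borel_measurable (emm_completion X)" for n using fL[of n] unfolding Lip1_iff[OF X] by simp
    fix h assume h: "lip_cylinder h"
    then obtain n L where L: "\<forall>z z'. \<bar>h z - h z'\<bar> \<le> L * (\<Sum>i<n. \<bar>z i - z' i\<bar>)"
      unfolding lip_cylinder_def by blast
    have eq: "integral\<^sup>L (emm_completion Y) (\<lambda>y. h (\<lambda>n. g k n y)) = integral\<^sup>L (emm_completion X) (\<lambda>x. h (\<lambda>n. f n x))" if k: "n \<le> k" for k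
    proof -
      have "\<forall>z z'. (\<forall>i<k. z i = z' i) \<longrightarrow> h z = h z'"
      proof (intro allI impI)
        fix z z' :: "nat \<Rightarrow> real" assume "\<forall>i<k. z i = z' i"
        then have "(\<Sum>i<n. \<bar>z i - z' i\<bar>) = 0" using k by (intro sum.neutral) auto
        then have "\<bar>h z - h z'\<bar> \<le> 0" using L[rule_format, of z z'] by simp
        then show "h z = h z'" by simp
      qed
      then show ?thesis using g[rule_format, of k] lip_cylinder_measurable[OF h] by blast
    qed
    show "(\<lambda>k. integral\<^sup>L (emm_completion Y) (\<lambda>x. h (\<lambda>n. g k n x))) \<longlonglongrightarrow> integral\<^sup>L (emm_completion X) (\<lambda>x. h (\<lambda>n. f n x))"
      by (rule tendsto_eventually, rule eventually_sequentiallyI[of n], rule eq)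
  qed
  then obtain G where G: "\<forall>n. G n \<in> Lip1 Y" "distr (emm_completion X) borel (\<lambda>x n. f n x) = distr (emm_completion Y) borel (\<lambda>y n. G n y)" by blast
  have "\<exists>\<phi>. dom_map Y X \<phi>"
    by (rule dom_map_of_equal_laws[OF X Y f[THEN conjunct1] G(1)[rule_format] G(2)])
  then show ?thesis unfolding dominated_iff[OF Y] .
qed

section \<open>Concentration and compactness\<close>

lemma L1_pullback_isometric:
  assumes X: "emm_space X" and Y: "emm_space Y" and \<phi>: "dom_map X Y \<phi>"
  shows "\<exists>A \<subseteq> mspace (L1 X). A \<noteq> {} \<and> isometric_metrics (L1 Y) (submetric (L1 X) A)"
proof -
  have "\<forall>F\<in>mspace (L1 Y). \<exists>f. f \<in> Lip1 Y \<and> F = L1_class Y f"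
    unfolding mspace_L1[OF Y] by blast
  from bchoice[OF this] obtain r where r: "\<forall>F\<in>mspace (L1 Y). r F \<in> Lip1 Y \<and> F = L1_class Y (r F)" ..
  define T where "T F = L1_class X (\<lambda>x. r F (\<phi> x))" for F
  have pull: "(\<lambda>x. r F (\<phi> x)) \<in> Lip1 X" if "F \<in> mspace (L1 Y)" for F
    using r that by (intro Lip1_pullback[OF X Y \<phi>]) blast
  have sub: "T ` mspace (L1 Y) \<subseteq> mspace (L1 X)"
    unfolding T_def mspace_L1[OF X] using pull by blast
  have "mdist (L1 X) (T F) (T G) = mdist (L1 Y) F G" if FG: "F \<in> mspace (L1 Y)" "G \<in> mspace (L1 Y)" for F G
  proof -
    have rF: "r F \<in> L0 Y" "r G \<in> L0 Y" "F = L1_class Y (r F)" "G = L1_class Y (r G)"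
      using r FG Lip1_subset_L0 by blast+
    have "mdist (L1 X) (T F) (T G) = kfan_mod (emm_completion X) (\<lambda>x. r F (\<phi> x)) (\<lambda>x. r G (\<phi> x))"
      unfolding T_def by (rule mdist_L1[OF X]) (use pull[OF FG(1)] pull[OF FG(2)] Lip1_subset_L0 in blast)+
    also have "\<dots> = kfan_mod (emm_completion Y) (r F) (r G)" by (rule kfan_mod_pullback[OF \<phi> rF(1,2)])
    also have "\<dots> = mdist (L1 Y) (L1_class Y (r F)) (L1_class Y (r G))" by (rule mdist_L1[OF Y rF(1,2), symmetric])
    also have "\<dots> = mdist (L1 Y) F G" using rF(3,4) by simp
    finally show ?thesis .
  qed
  then have "isometric_metrics (L1 Y) (submetric (L1 X) (T ` mspace (L1 Y)))"
    unfolding isometric_metrics_def isometric_embedding_def using sub by (intro exI[of _ T]) auto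
  moreover have "T ` mspace (L1 Y) \<noteq> {}"
    using const_Lip1[OF Y, of 0] unfolding mspace_L1[OF Y] by blast
  ultimately show ?thesis using sub by blast
qed

lemma L1_nonempty: "emm_space X \<Longrightarrow> mspace (L1 X) \<noteq> {}"
  using const_Lip1[of X 0] by (auto simp: mspace_L1)

lemma compact_metric_L1_mm: "mm_space Y \<Longrightarrow> compact_metric (L1 (emm_of_mm Y))"
  using L1_mm_compact L1_nonempty emm_space_emm_of_mm by (auto simp: compact_metric_def)

text \<open>Up to isometry all these spaces are compact, hence closed, subsets of the single compact
  space \<open>L1 X\<close>, so Blaschke's theorem applies.\<close>

lemma below_concentrated:
  assumes X: "emm_space X" and cpt: "compact_space (mtopology_of (L1 X))"
  shows "compactin gh_topology (gh_topology closure_of {isometry_class (L1 (emm_of_mm Y)) | Y. Y \<in> \<Union>(below X)})"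
proof (rule gh_compact_closed_subsets[OF cpt], rule subsetI)
  fix C assume "C \<in> {isometry_class (L1 (emm_of_mm Y)) | Y. Y \<in> \<Union>(below X)}"
  then obtain Y \<Y> where C: "C = isometry_class (L1 (emm_of_mm Y))" and Y: "\<Y> \<in> below X" "Y \<in> \<Y>" by blast
  note mm = below_member(2)[OF X Y]
  have "emm_of_mm Y \<prec>\<^sub>L X" by (rule below_member(1)[OF X Y])
  then obtain \<phi> where \<phi>: "dom_map X (emm_of_mm Y) \<phi>" unfolding dominated_iff[OF X] ..
  obtain A where A: "A \<subseteq> mspace (L1 X)" "A \<noteq> {}" and iso: "isometric_metrics (L1 (emm_of_mm Y)) (submetric (L1 X) A)"
    using L1_pullback_isometric[OF X emm_space_emm_of_mm[OF mm] \<phi>] by blast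
  interpret L: Metric_space "mspace (L1 X)" "mdist (L1 X)" by simp
  have "compact_metric (submetric (L1 X) A)"
    by (rule isometric_metrics_compact[OF iso compact_metric_L1_mm[OF mm]])
  then have "compactin (mtopology_of (L1 X)) A"
    unfolding compact_metric_def mtopology_of_submetric using A(1) by (simp add: compactin_subspace)
  then have "closedin (mtopology_of (L1 X)) A"
    using L.Hausdorff_space_mtopology by (intro compactin_imp_closedin) (simp_all add: mtopology_of_def)
  then show "C \<in> (\<lambda>A. isometry_class (submetric (L1 X) A)) ` {A. closedin (mtopology_of (L1 X)) A \<and> A \<noteq> {}}"
    using A(2) isometry_class_eq[OF iso] C by blast
qed

section \<open>The pyramid axioms\<close>

lemma class_dominatedD:
  assumes "class_dominated \<Y> \<X>" "\<Y> \<in> mm_classes" "\<X> \<in> mm_classes" "Y \<in> \<Y>" "X \<in> \<X>"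
  shows "emm_of_mm Y \<prec>\<^sub>L emm_of_mm X"
proof -
  obtain Y' X' where YX: "Y' \<in> \<Y>" "X' \<in> \<X>" "emm_of_mm Y' \<prec>\<^sub>L emm_of_mm X'"
    using assms(1) unfolding class_dominated_def by blast
  note e = emm_space_emm_of_mm[OF mm_class_member(1)]
  have "emm_of_mm Y \<prec>\<^sub>L emm_of_mm X'"
    by (rule dominated_trans[OF e[OF assms(3) YX(2,2)] e[OF assms(2) YX(1,1)] mm_class_member(2)[OF assms(2,4) YX(1)] YX(3)])
  then show ?thesis
    by (rule dominated_trans[OF e[OF assms(3,5,5)] e[OF assms(3) YX(2,2)] _ mm_class_member(2)[OF assms(3) YX(2) assms(5)]])
qed

lemma below_nonempty:
  assumes X: "emm_space X"
  shows "below X \<noteq> {}"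
proof -
  obtain Y :: "real mm" where Y: "mm_space Y \<and> dom_map X (emm_of_mm Y) (\<lambda>_. 0) \<and> mm_metric Y = euclidean_metric"
    using real_line_image[OF X const_Lip1[OF X]] ..
  then have "emm_of_mm Y \<prec>\<^sub>L X" unfolding dominated_iff[OF X] by blast
  then show ?thesis using mm_class_below Y by blast
qed

lemma below_directed:
  assumes X: "emm_space X" and \<Y>: "\<Y>1 \<in> below X" "\<Y>2 \<in> below X"
  shows "\<exists>\<Z>\<in>below X. class_dominated \<Y>1 \<Z> \<and> class_dominated \<Y>2 \<Z>"
proof -
  have c: "\<Y>1 \<in> mm_classes" "\<Y>2 \<in> mm_classes" using \<Y> by (simp_all add: below_def)
  obtain Y1 where Y1: "mm_space Y1" "\<Y>1 = mm_class Y1" using mm_classesE[OF c(1)] .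
  obtain Y2 where Y2: "mm_space Y2" "\<Y>2 = mm_class Y2" using mm_classesE[OF c(2)] .
  have m: "Y1 \<in> \<Y>1" "Y2 \<in> \<Y>2" using mm_class_self[OF Y1(1)] mm_class_self[OF Y2(1)] Y1(2) Y2(2) by simp_all
  from below_member(1)[OF X \<Y>(1) m(1)] obtain \<phi>1 where \<phi>1: "dom_map X (emm_of_mm Y1) \<phi>1"
    unfolding dominated_iff[OF X] ..
  from below_member(1)[OF X \<Y>(2) m(2)] obtain \<phi>2 where \<phi>2: "dom_map X (emm_of_mm Y2) \<phi>2"
    unfolding dominated_iff[OF X] ..
  from joint_domination[OF X Y1(1) \<phi>1 Y2(1) \<phi>2]
  obtain Z :: "real mm" and \<psi> p1 p2 where Z: "mm_space Z" "dom_map X (emm_of_mm Z) \<psi>"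
    and p: "\<forall>x. p1 (\<psi> x) = \<phi>1 x" "\<forall>x. p2 (\<psi> x) = \<phi>2 x"
      "\<forall>x\<in>mspace (mm_metric Z). p1 x \<in> mspace (mm_metric Y1) \<and> p2 x \<in> mspace (mm_metric Y2)"
      "\<forall>x\<in>mspace (mm_metric Z). \<forall>y\<in>mspace (mm_metric Z).
      mdist (mm_metric Y1) (p1 x) (p1 y) \<le> mdist (mm_metric Z) x y \<and> mdist (mm_metric Y2) (p2 x) (p2 y) \<le> mdist (mm_metric Z) x y"
    by blast
  have "dom_map (emm_of_mm Z) (emm_of_mm Y1) p1"
    by (rule dom_map_lipschitz_factor[OF X Y1(1) Z(1,2) \<phi>1]) (simp_all add: p)
  then have d1: "emm_of_mm Y1 \<prec>\<^sub>L emm_of_mm Z" unfolding dominated_iff[OF emm_space_emm_of_mm[OF Z(1)]] by blast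
  have "dom_map (emm_of_mm Z) (emm_of_mm Y2) p2"
    by (rule dom_map_lipschitz_factor[OF X Y2(1) Z(1,2) \<phi>2]) (simp_all add: p)
  then have d2: "emm_of_mm Y2 \<prec>\<^sub>L emm_of_mm Z" unfolding dominated_iff[OF emm_space_emm_of_mm[OF Z(1)]] by blast
  have "emm_of_mm Z \<prec>\<^sub>L X" unfolding dominated_iff[OF X] using Z(2) by blast
  then have "mm_class Z \<in> below X" by (rule mm_class_below[OF Z(1)])
  then show ?thesis using d1 d2 m mm_class_self[OF Z(1)] unfolding class_dominated_def by blast
qed

lemma pyramid_below:
  assumes X: "emm_space X" and cpt: "compact_space (mtopology_of (L1 X))"
  shows "pyramid (below X)"
  unfolding pyramid_def
proof (intro conjI ballI impI below_nonempty[OF X] box_closure_below[OF X cpt] below_directed[OF X])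
  show sub: "below X \<subseteq> mm_classes" by (auto simp: below_def)
  fix \<X> \<Y> assume \<X>: "\<X> \<in> below X" and \<Y>: "\<Y> \<in> mm_classes" and dom: "class_dominated \<Y> \<X>"
  have c: "\<X> \<in> mm_classes" using \<X> sub by blast
  obtain Y where Y: "mm_space Y" "\<Y> = mm_class Y" using mm_classesE[OF \<Y>] .
  obtain Z where Z: "mm_space Z" "\<X> = mm_class Z" using mm_classesE[OF c] .
  have m: "Y \<in> \<Y>" "Z \<in> \<X>" using mm_class_self[OF Y(1)] mm_class_self[OF Z(1)] Y(2) Z(2) by simp_all
  have "emm_of_mm Y \<prec>\<^sub>L X"
    by (rule dominated_trans[OF X emm_space_emm_of_mm[OF Z(1)] class_dominatedD[OF dom \<Y> c m] below_member(1)[OF X \<X> m(2)]])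
  then show "\<Y> \<in> below X" using mm_class_below[OF Y(1)] Y(2) by simp
qed

text \<open>A finite separated set involves finitely many Lipschitz functions, which factor through
  one mm-space \<open>Z\<close> below \<open>X\<close>. Pullback preserves the distance modulo
  constants, so the set reappears in \<open>L1\<close> of \<open>Z\<close> with the same
  separation.\<close>

lemma L1_separated_card_bound:
  assumes X: "emm_space X" and e: "0 < e"
    and N: "\<And>(Y :: real mm) P. mm_space Y \<Longrightarrow> emm_of_mm Y \<prec>\<^sub>L X \<Longrightarrow> finite P \<Longrightarrow> P \<subseteq> mspace (L1 (emm_of_mm Y)) \<Longrightarrow>
      (\<And>x y. x \<in> P \<Longrightarrow> y \<in> P \<Longrightarrow> x \<noteq> y \<Longrightarrow> e \<le> mdist (L1 (emm_of_mm Y)) x y) \<Longrightarrow> card P \<le> N"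
    and P: "finite P" "P \<subseteq> mspace (L1 X)" "\<And>x y. x \<in> P \<Longrightarrow> y \<in> P \<Longrightarrow> x \<noteq> y \<Longrightarrow> e \<le> mdist (L1 X) x y"
  shows "card P \<le> N"
proof -
  obtain b where b: "bij_betw b {0..<card P} P" using ex_bij_betw_nat_finite[OF P(1)] ..
  have bP: "b i \<in> P" if "i < card P" for i using bij_betwE[OF b] that by simp
  have bne: "b i \<noteq> b k" if "i < card P" "k < card P" "i \<noteq> k" for i k
    using inj_on_eq_iff[OF bij_betw_imp_inj_on[OF b], of i k] that by simp
  have "\<forall>i\<in>{..<card P}. \<exists>f. f \<in> Lip1 X \<and> b i = L1_class X f"
  proof
    fix i assume "i \<in> {..<card P}"
    then have "b i \<in> mspace (L1 X)" using bP P(2) by blast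
    then show "\<exists>f. f \<in> Lip1 X \<and> b i = L1_class X f" unfolding mspace_L1[OF X] by blast
  qed
  from bchoice[OF this] obtain f where f: "\<forall>i\<in>{..<card P}. f i \<in> Lip1 X \<and> b i = L1_class X (f i)" ..
  have "\<exists>(Z :: real mm) \<phi> u. mm_space Z \<and> dom_map X (emm_of_mm Z) \<phi> \<and>
      (\<forall>i<card P. u i \<in> Lip1 (emm_of_mm Z) \<and> (\<forall>x. u i (\<phi> x) = f i x))"
    by (rule finite_joint_realization[OF X]) (use f in simp)
  then obtain Z :: "real mm" and \<phi> u where Z: "mm_space Z" and \<phi>: "dom_map X (emm_of_mm Z) \<phi>"
    and u: "\<forall>i<card P. u i \<in> Lip1 (emm_of_mm Z) \<and> (\<forall>x. u i (\<phi> x) = f i x)" by blast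
  let ?Z = "emm_of_mm Z"
  note eZ = emm_space_emm_of_mm[OF Z]
  have uL: "u i \<in> Lip1 ?Z" if "i < card P" for i using u that by simp
  have dom: "?Z \<prec>\<^sub>L X" unfolding dominated_iff[OF X] using \<phi> by blast
  have sep: "e \<le> mdist (L1 ?Z) (L1_class ?Z (u i)) (L1_class ?Z (u k))" if ik: "i < card P" "k < card P" "i \<noteq> k" for i k
  proof -
    have "u i \<in> Lip1 ?Z" "u k \<in> Lip1 ?Z" "f i \<in> Lip1 X" "f k \<in> Lip1 X"
      using u[rule_format, OF ik(1)] u[rule_format, OF ik(2)] f[rule_format, of i] f[rule_format, of k] ik by simp_all
    note L0 = this[THEN subsetD[OF Lip1_subset_L0]]
    have "e \<le> mdist (L1 X) (b i) (b k)" by (intro P(3) bP bne ik)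
    also have "\<dots> = mdist (L1 X) (L1_class X (f i)) (L1_class X (f k))"
      using f[rule_format, of i] f[rule_format, of k] ik by simp
    also have "\<dots> = kfan_mod (emm_completion X) (f i) (f k)" by (rule mdist_L1[OF X L0(3,4)])
    also have "\<dots> = kfan_mod (emm_completion X) (\<lambda>x. u i (\<phi> x)) (\<lambda>x. u k (\<phi> x))" using u ik by simp
    also have "\<dots> = kfan_mod (emm_completion ?Z) (u i) (u k)" by (rule kfan_mod_pullback[OF \<phi> L0(1,2)])
    also have "\<dots> = mdist (L1 ?Z) (L1_class ?Z (u i)) (L1_class ?Z (u k))" by (rule mdist_L1[OF eZ L0(1,2), symmetric])
    finally show ?thesis .
  qed
  define Q where "Q = (\<lambda>i. L1_class ?Z (u i)) ` {..<card P}"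
  have "inj_on (\<lambda>i. L1_class ?Z (u i)) {..<card P}"
  proof (rule inj_onI, rule ccontr)
    fix i k assume ik: "i \<in> {..<card P}" "k \<in> {..<card P}" and eq: "L1_class ?Z (u i) = L1_class ?Z (u k)" and "i \<noteq> k"
    have "L1_class ?Z (u k) \<in> mspace (L1 ?Z)" unfolding mspace_L1[OF eZ] using ik(2) by (intro imageI uL) simp
    from mdist_zero[OF this this] have "mdist (L1 ?Z) (L1_class ?Z (u k)) (L1_class ?Z (u k)) = 0" by (rule iffD2) (rule refl)
    moreover have "e \<le> mdist (L1 ?Z) (L1_class ?Z (u i)) (L1_class ?Z (u k))" using ik \<open>i \<noteq> k\<close> by (intro sep) simp_all
    ultimately show False using e unfolding eq by linarith
  qed
  then have "card Q = card P" unfolding Q_def by (simp add: card_image)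
  moreover have "card Q \<le> N"
  proof (rule N[OF Z dom])
    show "finite Q" by (simp add: Q_def)
    show "Q \<subseteq> mspace (L1 ?Z)" unfolding Q_def mspace_L1[OF eZ] by (intro image_subsetI imageI uL) simp
    fix x y assume xy: "x \<in> Q" "y \<in> Q" "x \<noteq> y"
    from xy(1) obtain i where i: "i < card P" "x = L1_class ?Z (u i)" unfolding Q_def by (elim imageE) simp
    from xy(2) obtain k where k: "k < card P" "y = L1_class ?Z (u k)" unfolding Q_def by (elim imageE) simp
    have "i \<noteq> k" using i(2) k(2) xy(3) by auto
    then show "e \<le> mdist (L1 ?Z) x y" unfolding i(2) k(2) by (rule sep[OF i(1) k(1)])
  qed
  ultimately show ?thesis by simp
qed

text \<open>An \<open>e\<close>-separated set of largest cardinality is a finite net, since an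
  uncovered point could be added to it.\<close>

lemma bounded_separated_imp_totally_bounded:
  fixes m :: "'a metric"
  assumes bd: "\<And>e. 0 < e \<Longrightarrow> \<exists>N. \<forall>P. finite P \<and> P \<subseteq> mspace m \<and> (\<forall>x\<in>P. \<forall>y\<in>P. x \<noteq> y \<longrightarrow> e \<le> mdist m x y) \<longrightarrow> card P \<le> N"
  shows "Metric_space.mtotally_bounded (mspace m) (mdist m) (mspace m)"
proof -
  interpret Metric_space "mspace m" "mdist m" by simp
  show ?thesis
    unfolding mtotally_bounded_def
  proof (intro allI impI)
    fix e :: real assume e: "0 < e"
    define S where "S P \<longleftrightarrow> finite P \<and> P \<subseteq> mspace m \<and> (\<forall>x\<in>P. \<forall>y\<in>P. x \<noteq> y \<longrightarrow> e \<le> mdist m x y)" for P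
    obtain N where N: "\<forall>P. S P \<longrightarrow> card P \<le> N" using bd[OF e] unfolding S_def ..
    then have "\<forall>P. S P \<longrightarrow> card P < Suc N" by (simp add: less_Suc_eq_le)
    moreover have "S {}" by (simp add: S_def)
    ultimately have "\<exists>P. S P \<and> (\<forall>Q. S Q \<longrightarrow> card Q \<le> card P)"
      by (intro Lattices_Big.ex_has_greatest_nat)
    then obtain P where P: "S P" "\<forall>Q. S Q \<longrightarrow> card Q \<le> card P" by blast
    have "mspace m \<subseteq> (\<Union>x\<in>P. mball x e)"
    proof
      fix z assume z: "z \<in> mspace m"
      show "z \<in> (\<Union>x\<in>P. mball x e)"
      proof (rule ccontr)
        assume no: "z \<notin> (\<Union>x\<in>P. mball x e)"
        then have far: "e \<le> mdist m x z" if "x \<in> P" for x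
          using that z P(1) unfolding S_def by (auto simp: not_less)
        have far': "e \<le> mdist m z x" if "x \<in> P" for x
          using far[OF that] by (subst mdist_commute)
        have "z \<notin> P"
        proof
          assume "z \<in> P"
          then show False using far[of z] e z by simp
        qed
        have "S (insert z P)"
          using P(1) far far' z unfolding S_def by simp
        then have "card (insert z P) \<le> card P" using P(2) by blast
        then show False using \<open>z \<notin> P\<close> P(1) by (simp add: S_def)
      qed
    qed
    with P(1) show "\<exists>K. finite K \<and> K \<subseteq> mspace m \<and> mspace m \<subseteq> (\<Union>x\<in>K. mball x e)"
      unfolding S_def by (intro exI[of _ P] conjI) simp_all
  qed
qed

text \<open>Precompactness bounds separated sets uniformly over the whole closure, in particular
  over \<open>below X\<close>. The bound carries over to \<open>L1 X\<close>, which is thus totally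
  bounded, and it is complete.\<close>

lemma concentrated_imp_L1_compact:
  assumes X: "emm_space X" and conc: "concentrated_pyramid (box_closure (below X))"
  shows "compact_space (mtopology_of (L1 X))"
proof -
  let ?S = "{isometry_class (L1 (emm_of_mm Y)) | Y. Y \<in> \<Union>(box_closure (below X))}"
  have cpt: "compactin gh_topology (gh_topology closure_of ?S)" using conc by (simp add: concentrated_pyramid_def)
  have mm: "mm_space Y" if "Y \<in> \<Union>(box_closure (below X))" for Y :: "real mm"
  proof -
    obtain \<Y> where \<Y>: "\<Y> \<in> mm_classes" "Y \<in> \<Y>" using \<open>Y \<in> \<Union>(box_closure (below X))\<close> by (auto simp: box_closure_def)
    show ?thesis by (rule mm_class_member(1)[OF \<Y>(1,2,2)])
  qed
  have S: "?S \<subseteq> gh_classes"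
  proof
    fix C assume "C \<in> ?S"
    then obtain Y where Y: "C = isometry_class (L1 (emm_of_mm Y))" "Y \<in> \<Union>(box_closure (below X))" by blast
    show "C \<in> gh_classes"
      unfolding Y(1) by (rule isometry_class_in_gh_classes[OF compact_metric_L1_mm[OF mm[OF Y(2)]]])
  qed
  have "Metric_space.mtotally_bounded (mspace (L1 X)) (mdist (L1 X)) (mspace (L1 X))"
  proof (rule bounded_separated_imp_totally_bounded)
    fix e :: real assume e: "0 < e"
    show "\<exists>N. \<forall>P. finite P \<and> P \<subseteq> mspace (L1 X) \<and> (\<forall>x\<in>P. \<forall>y\<in>P. x \<noteq> y \<longrightarrow> e \<le> mdist (L1 X) x y) \<longrightarrow> card P \<le> N"
    proof (rule gh_precompact_uniformly_totally_bounded[OF S cpt e, where 'b = "(real \<Rightarrow> real) set"])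
      fix N :: nat
      assume N: "\<And>(K :: (real \<Rightarrow> real) set metric) P. \<lbrakk>compact_metric K; isometry_class K \<in> ?S; finite P; P \<subseteq> mspace K;
        \<And>x y. x \<in> P \<Longrightarrow> y \<in> P \<Longrightarrow> x \<noteq> y \<Longrightarrow> e \<le> mdist K x y\<rbrakk> \<Longrightarrow> card P \<le> N"
      show ?thesis
      proof (intro exI[of _ N] allI impI)
        fix P assume P: "finite P \<and> P \<subseteq> mspace (L1 X) \<and> (\<forall>x\<in>P. \<forall>y\<in>P. x \<noteq> y \<longrightarrow> e \<le> mdist (L1 X) x y)"
        show "card P \<le> N"
        proof (rule L1_separated_card_bound[OF X e])
          fix Y :: "real mm" and Q
          assume Y: "mm_space Y" "emm_of_mm Y \<prec>\<^sub>L X" and Q: "finite Q" "Q \<subseteq> mspace (L1 (emm_of_mm Y))"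
            "\<And>x y. x \<in> Q \<Longrightarrow> y \<in> Q \<Longrightarrow> x \<noteq> y \<Longrightarrow> e \<le> mdist (L1 (emm_of_mm Y)) x y"
          have "mm_class Y \<in> box_closure (below X)" using below_subset_box_closure mm_class_below[OF Y] by (rule subsetD)
          then have "isometry_class (L1 (emm_of_mm Y)) \<in> ?S" using mm_class_self[OF Y(1)] by blast
          then show "card Q \<le> N" by (rule N[OF compact_metric_L1_mm[OF Y(1)] _ Q])
        qed (use P in simp_all)
      qed
    qed
  qed
  then show ?thesis
    using L1_mcomplete[OF X] Metric_space.compact_space_eq_mcomplete_mtotally_bounded[OF Metric_space_mspace_mdist, of "L1 X"]
    by (simp add: mtopology_of_def mcomplete_of_def)
qed

section \<open>Isomorphism classes of concentrated spaces\<close>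

definition emm_class :: "'a emm \<Rightarrow> 'a emm set" where
  "emm_class X = {(X, Y). emm_space X \<and> emm_space Y \<and> emm_iso X Y} `` {X}"

lemma concentrated_emm_classesE:
  assumes "\<X> \<in> concentrated_emm_classes"
  obtains X where "emm_space X" "compact_space (mtopology_of (L1 X))" "\<X> = emm_class X"
  using assms unfolding concentrated_emm_classes_def emm_class_def concentrated_emm_space_def by (auto elim: quotientE)

text \<open>Isomorphic spaces dominate each other, so \<open>below\<close> is constant on the class
  and \<open>the_elem\<close> returns its value.\<close>

lemma class_below_emm_class:
  assumes X: "emm_space X"
  shows "class_below (emm_class X) = below X"
proof -
  have "below Y = below X" if Y: "Y \<in> emm_class X" for Y
  proof -
    have e: "emm_space Y" "emm_iso X Y" using Y by (simp_all add: emm_class_def)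
    show ?thesis
      using below_mono[OF X e(1) emm_iso_imp_dominated[OF emm_iso_sym[OF X e]]] below_mono[OF e(1) X emm_iso_imp_dominated[OF e(2)]]
      by (rule subset_antisym[rotated])
  qed
  moreover have "X \<in> emm_class X" using X emm_iso_refl by (simp add: emm_class_def)
  ultimately have "below ` emm_class X = {below X}" by blast
  then show ?thesis by (simp add: class_below_def)
qed

text \<open>Each inclusion yields a domination map, using compactness of \<open>L1\<close> of the
  dominating space; so both compactness assumptions enter.\<close>

lemma below_eq_imp_iso:
  assumes X: "emm_space X" "compact_space (mtopology_of (L1 X))" and Y: "emm_space Y" "compact_space (mtopology_of (L1 Y))"
    and eq: "below X = below Y"
  shows "emm_iso X Y"
proof -
  obtain \<psi> where \<psi>: "dom_map Y X \<psi>"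
    using below_subset_imp_dominated[OF X(1) Y] eq unfolding dominated_iff[OF Y(1)] by blast
  obtain \<phi> where \<phi>: "dom_map X Y \<phi>"
    using below_subset_imp_dominated[OF Y(1) X] eq unfolding dominated_iff[OF X(1)] by blast
  obtain f where f: "generating X f \<and> (\<forall>n. f n \<in> Lip1 X)" using exists_generating[OF X(1)] ..
  show ?thesis
    by (rule mutual_domination_imp_iso[OF X(1) Y(1) X(2) f[THEN conjunct1] f[THEN conjunct2, rule_format] \<phi> \<psi>])
qed

lemma emm_class_eqI:
  assumes X: "emm_space X" and Y: "emm_space Y" and iso: "emm_iso X Y"
  shows "emm_class X = emm_class Y"
  unfolding emm_class_def
  using X Y emm_iso_trans[OF X Y iso] emm_iso_trans[OF Y X emm_iso_sym[OF X Y iso]] by auto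

theorem theorem1p2:
  shows "(\<forall>X :: 'a emm. emm_space X \<longrightarrow>
            (compact_space (mtopology_of (L1 X)) \<longleftrightarrow>
             concentrated_pyramid (box_closure (below X)))) \<and>
         (class_below :: 'a emm set \<Rightarrow> real mm set set)
            \<in> concentrated_emm_classes \<rightarrow> {\<P>. pyramid \<P>} \<and>
         inj_on (class_below :: 'a emm set \<Rightarrow> real mm set set) concentrated_emm_classes"
proof (intro conjI allI impI)
  fix X :: "'a emm" assume X: "emm_space X"
  show "compact_space (mtopology_of (L1 X)) \<longleftrightarrow> concentrated_pyramid (box_closure (below X))"
  proof
    assume cpt: "compact_space (mtopology_of (L1 X))"
    show "concentrated_pyramid (box_closure (below X))"
      unfolding box_closure_below[OF X cpt] concentrated_pyramid_def
      using pyramid_below[OF X cpt] below_concentrated[OF X cpt] ..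
  qed (rule concentrated_imp_L1_compact[OF X])
next
  show "(class_below :: 'a emm set \<Rightarrow> real mm set set) \<in> concentrated_emm_classes \<rightarrow> {\<P>. pyramid \<P>}"
  proof
    fix \<X> :: "'a emm set" assume "\<X> \<in> concentrated_emm_classes"
    then obtain X where X: "emm_space X" "compact_space (mtopology_of (L1 X))" "\<X> = emm_class X"
      by (rule concentrated_emm_classesE)
    show "class_below \<X> \<in> {\<P>. pyramid \<P>}"
      using pyramid_below[OF X(1,2)] by (simp add: X(3) class_below_emm_class[OF X(1)])
  qed
next
  show "inj_on (class_below :: 'a emm set \<Rightarrow> real mm set set) concentrated_emm_classes"
  proof (rule inj_onI)
    fix \<X> \<Y> :: "'a emm set"
    assume \<X>: "\<X> \<in> concentrated_emm_classes" and \<Y>: "\<Y> \<in> concentrated_emm_classes" and eq: "class_below \<X> = class_below \<Y>"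
    obtain X where X: "emm_space X" "compact_space (mtopology_of (L1 X))" "\<X> = emm_class X"
      using \<X> by (rule concentrated_emm_classesE)
    obtain Y where Y: "emm_space Y" "compact_space (mtopology_of (L1 Y))" "\<Y> = emm_class Y"
      using \<Y> by (rule concentrated_emm_classesE)
    have "below X = below Y" using eq unfolding X(3) Y(3) class_below_emm_class[OF X(1)] class_below_emm_class[OF Y(1)] .
    then have "emm_iso X Y" by (rule below_eq_imp_iso[OF X(1,2) Y(1,2)])
    then show "\<X> = \<Y>" unfolding X(3) Y(3) by (rule emm_class_eqI[OF X(1) Y(1)])
  qed
qed

end
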